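(* Let $X$ be a complex projective manifold of dimension $n$, let $P\in\{N,N^*,G\}$, and let $E\to X$ be a $P$-positive holomorphic vector bundle of rank $r$. Then $$\mathrm{MAVol}_P(E)\le\frac{1}{n!\,r^n}\,c_1(E)^n.$$ Moreover, equality occurs, with the supremum defining $\mathrm{MAVol}_P(E)$ being a maximum, if and only if $E$ is projectively flat.
   Context: For a smooth hermitian metric $h$ on $E$, the Chern curvature tensor is written $\Theta_{E,h}=i\sum_{j,k,\lambda,\mu}c_{jk\lambda\mu}\,dz_j\wedge d\overline z_k\otimes e_\lambda^*\otimes e_\mu$ ($1\le j,k\le n$, $1\le\lambda,\mu\le r$) in holomorphic coordinates and an $h$-orthonormal frame $(e_\lambda)$ of $E$. It is called: - Nakano positive ($N$-positive) if $\sum c_{jk\lambda\mu}\gamma_{j\lambda}\overline\gamma_{k\mu}>0$ for all nonzero $\gamma\in T_X\otimes E$; - dual Nakano positive ($N^*$-positive) if $\sum c_{jk\mu\lambda}\gamma_{j\lambda}\overline\gamma_{k\mu}>0$ for all nonzero $\gamma\in T_X\otimes E^*$; - Griffiths positive ($G$-positive) if $\sum c_{jk\lambda\mu}\xi_j\overline\xi_kv_\lambda\overline v_\mu>0$ for all nonzero $\xi\in T_X$, $v\in E$. $E$ is $P$-positive if it possesses a smooth hermitian metric $h$ such that $\Theta_{E,h}$ is $P$-positive. Functionals (positive $(n,n)$-forms, defined when $\Theta_{E,h}$ is respectively $N$-, $N^*$-, $G$-positive): $\Phi_N(\Theta_{E,h})=\det(c_{jk\lambda\mu})_{(j,\lambda),(k,\mu)}^{1/r}\,i\,dz_1\wedge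 d\overline z_1\wedge\dots\wedge i\,dz_n\wedge d\overline z_n$; $\Phi_{N^*}(\Theta_{E,h})=\det(c_{jk\mu\lambda})_{(j,\lambda),(k,\mu)}^{1/r}\,i\,dz_1\wedge d\overline z_1\wedge\dots\wedge i\,dz_n\wedge d\overline z_n$; $\Phi_G(\Theta_{E,h})=\inf_{v\in E,\,|v|_h=1}\frac1{n!}\big(\langle\Theta_{E,h}\cdot v,v\rangle_h\big)^n$ (pointwise infimum on $X$). Monge-Ampère volume of a $P$-positive bundle: $\mathrm{MAVol}_P(E)=\sup_h\frac{1}{(2\pi)^n}\int_X\Phi_P(\Theta_{E,h})$, the supremum being over all smooth hermitian metrics $h$ on $E$ such that $\Theta_{E,h}$ is $P$-positive. $(E,h)$ is projectively flat if $\Theta_{E,h}=\alpha\otimes\mathrm{Id}_E$ for some $(1,1)$-form $\alpha$ on $X$ (then $\alpha=\frac1r\Theta_{\det E,\det h}$); $E$ is projectively flat if it admits a smooth hermitian metric $h$ with $(E,h)$ projectively flat. $c_1(E)^n$ denotes the intersection number $\int_Xc_1(E)^n$. *)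

theory Defs
  imports
    "HOL-Analysis.Analysis"
    "HOL-Library.Complex_Order"
begin

section \<open>Calculus on open subsets of complex coordinate space\<close>

text \<open>Both notions below are only used for open \<open>S\<close>.  Holomorphic means complex differentiable in
  the Frechet sense: the real derivative is complex linear.\<close>

definition holo_on :: "(complex^'n) set \<Rightarrow> (complex^'n \<Rightarrow> complex) \<Rightarrow> bool" where
  "holo_on S f \<longleftrightarrow> (\<forall>z\<in>S. \<exists>D. (f has_derivative D) (at z) \<and> (\<forall>a \<xi>. D (a *s \<xi>) = a * D \<xi>))"

primrec Ck_on :: "nat \<Rightarrow> 'a::real_normed_vector set \<Rightarrow> ('a \<Rightarrow> 'b::real_normed_vector) \<Rightarrow> bool" where
  "Ck_on 0 S f \<longleftrightarrow> continuous_on S f"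
| "Ck_on (Suc k) S f \<longleftrightarrow> (\<forall>x\<in>S. f differentiable (at x)) \<and>
     (\<forall>v. Ck_on k S (\<lambda>x. frechet_derivative f (at x) v))"

definition smooth_on :: "'a::real_normed_vector set \<Rightarrow> ('a \<Rightarrow> 'b::real_normed_vector) \<Rightarrow> bool" where
  "smooth_on S f \<longleftrightarrow> (\<forall>k. Ck_on k S f)"

text \<open>The Wirtinger derivatives with respect to \<open>z\<^sub>j\<close> and to the conjugate of \<open>z\<^sub>k\<close>.\<close>

definition dz :: "'n \<Rightarrow> (complex^'n \<Rightarrow> complex) \<Rightarrow> complex^'n \<Rightarrow> complex" where
  "dz j f z = (frechet_derivative f (at z) (axis j 1)
                 - \<i> * frechet_derivative f (at z) (axis j \<i>)) / 2"

definition dzbar :: "'n \<Rightarrow> (complex^'n \<Rightarrow> complex) \<Rightarrow> complex^'n \<Rightarrow> complex" where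
  "dzbar k f z = (frechet_derivative f (at z) (axis k 1)
                    + \<i> * frechet_derivative f (at z) (axis k \<i>)) / 2"


section \<open>Complex projective manifolds\<close>

text \<open>The underlying space is a whole Hausdorff type \<open>'x\<close> and the complex dimension is \<open>CARD('n)\<close>.
  An atlas need not be maximal.\<close>

type_synonym ('x, 'n) chart = "'x set \<times> ('x \<Rightarrow> complex^'n)"

abbreviation cinv :: "('x, 'n) chart \<Rightarrow> complex^'n \<Rightarrow> 'x" where
  "cinv c \<equiv> inv_into (fst c) (snd c)"

definition complex_manifold :: "('x::t2_space, 'n::finite) chart set \<Rightarrow> bool" where
  "complex_manifold A \<longleftrightarrow>
     (\<Union>c\<in>A. fst c) = UNIV \<and>
     (\<forall>c\<in>A. open (fst c) \<and> open (snd c ` fst c) \<and>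
        homeomorphism (fst c) (snd c ` fst c) (snd c) (cinv c)) \<and>
     (\<forall>c\<in>A. \<forall>d\<in>A. \<forall>l. holo_on (snd c ` (fst c \<inter> fst d)) (\<lambda>z. snd d (cinv c z) $ l))"

definition holo_fun :: "('x, 'n::finite) chart set \<Rightarrow> 'x set \<Rightarrow> ('x \<Rightarrow> complex) \<Rightarrow> bool" where
  "holo_fun A V f \<longleftrightarrow> (\<forall>c\<in>A. holo_on (snd c ` (fst c \<inter> V)) (\<lambda>z. f (cinv c z)))"

definition smooth_fun ::
    "('x, 'n::finite) chart set \<Rightarrow> 'x set \<Rightarrow> ('x \<Rightarrow> 'b::real_normed_vector) \<Rightarrow> bool" where
  "smooth_fun A V f \<longleftrightarrow> (\<forall>c\<in>A. smooth_on (snd c ` (fst c \<inter> V)) (\<lambda>z. f (cinv c z)))"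

text \<open>A point of the projective space of dimension \<open>N\<close> is the class of its vectors of
  homogeneous coordinates \<open>v 0, \<dots>, v N\<close> modulo nonzero scalars.\<close>

definition proj_class :: "(nat \<Rightarrow> complex) \<Rightarrow> (nat \<Rightarrow> complex) set" where
  "proj_class v = {\<lambda>i. a * v i | a. a \<noteq> 0}"

definition proj_space :: "nat \<Rightarrow> (nat \<Rightarrow> complex) set set" where
  "proj_space N = proj_class ` {v. (\<exists>i. v i \<noteq> 0) \<and> (\<forall>i>N. v i = 0)}"

definition affine_piece :: "nat \<Rightarrow> (nat \<Rightarrow> complex) set set" where
  "affine_piece i = {L. \<forall>v\<in>L. v i \<noteq> 0}"

definition affine_coord :: "nat \<Rightarrow> nat \<Rightarrow> (nat \<Rightarrow> complex) set \<Rightarrow> complex" where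
  "affine_coord i j L = (THE w. \<forall>v\<in>L. w = v j / v i)"

text \<open>Injective holomorphic immersions into projective space, expressed in the standard affine
  charts of projective space (the coordinate \<open>j = i\<close> in the \<open>i\<close>-th chart is constant and harmless).
  On a compact manifold these are exactly the closed holomorphic embeddings.\<close>

definition projective_embedding ::
    "('x::t2_space, 'n::finite) chart set \<Rightarrow> nat \<Rightarrow> ('x \<Rightarrow> (nat \<Rightarrow> complex) set) \<Rightarrow> bool" where
  "projective_embedding A N f \<longleftrightarrow>
     range f \<subseteq> proj_space N \<and> inj f \<and>
     (\<forall>i\<le>N. open (f -` affine_piece i) \<and>
        (\<forall>j\<le>N. holo_fun A (f -` affine_piece i) (\<lambda>x. affine_coord i j (f x))) \<and>
        (\<forall>c\<in>A. \<forall>x\<in>fst c \<inter> f -` affine_piece i. \<forall>\<xi>. \<xi> \<noteq> 0 \<longrightarrow>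
           (\<exists>j\<le>N. frechet_derivative (\<lambda>z. affine_coord i j (f (cinv c z))) (at (snd c x)) \<xi> \<noteq> 0)))"

definition complex_projective_manifold :: "('x::t2_space, 'n::finite) chart set \<Rightarrow> bool" where
  "complex_projective_manifold A \<longleftrightarrow>
     complex_manifold A \<and> compact (UNIV :: 'x set) \<and> (\<exists>N f. projective_embedding A N f)"


section \<open>Forms and integration\<close>

text \<open>A \<open>(1,1)\<close>-form is given in each chart by the coefficients \<open>a\<^sub>j\<^sub>k\<close> in
  \<open>i \<Sum> a\<^sub>j\<^sub>k dz\<^sub>j \<and> d(conj z\<^sub>k)\<close>.\<close>

definition form11 ::
    "('x, 'n::finite) chart set \<Rightarrow> (('x, 'n) chart \<Rightarrow> 'x \<Rightarrow> complex^'n^'n) \<Rightarrow> bool" where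
  "form11 A \<alpha> \<longleftrightarrow>
     (\<forall>c\<in>A. \<forall>j k. smooth_on (snd c ` fst c) (\<lambda>z. \<alpha> c (cinv c z) $ j $ k)) \<and>
     (\<forall>c\<in>A. \<forall>d\<in>A. \<forall>x\<in>fst c \<inter> fst d. \<forall>j k.
        \<alpha> c x $ j $ k =
          (\<Sum>l\<in>UNIV. \<Sum>m\<in>UNIV. \<alpha> d x $ l $ m
             * dz j (\<lambda>z. snd d (cinv c z) $ l) (snd c x)
             * cnj (dz k (\<lambda>z. snd d (cinv c z) $ m) (snd c x))))"

text \<open>The coefficient of the exterior power \<open>\<alpha>\<^sup>n\<close>, \<open>n = CARD('n)\<close>, of
  \<open>\<alpha> = i \<Sum> a\<^sub>j\<^sub>k dz\<^sub>j \<and> d(conj z\<^sub>k)\<close> with respect to the volume form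
  \<open>i dz\<^sub>1 \<and> d(conj z\<^sub>1) \<and> \<dots> \<and> i dz\<^sub>n \<and> d(conj z\<^sub>n)\<close>: expand the product; the factors commute, and
  only the terms in which the \<open>j\<close>'s and the \<open>k\<close>'s are both permutations survive.\<close>

definition top_power :: "complex^'n^'n \<Rightarrow> complex" where
  "top_power a = (\<Sum>\<sigma> | \<sigma> permutes (UNIV :: 'n set). \<Sum>\<tau> | \<tau> permutes (UNIV :: 'n set).
     of_int (sign \<sigma>) * of_int (sign \<tau>) * (\<Prod>s\<in>UNIV. a $ \<sigma> s $ \<tau> s))"

text \<open>Real \<open>(n,n)\<close>-forms are given in each chart by their coefficient with respect to the same volume
  form, which is \<open>2 ^ n\<close> times Lebesgue measure.  They are integrated by a smooth partition of unity;
  the choice is irrelevant.\<close>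

definition partition_of_unity ::
    "('x::topological_space, 'n::finite) chart set \<Rightarrow> ('x, 'n) chart set \<Rightarrow>
     (('x, 'n) chart \<Rightarrow> 'x \<Rightarrow> real) \<Rightarrow> bool" where
  "partition_of_unity A C \<rho> \<longleftrightarrow>
     finite C \<and> C \<subseteq> A \<and>
     (\<forall>c\<in>C. smooth_fun A UNIV (\<rho> c) \<and> (\<forall>x. 0 \<le> \<rho> c x) \<and> closure {x. \<rho> c x \<noteq> 0} \<subseteq> fst c) \<and>
     (\<forall>x. (\<Sum>c\<in>C. \<rho> c x) = 1)"

definition form_integral ::
    "('x::topological_space, 'n::finite) chart set \<Rightarrow> (('x, 'n) chart \<Rightarrow> 'x \<Rightarrow> real) \<Rightarrow> real" where
  "form_integral A \<omega> =
     (let (C, \<rho>) = (SOME (C, \<rho>). partition_of_unity A C \<rho>) in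
      \<Sum>c\<in>C. LINT z:(snd c ` fst c)|lborel. 2 ^ CARD('n) * (\<rho> c (cinv c z) * \<omega> c (cinv c z)))"


section \<open>Holomorphic vector bundles and hermitian metrics\<close>

text \<open>A bundle of rank \<open>CARD('r)\<close> is a projection \<open>p\<close> from the total space \<open>'e\<close> with a family of local
  trivializations \<open>(V, \<tau>)\<close>, where \<open>\<tau>\<close> gives the fibre coordinates over \<open>V\<close>.  The linear structure
  of the fibres and the complex structure of \<open>'e\<close> are those induced by the trivializations;
  transition matrices are invertible because fibre coordinates are bijective.\<close>

type_synonym ('x, 'e, 'r) triv = "'x set \<times> ('e \<Rightarrow> complex^'r)"

definition holomorphic_vector_bundle ::
    "('x::topological_space, 'n::finite) chart set \<Rightarrow> ('e \<Rightarrow> 'x) \<Rightarrow> ('x, 'e, 'r::finite) triv set \<Rightarrow>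
     bool" where
  "holomorphic_vector_bundle A p T \<longleftrightarrow>
     (\<Union>t\<in>T. fst t) = UNIV \<and>
     (\<forall>t\<in>T. open (fst t) \<and> (\<forall>x\<in>fst t. bij_betw (snd t) (p -` {x}) UNIV)) \<and>
     (\<forall>t\<in>T. \<forall>s\<in>T. \<exists>g :: 'x \<Rightarrow> complex^'r^'r.
        (\<forall>u. p u \<in> fst t \<inter> fst s \<longrightarrow> snd s u = g (p u) *v snd t u) \<and>
        (\<forall>\<kappa> \<mu>. holo_fun A (fst t \<inter> fst s) (\<lambda>x. g x $ \<kappa> $ \<mu>)))"

definition frame :: "('e \<Rightarrow> 'x) \<Rightarrow> ('x, 'e, 'r::finite) triv \<Rightarrow> 'x \<Rightarrow> 'r \<Rightarrow> 'e" where
  "frame p t x \<kappa> = inv_into (p -` {x}) (snd t) (axis \<kappa> 1)"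

definition gram ::
    "('e \<Rightarrow> 'x) \<Rightarrow> ('x, 'e, 'r::finite) triv \<Rightarrow> ('e \<Rightarrow> 'e \<Rightarrow> complex) \<Rightarrow> 'x \<Rightarrow> complex^'r^'r" where
  "gram p t h x = (\<chi> \<kappa> \<mu>. h (frame p t x \<kappa>) (frame p t x \<mu>))"

text \<open>Smooth hermitian metrics: \<open>h u v\<close> is linear in \<open>u\<close> and conjugate linear in \<open>v\<close>; its values on
  pairs from different fibres are irrelevant.\<close>

definition hermitian_metric ::
    "('x, 'n::finite) chart set \<Rightarrow> ('e \<Rightarrow> 'x) \<Rightarrow> ('x, 'e, 'r::finite) triv set \<Rightarrow>
     ('e \<Rightarrow> 'e \<Rightarrow> complex) \<Rightarrow> bool" where
  "hermitian_metric A p T h \<longleftrightarrow>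
     (\<forall>u v. p u = p v \<longrightarrow> h v u = cnj (h u v)) \<and>
     (\<forall>t\<in>T.
        (\<forall>u v. p u = p v \<and> p u \<in> fst t \<longrightarrow>
           h u v = (\<Sum>\<kappa>\<in>UNIV. \<Sum>\<mu>\<in>UNIV.
                      snd t u $ \<kappa> * cnj (snd t v $ \<mu>) * gram p t h (p u) $ \<kappa> $ \<mu>)) \<and>
        (\<forall>u. p u \<in> fst t \<and> snd t u \<noteq> 0 \<longrightarrow> 0 < h u u) \<and>
        (\<forall>\<kappa> \<mu>. smooth_fun A (fst t) (\<lambda>x. gram p t h x $ \<kappa> $ \<mu>)))"


section \<open>Chern curvature\<close>

text \<open>In the holomorphic frame \<open>f\<close> of a trivialization, with Gram matrix \<open>H\<close>, the Chern connection
  satisfies \<open>D f\<^sub>\<kappa> = \<Sum> \<theta>\<^sub>\<kappa>\<^sub>\<mu> f\<^sub>\<mu>\<close> with \<open>\<theta> = (\<partial>H) H\<^sup>-\<^sup>1\<close>, and its curvature is the conjugate exterior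
  derivative of \<open>\<theta>\<close>.  Thus the curvature tensor is \<open>i \<Sum> C\<^sub>j\<^sub>k dz\<^sub>j \<and> d(conj z\<^sub>k)\<close>, where \<open>C\<^sub>j\<^sub>k\<close> sends
  \<open>f\<^sub>\<kappa>\<close> to \<open>\<Sum> (C\<^sub>j\<^sub>k)\<^sub>\<kappa>\<^sub>\<mu> f\<^sub>\<mu>\<close>; the sign comes from exchanging \<open>d(conj z\<^sub>k)\<close> and \<open>dz\<^sub>j\<close>.\<close>

definition chern_connection ::
    "('e \<Rightarrow> 'x) \<Rightarrow> ('x, 'e, 'r::finite) triv \<Rightarrow> ('e \<Rightarrow> 'e \<Rightarrow> complex) \<Rightarrow> ('x, 'n::finite) chart \<Rightarrow>
     'n \<Rightarrow> complex^'n \<Rightarrow> complex^'r^'r" where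
  "chern_connection p t h c j z =
     (\<chi> \<kappa> \<mu>. dz j (\<lambda>w. gram p t h (cinv c w) $ \<kappa> $ \<mu>) z) ** matrix_inv (gram p t h (cinv c z))"

definition curvature_matrix ::
    "('e \<Rightarrow> 'x) \<Rightarrow> ('x, 'e, 'r::finite) triv \<Rightarrow> ('e \<Rightarrow> 'e \<Rightarrow> complex) \<Rightarrow> ('x, 'n::finite) chart \<Rightarrow>
     'x \<Rightarrow> 'n \<Rightarrow> 'n \<Rightarrow> complex^'r^'r" where
  "curvature_matrix p t h c x j k =
     (\<chi> \<kappa> \<mu>. - dzbar k (\<lambda>z. chern_connection p t h c j z $ \<kappa> $ \<mu>) (snd c x))"

text \<open>A trivialization around \<open>x\<close>; the curvature as an endomorphism does not depend on it.\<close>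

definition triv_at :: "('x, 'e, 'r::finite) triv set \<Rightarrow> 'x \<Rightarrow> ('x, 'e, 'r) triv" where
  "triv_at T x = (SOME t. t \<in> T \<and> x \<in> fst t)"

text \<open>\<open>\<langle>\<Theta>\<^sub>j\<^sub>k u, v\<rangle>\<close> for \<open>u\<close>, \<open>v\<close> in the fibre at \<open>x\<close>, where \<open>\<Theta> = i \<Sum> \<Theta>\<^sub>j\<^sub>k dz\<^sub>j \<and> d(conj z\<^sub>k)\<close>.\<close>

definition curv ::
    "('e \<Rightarrow> 'x) \<Rightarrow> ('x, 'e, 'r::finite) triv set \<Rightarrow> ('e \<Rightarrow> 'e \<Rightarrow> complex) \<Rightarrow> ('x, 'n::finite) chart \<Rightarrow>
     'x \<Rightarrow> 'n \<Rightarrow> 'n \<Rightarrow> 'e \<Rightarrow> 'e \<Rightarrow> complex" where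
  "curv p T h c x j k u v =
     (let t = triv_at T x in
      \<Sum>\<kappa>\<in>UNIV. \<Sum>\<mu>\<in>UNIV. snd t u $ \<kappa> * curvature_matrix p t h c x j k $ \<kappa> $ \<mu> * h (frame p t x \<mu>) v)"

definition orthonormal_frame ::
    "('e \<Rightarrow> 'x) \<Rightarrow> ('e \<Rightarrow> 'e \<Rightarrow> complex) \<Rightarrow> 'x \<Rightarrow> ('r::finite \<Rightarrow> 'e) \<Rightarrow> bool" where
  "orthonormal_frame p h x e \<longleftrightarrow>
     (\<forall>\<kappa>. p (e \<kappa>) = x) \<and> (\<forall>\<kappa> \<mu>. h (e \<kappa>) (e \<mu>) = (if \<kappa> = \<mu> then 1 else 0))"

text \<open>The coefficients \<open>c\<^sub>j\<^sub>k\<^sub>\<kappa>\<^sub>\<mu>\<close> of the curvature tensor in an orthonormal frame \<open>e\<close> at \<open>x\<close>.\<close>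

definition curv_coeff ::
    "('e \<Rightarrow> 'x) \<Rightarrow> ('x, 'e, 'r::finite) triv set \<Rightarrow> ('e \<Rightarrow> 'e \<Rightarrow> complex) \<Rightarrow> ('x, 'n::finite) chart \<Rightarrow>
     'x \<Rightarrow> ('r \<Rightarrow> 'e) \<Rightarrow> 'n \<Rightarrow> 'n \<Rightarrow> 'r \<Rightarrow> 'r \<Rightarrow> complex" where
  "curv_coeff p T h c x e j k \<kappa> \<mu> = curv p T h c x j k (e \<kappa>) (e \<mu>)"


section \<open>Positivity, Monge-Ampere volumes and projective flatness\<close>

datatype positivity = Nakano | Dual_Nakano | Griffiths

text \<open>Pointwise positivity in terms of the coefficients \<open>q j k \<kappa> \<mu>\<close>.  In this order on the complex
  numbers, \<open>0 < z\<close> means that \<open>z\<close> is a positive real.\<close>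

primrec positive_coeffs ::
    "positivity \<Rightarrow> ('n::finite \<Rightarrow> 'n \<Rightarrow> 'r::finite \<Rightarrow> 'r \<Rightarrow> complex) \<Rightarrow> bool" where
  "positive_coeffs Nakano q \<longleftrightarrow> (\<forall>\<gamma> :: complex^'r^'n. \<gamma> \<noteq> 0 \<longrightarrow>
     0 < (\<Sum>j\<in>UNIV. \<Sum>k\<in>UNIV. \<Sum>\<kappa>\<in>UNIV. \<Sum>\<mu>\<in>UNIV. q j k \<kappa> \<mu> * \<gamma> $ j $ \<kappa> * cnj (\<gamma> $ k $ \<mu>)))"
| "positive_coeffs Dual_Nakano q \<longleftrightarrow> (\<forall>\<gamma> :: complex^'r^'n. \<gamma> \<noteq> 0 \<longrightarrow>
     0 < (\<Sum>j\<in>UNIV. \<Sum>k\<in>UNIV. \<Sum>\<kappa>\<in>UNIV. \<Sum>\<mu>\<in>UNIV. q j k \<mu> \<kappa> * \<gamma> $ j $ \<kappa> * cnj (\<gamma> $ k $ \<mu>)))"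
| "positive_coeffs Griffiths q \<longleftrightarrow> (\<forall>(\<xi> :: complex^'n) (v :: complex^'r). \<xi> \<noteq> 0 \<and> v \<noteq> 0 \<longrightarrow>
     0 < (\<Sum>j\<in>UNIV. \<Sum>k\<in>UNIV. \<Sum>\<kappa>\<in>UNIV. \<Sum>\<mu>\<in>UNIV.
            q j k \<kappa> \<mu> * \<xi> $ j * cnj (\<xi> $ k) * v $ \<kappa> * cnj (v $ \<mu>)))"

definition positive_metric ::
    "positivity \<Rightarrow> ('x, 'n::finite) chart set \<Rightarrow> ('e \<Rightarrow> 'x) \<Rightarrow> ('x, 'e, 'r::finite) triv set \<Rightarrow>
     ('e \<Rightarrow> 'e \<Rightarrow> complex) \<Rightarrow> bool" where
  "positive_metric P A p T h \<longleftrightarrow>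
     hermitian_metric A p T h \<and>
     (\<forall>c\<in>A. \<forall>x\<in>fst c. \<forall>e :: 'r \<Rightarrow> 'e. orthonormal_frame p h x e \<longrightarrow>
        positive_coeffs P (curv_coeff p T h c x e))"

definition positive_bundle ::
    "positivity \<Rightarrow> ('x, 'n::finite) chart set \<Rightarrow> ('e \<Rightarrow> 'x) \<Rightarrow> ('x, 'e, 'r::finite) triv set \<Rightarrow>
     bool" where
  "positive_bundle P A p T \<longleftrightarrow> (\<exists>h. positive_metric P A p T h)"

text \<open>The functionals, as coefficients with respect to the volume form
  \<open>i dz\<^sub>1 \<and> d(conj z\<^sub>1) \<and> \<dots> \<and> i dz\<^sub>n \<and> d(conj z\<^sub>n)\<close>.  The determinants are those of positive definite
  hermitian matrices and do not depend on the orthonormal frame.\<close>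

primrec Phi ::
    "positivity \<Rightarrow> ('e \<Rightarrow> 'x) \<Rightarrow> ('x, 'e, 'r::finite) triv set \<Rightarrow> ('e \<Rightarrow> 'e \<Rightarrow> complex) \<Rightarrow>
     ('x, 'n::finite) chart \<Rightarrow> 'x \<Rightarrow> real" where
  "Phi Nakano p T h c x =
     (let q = curv_coeff p T h c x (SOME e. orthonormal_frame p h x e) in
      Re (det (\<chi> a b. q (fst a) (fst b) (snd a) (snd b) :: complex^('n \<times> 'r)^('n \<times> 'r)))
        powr (1 / CARD('r)))"
| "Phi Dual_Nakano p T h c x =
     (let q = curv_coeff p T h c x (SOME e. orthonormal_frame p h x e) in
      Re (det (\<chi> a b. q (fst a) (fst b) (snd b) (snd a) :: complex^('n \<times> 'r)^('n \<times> 'r)))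
        powr (1 / CARD('r)))"
| "Phi Griffiths p T h c x =
     (INF v \<in> {v. p v = x \<and> h v v = 1}.
        1 / fact CARD('n) * Re (top_power (\<chi> j k. curv p T h c x j k v v)))"

text \<open>The supremum is taken in the extended reals, so that it is meaningful without knowing
  beforehand that it is finite.\<close>

definition MA_integral ::
    "positivity \<Rightarrow> ('x::topological_space, 'n::finite) chart set \<Rightarrow> ('e \<Rightarrow> 'x) \<Rightarrow>
     ('x, 'e, 'r::finite) triv set \<Rightarrow> ('e \<Rightarrow> 'e \<Rightarrow> complex) \<Rightarrow> real" where
  "MA_integral P A p T h = 1 / (2 * pi) ^ CARD('n) * form_integral A (Phi P p T h)"

definition MAVol ::
    "positivity \<Rightarrow> ('x::topological_space, 'n::finite) chart set \<Rightarrow> ('e \<Rightarrow> 'x) \<Rightarrow>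
     ('x, 'e, 'r::finite) triv set \<Rightarrow> ereal" where
  "MAVol P A p T = (SUP h \<in> {h. positive_metric P A p T h}. ereal (MA_integral P A p T h))"

text \<open>The first Chern class is represented, for any smooth hermitian metric, by the form
  \<open>1/(2 \<pi>) tr \<Theta>\<close>, the Chern form of the determinant bundle; the integral of its \<open>n\<close>-th power does not
  depend on the metric.\<close>

definition chern_form ::
    "('e \<Rightarrow> 'x) \<Rightarrow> ('x, 'e, 'r::finite) triv set \<Rightarrow> ('e \<Rightarrow> 'e \<Rightarrow> complex) \<Rightarrow>
     ('x, 'n::finite) chart \<Rightarrow> 'x \<Rightarrow> complex^'n^'n" where
  "chern_form p T h c x =
     (\<chi> j k. trace (curvature_matrix p (triv_at T x) h c x j k) / (2 * of_real pi))"

definition c1_power ::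
    "('x::topological_space, 'n::finite) chart set \<Rightarrow> ('e \<Rightarrow> 'x) \<Rightarrow> ('x, 'e, 'r::finite) triv set \<Rightarrow>
     real" where
  "c1_power A p T =
     (let h = (SOME h. hermitian_metric A p T h) in
      form_integral A (\<lambda>c x. Re (top_power (chern_form p T h c x))))"

definition projectively_flat ::
    "('x, 'n::finite) chart set \<Rightarrow> ('e \<Rightarrow> 'x) \<Rightarrow> ('x, 'e, 'r::finite) triv set \<Rightarrow> bool" where
  "projectively_flat A p T \<longleftrightarrow>
     (\<exists>h. hermitian_metric A p T h \<and>
        (\<exists>\<alpha>. form11 A \<alpha> \<and>
           (\<forall>c\<in>A. \<forall>x\<in>fst c. \<forall>j k.
              curvature_matrix p (triv_at T x) h c x j k = mat (\<alpha> c x $ j $ k))))"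

end

theory Submission
  imports Defs "HOL-Complex_Analysis.Cauchy_Integral_Formula"
begin

text \<open>Let \<open>S\<close> be the fibrewise trace of the curvature of a positive metric.  Among the positive
  semidefinite matrices on the tensor product of the tangent space and the fibre with partial trace
  \<open>S\<close>, the determinant is maximal exactly at \<open>S / r\<close> times the identity of the fibre.  Hence, pointwise,
  each functional is at most \<open>det (S / r)\<close>, with equality only where the curvature is scalar; in the
  Griffiths case this is applied to the block diagonal matrix of the forms \<open>\<langle>\<Theta> e\<^sub>\<kappa>, e\<^sub>\<kappa>\<rangle>\<close> for an
  orthonormal frame, whose determinant bounds the \<open>r\<close>-th power of the infimum.  The integral of
  \<open>det S\<close> does not depend on the metric: the traces of two Chern connections differ by a global
  \<open>(1,0)\<close>-form, so the traces of the curvatures differ by its \<open>dbar\<close>, and Stokes' theorem applies.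
  This gives the bound.

  A metric attaining the bound has scalar curvature almost everywhere, hence everywhere by
  continuity.  Conversely, a projectively flat metric can be multiplied by a positive function so
  that its determinant becomes that of a given positive metric; its curvature stays scalar and
  acquires the trace \<open>S\<close> of the positive metric, so it equals \<open>S / r\<close> times the identity and the
  bound is attained.\<close>

section \<open>Smooth functions on open sets\<close>

text \<open>Equality in the Griffiths case needs more than one orthonormal basis: a basis fixes only
  the diagonal blocks, and the mixed ones are removed by rotating two basis vectors into each other
  with two different phases. Normalizing the determinant of a projectively flat metric controls the
  trace of its curvature because the trace of the Chern connection is the logarithmic derivative of
  the determinant of the Gram matrix. Three obstacles shape the analysis. \<open>holo_on\<close>
  asks only for a derivative at each point, so smoothness of the transition maps has to come from
  Cauchy's integral formula before forms can be differentiated. \<open>form_integral\<close> takes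
  its partition of unity by choice, so Stokes' theorem cuts the (1,0)-form with that same partition
  and gathers each piece into one chart by a change of variables. The functionals are given by a
  chosen frame or by an infimum, so their integrability is not at hand; they are compared with a
  continuous positive density, against which the value 0 of an integral that does not exist does no
  harm.\<close>

lemma Ck_on_cong_imp:
  assumes "open S" "\<And>x. x \<in> S \<Longrightarrow> f x = g x" "Ck_on k S f"
  shows "Ck_on k S g"
  using assms(2,3)
proof (induction k arbitrary: f g)
  case 0
  then show ?case using continuous_on_cong by force
next
  case (Suc k)
  show ?case unfolding Ck_on.simps
  proof (intro conjI ballI allI)
    fix x assume x: "x \<in> S"
    then have "(f has_derivative frechet_derivative f (at x)) (at x)"
      using Suc.prems frechet_derivative_works by auto
    then have "(g has_derivative frechet_derivative f (at x)) (at x)"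
      using x Suc.prems(1) assms(1) has_derivative_transform_within_open by blast
    then show "g differentiable at x" by (auto simp: differentiable_def)
  next
    fix v
    show "Ck_on k S (\<lambda>x. frechet_derivative g (at x) v)"
    proof (rule Suc.IH)
      show "Ck_on k S (\<lambda>x. frechet_derivative f (at x) v)" using Suc.prems by auto
      fix x assume "x \<in> S"
      then show "frechet_derivative f (at x) v = frechet_derivative g (at x) v"
        using frechet_derivative_transform_within_open[of f x S g] Suc.prems assms(1) by auto
    qed
  qed
qed

text \<open>\<open>frechet_derivative\<close> is a choice operator; this rule lets any exhibited
  derivative take its place in the induction on the order.\<close>

lemma Ck_on_SucI:
  assumes "open S" "\<And>x. x \<in> S \<Longrightarrow> (f has_derivative D x) (at x)"
    and "\<And>v. Ck_on k S (\<lambda>x. D x v)"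
  shows "Ck_on (Suc k) S f"
  unfolding Ck_on.simps
proof (intro conjI ballI allI)
  fix x assume "x \<in> S"
  then show "f differentiable at x" using assms(2) by (auto simp: differentiable_def)
next
  fix v
  show "Ck_on k S (\<lambda>x. frechet_derivative f (at x) v)"
    by (rule Ck_on_cong_imp[OF assms(1) _ assms(3)[of v]]) (use assms(2) frechet_derivative_at in metis)
qed

lemma Ck_on_has_derivative:
  "Ck_on (Suc k) S f \<Longrightarrow> x \<in> S \<Longrightarrow> (f has_derivative frechet_derivative f (at x)) (at x)"
  using frechet_derivative_works by auto

lemma Ck_on_SucD: "Ck_on (Suc k) S f \<Longrightarrow> Ck_on k S f"
proof (induction k arbitrary: f)
  case 0
  then show ?case
    by (auto intro!: continuous_at_imp_continuous_on differentiable_imp_continuous_within)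
qed auto

lemma Ck_on_subset: "Ck_on k S f \<Longrightarrow> R \<subseteq> S \<Longrightarrow> Ck_on k R f"
  by (induction k arbitrary: f) (auto intro: continuous_on_subset)

lemma Ck_on_local:
  assumes "\<And>x. x \<in> S \<Longrightarrow> \<exists>U. open U \<and> x \<in> U \<and> Ck_on k U f"
  shows "Ck_on k S f"
  using assms
proof (induction k arbitrary: f)
  case 0
  show ?case unfolding Ck_on.simps
  proof (rule continuous_at_imp_continuous_on, rule ballI)
    fix x assume "x \<in> S"
    then obtain U where "open U" "x \<in> U" "continuous_on U f" using 0 by auto
    then show "isCont f x" by (simp add: continuous_on_eq_continuous_at)
  qed
next
  case (Suc k)
  show ?case unfolding Ck_on.simps
  proof (intro conjI ballI allI)
    fix x assume "x \<in> S"
    then show "f differentiable at x" using Suc.prems by force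
  next
    fix v
    show "Ck_on k S (\<lambda>x. frechet_derivative f (at x) v)"
      by (rule Suc.IH) (use Suc.prems in force)
  qed
qed

lemma Ck_on_const: "open S \<Longrightarrow> Ck_on k S (\<lambda>x. c)"
proof (induction k arbitrary: c)
  case (Suc k)
  show ?case by (rule Ck_on_SucI[where D = "\<lambda>x v. 0"]) (use Suc in \<open>auto\<close>)
qed auto

lemma Ck_on_bounded_linear:
  assumes "open S" "bounded_linear L"
  shows "Ck_on k S f \<Longrightarrow> Ck_on k S (\<lambda>x. L (f x))"
proof (induction k arbitrary: f)
  case 0
  then show ?case using bounded_linear.continuous_on[OF assms(2)] by auto
next
  case (Suc k)
  show ?case
    by (rule Ck_on_SucI[OF assms(1) bounded_linear.has_derivative[OF assms(2) Ck_on_has_derivative[OF Suc.prems]]])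
       (use Suc in auto)
qed

lemma Ck_on_add:
  assumes "open S"
  shows "Ck_on k S f \<Longrightarrow> Ck_on k S g \<Longrightarrow> Ck_on k S (\<lambda>x. f x + g x)"
proof (induction k arbitrary: f g)
  case 0
  then show ?case by (auto intro: continuous_intros)
next
  case (Suc k)
  show ?case
    by (rule Ck_on_SucI[OF assms has_derivative_add[OF Ck_on_has_derivative[OF Suc.prems(1)]
          Ck_on_has_derivative[OF Suc.prems(2)]]]) (use Suc in auto)
qed

lemma Ck_on_mult:
  fixes f g :: "'a::real_normed_vector \<Rightarrow> 'b::real_normed_algebra"
  assumes "open S"
  shows "Ck_on k S f \<Longrightarrow> Ck_on k S g \<Longrightarrow> Ck_on k S (\<lambda>x. f x * g x)"
proof (induction k arbitrary: f g)
  case 0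
  then show ?case by (auto intro: continuous_intros)
next
  case (Suc k)
  show ?case
    by (rule Ck_on_SucI[OF assms has_derivative_mult[OF Ck_on_has_derivative[OF Suc.prems(1)]
          Ck_on_has_derivative[OF Suc.prems(2)]]])
       (use Suc Suc.prems[THEN Ck_on_SucD] in \<open>auto intro!: Ck_on_add[OF assms]\<close>)
qed

lemma Ck_on_inverse:
  fixes f :: "'a::real_normed_vector \<Rightarrow> 'b::real_normed_field"
  assumes "open S" "\<And>x. x \<in> S \<Longrightarrow> f x \<noteq> 0"
  shows "Ck_on k S f \<Longrightarrow> Ck_on k S (\<lambda>x. inverse (f x))"
proof (induction k)
  case 0
  then show ?case using assms by (auto intro!: continuous_intros)
next
  case (Suc k)
  have "Ck_on k S (\<lambda>x. inverse (f x))" using Suc Ck_on_SucD by auto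
  moreover have "Ck_on k S (\<lambda>x. frechet_derivative f (at x) v)" for v using Suc.prems by auto
  ultimately have "Ck_on k S (\<lambda>x. - (inverse (f x) * frechet_derivative f (at x) v * inverse (f x)))" for v
    by (intro Ck_on_bounded_linear[OF assms(1) bounded_linear_minus[OF bounded_linear_ident]]
          Ck_on_mult[OF assms(1)]) auto
  then show ?case
    by (intro Ck_on_SucI[OF assms(1) Deriv.has_derivative_inverse[OF assms(2) Ck_on_has_derivative[OF Suc.prems(1)]]]) auto
qed

text \<open>Stated for a family closed under differentiation, so that the induction on
  \<open>k\<close>, which trades \<open>F i\<close> for its derivative \<open>F j\<close>, stays
  inside the family. The instances are \<open>exp\<close> alone and the functions
  \<open>flat p\<close>.\<close>

lemma Ck_on_compose_real:
  fixes F :: "'i \<Rightarrow> real \<Rightarrow> real" and u :: "'a::real_normed_vector \<Rightarrow> real"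
  assumes "open S" "\<And>x. x \<in> S \<Longrightarrow> u x \<in> I"
    and F: "\<And>i. \<exists>j. \<forall>y\<in>I. (F i has_real_derivative F j y) (at y)"
  shows "Ck_on k S u \<Longrightarrow> Ck_on k S (\<lambda>x. F i (u x))"
proof (induction k arbitrary: i)
  case 0
  have "isCont (F i) y" if "y \<in> I" for y using F[of i] that DERIV_isCont by blast
  then have "continuous_on I (F i)" by (simp add: continuous_at_imp_continuous_on)
  then have "continuous_on S (\<lambda>x. F i (u x))"
    by (rule continuous_on_compose2) (use 0 assms(2) in auto)
  then show ?case by simp
next
  case (Suc k)
  obtain j where j: "\<forall>y\<in>I. (F i has_real_derivative F j y) (at y)" using F by blast
  have d: "((\<lambda>x. F i (u x)) has_derivative (\<lambda>v. F j (u x) * frechet_derivative u (at x) v)) (at x)" if "x \<in> S" for x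
  proof -
    have "(F i has_derivative (\<lambda>h. F j (u x) * h)) (at (u x))"
      using j assms(2)[OF that] by (auto simp: has_field_derivative_def)
    then show ?thesis
      using has_derivative_compose[OF Ck_on_has_derivative[OF Suc.prems that]] by auto
  qed
  show ?case
    by (rule Ck_on_SucI[OF assms(1) d]) (use Suc Ck_on_SucD in \<open>auto intro!: Ck_on_mult[OF assms(1)]\<close>)
qed

lemma smooth_on_cong_imp: "open S \<Longrightarrow> (\<And>x. x \<in> S \<Longrightarrow> f x = g x) \<Longrightarrow> smooth_on S f \<Longrightarrow> smooth_on S g"
  unfolding smooth_on_def using Ck_on_cong_imp by blast

lemma smooth_on_subset: "smooth_on S f \<Longrightarrow> R \<subseteq> S \<Longrightarrow> smooth_on R f"
  unfolding smooth_on_def using Ck_on_subset by blast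

lemma smooth_on_local:
  assumes "\<And>x. x \<in> S \<Longrightarrow> \<exists>U. open U \<and> x \<in> U \<and> smooth_on U f"
  shows "smooth_on S f"
  unfolding smooth_on_def
proof (intro allI Ck_on_local)
  fix k x assume "x \<in> S"
  then show "\<exists>U. open U \<and> x \<in> U \<and> Ck_on k U f" using assms unfolding smooth_on_def by blast
qed

lemma smooth_on_const [simp]: "open S \<Longrightarrow> smooth_on S (\<lambda>x. c)"
  unfolding smooth_on_def using Ck_on_const by blast

lemma smooth_on_bounded_linear:
  "open S \<Longrightarrow> bounded_linear L \<Longrightarrow> smooth_on S f \<Longrightarrow> smooth_on S (\<lambda>x. L (f x))"
  unfolding smooth_on_def using Ck_on_bounded_linear by blast

lemma smooth_on_add:
  "open S \<Longrightarrow> smooth_on S f \<Longrightarrow> smooth_on S g \<Longrightarrow> smooth_on S (\<lambda>x. f x + g x)"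
  unfolding smooth_on_def using Ck_on_add by blast

lemma smooth_on_minus: "open S \<Longrightarrow> smooth_on S f \<Longrightarrow> smooth_on S (\<lambda>x. - f x)"
  using smooth_on_bounded_linear[OF _ bounded_linear_minus[OF bounded_linear_ident]] by auto

lemma smooth_on_diff:
  "open S \<Longrightarrow> smooth_on S f \<Longrightarrow> smooth_on S g \<Longrightarrow> smooth_on S (\<lambda>x. f x - g x)"
  using smooth_on_add[of S f "\<lambda>x. - g x"] smooth_on_minus by auto

lemma smooth_on_mult:
  fixes f g :: "'a::real_normed_vector \<Rightarrow> 'b::real_normed_algebra"
  shows "open S \<Longrightarrow> smooth_on S f \<Longrightarrow> smooth_on S g \<Longrightarrow> smooth_on S (\<lambda>x. f x * g x)"
  unfolding smooth_on_def using Ck_on_mult by blast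

lemma smooth_on_sum:
  "open S \<Longrightarrow> (\<And>i. i \<in> I \<Longrightarrow> smooth_on S (f i)) \<Longrightarrow> smooth_on S (\<lambda>x. \<Sum>i\<in>I. f i x)"
  by (induction I rule: infinite_finite_induct) (auto intro: smooth_on_add)

lemma smooth_on_prod:
  fixes f :: "'i \<Rightarrow> 'a::real_normed_vector \<Rightarrow> 'b::real_normed_field"
  shows "open S \<Longrightarrow> (\<And>i. i \<in> I \<Longrightarrow> smooth_on S (f i)) \<Longrightarrow> smooth_on S (\<lambda>x. \<Prod>i\<in>I. f i x)"
  by (induction I rule: infinite_finite_induct) (auto intro: smooth_on_mult)

lemma smooth_on_inverse:
  fixes f :: "'a::real_normed_vector \<Rightarrow> 'b::real_normed_field"
  shows "open S \<Longrightarrow> (\<And>x. x \<in> S \<Longrightarrow> f x \<noteq> 0) \<Longrightarrow> smooth_on S f \<Longrightarrow> smooth_on S (\<lambda>x. inverse (f x))"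
  unfolding smooth_on_def using Ck_on_inverse by blast

lemma smooth_on_divide:
  fixes f :: "'a::real_normed_vector \<Rightarrow> 'b::real_normed_field"
  shows "open S \<Longrightarrow> (\<And>x. x \<in> S \<Longrightarrow> g x \<noteq> 0) \<Longrightarrow> smooth_on S f \<Longrightarrow> smooth_on S g \<Longrightarrow> smooth_on S (\<lambda>x. f x / g x)"
  using smooth_on_mult[of S f "\<lambda>x. inverse (g x)"] smooth_on_inverse[of S g] by (auto simp: divide_inverse)

lemma smooth_on_compose_real:
  fixes F :: "'i \<Rightarrow> real \<Rightarrow> real" and u :: "'a::real_normed_vector \<Rightarrow> real"
  assumes "open S" "\<And>x. x \<in> S \<Longrightarrow> u x \<in> I"
    and "\<And>i. \<exists>j. \<forall>y\<in>I. (F i has_real_derivative F j y) (at y)"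
  shows "smooth_on S u \<Longrightarrow> smooth_on S (\<lambda>x. F i (u x))"
  unfolding smooth_on_def using Ck_on_compose_real[where u = u and F = F and I = I, OF assms] by blast

lemma smooth_on_has_derivative:
  "smooth_on S f \<Longrightarrow> x \<in> S \<Longrightarrow> (f has_derivative frechet_derivative f (at x)) (at x)"
  unfolding smooth_on_def using Ck_on_has_derivative by blast

lemma smooth_on_differentiable: "smooth_on S f \<Longrightarrow> x \<in> S \<Longrightarrow> f differentiable (at x)"
  using smooth_on_has_derivative by (auto simp: differentiable_def)

lemma smooth_on_continuous: "smooth_on S f \<Longrightarrow> continuous_on S f"
  unfolding smooth_on_def using Ck_on.simps(1) by blast

lemma smooth_on_frechet_derivative: "smooth_on S f \<Longrightarrow> smooth_on S (\<lambda>x. frechet_derivative f (at x) v)"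
  unfolding smooth_on_def
proof
  fix k assume "\<forall>k. Ck_on k S f"
  then have "Ck_on (Suc k) S f" by blast
  then show "Ck_on k S (\<lambda>x. frechet_derivative f (at x) v)" by auto
qed

lemma smooth_on_cnj: "open S \<Longrightarrow> smooth_on S f \<Longrightarrow> smooth_on S (\<lambda>x. cnj (f x))"
  using smooth_on_bounded_linear bounded_linear_cnj by blast

lemma smooth_on_of_real:
  "open S \<Longrightarrow> smooth_on S f \<Longrightarrow> smooth_on S (\<lambda>x. of_real (f x) :: 'a::real_normed_algebra_1)"
  using smooth_on_bounded_linear bounded_linear_of_real by blast

lemma smooth_on_Re: "open S \<Longrightarrow> smooth_on S f \<Longrightarrow> smooth_on S (\<lambda>x. Re (f x))"
  using smooth_on_bounded_linear bounded_linear_Re by blast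

lemma smooth_on_dz: "open S \<Longrightarrow> smooth_on S f \<Longrightarrow> smooth_on S (dz j f)"
  unfolding dz_def
  by (intro smooth_on_divide smooth_on_diff smooth_on_mult smooth_on_frechet_derivative smooth_on_const) auto

lemma smooth_on_dzbar: "open S \<Longrightarrow> smooth_on S f \<Longrightarrow> smooth_on S (dzbar j f)"
  unfolding dzbar_def
  by (intro smooth_on_divide smooth_on_add smooth_on_mult smooth_on_frechet_derivative smooth_on_const) auto

text \<open>One derivative turns \<open>ln\<close> into a reciprocal, whose regularity is already
  known; hence a case distinction on the order in place of an induction.\<close>

lemma smooth_on_ln: "open S \<Longrightarrow> (\<And>x. x \<in> S \<Longrightarrow> f x > 0) \<Longrightarrow> smooth_on S f \<Longrightarrow> smooth_on S (\<lambda>x. ln (f x :: real))"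
proof -
  assume S: "open S" "\<And>x. x \<in> S \<Longrightarrow> f x > 0" "smooth_on S f"
  show ?thesis unfolding smooth_on_def
  proof
    fix k
    have f: "\<And>k. Ck_on k S f" using S(3) unfolding smooth_on_def by blast
    show "Ck_on k S (\<lambda>x. ln (f x) :: real)"
    proof (cases k)
      case 0
      have c: "continuous_on S f" using f[of 0] by simp
      have "continuous_on S (\<lambda>x. ln (f x))"
        using S(2) by (force intro!: continuous_on_ln[OF c])
      then show ?thesis using 0 by simp
    next
      case (Suc m)
      have "\<And>x. x \<in> S \<Longrightarrow> ((\<lambda>x. ln (f x)) has_derivative (\<lambda>v. frechet_derivative f (at x) v * inverse (f x))) (at x)"
        using smooth_on_has_derivative[OF S(3)] S(2) by (auto intro!: derivative_eq_intros simp: divide_inverse)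
      then show ?thesis unfolding Suc
      proof (rule Ck_on_SucI[OF S(1)])
        fix v
        show "Ck_on m S (\<lambda>x. frechet_derivative f (at x) v * inverse (f x))"
          using f[of "Suc m"] f[of m] S(2)
          by (intro Ck_on_mult[OF S(1)] Ck_on_inverse[OF S(1)]) force+
      qed
    qed
  qed
qed

lemma smooth_on_powr:
  fixes f :: "'a::real_normed_vector \<Rightarrow> real"
  assumes "open S" "\<And>x. x \<in> S \<Longrightarrow> f x > 0" "smooth_on S f"
  shows "smooth_on S (\<lambda>x. f x powr a)"
proof -
  \<comment> \<open>A family with a single index: \<open>exp\<close> is its own derivative.\<close>
  have "smooth_on S (\<lambda>x. (\<lambda>_::unit. exp) () (a * ln (f x)))"
    by (rule smooth_on_compose_real[where I = UNIV])
       (use assms in \<open>auto intro!: smooth_on_mult smooth_on_ln\<close>)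
  then have "smooth_on S (\<lambda>x. exp (a * ln (f x)))" by simp
  then show ?thesis
    by (rule smooth_on_cong_imp[OF assms(1), rotated]) (use assms(2) in \<open>force simp: powr_def\<close>)
qed

section \<open>Wirtinger calculus\<close>

lemma axis_ii: "axis j \<i> = \<i> *s axis j (1::complex)"
  by (simp add: vec_eq_iff axis_def)

lemma vec_complex_expand:
  fixes w :: "complex^'n"
  shows "w = (\<Sum>l\<in>UNIV. Re (w$l) *\<^sub>R axis l 1 + Im (w$l) *\<^sub>R axis l \<i>)"
proof -
  have "(\<Sum>l\<in>UNIV. Re (w$l) *\<^sub>R axis l 1 + Im (w$l) *\<^sub>R axis l \<i>) $ m = w $ m" for m
  proof -
    have "(\<Sum>l\<in>UNIV. Re (w$l) *\<^sub>R axis l 1 + Im (w$l) *\<^sub>R axis l \<i>) $ m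
       = (\<Sum>l\<in>UNIV. if l = m then w $ m else 0)"
      unfolding sum_component
      by (rule sum.cong) (auto simp: axis_def complex_eq_iff)
    then show ?thesis by simp
  qed
  then show ?thesis by (simp add: vec_eq_iff)
qed

text \<open>A real linear map is the sum of a complex linear and a conjugate linear one. The two
  brackets are their values on the basis, found by writing real and imaginary parts through
  \<open>w\<close> and its conjugate.\<close>

lemma linear_wirtinger:
  fixes D :: "complex^'n \<Rightarrow> complex"
  assumes "linear D"
  shows "D w = (\<Sum>l\<in>UNIV. w$l * ((D (axis l 1) - \<i> * D (axis l \<i>)) / 2)
                 + cnj (w$l) * ((D (axis l 1) + \<i> * D (axis l \<i>)) / 2))"
proof -
  have "D w = D (\<Sum>l\<in>UNIV. Re (w$l) *\<^sub>R axis l 1 + Im (w$l) *\<^sub>R axis l \<i>)"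
    using vec_complex_expand[of w] by simp
  also have "\<dots> = (\<Sum>l\<in>UNIV. of_real (Re (w$l)) * D (axis l 1) + of_real (Im (w$l)) * D (axis l \<i>))"
    unfolding linear_sum[OF assms] linear_add[OF assms] linear_scale[OF assms] by (simp add: scaleR_conv_of_real)
  also have "\<dots> = (\<Sum>l\<in>UNIV. w$l * ((D (axis l 1) - \<i> * D (axis l \<i>)) / 2)
                 + cnj (w$l) * ((D (axis l 1) + \<i> * D (axis l \<i>)) / 2))"
  proof (rule sum.cong[OF refl])
    fix l :: 'n
    have 1: "complex_of_real (Re (w$l)) = (w$l + cnj (w$l)) / 2" by (simp add: complex_eq_iff)
    have 2: "complex_of_real (Im (w$l)) = - \<i> * (w$l - cnj (w$l)) / 2" by (simp add: complex_eq_iff)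
    show "of_real (Re (w$l)) * D (axis l 1) + of_real (Im (w$l)) * D (axis l \<i>) =
      w$l * ((D (axis l 1) - \<i> * D (axis l \<i>)) / 2) + cnj (w$l) * ((D (axis l 1) + \<i> * D (axis l \<i>)) / 2)"
      unfolding 1 2 by (simp add: field_simps)
  qed
  finally show ?thesis .
qed

lemma frechet_wirtinger:
  fixes f :: "complex^'n \<Rightarrow> complex"
  assumes "f differentiable (at z)"
  shows "frechet_derivative f (at z) w = (\<Sum>l\<in>UNIV. w$l * dz l f z + cnj (w$l) * dzbar l f z)"
  unfolding dz_def dzbar_def
  by (rule linear_wirtinger) (use assms linear_frechet_derivative in blast)

lemma dz_eq: "(f has_derivative D) (at z) \<Longrightarrow> dz j f z = (D (axis j 1) - \<i> * D (axis j \<i>)) / 2"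
  unfolding dz_def using frechet_derivative_at by metis

lemma dzbar_eq: "(f has_derivative D) (at z) \<Longrightarrow> dzbar j f z = (D (axis j 1) + \<i> * D (axis j \<i>)) / 2"
  unfolding dzbar_def using frechet_derivative_at by metis

lemma differentiable_has_derivative:
  "f differentiable (at z) \<Longrightarrow> (f has_derivative frechet_derivative f (at z)) (at z)"
  using frechet_derivative_works by blast

lemma dz_const [simp]: "dz j (\<lambda>z. c) z = 0" and dzbar_const [simp]: "dzbar j (\<lambda>z. c) z = 0"
  by (simp_all add: dz_def dzbar_def)

lemma
  assumes "f differentiable (at z)" "g differentiable (at z)"
  shows dzbar_add: "dzbar j (\<lambda>z. f z + g z) z = dzbar j f z + dzbar j g z"
    and dzbar_diff: "dzbar j (\<lambda>z. f z - g z) z = dzbar j f z - dzbar j g z"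
    and dz_mult: "dz j (\<lambda>z. f z * g z) z = f z * dz j g z + dz j f z * g z"
    and dzbar_mult: "dzbar j (\<lambda>z. f z * g z) z = f z * dzbar j g z + dzbar j f z * g z"
proof -
  note d = assms[THEN differentiable_has_derivative]
  note m = has_derivative_mult[OF d] and a = has_derivative_add[OF d] and s = has_derivative_diff[OF d]
  show "dzbar j (\<lambda>z. f z + g z) z = dzbar j f z + dzbar j g z"
    "dzbar j (\<lambda>z. f z - g z) z = dzbar j f z - dzbar j g z"
    "dz j (\<lambda>z. f z * g z) z = f z * dz j g z + dz j f z * g z"
    "dzbar j (\<lambda>z. f z * g z) z = f z * dzbar j g z + dzbar j f z * g z"
    unfolding dz_eq[OF m] dzbar_eq[OF a] dzbar_eq[OF m] dzbar_eq[OF s]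
      dz_eq[OF d(1)] dz_eq[OF d(2)] dzbar_eq[OF d(1)] dzbar_eq[OF d(2)]
    by (simp_all add: field_simps)
qed

lemma
  assumes "\<And>i. i \<in> I \<Longrightarrow> f i differentiable (at z)"
  shows dz_sum: "dz j (\<lambda>z. \<Sum>i\<in>I. f i z) z = (\<Sum>i\<in>I. dz j (f i) z)"
    and dzbar_sum: "dzbar j (\<lambda>z. \<Sum>i\<in>I. f i z) z = (\<Sum>i\<in>I. dzbar j (f i) z)"
proof -
  have d: "((\<lambda>z. \<Sum>i\<in>I. f i z) has_derivative (\<lambda>v. \<Sum>i\<in>I. frechet_derivative (f i) (at z) v)) (at z)"
    by (rule has_derivative_sum) (use assms differentiable_has_derivative in blast)
  show "dz j (\<lambda>z. \<Sum>i\<in>I. f i z) z = (\<Sum>i\<in>I. dz j (f i) z)"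
    unfolding dz_eq[OF d] unfolding dz_def
    by (simp add: sum_distrib_left sum_subtractf flip: sum_divide_distrib)
  show "dzbar j (\<lambda>z. \<Sum>i\<in>I. f i z) z = (\<Sum>i\<in>I. dzbar j (f i) z)"
    unfolding dzbar_eq[OF d] unfolding dzbar_def
    by (simp add: sum_distrib_left sum.distrib flip: sum_divide_distrib)
qed

lemma
  assumes "f differentiable (at z)"
  shows dz_cnj: "dz j (\<lambda>z. cnj (f z)) z = cnj (dzbar j f z)"
    and dzbar_minus: "dzbar j (\<lambda>z. - f z) z = - dzbar j f z"
proof -
  note d = differentiable_has_derivative[OF assms]
  note c = bounded_linear.has_derivative[OF bounded_linear_cnj d]
  note m = bounded_linear.has_derivative[OF bounded_linear_minus[OF bounded_linear_ident] d]
  show "dz j (\<lambda>z. cnj (f z)) z = cnj (dzbar j f z)"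
    "dzbar j (\<lambda>z. - f z) z = - dzbar j f z"
    unfolding dz_eq[OF c] dzbar_eq[OF m] unfolding dzbar_def
    by (simp_all add: field_simps)
qed

lemma
  assumes "open S" "z \<in> S" "\<And>w. w \<in> S \<Longrightarrow> f w = g w"
  shows dz_cong: "dz j f z = dz j g z" and dzbar_cong: "dzbar j f z = dzbar j g z"
proof -
  have "(f has_derivative D) (at z) \<longleftrightarrow> (g has_derivative D) (at z)" for D
    using has_derivative_transform_within_open[of f D z UNIV S g]
      has_derivative_transform_within_open[of g D z UNIV S f] assms by auto
  then have "frechet_derivative f (at z) = frechet_derivative g (at z)"
    unfolding frechet_derivative_def by simp
  then show "dz j f z = dz j g z" "dzbar j f z = dzbar j g z" by (simp_all add: dz_def dzbar_def)
qed

section \<open>Holomorphic functions and the Wirtinger chain rule\<close>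

lemma holo_on_differentiable: "holo_on S f \<Longrightarrow> z \<in> S \<Longrightarrow> f differentiable (at z)"
  unfolding holo_on_def differentiable_def by blast

lemma holo_on_frechet_scale:
  assumes "holo_on S f" "z \<in> S"
  shows "frechet_derivative f (at z) (a *s \<xi>) = a * frechet_derivative f (at z) \<xi>"
proof -
  obtain D where D: "(f has_derivative D) (at z)" "\<forall>a \<xi>. D (a *s \<xi>) = a * D \<xi>"
    using assms unfolding holo_on_def by blast
  then show ?thesis using frechet_derivative_at by metis
qed

lemma
  assumes "holo_on S f" "z \<in> S"
  shows holo_on_dzbar: "dzbar k f z = 0"
    and holo_on_dz: "dz k f z = frechet_derivative f (at z) (axis k 1)"
  using holo_on_frechet_scale[OF assms, of \<i> "axis k 1"]
  by (simp_all add: dz_def dzbar_def axis_ii)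

lemma holo_on_frechet:
  fixes f :: "complex^'n \<Rightarrow> complex"
  assumes "holo_on S f" "z \<in> S"
  shows "frechet_derivative f (at z) w = (\<Sum>l\<in>UNIV. w$l * dz l f z)"
  using frechet_wirtinger[OF holo_on_differentiable[OF assms]] holo_on_dzbar[OF assms] by simp

lemma has_derivative_vecI:
  fixes g :: "'a::real_normed_vector \<Rightarrow> 'b::euclidean_space^'n"
  assumes "\<And>l. ((\<lambda>z. g z $ l) has_derivative (\<lambda>v. D v $ l)) (at x within S)"
  shows "(g has_derivative D) (at x within S)"
proof (rule has_derivative_componentwise_within[THEN iffD2], rule ballI)
  fix i :: "'b^'n" assume "i \<in> Basis"
  then obtain l b where i: "i = axis l b" unfolding Basis_vec_def by blast
  show "((\<lambda>x. g x \<bullet> i) has_derivative (\<lambda>x. D x \<bullet> i)) (at x within S)"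
    using has_derivative_inner_left[OF assms[of l], of b] by (simp add: i inner_axis)
qed

text \<open>One term of the chain rule for a complex linear inner derivative: \<open>a\<close> is
  its value on \<open>axis j 1\<close> and \<open>\<i> * a\<close> the one on
  \<open>axis j \<i>\<close>. The combination defining \<open>dz\<close> cancels the conjugate
  linear part of the outer derivative, the one defining \<open>dzbar\<close> the linear
  part.\<close>

lemma wirtinger_alg:
  fixes a F B :: complex
  shows "(a * F + cnj a * B - \<i> * ((\<i> * a) * F + cnj (\<i> * a) * B)) / 2 = F * a"
    and "(a * F + cnj a * B + \<i> * ((\<i> * a) * F + cnj (\<i> * a) * B)) / 2 = B * cnj a"
proof -
  have "\<i> * ((\<i> * a) * F + cnj (\<i> * a) * B) = - (a * F) + cnj a * B"
    by (simp add: complex_eq_iff)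
  then show "(a * F + cnj a * B - \<i> * ((\<i> * a) * F + cnj (\<i> * a) * B)) / 2 = F * a"
    and "(a * F + cnj a * B + \<i> * ((\<i> * a) * F + cnj (\<i> * a) * B)) / 2 = B * cnj a"
    by simp_all
qed

text \<open>A holomorphic inner map has no conjugate derivatives, so the mixed terms of the
  Wirtinger chain rule vanish. This is why coefficients in different charts transform by the
  Jacobian or its conjugate.\<close>

lemma
  fixes f :: "complex^'n \<Rightarrow> complex" and g :: "complex^'m \<Rightarrow> complex^'n"
  assumes f: "f differentiable (at (g z))"
    and g: "\<And>l. holo_on U (\<lambda>z. g z $ l)" and z: "z \<in> U"
  shows dz_compose: "dz j (\<lambda>z. f (g z)) z = (\<Sum>l\<in>UNIV. dz l f (g z) * dz j (\<lambda>z. g z $ l) z)"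
    and dzbar_compose: "dzbar j (\<lambda>z. f (g z)) z = (\<Sum>l\<in>UNIV. dzbar l f (g z) * cnj (dz j (\<lambda>z. g z $ l) z))"
    and differentiable_compose_holo: "(\<lambda>z. f (g z)) differentiable (at z)"
proof -
  let ?D = "\<lambda>v. \<chi> l. frechet_derivative (\<lambda>z. g z $ l) (at z) v"
  have "((\<lambda>z. g z $ l) has_derivative frechet_derivative (\<lambda>z. g z $ l) (at z)) (at z)" for l
    using holo_on_differentiable[OF g z] differentiable_has_derivative by blast
  then have gd: "(g has_derivative ?D) (at z)"
    by (intro has_derivative_vecI) simp
  note fd = has_derivative_compose[OF gd differentiable_has_derivative[OF f]]
  have *: "frechet_derivative f (at (g z)) (?D v) = (\<Sum>l\<in>UNIV.
      frechet_derivative (\<lambda>z. g z $ l) (at z) v * dz l f (g z) + cnj (frechet_derivative (\<lambda>z. g z $ l) (at z) v) * dzbar l f (g z))" for v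
    using frechet_wirtinger[OF f, of "?D v"] by (simp only: vec_lambda_beta)
  have g1: "frechet_derivative (\<lambda>z. g z $ l) (at z) (axis j 1) = dz j (\<lambda>z. g z $ l) z" for l
    using holo_on_dz[OF g z] by simp
  have g2: "frechet_derivative (\<lambda>z. g z $ l) (at z) (axis j \<i>) = \<i> * dz j (\<lambda>z. g z $ l) z" for l
    using holo_on_frechet_scale[OF g z] holo_on_dz[OF g z] by (simp add: axis_ii)
  show "dz j (\<lambda>z. f (g z)) z = (\<Sum>l\<in>UNIV. dz l f (g z) * dz j (\<lambda>z. g z $ l) z)"
    unfolding dz_eq[OF fd] * unfolding g1 g2 sum_distrib_left sum_subtractf[symmetric] sum_divide_distrib
    by (rule sum.cong[OF refl]) (rule wirtinger_alg)
  show "dzbar j (\<lambda>z. f (g z)) z = (\<Sum>l\<in>UNIV. dzbar l f (g z) * cnj (dz j (\<lambda>z. g z $ l) z))"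
    unfolding dzbar_eq[OF fd] * unfolding g1 g2 sum_distrib_left sum.distrib[symmetric] sum_divide_distrib
    by (rule sum.cong[OF refl]) (rule wirtinger_alg)
  show "(\<lambda>z. f (g z)) differentiable (at z)" using fd by (auto simp: differentiable_def)
qed

section \<open>Holomorphic functions are smooth\<close>

lemma norm_vector_smult: "norm (a *s x) = norm a * norm (x :: complex^'n)"
  by (simp add: norm_vec_def norm_mult L2_set_right_distrib)

lemma holo_on_slice:
  fixes f :: "complex^'n \<Rightarrow> complex"
  assumes "holo_on S f" "z + \<zeta> *s \<xi> \<in> S"
  shows "((\<lambda>\<zeta>. f (z + \<zeta> *s \<xi>)) has_field_derivative frechet_derivative f (at (z + \<zeta> *s \<xi>)) \<xi>) (at \<zeta>)"
proof -
  have 1: "((\<lambda>\<zeta>. z + \<zeta> *s \<xi>) has_derivative (\<lambda>h. h *s \<xi>)) (at \<zeta>)"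
    by (rule has_derivative_vecI) (auto intro!: derivative_eq_intros)
  have "((\<lambda>\<zeta>. f (z + \<zeta> *s \<xi>)) has_derivative (\<lambda>h. frechet_derivative f (at (z + \<zeta> *s \<xi>)) (h *s \<xi>))) (at \<zeta>)"
    by (rule has_derivative_compose[OF 1 differentiable_has_derivative[OF holo_on_differentiable[OF assms]]])
  then show ?thesis
    unfolding holo_on_frechet_scale[OF assms] by (rule has_derivative_imp_has_field_derivative) simp
qed

text \<open>The circle in closed form over the parameter interval from 0 to 1, so that Cauchy's
  formula becomes an ordinary integral that depends on the centre only through
  \<open>f\<close>.\<close>

definition circ :: "real \<Rightarrow> real \<Rightarrow> complex" where
  "circ r t = of_real r * exp (2 * of_real pi * \<i> * of_real t)"

lemma norm_circ [simp]: "norm (circ r t) = \<bar>r\<bar>"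
  by (simp add: circ_def norm_mult)

lemma circ_eq_0 [simp]: "circ r t = 0 \<longleftrightarrow> r = 0"
  by (simp add: circ_def)

lemma continuous_on_circ [continuous_intros]:
  "continuous_on S g \<Longrightarrow> continuous_on S (\<lambda>x. circ r (g x))"
  unfolding circ_def by (intro continuous_intros)

text \<open>Cauchy's formula for the first derivative, on the complex line through \<open>z\<close>
  in direction \<open>\<xi>\<close>. The velocity of the circle is \<open>2 * pi * \<i>\<close>
  times \<open>circ r t\<close>, which cancels the constant and one of the two powers in the
  denominator.\<close>

lemma holo_on_cauchy:
  fixes f :: "complex^'n \<Rightarrow> complex"
  assumes "open S" "holo_on S f" "r > 0" and S: "\<And>\<zeta>. norm \<zeta> \<le> r \<Longrightarrow> z + \<zeta> *s \<xi> \<in> S"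
  shows "frechet_derivative f (at z) \<xi> =
    integral {0..1} (\<lambda>t. f (z + circ r t *s \<xi>) / circ r t)"
proof -
  let ?F = "\<lambda>\<zeta>. f (z + \<zeta> *s \<xi>)"
  have hol: "?F holomorphic_on cball 0 r"
    by (rule holomorphic_onI) (use holo_on_slice[OF assms(2) S] in \<open>auto simp: field_differentiable_def intro: has_field_derivative_at_within\<close>)
  have "(?F has_field_derivative (1 / (2 * of_real pi * \<i>) * contour_integral (circlepath 0 r) (\<lambda>u. ?F u / (u - 0)\<^sup>2))) (at 0)"
    by (rule Cauchy_derivative_integral_circlepath(2))
      (use hol \<open>r > 0\<close> in \<open>auto intro: holomorphic_on_subset holomorphic_on_imp_continuous_on\<close>)
  moreover have "(?F has_field_derivative frechet_derivative f (at z) \<xi>) (at 0)"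
    using holo_on_slice[OF assms(2) S[of 0]] \<open>r > 0\<close> by (simp add: vector_smult_lzero)
  ultimately have "frechet_derivative f (at z) \<xi> = 1 / (2 * of_real pi * \<i>) * contour_integral (circlepath 0 r) (\<lambda>u. ?F u / (u - 0)\<^sup>2)"
    using DERIV_unique by blast
  also have "\<dots> = 1 / (2 * of_real pi * \<i>) *
     integral {0..1} (\<lambda>t. (2 * of_real pi * \<i>) * (f (z + circ r t *s \<xi>) / circ r t))"
  proof -
    have "?F (circlepath 0 r t) / (circlepath 0 r t - 0)\<^sup>2 * (2 * of_real pi * \<i> * r * exp (2 * of_real pi * \<i> * t))
       = (2 * of_real pi * \<i>) * (f (z + circ r t *s \<xi>) / circ r t)" for t
    proof -
      have e: "circlepath 0 r t = circ r t" "2 * of_real pi * \<i> * r * exp (2 * of_real pi * \<i> * t) = 2 * of_real pi * \<i> * circ r t"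
        by (simp_all add: circlepath circ_def)
      have "circ r t \<noteq> 0" using \<open>r > 0\<close> by simp
      then show ?thesis unfolding e by (simp add: power2_eq_square)
    qed
    then show ?thesis unfolding contour_integral_integral vector_derivative_circlepath by simp
  qed
  also have "\<dots> = integral {0..1} (\<lambda>t. f (z + circ r t *s \<xi>) / circ r t)"
    unfolding integral_mult_right by simp
  finally show ?thesis .
qed

lemma cauchy_radius:
  fixes z0 \<xi> :: "complex^'n"
  assumes "open S" "z0 \<in> S"
  obtains \<epsilon> r :: real where "\<epsilon> > 0" "r > 0" "\<And>z \<zeta>. z \<in> ball z0 \<epsilon> \<Longrightarrow> norm \<zeta> \<le> r \<Longrightarrow> z + \<zeta> *s \<xi> \<in> S"
proof -
  obtain e where e: "e > 0" "ball z0 e \<subseteq> S" using assms openE by blast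
  \<comment> \<open>Half of \<open>e\<close> is left for moving the centre and half for the disc;
    the summand \<open>1\<close> covers \<open>\<xi> = 0\<close>.\<close>
  define r where "r = e / 2 / (norm \<xi> + 1)"
  have r: "r > 0" using e by (auto simp: r_def intro!: divide_pos_pos add_nonneg_pos)
  show thesis
  proof (rule that[of "e/2" r])
    fix z \<zeta> assume z: "z \<in> ball z0 (e/2)" "norm (\<zeta>::complex) \<le> r"
    have "norm (\<zeta> *s \<xi>) \<le> r * (norm \<xi> + 1)"
      unfolding norm_vector_smult using z(2) r by (intro mult_mono) auto
    also have "\<dots> = e / 2" unfolding r_def
      by (rule nonzero_eq_divide_eq[THEN iffD1, OF _ refl]) (use norm_ge_zero[of \<xi>] in linarith)
    finally have "norm (\<zeta> *s \<xi>) \<le> e / 2" .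
    moreover have "dist z0 (z + \<zeta> *s \<xi>) \<le> dist z0 z + norm (\<zeta> *s \<xi>)"
      using dist_triangle[of z0 "z + \<zeta> *s \<xi>" z] by (simp add: dist_norm)
    ultimately have "dist z0 (z + \<zeta> *s \<xi>) < e" using z(1) by simp
    then show "z + \<zeta> *s \<xi> \<in> S" using e(2) by auto
  qed (use e r in auto)
qed

lemma continuous_on_circle_shift:
  fixes f :: "complex^'n \<Rightarrow> complex" and U :: "(complex^'n) set" and r :: real
  assumes "continuous_on S f" "r > 0"
    and "\<And>z \<zeta>. z \<in> U \<Longrightarrow> norm \<zeta> \<le> r \<Longrightarrow> z + \<zeta> *s \<xi> \<in> S"
  shows "continuous_on (U \<times> cbox (0::real) 1)
     (\<lambda>(z, t). f (z + circ r t *s \<xi>) / circ r t)"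
proof -
  have c: "continuous_on (U \<times> cbox (0::real) 1) (\<lambda>x. circ r (snd x))"
    by (intro continuous_intros)
  have "continuous_on (U \<times> cbox (0::real) 1) (\<lambda>x. fst x + circ r (snd x) *s \<xi>)"
    unfolding vector_scalar_mult_def
    by (intro continuous_on_add continuous_on_fst continuous_on_id continuous_on_vec_lambda continuous_on_mult c continuous_on_const)
  then have "continuous_on (U \<times> cbox (0::real) 1) (\<lambda>x. f (fst x + circ r (snd x) *s \<xi>))"
    by (rule continuous_on_compose2[OF assms(1)]) (use assms(2,3) in \<open>auto simp: norm_mult\<close>)
  then have "continuous_on (U \<times> cbox (0::real) 1)
     (\<lambda>x. f (fst x + circ r (snd x) *s \<xi>) / circ r (snd x))"
    by (intro continuous_on_divide c) (use \<open>r > 0\<close> in auto)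
  then show ?thesis by (simp add: case_prod_unfold)
qed

lemma holo_on_continuous_on: "holo_on S f \<Longrightarrow> continuous_on S f"
  by (intro continuous_at_imp_continuous_on ballI differentiable_imp_continuous_within) (rule holo_on_differentiable)

text \<open>\<open>holo_on\<close> says nothing about continuity of the derivative. The Cauchy
  integral depends continuously on its centre, and the Leibniz rule below relies on this.\<close>

lemma holo_on_continuous_frechet:
  fixes f :: "complex^'n \<Rightarrow> complex"
  assumes "open S" "holo_on S f"
  shows "continuous_on S (\<lambda>z. frechet_derivative f (at z) \<xi>)"
proof (rule continuous_at_imp_continuous_on, rule ballI)
  fix z0 assume "z0 \<in> S"
  then obtain \<epsilon> r where r: "\<epsilon> > 0" "r > 0" "\<And>z \<zeta>. z \<in> ball z0 \<epsilon> \<Longrightarrow> norm \<zeta> \<le> r \<Longrightarrow> z + \<zeta> *s \<xi> \<in> S"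
    using cauchy_radius[OF assms(1)] by metis
  have "continuous_on (ball z0 \<epsilon>) (\<lambda>z. integral (cbox 0 1)
     (\<lambda>t. f (z + circ r t *s \<xi>) / circ r t))"
    by (rule integral_continuous_on_param)
      (rule continuous_on_circle_shift[OF holo_on_continuous_on[OF assms(2)] r(2,3)])
  then have "continuous_on (ball z0 \<epsilon>) (\<lambda>z. frechet_derivative f (at z) \<xi>)"
    by (rule continuous_on_cong[THEN iffD2, rotated -1])
       (use holo_on_cauchy[OF assms r(2,3)] in \<open>auto simp: cbox_interval\<close>)
  then show "isCont (\<lambda>z. frechet_derivative f (at z) \<xi>) z0"
    using r(1) by (simp add: continuous_on_eq_continuous_at)
qed

text \<open>Differentiation of the Cauchy integral under the integral sign: the derivative of the
  integrand is complex linear, and so is its integral. Iteration gives smoothness.\<close>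

theorem holo_on_frechet_derivative:
  fixes f :: "complex^'n \<Rightarrow> complex"
  assumes "open S" "holo_on S f"
  shows "holo_on S (\<lambda>z. frechet_derivative f (at z) \<xi>)"
  unfolding holo_on_def
proof
  fix z0 assume z0: "z0 \<in> S"
  then obtain \<epsilon> r where r: "\<epsilon> > 0" "r > 0" "\<And>z \<zeta>. z \<in> ball z0 \<epsilon> \<Longrightarrow> norm \<zeta> \<le> r \<Longrightarrow> z + \<zeta> *s \<xi> \<in> S"
    using cauchy_radius[OF assms(1)] by metis
  let ?U = "ball z0 \<epsilon>"
  \<comment> \<open>The derivative of the Cauchy integrand in the centre. It is bundled by
    \<open>Blinfun\<close> below because the Leibniz rule integrates operator-valued
    functions.\<close>
  define G where "G z t = (\<lambda>\<eta>. frechet_derivative f (at (z + circ r t *s \<xi>)) \<eta> / circ r t)" for z t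
  have S: "z + circ r t *s \<xi> \<in> S" if "z \<in> ?U" for z t
    using r(3)[OF that, of "circ r t"] r(2) by simp
  have bl: "bounded_linear (G z t)" if "z \<in> ?U" for z t
    unfolding G_def
    by (intro bounded_linear_compose[OF bounded_linear_divide]
        has_derivative_bounded_linear[OF differentiable_has_derivative[OF holo_on_differentiable[OF assms(2) S[OF that]]]])
  have dint: "((\<lambda>z. integral (cbox 0 1) (\<lambda>t. f (z + circ r t *s \<xi>) / circ r t)) has_derivative
     blinfun_apply (integral (cbox 0 1) (\<lambda>t. Blinfun (G z0 t)))) (at z0 within ?U)"
  proof (rule leibniz_rule)
    fix z and t :: real assume z: "z \<in> ?U"
    have "((\<lambda>z. f (z + circ r t *s \<xi>)) has_derivative (\<lambda>h. frechet_derivative f (at (z + circ r t *s \<xi>)) h)) (at z)"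
      by (rule has_derivative_compose[OF has_derivative_add[OF has_derivative_ident has_derivative_const, simplified]
          differentiable_has_derivative[OF holo_on_differentiable[OF assms(2) S[OF z]]]])
    then have "((\<lambda>z. f (z + circ r t *s \<xi>) / circ r t) has_derivative G z t) (at z)"
      unfolding G_def by (intro bounded_linear.has_derivative[OF bounded_linear_divide])
    then show "((\<lambda>z. f (z + circ r t *s \<xi>) / circ r t) has_derivative blinfun_apply (Blinfun (G z t))) (at z within ?U)"
      unfolding bounded_linear_Blinfun_apply[OF bl[OF z]] by (rule has_derivative_at_withinI)
  next
    fix z assume z: "z \<in> ?U"
    have "continuous_on (?U \<times> cbox (0::real) 1) (\<lambda>(z, t). f (z + circ r t *s \<xi>) / circ r t)"
      by (rule continuous_on_circle_shift[OF holo_on_continuous_on[OF assms(2)] r(2,3)])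
    moreover have "continuous_on (cbox (0::real) 1) (Pair z)" by (intro continuous_intros)
    moreover have "Pair z ` cbox 0 1 \<subseteq> ?U \<times> cbox (0::real) 1" using z by auto
    ultimately have "continuous_on (cbox 0 1) (\<lambda>t. case (z, t) of (z, t) \<Rightarrow> f (z + circ r t *s \<xi>) / circ r t)"
      by (rule continuous_on_compose2)
    then have "continuous_on (cbox 0 1) (\<lambda>t. f (z + circ r t *s \<xi>) / circ r t)" by simp
    then show "(\<lambda>t. f (z + circ r t *s \<xi>) / circ r t) integrable_on cbox 0 1"
      by (rule integrable_continuous)
  next
    show "continuous_on (?U \<times> cbox 0 1) (\<lambda>(z, t). Blinfun (G z t))"
    proof (rule continuous_on_blinfun_componentwise)
      fix i :: "complex^'n"
      have "continuous_on (?U \<times> cbox 0 1) (\<lambda>(z, t). G z t i)"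
        unfolding G_def
        by (rule continuous_on_circle_shift[OF holo_on_continuous_frechet[OF assms] r(2,3)])
      then show "continuous_on (?U \<times> cbox 0 1) (\<lambda>x. blinfun_apply (case x of (z, t) \<Rightarrow> Blinfun (G z t)) i)"
        by (rule continuous_on_cong[THEN iffD2, rotated -1])
           (auto simp: bounded_linear_Blinfun_apply[OF bl])
    qed
  qed (use r(1) in auto)
  have contG: "continuous_on (cbox 0 1) (\<lambda>t. Blinfun (G z0 t))"
  proof (rule continuous_on_blinfun_componentwise)
    fix i :: "complex^'n"
    have "continuous_on (?U \<times> cbox 0 1) (\<lambda>(z, t). G z t i)"
      unfolding G_def
      by (rule continuous_on_circle_shift[OF holo_on_continuous_frechet[OF assms] r(2,3)])
    then have "continuous_on (cbox 0 1) ((\<lambda>(z, t). G z t i) \<circ> (\<lambda>t. (z0, t)))"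
      by (intro continuous_on_compose) (use r(1) in \<open>auto intro!: continuous_intros elim!: continuous_on_subset\<close>)
    then show "continuous_on (cbox 0 1) (\<lambda>t. blinfun_apply (Blinfun (G z0 t)) i)"
      using r(1) by (simp add: o_def bounded_linear_Blinfun_apply[OF bl])
  qed
  let ?D = "blinfun_apply (integral (cbox 0 1) (\<lambda>t. Blinfun (G z0 t)))"
  have D: "?D \<eta> = integral (cbox 0 1) (\<lambda>t. G z0 t \<eta>)" for \<eta>
  proof -
    have "integral (cbox 0 1) ((\<lambda>F. blinfun_apply F \<eta>) \<circ> (\<lambda>t. Blinfun (G z0 t))) = ?D \<eta>"
      by (rule integral_linear[OF integrable_continuous[OF contG] blinfun.bounded_linear_left])
    then show ?thesis using r(1) by (simp add: o_def bounded_linear_Blinfun_apply[OF bl])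
  qed
  have "((\<lambda>z. frechet_derivative f (at z) \<xi>) has_derivative ?D) (at z0)"
  proof (rule has_derivative_transform_within_open[of _ _ _ _ ?U])
    show "((\<lambda>z. integral (cbox 0 1) (\<lambda>t. f (z + circ r t *s \<xi>) / circ r t)) has_derivative ?D) (at z0)"
      using dint r(1) by (simp add: at_within_open[of z0 ?U])
    fix z assume "z \<in> ?U"
    then show "integral (cbox 0 1) (\<lambda>t. f (z + circ r t *s \<xi>) / circ r t) = frechet_derivative f (at z) \<xi>"
      using holo_on_cauchy[OF assms r(2,3)] by simp
  qed (use r(1) in auto)
  moreover have "?D (a *s \<eta>) = a * ?D \<eta>" for a \<eta>
  proof -
    have "G z0 t (a *s \<eta>) = a * G z0 t \<eta>" for t
      unfolding G_def using holo_on_frechet_scale[OF assms(2) S] r(1) by simp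
    then show ?thesis unfolding D by simp
  qed
  ultimately show "\<exists>D. ((\<lambda>z. frechet_derivative f (at z) \<xi>) has_derivative D) (at z0) \<and> (\<forall>a \<xi>. D (a *s \<xi>) = a * D \<xi>)"
    by (intro exI[of _ ?D]) simp
qed

lemma holo_on_cong_imp:
  assumes "open S" "\<And>z. z \<in> S \<Longrightarrow> f z = g z" "holo_on S f"
  shows "holo_on S g"
  unfolding holo_on_def
proof
  fix z assume z: "z \<in> S"
  then obtain D where "(f has_derivative D) (at z)" "\<forall>a \<xi>. D (a *s \<xi>) = a * D \<xi>"
    using assms(3) unfolding holo_on_def by blast
  then show "\<exists>D. (g has_derivative D) (at z) \<and> (\<forall>a \<xi>. D (a *s \<xi>) = a * D \<xi>)"
    using has_derivative_transform_within_open[of f D z UNIV S g] assms(1,2) z by auto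
qed

lemma holo_on_dz_holo:
  assumes "open S" "holo_on S f"
  shows "holo_on S (dz j f)"
  by (rule holo_on_cong_imp[OF assms(1) _ holo_on_frechet_derivative[OF assms, of "axis j 1"]])
     (use holo_on_dz[OF assms(2)] in simp)

lemma holo_on_smooth:
  fixes f :: "complex^'n \<Rightarrow> complex"
  assumes "open S" "holo_on S f"
  shows "smooth_on S f"
  unfolding smooth_on_def
proof
  fix k show "Ck_on k S f"
    using assms(2)
  proof (induction k arbitrary: f)
    case 0
    then show ?case by (simp add: holo_on_continuous_on)
  next
    case (Suc k)
    show ?case
      using Suc.IH[OF holo_on_frechet_derivative[OF assms(1) Suc.prems]] holo_on_differentiable[OF Suc.prems]
      by simp
  qed
qed

section \<open>Symmetry of second derivatives\<close>

text \<open>The mean value theorem is applied to the increment in direction \<open>v\<close> as a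
  function along \<open>u\<close>, and then along \<open>v\<close>. The second difference is
  symmetric in \<open>u\<close> and \<open>v\<close> while the derivative on the right is visibly
  not; this is the source of the symmetry below.\<close>

lemma second_difference:
  fixes g :: "'a::real_normed_vector \<Rightarrow> real"
  assumes "smooth_on S g" "s > 0" and S: "\<And>a b. 0 \<le> a \<Longrightarrow> a \<le> s \<Longrightarrow> 0 \<le> b \<Longrightarrow> b \<le> s \<Longrightarrow> x + a *\<^sub>R u + b *\<^sub>R v \<in> S"
  shows "\<exists>a b. 0 < a \<and> a < s \<and> 0 < b \<and> b < s \<and>
     g (x + s *\<^sub>R u + s *\<^sub>R v) - g (x + s *\<^sub>R u) - g (x + s *\<^sub>R v) + g x
      = s * s * frechet_derivative (\<lambda>y. frechet_derivative g (at y) u) (at (x + a *\<^sub>R u + b *\<^sub>R v)) v"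
proof -
  let ?Du = "\<lambda>y. frechet_derivative g (at y) u"
  have d1: "((\<lambda>a. g (x + a *\<^sub>R u + b *\<^sub>R v)) has_real_derivative ?Du (x + a *\<^sub>R u + b *\<^sub>R v)) (at a)"
    if "0 \<le> a" "a \<le> s" "0 \<le> b" "b \<le> s" for a b
  proof -
    note d = smooth_on_has_derivative[OF assms(1) S[OF that]]
    have "((\<lambda>a. x + a *\<^sub>R u + b *\<^sub>R v) has_derivative (\<lambda>h. h *\<^sub>R u)) (at a)"
      by (auto intro!: derivative_eq_intros)
    from has_derivative_compose[OF this d] show ?thesis
      unfolding linear_scale[OF has_derivative_linear[OF d]]
      by (rule has_derivative_imp_has_field_derivative) simp
  qed
  have d2: "((\<lambda>b. ?Du (x + a *\<^sub>R u + b *\<^sub>R v)) has_real_derivative frechet_derivative ?Du (at (x + a *\<^sub>R u + b *\<^sub>R v)) v) (at b)"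
    if "0 \<le> a" "a \<le> s" "0 \<le> b" "b \<le> s" for a b
  proof -
    note d = smooth_on_has_derivative[OF smooth_on_frechet_derivative[OF assms(1), of u] S[OF that]]
    have "((\<lambda>b. x + a *\<^sub>R u + b *\<^sub>R v) has_derivative (\<lambda>h. h *\<^sub>R v)) (at b)"
      by (auto intro!: derivative_eq_intros)
    from has_derivative_compose[OF this d] show ?thesis
      unfolding linear_scale[OF has_derivative_linear[OF d]]
      by (rule has_derivative_imp_has_field_derivative) simp
  qed
  have "\<exists>a>0. a < s \<and> (g (x + s *\<^sub>R u + s *\<^sub>R v) - g (x + s *\<^sub>R u + 0 *\<^sub>R v)) - (g (x + 0 *\<^sub>R u + s *\<^sub>R v) - g (x + 0 *\<^sub>R u + 0 *\<^sub>R v))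
      = (s - 0) * (?Du (x + a *\<^sub>R u + s *\<^sub>R v) - ?Du (x + a *\<^sub>R u + 0 *\<^sub>R v))"
    by (rule MVT2[OF assms(2)]) (auto intro!: DERIV_diff d1 simp: assms(2) less_imp_le simp del: scaleR_zero_left)
  then obtain a where a: "0 < a" "a < s" and ea: "g (x + s *\<^sub>R u + s *\<^sub>R v) - g (x + s *\<^sub>R u) - g (x + s *\<^sub>R v) + g x
     = s * (?Du (x + a *\<^sub>R u + s *\<^sub>R v) - ?Du (x + a *\<^sub>R u + 0 *\<^sub>R v))" by auto
  have "\<exists>b>0. b < s \<and> ?Du (x + a *\<^sub>R u + s *\<^sub>R v) - ?Du (x + a *\<^sub>R u + 0 *\<^sub>R v)
      = (s - 0) * frechet_derivative ?Du (at (x + a *\<^sub>R u + b *\<^sub>R v)) v"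
    by (rule MVT2[OF assms(2)]) (use a in \<open>auto intro!: d2\<close>)
  then show ?thesis using a ea by auto
qed

text \<open>Both mixed derivatives, taken at suitable points of a small parallelogram at
  \<open>x\<close>, equal the same second difference divided by \<open>s * s\<close>; continuity
  carries the equality to \<open>x\<close>.\<close>

lemma real_second_derivative_symmetric:
  fixes g :: "'a::real_normed_vector \<Rightarrow> real"
  assumes "open S" "smooth_on S g" "x \<in> S"
  shows "frechet_derivative (\<lambda>y. frechet_derivative g (at y) u) (at x) v
       = frechet_derivative (\<lambda>y. frechet_derivative g (at y) v) (at x) u" (is "?A x = ?B x")
proof (rule ccontr)
  assume ne: "?A x \<noteq> ?B x"
  \<comment> \<open>Half the gap: two numbers that are closer than this to the two values cannot
    coincide.\<close>
  define \<epsilon> where "\<epsilon> = \<bar>?A x - ?B x\<bar> / 2"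
  have e: "\<epsilon> > 0" using ne by (simp add: \<epsilon>_def)
  have "continuous_on S ?A" "continuous_on S ?B"
    using assms smooth_on_frechet_derivative smooth_on_continuous by blast+
  then have "isCont ?A x" "isCont ?B x" using assms by (simp_all add: continuous_on_eq_continuous_at)
  then obtain d1 d2 where d: "d1 > 0" "d2 > 0" "\<And>y. dist y x < d1 \<Longrightarrow> \<bar>?A y - ?A x\<bar> < \<epsilon>"
      "\<And>y. dist y x < d2 \<Longrightarrow> \<bar>?B y - ?B x\<bar> < \<epsilon>"
    unfolding continuous_at_eps_delta using e by (auto simp: dist_real_def) metis
  obtain d3 where d3: "d3 > 0" "ball x d3 \<subseteq> S" using assms openE by blast
  define m where "m = min (min d1 d2) d3"
  have m: "m > 0" using d d3 by (auto simp: m_def)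
  \<comment> \<open>Keeps the parallelogram spanned by \<open>s *\<^sub>R u\<close> and
    \<open>s *\<^sub>R v\<close> within distance \<open>m / 2\<close> of \<open>x\<close>; the
    summand \<open>1\<close> covers \<open>u = v = 0\<close>.\<close>
  define s where "s = m / 2 / (norm u + norm v + 1)"
  have nn: "norm u + norm v + 1 > 0" by (auto intro!: add_nonneg_pos)
  have s: "s > 0" using m nn by (auto simp: s_def)
  have near: "dist (x + a *\<^sub>R u + b *\<^sub>R v) x < m" if "0 \<le> a" "a \<le> s" "0 \<le> b" "b \<le> s" for a b
  proof -
    have "norm (a *\<^sub>R u + b *\<^sub>R v) \<le> a * norm u + b * norm v"
      using that by (intro norm_triangle_le) auto
    also have "\<dots> \<le> s * norm u + s * norm v" using that by (intro add_mono mult_right_mono) auto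
    also have "\<dots> \<le> s * (norm u + norm v + 1)" using s by (simp add: algebra_simps)
    also have "\<dots> = m / 2" unfolding s_def
      by (rule nonzero_eq_divide_eq[THEN iffD1, OF _ refl]) (use nn in linarith)
    also have "\<dots> < m" using m by simp
    finally show ?thesis by (simp add: dist_norm add.assoc)
  qed
  have inS: "x + a *\<^sub>R u + b *\<^sub>R v \<in> S" if "0 \<le> a" "a \<le> s" "0 \<le> b" "b \<le> s" for a b
    using near[OF that] d3(2) by (auto simp: m_def dist_commute)
  obtain a b where ab: "0 < a" "a < s" "0 < b" "b < s"
    "g (x + s *\<^sub>R u + s *\<^sub>R v) - g (x + s *\<^sub>R u) - g (x + s *\<^sub>R v) + g x = s * s * ?A (x + a *\<^sub>R u + b *\<^sub>R v)"
    using second_difference[OF assms(2) s inS] by auto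
  obtain a' b' where ab': "0 < a'" "a' < s" "0 < b'" "b' < s"
    "g (x + s *\<^sub>R v + s *\<^sub>R u) - g (x + s *\<^sub>R v) - g (x + s *\<^sub>R u) + g x = s * s * ?B (x + a' *\<^sub>R v + b' *\<^sub>R u)"
    using second_difference[OF assms(2) s, of x v u] inS by (auto simp: add.assoc add.commute[of "_ *\<^sub>R v"])
  have sw: "x + a' *\<^sub>R v + b' *\<^sub>R u = x + b' *\<^sub>R u + a' *\<^sub>R v" "x + s *\<^sub>R v + s *\<^sub>R u = x + s *\<^sub>R u + s *\<^sub>R v" by simp_all
  have "s * s * ?A (x + a *\<^sub>R u + b *\<^sub>R v) = s * s * ?B (x + b' *\<^sub>R u + a' *\<^sub>R v)"
    using ab(5) ab'(5) unfolding sw by linarith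
  then have "?A (x + a *\<^sub>R u + b *\<^sub>R v) = ?B (x + b' *\<^sub>R u + a' *\<^sub>R v)"
    using s by simp
  moreover have "\<bar>?A (x + a *\<^sub>R u + b *\<^sub>R v) - ?A x\<bar> < \<epsilon>" "\<bar>?B (x + b' *\<^sub>R u + a' *\<^sub>R v) - ?B x\<bar> < \<epsilon>"
    using ab ab' near[of a b] near[of b' a'] by (auto intro!: d simp: m_def)
  moreover have "p = q \<Longrightarrow> \<bar>p - A\<bar> < \<bar>A - B\<bar> / 2 \<Longrightarrow> \<bar>q - B\<bar> < \<bar>A - B\<bar> / 2 \<Longrightarrow> False" for p q A B :: real
    by (smt (verit) field_sum_of_halves)
  ultimately show False unfolding \<epsilon>_def by blast
qed

lemma frechet_bounded_linear:
  assumes "bounded_linear L" "f differentiable (at x)"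
  shows "frechet_derivative (\<lambda>y. L (f y)) (at x) v = L (frechet_derivative f (at x) v)"
  using frechet_derivative_at[OF bounded_linear.has_derivative[OF assms(1) differentiable_has_derivative[OF assms(2)]]]
  by (metis)

text \<open>Through real and imaginary parts, since the mean value theorem behind the real case
  fails for complex values.\<close>

lemma second_derivative_symmetric:
  fixes f :: "'a::real_normed_vector \<Rightarrow> complex"
  assumes "open S" "smooth_on S f" "x \<in> S"
  shows "frechet_derivative (\<lambda>y. frechet_derivative f (at y) u) (at x) v
       = frechet_derivative (\<lambda>y. frechet_derivative f (at y) v) (at x) u"
proof -
  have *: "L (frechet_derivative (\<lambda>y. frechet_derivative f (at y) u) (at x) v)
     = frechet_derivative (\<lambda>y. frechet_derivative (\<lambda>y. L (f y)) (at y) u) (at x) v"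
    if L: "bounded_linear L" for L :: "complex \<Rightarrow> real" and u v
  proof -
    have "frechet_derivative (\<lambda>y. frechet_derivative (\<lambda>y. L (f y)) (at y) u) (at x)
      = frechet_derivative (\<lambda>y. L (frechet_derivative f (at y) u)) (at x)"
    proof (rule frechet_derivative_transform_within_open[OF _ assms(1,3)])
      show "\<And>y. y \<in> S \<Longrightarrow> frechet_derivative (\<lambda>y. L (f y)) (at y) u = L (frechet_derivative f (at y) u)"
        by (rule frechet_bounded_linear[OF L]) (use assms smooth_on_differentiable in blast)
      show "(\<lambda>y. frechet_derivative (\<lambda>y. L (f y)) (at y) u) differentiable at x"
        using assms L smooth_on_bounded_linear smooth_on_frechet_derivative smooth_on_differentiable by blast
    qed
    then show ?thesis
      using frechet_bounded_linear[OF L smooth_on_differentiable[OF smooth_on_frechet_derivative[OF assms(2)] assms(3)]]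
      by metis
  qed
  show ?thesis
    by (rule complex_eqI; (subst *[OF bounded_linear_Re] | subst *[OF bounded_linear_Im]);
        (subst *[OF bounded_linear_Re] | subst *[OF bounded_linear_Im]);
        rule real_second_derivative_symmetric[OF assms(1) _ assms(3)];
        rule smooth_on_bounded_linear[OF assms(1) _ assms(2)]; rule bounded_linear_Re bounded_linear_Im)
qed

text \<open>In coordinates, the vanishing of the square of the dbar operator; it reduces to the
  symmetry of second derivatives in the real coordinate directions.\<close>

lemma dzbar_commute:
  assumes "open S" "smooth_on S f" "z \<in> S"
  shows "dzbar i (dzbar k f) z = dzbar k (dzbar i f) z"
proof -
  have D: "frechet_derivative (dzbar m f) (at z) v
     = (frechet_derivative (\<lambda>y. frechet_derivative f (at y) (axis m 1)) (at z) v
        + \<i> * frechet_derivative (\<lambda>y. frechet_derivative f (at y) (axis m \<i>)) (at z) v) / 2" for m v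
  proof -
    have d: "((\<lambda>y. frechet_derivative f (at y) w) has_derivative
       frechet_derivative (\<lambda>y. frechet_derivative f (at y) w) (at z)) (at z)" for w
      using assms smooth_on_frechet_derivative smooth_on_has_derivative by blast
    have "(dzbar m f has_derivative (\<lambda>v. (frechet_derivative (\<lambda>y. frechet_derivative f (at y) (axis m 1)) (at z) v
        + \<i> * frechet_derivative (\<lambda>y. frechet_derivative f (at y) (axis m \<i>)) (at z) v) / 2)) (at z)"
      unfolding dzbar_def
      by (intro bounded_linear.has_derivative[OF bounded_linear_divide] has_derivative_add has_derivative_mult_right d)
    from fun_cong[OF frechet_derivative_at[OF this], of v] show ?thesis by (rule sym)
  qed
  have alg: "((a + \<i> * b) / 2 + \<i> * ((c + \<i> * d) / 2)) / 2 = ((a + \<i> * c) / 2 + \<i> * ((b + \<i> * d) / 2)) / 2"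
    for a b c d :: complex
    by (simp add: field_simps)
  note symm = second_derivative_symmetric[OF assms]
  define a b c d where "a = frechet_derivative (\<lambda>y. frechet_derivative f (at y) (axis i 1)) (at z) (axis k 1)"
    and "b = frechet_derivative (\<lambda>y. frechet_derivative f (at y) (axis i 1)) (at z) (axis k \<i>)"
    and "c = frechet_derivative (\<lambda>y. frechet_derivative f (at y) (axis i \<i>)) (at z) (axis k 1)"
    and "d = frechet_derivative (\<lambda>y. frechet_derivative f (at y) (axis i \<i>)) (at z) (axis k \<i>)"
  note abcd = this
  have 1: "dzbar k (dzbar i f) z = ((a + \<i> * c) / 2 + \<i> * ((b + \<i> * d) / 2)) / 2"
    by (subst dzbar_def) (simp only: D abcd)
  have 2: "dzbar i (dzbar k f) z = ((a + \<i> * b) / 2 + \<i> * ((c + \<i> * d) / 2)) / 2"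
    by (subst dzbar_def) (simp only: D abcd symm[of "axis i _" "axis k _"])
  show ?thesis unfolding 1 2 by (rule alg)
qed

section \<open>Determinants\<close>

text \<open>For fixed \<open>\<sigma>\<close>, reindexing \<open>\<tau>\<close> as
  \<open>\<tau> \<circ> \<sigma>\<close> turns the inner sum into the full determinant, and there
  are \<open>fact CARD('n)\<close> choices of \<open>\<sigma>\<close>. This factor cancels the
  reciprocal factorial in the Griffiths functional.\<close>

lemma top_power_eq_det: "top_power a = fact CARD('n) * det (a :: complex^'n^'n)"
proof -
  let ?P = "{\<sigma>. \<sigma> permutes (UNIV :: 'n set)}"
  have "(\<Sum>\<tau>\<in>?P. of_int (sign \<sigma>) * of_int (sign \<tau>) * (\<Prod>s\<in>UNIV. a $ \<sigma> s $ \<tau> s)) = det a" if \<sigma>: "\<sigma> \<in> ?P" for \<sigma>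
  proof -
    have s: "sign (\<tau> \<circ> \<sigma>) = sign \<tau> * sign \<sigma>" if "\<tau> \<in> ?P" for \<tau>
      using that \<sigma> by (intro sign_compose) (auto simp: permutation_permutes)
    have ss: "of_int (sign \<sigma>) * (of_int (sign \<sigma>) :: complex) = 1"
      by (metis of_int_1 of_int_mult sign_idempotent)
    have "(\<Sum>\<tau>\<in>?P. of_int (sign \<sigma>) * of_int (sign \<tau>) * (\<Prod>s\<in>UNIV. a $ \<sigma> s $ \<tau> s))
      = (\<Sum>\<tau>\<in>?P. of_int (sign \<sigma>) * of_int (sign (\<tau> \<circ> \<sigma>)) * (\<Prod>s\<in>UNIV. a $ \<sigma> s $ (\<tau> \<circ> \<sigma>) s))"
      by (rule sum_permutations_compose_right[OF \<sigma>[simplified]])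
    also have "\<dots> = (\<Sum>\<tau>\<in>?P. of_int (sign \<tau>) * (\<Prod>s\<in>UNIV. a $ s $ \<tau> s))"
    proof (rule sum.cong[OF refl])
      fix \<tau> assume "\<tau> \<in> ?P"
      have "(\<Prod>s\<in>UNIV. a $ \<sigma> s $ (\<tau> \<circ> \<sigma>) s) = (\<Prod>s\<in>UNIV. a $ s $ \<tau> s)"
        using prod.permute[of \<sigma> UNIV "\<lambda>s. a $ s $ \<tau> s"] \<sigma> by (simp add: o_def)
      then show "of_int (sign \<sigma>) * of_int (sign (\<tau> \<circ> \<sigma>)) * (\<Prod>s\<in>UNIV. a $ \<sigma> s $ (\<tau> \<circ> \<sigma>) s)
         = of_int (sign \<tau>) * (\<Prod>s\<in>UNIV. a $ s $ \<tau> s)"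
        using ss unfolding s[OF \<open>\<tau> \<in> ?P\<close>] of_int_mult by (simp add: mult_ac)
    qed
    finally show ?thesis unfolding det_def .
  qed
  then have "top_power a = (\<Sum>\<sigma>\<in>?P. det a)" unfolding top_power_def by (intro sum.cong) auto
  then show ?thesis by (simp add: card_permutations)
qed

text \<open>Only permutations of the range of \<open>f\<close> contribute to the determinant of \<open>A\<close>.\<close>

lemma det_embed:
  fixes A :: "'a::comm_ring_1^'n^'n" and f :: "'m::finite \<Rightarrow> 'n"
  assumes f: "inj f" and A: "\<And>a b. a \<notin> range f \<Longrightarrow> A$a$b = (if a = b then 1 else 0)"
  shows "det A = det (\<chi> i j. A $ f i $ f j)"
proof -
  let ?t = "\<lambda>\<sigma>. of_int (sign \<sigma>) * (\<Prod>a\<in>UNIV. A $ a $ \<sigma> a)"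
  have z: "?t \<sigma> = 0" if "\<sigma> permutes UNIV" "\<not> \<sigma> permutes range f" for \<sigma>
  proof -
    have "\<exists>a. a \<notin> range f \<and> \<sigma> a \<noteq> a" using that unfolding permutes_def by auto
    then obtain a where "a \<notin> range f" "\<sigma> a \<noteq> a" by auto
    then have "A $ a $ \<sigma> a = 0" using A by auto
    then show ?thesis by (metis finite UNIV_I mult_zero_right prod_zero)
  qed
  have "det A = (\<Sum>\<sigma> | \<sigma> permutes range f. ?t \<sigma>)"
    unfolding det_def
    by (rule sum.mono_neutral_right) (use z permutes_subset[OF _ subset_UNIV] in \<open>auto simp: finite_permutations\<close>)
  also have "\<dots> = (\<Sum>p | p permutes (UNIV::'m set). of_int (sign p) * (\<Prod>i\<in>UNIV. A $ f i $ f (p i)))"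
  proof (rule sum.reindex_bij_witness[where i = "map_permutation UNIV f" and j = "map_permutation (range f) (inv f)"])
    fix \<sigma> assume \<sigma>: "\<sigma> \<in> {\<sigma>. \<sigma> permutes range f}"
    have b: "bij_betw (inv f) (range f) UNIV" using f by (simp add: bij_betw_inv_into inj_imp_bij_betw_inv)
    have "map_permutation UNIV f (map_permutation (range f) (inv f) \<sigma>) = map_permutation (range f) (f \<circ> inv f) \<sigma>"
      using \<sigma> f by (intro map_permutation_compose[OF b]) auto
    also have "\<dots> = map_permutation (range f) id \<sigma>"
      by (rule map_permutation_cong) (use \<sigma> in \<open>auto simp: inj_on_def f_inv_into_f\<close>)
    finally show e: "map_permutation UNIV f (map_permutation (range f) (inv f) \<sigma>) = \<sigma>" using \<sigma> by simp
    let ?p = "map_permutation (range f) (inv f) \<sigma>"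
    show p: "?p \<in> {p. p permutes UNIV}" using \<sigma> b by (auto intro: map_permutation_permutes)
    have "sign (map_permutation UNIV f ?p) = sign ?p" using p f by (intro sign_map_permutation) auto
    moreover have mp: "map_permutation UNIV f ?p (f i) = f (?p i)" for i
      using f by (simp add: map_permutation_def)
    moreover have "(\<Prod>a\<in>UNIV. A $ a $ \<sigma> a) = (\<Prod>a\<in>range f. A $ a $ \<sigma> a)"
      by (rule prod.mono_neutral_right) (use \<sigma> A in \<open>auto simp: permutes_not_in\<close>)
    moreover have "\<dots> = (\<Prod>i\<in>UNIV. A $ f i $ \<sigma> (f i))" using f by (simp add: prod.reindex)
    ultimately show "of_int (sign ?p) * (\<Prod>i\<in>UNIV. A $ f i $ f (?p i)) = ?t \<sigma>"
      unfolding e by simp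
  next
    fix p :: "'m \<Rightarrow> 'm" assume p: "p \<in> {p. p permutes UNIV}"
    have "map_permutation (range f) (inv f) (map_permutation UNIV f p) = map_permutation UNIV (inv f \<circ> f) p"
      using f p by (intro map_permutation_compose) (auto simp: inj_on_inv_into bij_betw_def)
    then show "map_permutation (range f) (inv f) (map_permutation UNIV f p) = p"
      using f p by (simp add: inv_o_cancel)
    show "map_permutation UNIV f p \<in> {\<sigma>. \<sigma> permutes range f}"
      using p f by (auto intro!: map_permutation_permutes simp: bij_betw_def)
  qed
  finally show ?thesis unfolding det_def by simp
qed

text \<open>The blocks are indexed by the second component, the fibre index. A constant family is
  the tensor product of one block with the identity of the fibre.\<close>

definition blockdiag :: "('r::finite \<Rightarrow> 'a::zero^'n^'n) \<Rightarrow> 'a^('n::finite \<times> 'r)^('n \<times> 'r)" where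
  "blockdiag Q = (\<chi> a b. if snd a = snd b then Q (snd a) $ fst a $ fst b else 0)"

lemma sum_UNIV_prod: "(\<Sum>x\<in>UNIV. f (x :: 'a::finite \<times> 'b::finite)) = (\<Sum>i\<in>UNIV. \<Sum>j\<in>UNIV. f (i, j))"
  unfolding sum.cartesian_product UNIV_Times_UNIV by (simp add: case_prod_unfold)

lemma blockdiag_nth: "blockdiag Q $ (i, \<kappa>) $ (j, \<nu>) = (if \<kappa> = \<nu> then Q \<kappa> $ i $ j else 0)"
  by (simp add: blockdiag_def)

lemma blockdiag_mult:
  fixes Q R :: "'r::finite \<Rightarrow> 'a::semiring_1^'n^'n"
  shows "blockdiag Q ** blockdiag R = blockdiag (\<lambda>\<kappa>. Q \<kappa> ** R \<kappa>)"
proof -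
  have "(blockdiag Q ** blockdiag R) $ (i, \<kappa>) $ (j, \<nu>) = blockdiag (\<lambda>\<kappa>. Q \<kappa> ** R \<kappa>) $ (i, \<kappa>) $ (j, \<nu>)" for i \<kappa> j \<nu>
  proof -
    have "(blockdiag Q ** blockdiag R) $ (i, \<kappa>) $ (j, \<nu>)
      = (\<Sum>l\<in>UNIV. \<Sum>\<eta>\<in>UNIV. blockdiag Q $ (i, \<kappa>) $ (l, \<eta>) * blockdiag R $ (l, \<eta>) $ (j, \<nu>))"
      by (simp add: matrix_matrix_mult_def sum_UNIV_prod)
    also have "\<dots> = (\<Sum>l\<in>UNIV. \<Sum>\<eta>\<in>UNIV. if \<kappa> = \<eta> then (if \<kappa> = \<nu> then Q \<kappa> $ i $ l * R \<kappa> $ l $ j else 0) else 0)"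
      by (intro sum.cong refl) (auto simp: blockdiag_nth)
    also have "\<dots> = blockdiag (\<lambda>\<kappa>. Q \<kappa> ** R \<kappa>) $ (i, \<kappa>) $ (j, \<nu>)"
      by (simp add: blockdiag_nth matrix_matrix_mult_def)
    finally show ?thesis .
  qed
  then show ?thesis by (simp add: vec_eq_iff)
qed

lemma blockdiag_1: "blockdiag (\<lambda>_. mat 1) = mat 1"
  by (auto simp: vec_eq_iff blockdiag_def mat_def)

text \<open>The matrix is a product of matrices with a single block different from the identity, and
  \<open>det_embed\<close> reduces each of these to its block.\<close>

lemma det_blockdiag:
  fixes Q :: "'r::finite \<Rightarrow> 'a::comm_ring_1^'n^'n"
  shows "det (blockdiag Q) = (\<Prod>\<kappa>\<in>UNIV. det (Q \<kappa>))"
proof -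
  have single: "det (blockdiag (\<lambda>\<kappa>. if \<kappa> = \<nu> then Q \<nu> else mat 1)) = det (Q \<nu>)" for \<nu>
  proof -
    have "det (blockdiag (\<lambda>\<kappa>. if \<kappa> = \<nu> then Q \<nu> else mat 1)) =
      det (\<chi> i j. blockdiag (\<lambda>\<kappa>. if \<kappa> = \<nu> then Q \<nu> else mat 1) $ (\<lambda>i. (i, \<nu>)) i $ (\<lambda>i. (i, \<nu>)) j)"
    proof (rule det_embed)
      fix a b :: "'n \<times> 'r"
      assume "a \<notin> range (\<lambda>i. (i, \<nu>))"
      then have "snd a \<noteq> \<nu>" by (metis rangeI surjective_pairing)
      then show "blockdiag (\<lambda>\<kappa>. if \<kappa> = \<nu> then Q \<nu> else mat 1) $ a $ b = (if a = b then 1 else 0)"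
        by (auto simp: blockdiag_def mat_def prod_eq_iff)
    qed (auto simp: inj_def)
    also have "\<dots> = det (Q \<nu>)" by (intro arg_cong[where f = det]) (simp add: vec_eq_iff blockdiag_def)
    finally show ?thesis .
  qed
  have "det (blockdiag (\<lambda>\<kappa>. if \<kappa> \<in> F then Q \<kappa> else mat 1)) = (\<Prod>\<kappa>\<in>F. det (Q \<kappa>))" for F
    using finite[of F]
  proof (induction F rule: finite_induct)
    case empty
    then show ?case by (simp add: blockdiag_1)
  next
    case (insert \<nu> F)
    have "blockdiag (\<lambda>\<kappa>. if \<kappa> = \<nu> then Q \<nu> else mat 1) ** blockdiag (\<lambda>\<kappa>. if \<kappa> \<in> F then Q \<kappa> else mat 1)
        = blockdiag (\<lambda>\<kappa>. if \<kappa> \<in> insert \<nu> F then Q \<kappa> else mat 1)"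
      unfolding blockdiag_mult by (rule arg_cong[where f = blockdiag]) (use insert in auto)
    from arg_cong[OF this, of det] have "det (Q \<nu>) * (\<Prod>\<kappa>\<in>F. det (Q \<kappa>)) = det (blockdiag (\<lambda>\<kappa>. if \<kappa> \<in> insert \<nu> F then Q \<kappa> else mat 1))"
      unfolding det_mul single insert.IH .
    then show ?case using insert.hyps by simp
  qed
  from this[of UNIV] show ?thesis by simp
qed

lemma det_of_real: "det (\<chi> i j. of_real (A $ i $ j)) = (of_real (det (A :: real^'n^'n)) :: 'a::{real_algebra_1,comm_ring_1})"
  by (simp add: det_def)

lemma det_cnj: "det (\<chi> i j. cnj (A $ i $ j)) = cnj (det (A :: complex^'n^'n))"
  by (simp add: det_def)

text \<open>The flag \<open>True\<close> marks real and \<open>False\<close> imaginary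
  coordinates.\<close>

definition real_matrix :: "complex^'n::finite^'n \<Rightarrow> real^('n \<times> bool)^('n \<times> bool)" where
  "real_matrix J = (\<chi> a b. let w = J $ fst a $ fst b in
     if snd a = snd b then Re w else if snd a then - Im w else Im w)"

text \<open>Over the complex numbers the real matrix of a complex linear map \<open>J\<close> is similar to
  the block matrix with blocks \<open>J\<close> and its conjugate.\<close>

lemma det_real_matrix:
  fixes J :: "complex^'n^'n"
  shows "det (real_matrix J) = (norm (det J))\<^sup>2"
proof -
  define t :: "(bool \<Rightarrow> bool \<Rightarrow> complex) \<Rightarrow> complex^('n \<times> bool)^('n \<times> bool)"
    where "t u = (\<chi> a b. if fst a = fst b then u (snd a) (snd b) else 0)" for u
  \<comment> \<open>The columns of \<open>U\<close> are built from the pairs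
    \<open>1, - \<i>\<close> and \<open>1, \<i>\<close>: on the first kind the real matrix acts as
    \<open>J\<close>, on the second as its conjugate. \<open>V\<close> is the inverse of
    \<open>U\<close>.\<close>
  define U :: "complex^('n \<times> bool)^('n \<times> bool)" where "U = t (\<lambda>b c. if b then 1 else if c then - \<i> else \<i>)"
  define V :: "complex^('n \<times> bool)^('n \<times> bool)" where "V = t (\<lambda>b c. if c then 1 / 2 else if b then \<i> / 2 else - \<i> / 2)"
  let ?M = "(\<chi> a b. of_real (real_matrix J $ a $ b)) :: complex^('n \<times> bool)^('n \<times> bool)"
  let ?B = "blockdiag (\<lambda>b. if b then J else (\<chi> i j. cnj (J $ i $ j)))"
  have tl: "(t u ** X) $ (i, b) $ c = (\<Sum>c'\<in>UNIV. u b c' * X $ (i, c') $ c)"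
    for u i b c and X :: "complex^('n \<times> bool)^('n \<times> bool)"
  proof -
    have "(t u ** X) $ (i, b) $ c = (\<Sum>l\<in>UNIV. \<Sum>c'\<in>UNIV. (if i = l then u b c' else 0) * X $ (l, c') $ c)"
      by (simp add: t_def matrix_matrix_mult_def sum_UNIV_prod cong: if_cong)
    also have "\<dots> = (\<Sum>l\<in>UNIV. if i = l then (\<Sum>c'\<in>UNIV. u b c' * X $ (l, c') $ c) else 0)"
      by (intro sum.cong refl) auto
    finally show ?thesis by simp
  qed
  have tr: "(X ** t u) $ a $ (j, c) = (\<Sum>b\<in>UNIV. X $ a $ (j, b) * u b c)"
    for u a j c and X :: "complex^('n \<times> bool)^('n \<times> bool)"
  proof -
    have "(X ** t u) $ a $ (j, c) = (\<Sum>l\<in>UNIV. \<Sum>b\<in>UNIV. X $ a $ (l, b) * (if l = j then u b c else 0))"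
      by (simp add: t_def matrix_matrix_mult_def sum_UNIV_prod cong: if_cong)
    also have "\<dots> = (\<Sum>l\<in>UNIV. if l = j then (\<Sum>b\<in>UNIV. X $ a $ (l, b) * u b c) else 0)"
      by (intro sum.cong refl) auto
    finally show ?thesis by simp
  qed
  have UV: "U ** V = mat 1"
  proof -
    have "(U ** V) $ (i, b) $ (j, c) = mat 1 $ (i, b) $ (j, c)" for i b j c
      unfolding U_def tl unfolding V_def t_def UNIV_bool by (cases b; cases c) (simp_all add: mat_def)
    then show ?thesis by (simp add: vec_eq_iff)
  qed
  have MU: "?M ** U = U ** ?B"
  proof -
    have "(?M ** U) $ (i, b) $ (j, c) = (U ** ?B) $ (i, b) $ (j, c)" for i b j c
      unfolding U_def tl tr UNIV_bool
      by (cases b; cases c) (simp_all add: real_matrix_def blockdiag_nth complex_eq_iff)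
    then show ?thesis by (simp add: vec_eq_iff)
  qed
  have "det U * det V = 1" using arg_cong[OF UV, of det] by (simp only: det_mul det_I)
  then have U: "det U \<noteq> 0" by auto
  have "det ?M * det U = det U * det ?B" using arg_cong[OF MU, of det] by (simp only: det_mul)
  then have "det ?M * det U = det ?B * det U" by (simp only: mult.commute)
  then have MB: "det ?M = det ?B" by (simp only: mult_right_cancel[OF U])
  have "complex_of_real (det (real_matrix J)) = det ?M" by (rule det_of_real[symmetric])
  also have "\<dots> = det J * cnj (det J)" unfolding MB by (simp add: det_blockdiag UNIV_bool det_cnj)
  also have "\<dots> = complex_of_real ((norm (det J))\<^sup>2)" by (rule complex_norm_square[symmetric])
  finally show ?thesis by (simp only: of_real_eq_iff)
qed

section \<open>The derivative of the determinant\<close>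

text \<open>Differentiating a product removes one factor, but a permutation other than
  \<open>id\<close> moves at least two indices and so leaves a zero factor of the identity matrix.
  Only the diagonal survives.\<close>

lemma has_derivative_det_1: "((det :: complex^'n^'n \<Rightarrow> complex) has_derivative trace) (at (mat 1))"
proof -
  let ?P = "{p. p permutes (UNIV :: 'n set)}"
  have e: "((\<lambda>X :: complex^'n^'n. X $ i $ j) has_derivative (\<lambda>X. X $ i $ j)) F" for i j F
    by (intro bounded_linear_imp_has_derivative bounded_linear_compose[OF bounded_linear_vec_nth] bounded_linear_vec_nth)
  have "((\<lambda>X :: complex^'n^'n. \<Sum>p\<in>?P. of_int (sign p) * (\<Prod>i\<in>UNIV. X $ i $ p i)) has_derivative
     (\<lambda>K. \<Sum>p\<in>?P. of_int (sign p) * (\<Sum>i\<in>UNIV. K $ i $ p i * (\<Prod>j\<in>UNIV - {i}. (mat 1 :: complex^'n^'n) $ j $ p j)))) (at (mat 1))"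
    by (intro has_derivative_sum has_derivative_mult_right has_derivative_prod e)
  moreover have "(\<Sum>p\<in>?P. of_int (sign p) * (\<Sum>i\<in>UNIV. K $ i $ p i * (\<Prod>j\<in>UNIV - {i}. (mat 1 :: complex^'n^'n) $ j $ p j))) = trace K"
    for K :: "complex^'n^'n"
  proof -
    have z: "(\<Prod>j\<in>UNIV - {i}. (mat 1 :: complex^'n^'n) $ j $ p j) = 0" if "p \<in> ?P" "p \<noteq> id" for p i
    proof -
      have "\<exists>j. j \<noteq> i \<and> p j \<noteq> j"
      proof (rule ccontr)
        assume "\<not> ?thesis"
        then have fix1: "p j = j" if "j \<noteq> i" for j using that by blast
        have "inj p" using \<open>p \<in> ?P\<close> permutes_inj by auto
        then have "p i = i" using fix1[of "p i"] by (auto dest: injD)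
        then have "p j = j" for j using fix1 by (cases "j = i") auto
        then show False using \<open>p \<noteq> id\<close> by auto
      qed
      then obtain j where "j \<noteq> i" "p j \<noteq> j" by blast
      then show ?thesis by (intro prod_zero bexI[of _ j]) (auto simp: mat_def)
    qed
    have "(\<Sum>p\<in>?P. of_int (sign p) * (\<Sum>i\<in>UNIV. K $ i $ p i * (\<Prod>j\<in>UNIV - {i}. (mat 1 :: complex^'n^'n) $ j $ p j)))
      = (\<Sum>p\<in>{id}. of_int (sign p) * (\<Sum>i\<in>UNIV. K $ i $ p i * (\<Prod>j\<in>UNIV - {i}. (mat 1 :: complex^'n^'n) $ j $ p j)))"
      by (rule sum.mono_neutral_right) (auto simp: z permutes_id finite_permutations)
    also have "\<dots> = trace K" by (simp add: trace_def mat_def sign_id)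
    finally show ?thesis .
  qed
  ultimately show ?thesis unfolding det_def by simp
qed

lemma
  fixes A :: "complex^'n^'n"
  assumes "det A \<noteq> 0"
  shows matrix_inv_left: "matrix_inv A ** A = mat 1"
    and matrix_inv_right: "A ** matrix_inv A = mat 1"
proof -
  have "\<exists>B. A ** B = mat 1 \<and> B ** A = mat 1"
    using assms unfolding invertible_det_nz[symmetric] invertible_def .
  then have "A ** matrix_inv A = mat 1 \<and> matrix_inv A ** A = mat 1"
    unfolding matrix_inv_def by (rule someI_ex)
  then show "matrix_inv A ** A = mat 1" "A ** matrix_inv A = mat 1" by auto
qed

lemma matrix_inv_unique:
  assumes AB: "A ** B = mat 1"
  shows "matrix_inv A = (B :: complex^'n^'n)"
proof -
  have "det A * det B = 1" using arg_cong[OF AB, of det] by (simp only: det_mul det_I)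
  then have "det A \<noteq> 0" by auto
  have "matrix_inv A = matrix_inv A ** (A ** B)" unfolding AB by (simp only: matrix_mul_rid)
  also have "\<dots> = B" unfolding matrix_mul_assoc matrix_inv_left[OF \<open>det A \<noteq> 0\<close>] by (rule matrix_mul_lid)
  finally show ?thesis .
qed

lemma linear_matrix_mult: "linear (\<lambda>X :: complex^'n^'n. (A :: complex^'n^'n) ** X)"
proof (rule linearI)
  show "A ** (X + Y) = A ** X + A ** Y" for X Y :: "complex^'n^'n" by (rule matrix_add_ldistrib)
  show "A ** (c *\<^sub>R X) = c *\<^sub>R (A ** X)" for c and X :: "complex^'n^'n"
    unfolding vec_eq_iff matrix_matrix_mult_def vec_lambda_beta vector_scaleR_component mult_scaleR_right scaleR_sum_right
    by simp
qed


text \<open>Jacobi's formula, moved to the identity matrix by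
  \<open>det M * det (matrix_inv M ** X) = det X\<close>.\<close>

theorem has_derivative_det:
  fixes M :: "complex^'n^'n"
  assumes "det M \<noteq> 0"
  shows "(det has_derivative (\<lambda>K. det M * trace (matrix_inv M ** K))) (at M)"
proof -
  have l: "((\<lambda>X. matrix_inv M ** X) has_derivative (\<lambda>K. matrix_inv M ** K)) (at M)"
    by (rule linear_imp_has_derivative[OF linear_matrix_mult])
  have d: "(det has_derivative trace) (at (matrix_inv M ** M))"
    unfolding matrix_inv_left[OF assms] by (rule has_derivative_det_1)
  have "((\<lambda>X. det (matrix_inv M ** X)) has_derivative (\<lambda>K. trace (matrix_inv M ** K))) (at M)"
    by (rule has_derivative_compose[OF l d])
  then have "((\<lambda>X. det M * det (matrix_inv M ** X)) has_derivative (\<lambda>K. det M * trace (matrix_inv M ** K))) (at M)"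
    by (rule has_derivative_mult_right)
  moreover have "det M * det (matrix_inv M ** X) = det X" for X
  proof -
    have "det M * det (matrix_inv M ** X) = det ((M ** matrix_inv M) ** X)"
      by (simp only: det_mul[symmetric] matrix_mul_assoc)
    then show ?thesis by (simp only: matrix_inv_right[OF assms] matrix_mul_lid)
  qed
  ultimately show ?thesis by simp
qed

section \<open>Positive definite matrices\<close>

text \<open>As a matrix product this is the row \<open>u\<close> times \<open>M\<close> times the
  conjugate of \<open>v\<close>: the row index belongs to the linear argument, as in the sums of
  \<open>positive_coeffs\<close>.\<close>

definition sesq :: "complex^'m^'m \<Rightarrow> complex^'m \<Rightarrow> complex^'m \<Rightarrow> complex" where
  "sesq M u v = (\<Sum>a\<in>UNIV. \<Sum>b\<in>UNIV. M $ a $ b * u $ a * cnj (v $ b))"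

text \<open>The order on the complex numbers makes the values of the form real, so hermitian
  symmetry is a consequence.\<close>

definition possemidef :: "complex^'m^'m \<Rightarrow> bool" where
  "possemidef M \<longleftrightarrow> (\<forall>u. 0 \<le> sesq M u u)"

definition posdef :: "complex^'m^'m \<Rightarrow> bool" where
  "posdef M \<longleftrightarrow> (\<forall>u. u \<noteq> 0 \<longrightarrow> 0 < sesq M u u)"

definition hermitian :: "complex^'m^'m \<Rightarrow> bool" where
  "hermitian M \<longleftrightarrow> (\<forall>a b. M $ b $ a = cnj (M $ a $ b))"

lemma hermitianD: "hermitian M \<Longrightarrow> M $ b $ a = cnj (M $ a $ b)"
  unfolding hermitian_def by (elim allE)

lemma sesq_0 [simp]: "sesq M 0 v = 0" "sesq M u 0 = 0"
  by (simp_all add: sesq_def)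

lemma sesq_add_left: "sesq M (u + w) v = sesq M u v + sesq M w v"
  and sesq_add_right: "sesq M u (v + w) = sesq M u v + sesq M u w"
  and sesq_scale_left: "sesq M (c *s u) v = c * sesq M u v"
  and sesq_scale_right: "sesq M u (c *s v) = cnj c * sesq M u v"
  and sesq_add_matrix: "sesq (M + N) u v = sesq M u v + sesq N u v"
  by (simp_all add: sesq_def algebra_simps sum.distrib sum_distrib_left)

lemma sesq_scaleR_matrix: "sesq (t *\<^sub>R M) u v = of_real t * sesq M u v"
  unfolding sesq_def vector_scaleR_component scaleR_conv_of_real[of t "_ :: complex"] sum_distrib_left
  by (intro sum.cong refl) (simp only: mult.assoc)

lemma sesq_axis: "sesq M (axis a s) (axis b t) = M $ a $ b * s * cnj t"
proof -
  have "sesq M (axis a s) (axis b t) = (\<Sum>i\<in>UNIV. if i = a then \<Sum>j\<in>UNIV. (if j = b then M $ i $ j * s * cnj t else 0) else 0)"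
    unfolding sesq_def by (intro sum.cong refl) (auto simp: axis_def if_distrib cong: if_cong intro!: sum.cong)
  then show ?thesis by simp
qed

lemma sesq_transpose: "sesq M u v = (\<Sum>b\<in>UNIV. (u v* M) $ b * cnj (v $ b))"
  unfolding sesq_def
  by (subst sum.swap) (simp add: vector_matrix_mult_def sum_distrib_left mult_ac)

lemma posdef_possemidef: "posdef M \<Longrightarrow> possemidef M"
  unfolding posdef_def possemidef_def by (metis order.strict_implies_order order_refl sesq_0(1))

lemma sesq_expand:
  "sesq M (axis a 1 + t *s axis b 1) (axis a 1 + t *s axis b 1) =
     M $ a $ a + M $ b $ b * (t * cnj t) + M $ a $ b * cnj t + M $ b $ a * t"
  by (simp add: sesq_add_left sesq_add_right sesq_scale_left sesq_scale_right sesq_axis algebra_simps)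

lemma nonneg_complex_iff: "0 \<le> z \<longleftrightarrow> 0 \<le> Re z \<and> Im z = 0" for z :: complex
  by (auto simp: less_eq_complex_def)

lemma pos_complex_iff: "0 < z \<longleftrightarrow> 0 < Re z \<and> Im z = 0" for z :: complex
  by (auto simp: less_complex_def)

lemma possemidef_diag: "possemidef M \<Longrightarrow> 0 \<le> M $ a $ a"
  using sesq_axis[of M a 1 a 1] unfolding possemidef_def by (metis complex_cnj_one mult.right_neutral)

text \<open>Polarization: the form is real at \<open>axis a 1 + t *s axis b 1\<close>. The choice
  \<open>t = 1\<close> compares the imaginary parts of the two entries, \<open>t = \<i>\<close>
  their real parts.\<close>

lemma possemidef_hermitian: "possemidef M \<Longrightarrow> hermitian M"
  unfolding hermitian_def
proof (intro allI)
  fix a b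
  assume M: "possemidef M"
  have d: "Im (M $ a $ a) = 0" "Im (M $ b $ b) = 0"
    using possemidef_diag[OF M] by (simp_all add: nonneg_complex_iff)
  have "Im (M $ a $ a + M $ b $ b * (t * cnj t) + M $ a $ b * cnj t + M $ b $ a * t) = 0" for t
    using M sesq_expand[of M a t b] unfolding possemidef_def nonneg_complex_iff by metis
  from this[of 1] this[of \<i>] show "M $ b $ a = cnj (M $ a $ b)"
    using d by (simp add: complex_eq_iff)
qed

text \<open>The form is evaluated where both cross terms equal minus the modulus of the entry. The
  diagonal therefore controls all entries, which makes the set of semidefinite matrices with given
  partial trace bounded.\<close>

lemma possemidef_bound:
  assumes "possemidef M"
  shows "2 * norm (M $ a $ b) \<le> Re (M $ a $ a) + Re (M $ b $ b)"
proof (cases "M $ a $ b = 0")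
  case True
  then show ?thesis using possemidef_diag[OF assms] by (simp add: nonneg_complex_iff)
next
  case False
  define m n where "m = M $ a $ b" and "n = complex_of_real (norm m)"
  have n: "n \<noteq> 0" "cnj n = n" using False by (simp_all add: m_def n_def)
  have mm: "m * cnj m = n * n"
    using complex_norm_square[of m] by (simp add: n_def power2_eq_square)
  \<comment> \<open>A number of modulus 1 opposite to the phase of \<open>m\<close>, so that
    \<open>m * cnj t\<close> becomes \<open>- n\<close>.\<close>
  define t where "t = - m / n"
  have "cnj t = - cnj m / n" by (simp add: t_def n)
  then have "m * cnj t = - (m * cnj m) / n" by simp
  then have mt: "m * cnj t = - n" unfolding mm using n by simp
  have "t * w = - (m * w) / n" for w by (simp add: t_def)
  from this[of "cnj t"] have tt: "t * cnj t = 1" unfolding mt using n by simp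
  have "M $ b $ a = cnj m" unfolding m_def by (rule hermitianD[OF possemidef_hermitian[OF assms]])
  then have mt': "M $ b $ a * t = - n" using arg_cong[OF mt, of cnj] n by simp
  have "0 \<le> Re (M $ a $ a + M $ b $ b * (t * cnj t) + m * cnj t + M $ b $ a * t)"
    using assms sesq_expand[of M a t b] unfolding possemidef_def nonneg_complex_iff m_def by metis
  then show ?thesis unfolding tt mt mt' by (simp add: n_def m_def)
qed

lemma hermitian_sesq: "hermitian M \<Longrightarrow> sesq M v u = cnj (sesq M u v)"
  unfolding sesq_def cnj_sum
  by (subst sum.swap) (intro sum.cong refl, simp add: hermitianD[of M _ _, symmetric] mult_ac)

lemma det_hermitian: "hermitian M \<Longrightarrow> Im (det M) = 0"
proof -
  assume "hermitian M"
  then have "M = transpose (\<chi> i j. cnj (M $ i $ j))"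
    unfolding vec_eq_iff transpose_def vec_lambda_beta using hermitianD by blast
  then have "det M = cnj (det M)" using det_transpose det_cnj by metis
  then show ?thesis by (simp add: complex_eq_iff)
qed

lemma matrix_kernel:
  fixes M :: "complex^'m^'m"
  assumes "det M = 0"
  obtains u where "u \<noteq> 0" "M *v u = 0"
proof -
  have "\<not> (\<exists>B. B ** M = mat 1)"
  proof
    assume "\<exists>B. B ** M = mat 1"
    then obtain B where "B ** M = mat 1" by blast
    from arg_cong[OF this, of det] assms show False by (simp add: det_mul)
  qed
  then show thesis using that matrix_left_invertible_ker[of M] by blast
qed

lemma posdef_det_nz: "posdef M \<Longrightarrow> det M \<noteq> 0"
proof
  assume M: "posdef M" "det M = 0"
  then have "det (transpose M) = 0" by simp
  then obtain u where "u \<noteq> 0" "transpose M *v u = 0" using matrix_kernel by blast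
  then have "u \<noteq> 0" "u v* M = 0" by simp_all
  then have "sesq M u u = 0" "0 < sesq M u u" using M(1) by (simp add: sesq_transpose, simp add: posdef_def)
  then show False by simp
qed

lemma posdef_1: "posdef (mat 1)"
  unfolding posdef_def
proof (intro allI impI)
  fix u :: "complex^'m" assume "u \<noteq> 0"
  then obtain i where i: "u $ i \<noteq> 0" by (auto simp: vec_eq_iff)
  have "sesq (mat 1) u u = (\<Sum>a\<in>UNIV. of_real ((norm (u $ a))\<^sup>2))"
    unfolding sesq_def complex_norm_square
  proof (intro sum.cong refl)
    fix a
    have "(\<Sum>b\<in>UNIV. mat 1 $ a $ b * u $ a * cnj (u $ b)) = (\<Sum>b\<in>UNIV. if a = b then u $ a * cnj (u $ a) else 0)"
      by (intro sum.cong refl) (auto simp: mat_def)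
    then show "(\<Sum>b\<in>UNIV. mat 1 $ a $ b * u $ a * cnj (u $ b)) = u $ a * cnj (u $ a)" by simp
  qed
  moreover have "0 < (\<Sum>a\<in>UNIV. (norm (u $ a))\<^sup>2)"
    by (rule sum_pos2[of _ i]) (use i in auto)
  ultimately show "0 < sesq (mat 1) u u" by (simp add: pos_complex_iff flip: of_real_sum)
qed

lemma posdef_convex:
  fixes M N :: "complex^'m^'m"
  assumes "posdef M" "posdef N" "0 \<le> t" "t \<le> 1"
  shows "posdef ((1 - t) *\<^sub>R M + t *\<^sub>R N)"
  unfolding posdef_def
proof (intro allI impI)
  fix u :: "complex^'m" assume "u \<noteq> 0"
  then have "0 < sesq M u u" "0 < sesq N u u" using assms by (auto simp: posdef_def)
  then show "0 < sesq ((1 - t) *\<^sub>R M + t *\<^sub>R N) u u"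
    using assms(3,4) unfolding sesq_add_matrix sesq_scaleR_matrix pos_complex_iff
    by (cases "t = 0") (auto intro: add_nonneg_pos)
qed

lemma continuous_on_det: "continuous_on S (det :: complex^'m^'m \<Rightarrow> complex)"
  unfolding det_def by (intro continuous_intros)

text \<open>Along the segment from the identity to \<open>M\<close> the determinant is real and
  never zero, hence keeps the sign it has at the identity.\<close>

lemma posdef_det: assumes "posdef (M :: complex^'m^'m)" shows "0 < det M"
proof -
  let ?f = "\<lambda>t::real. det ((1 - t) *\<^sub>R mat 1 + t *\<^sub>R M)"
  have pd: "posdef ((1 - t) *\<^sub>R mat 1 + t *\<^sub>R M)" if "0 \<le> t" "t \<le> 1" for t
    using posdef_convex[OF posdef_1 assms that] .
  have im: "Im (?f t) = 0" if "0 \<le> t" "t \<le> 1" for t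
    using det_hermitian possemidef_hermitian posdef_possemidef pd[OF that] by blast
  have "continuous_on {0..1} (\<lambda>t. Re (?f t))"
    by (intro continuous_intros continuous_on_compose2[OF continuous_on_det[of UNIV]]) auto
  have "0 < Re (?f 1)"
  proof (rule ccontr)
    assume "\<not> 0 < Re (?f 1)"
    then obtain t where t: "0 \<le> t" "t \<le> 1" "Re (?f t) = 0"
      using IVT2'[of "\<lambda>t. Re (?f t)" 1 0 0] \<open>continuous_on {0..1} (\<lambda>t. Re (?f t))\<close> by auto
    then show False using posdef_det_nz[OF pd[OF t(1,2)]] im[OF t(1,2)] by (simp add: complex_eq_iff)
  qed
  then show ?thesis using im[of 1] by (simp add: pos_complex_iff)
qed

text \<open>The null case of the Cauchy-Schwarz inequality: otherwise a small step from
  \<open>u\<close> along a suitable multiple of \<open>v\<close> would make the form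
  negative.\<close>

lemma possemidef_null:
  assumes M: "possemidef M" and u: "sesq M u u = 0"
  shows "sesq M u v = 0"
proof (rule ccontr)
  assume "sesq M u v \<noteq> 0"
  define B where "B = sesq M u v"
  define q where "q = Re (sesq M v v)"
  have q: "sesq M v v = of_real q" "q \<ge> 0"
    using M by (auto simp: possemidef_def q_def nonneg_complex_iff complex_eq_iff)
  \<comment> \<open>Small enough for \<open>s * q < 1\<close>, so that the linear term
    \<open>- 2 * s\<close> outweighs the quadratic one.\<close>
  define s where "s = 1 / (q + 1)"
  have s: "s > 0" using q by (simp add: s_def)
  define t where "t = - of_real s * B"
  have "sesq M (u + t *s v) (u + t *s v) = t * cnj B + cnj t * B + t * cnj t * of_real q"
    unfolding sesq_add_left sesq_add_right sesq_scale_left sesq_scale_right u q(1)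
      hermitian_sesq[OF possemidef_hermitian[OF M], of v u] B_def by (simp add: algebra_simps)
  also have "\<dots> = of_real ((- 2 * s + s * s * q) * (norm B)\<^sup>2)"
    unfolding t_def of_real_mult complex_norm_square by (simp add: algebra_simps)
  finally have "0 \<le> (- 2 * s + s * s * q) * (norm B)\<^sup>2"
    using M unfolding possemidef_def nonneg_complex_iff by (metis Re_complex_of_real)
  moreover have "(norm B)\<^sup>2 > 0" using \<open>sesq M u v \<noteq> 0\<close> by (simp add: B_def)
  ultimately have "0 \<le> - 2 * s + s * s * q" by (auto simp: zero_le_mult_iff)
  then have "0 \<le> s * (s * q - 2)" by (simp add: algebra_simps)
  then have "0 \<le> s * q - 2" using s by (auto simp: zero_le_mult_iff)
  moreover have "s * q < 1" using q by (simp add: s_def)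
  ultimately show False by simp
qed

text \<open>A null vector of a semidefinite form pairs to zero with every vector, so it lies in the
  kernel of the transposed matrix.\<close>

lemma possemidef_det_posdef:
  fixes M :: "complex^'m^'m"
  assumes M: "possemidef M" and d: "det M \<noteq> 0"
  shows "posdef M"
  unfolding posdef_def
proof (intro allI impI)
  fix u :: "complex^'m" assume u: "u \<noteq> 0"
  have "sesq M u u \<noteq> 0"
  proof
    assume "sesq M u u = 0"
    then have z: "sesq M u v = 0" for v using possemidef_null[OF M] by blast
    have "(u v* M) $ b = 0" for b
    proof -
      have "sesq M u (axis b 1) = (\<Sum>c\<in>UNIV. if c = b then (u v* M) $ b else 0)"
        unfolding sesq_transpose by (intro sum.cong refl) (auto simp: axis_def)
      then show ?thesis using z by simp
    qed
    then have "transpose M *v u = 0" by (simp add: vec_eq_iff)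
    moreover have "det (transpose M) \<noteq> 0" using d by simp
    ultimately have "matrix_inv (transpose M) ** transpose M *v u = 0"
      by (simp flip: matrix_vector_mul_assoc)
    then show False using u \<open>det (transpose M) \<noteq> 0\<close> by (simp add: matrix_inv_left)
  qed
  then show "0 < sesq M u u" using M by (auto simp: possemidef_def order.strict_iff_order)
qed

lemma continuous_on_sesq: "continuous_on S (\<lambda>u. sesq M u u)"
  unfolding sesq_def by (intro continuous_intros)

lemma sesq_bound: "norm (sesq M u u) \<le> (\<Sum>a\<in>UNIV. \<Sum>b\<in>UNIV. norm (M $ a $ b)) * (norm u)\<^sup>2"
proof -
  have "norm (sesq M u u) \<le> (\<Sum>a\<in>UNIV. \<Sum>b\<in>UNIV. norm (M $ a $ b) * (norm u)\<^sup>2)"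
    unfolding sesq_def
  proof (intro sum_norm_le)
    fix a b
    show "norm (M $ a $ b * u $ a * cnj (u $ b)) \<le> norm (M $ a $ b) * (norm u)\<^sup>2"
      unfolding norm_mult power2_eq_square mult.assoc complex_mod_cnj
      by (intro mult_mono Finite_Cartesian_Product.norm_nth_le) auto
  qed
  then show ?thesis by (simp add: sum_distrib_right)
qed

text \<open>By compactness of the unit sphere.\<close>

lemma posdef_open:
  fixes M K :: "complex^'m^'m"
  assumes M: "posdef M" and K: "hermitian K"
  obtains \<epsilon> where "\<epsilon> > 0" "\<And>t. \<bar>t\<bar> < \<epsilon> \<Longrightarrow> posdef (M + t *\<^sub>R K)"
proof -
  obtain u0 where u0: "u0 \<in> sphere (0::complex^'m) 1" "\<And>u. u \<in> sphere 0 1 \<Longrightarrow> Re (sesq M u0 u0) \<le> Re (sesq M u u)"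
    using continuous_attains_inf[OF compact_sphere[of "0::complex^'m" 1] _ continuous_on_Re[OF continuous_on_sesq[of _ M]]] by auto
  define c where "c = Re (sesq M u0 u0)"
  have "u0 \<noteq> 0" using u0(1) by auto
  then have c: "c > 0" using M unfolding c_def posdef_def pos_complex_iff by blast
  \<comment> \<open>Bounds the form of \<open>K\<close> on the unit sphere; the summand
    \<open>1\<close> keeps it positive for \<open>K = 0\<close>.\<close>
  define k where "k = (\<Sum>a\<in>UNIV. \<Sum>b\<in>UNIV. norm (K $ a $ b)) + 1"
  have k: "k > 0" unfolding k_def by (intro add_nonneg_pos sum_nonneg) auto
  show thesis
  proof (rule that[of "c / k"])
    fix t :: real assume t: "\<bar>t\<bar> < c / k"
    show "posdef (M + t *\<^sub>R K)"
      unfolding posdef_def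
    proof (intro allI impI)
      fix u :: "complex^'m" assume u: "u \<noteq> 0"
      define w where "w = (1 / of_real (norm u)) *s u"
      have w: "norm w = 1" unfolding w_def norm_vector_smult using u by (simp add: norm_divide)
      have uw: "u = of_real (norm u) *s w" using u by (simp add: w_def vector_smult_assoc)
      have im: "Im (sesq K w w) = 0" using hermitian_sesq[OF K, of w w] by (simp add: complex_eq_iff)
      have imM: "Im (sesq M w w) = 0" using hermitian_sesq[OF possemidef_hermitian[OF posdef_possemidef[OF M]], of w w] by (simp add: complex_eq_iff)
      have "\<bar>Re (sesq K w w)\<bar> \<le> norm (sesq K w w)" by (rule abs_Re_le_cmod)
      also have "\<dots> \<le> k" using sesq_bound[of K w] w by (simp add: k_def)
      finally have "\<bar>t * Re (sesq K w w)\<bar> \<le> \<bar>t\<bar> * k" unfolding abs_mult by (intro mult_left_mono) auto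
      also have "\<dots> < c" using t k by (simp add: field_simps)
      finally have "\<bar>t * Re (sesq K w w)\<bar> < c" .
      moreover have "c \<le> Re (sesq M w w)" unfolding c_def by (rule u0(2)) (use w in simp)
      ultimately have "0 < Re (sesq (M + t *\<^sub>R K) w w)" unfolding sesq_add_matrix sesq_scaleR_matrix by simp
      moreover have "Im (sesq (M + t *\<^sub>R K) w w) = 0" unfolding sesq_add_matrix sesq_scaleR_matrix using im imM by simp
      moreover have "sesq (M + t *\<^sub>R K) u u = of_real ((norm u)\<^sup>2) * sesq (M + t *\<^sub>R K) w w"
        by (subst uw, subst (2) uw) (simp only: sesq_scale_left sesq_scale_right complex_cnj_complex_of_real power2_eq_square of_real_mult mult.assoc)
      ultimately show "0 < sesq (M + t *\<^sub>R K) u u" using u by (simp add: pos_complex_iff)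
    qed
  qed (use c k in auto)
qed

text \<open>Induction on the set of indices already served. Orthogonality to the earlier vectors is
  a linear system whose matrix has the zero row \<open>\<nu>\<close>, hence is singular; a kernel
  vector, normalized, is the next vector.\<close>

lemma orthonormal_exists:
  fixes H :: "complex^'r^'r"
  assumes "posdef H"
  obtains E :: "'r \<Rightarrow> complex^'r" where "\<And>\<kappa> \<mu>. sesq H (E \<kappa>) (E \<mu>) = (if \<kappa> = \<mu> then 1 else 0)"
proof -
  have "\<exists>E :: 'r \<Rightarrow> complex^'r. \<forall>\<kappa>\<in>F. \<forall>\<mu>\<in>F. sesq H (E \<kappa>) (E \<mu>) = (if \<kappa> = \<mu> then 1 else 0)" for F :: "'r set"
    using finite[of F]
  proof (induction F rule: finite_induct)
    case empty
    then show ?case by simp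
  next
    case (insert \<nu> F)
    then obtain E :: "'r \<Rightarrow> complex^'r" where E: "\<forall>\<kappa>\<in>F. \<forall>\<mu>\<in>F. sesq H (E \<kappa>) (E \<mu>) = (if \<kappa> = \<mu> then 1 else 0)" by blast
    define R :: "complex^'r^'r" where "R = (\<chi> \<mu>. if \<mu> \<in> F then (\<chi> a. \<Sum>b\<in>UNIV. H $ a $ b * cnj (E \<mu> $ b)) else 0)"
    have "row \<nu> R = 0" using insert.hyps by (simp add: row_def R_def vec_eq_iff)
    then have "det R = 0" by (rule det_zero_row)
    then obtain u where u: "u \<noteq> 0" "R *v u = 0" using matrix_kernel by blast
    have Ru: "sesq H u (E \<mu>) = 0" if "\<mu> \<in> F" for \<mu>
    proof -
      have "sesq H u (E \<mu>) = (R *v u) $ \<mu>"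
        using that unfolding sesq_def matrix_vector_mult_def R_def by (simp add: sum_distrib_left mult_ac)
      then show ?thesis using u(2) by simp
    qed
    have s: "0 < sesq H u u" using assms u(1) by (simp add: posdef_def)
    define c where "c = 1 / sqrt (Re (sesq H u u))"
    have cc: "of_real (c * c) * sesq H u u = 1"
      using s by (simp add: pos_complex_iff complex_eq_iff c_def)
    define w where "w = of_real c *s u"
    have w1: "sesq H w w = 1" unfolding w_def sesq_scale_left sesq_scale_right using cc by (simp add: mult.assoc)
    have w2: "sesq H w (E \<mu>) = 0" if "\<mu> \<in> F" for \<mu> unfolding w_def sesq_scale_left Ru[OF that] by simp
    have w3: "sesq H (E \<mu>) w = 0" if "\<mu> \<in> F" for \<mu>
      using hermitian_sesq[OF possemidef_hermitian[OF posdef_possemidef[OF assms]], of "E \<mu>" w] w2[OF that] by simp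
    show ?case
      by (rule exI[of _ "E(\<nu> := w)"]) (use E w1 w2 w3 insert.hyps in auto)
  qed
  from this[of UNIV] show thesis using that by auto
qed

section \<open>The determinant is maximal on multiples of the identity\<close>

text \<open>The trace over the fibre index; on curvature coefficients it gives the curvature of the
  determinant bundle.\<close>

definition ptrace :: "complex^('n::finite \<times> 'r::finite)^('n \<times> 'r) \<Rightarrow> complex^'n^'n" where
  "ptrace M = (\<chi> j k. \<Sum>\<kappa>\<in>UNIV. M $ (j, \<kappa>) $ (k, \<kappa>))"

text \<open>The \<open>itself\<close> argument carries the fibre type, whose cardinality is the
  divisor and which does not occur in the type of \<open>S\<close>.\<close>

definition scaled :: "complex^'n^'n \<Rightarrow> 'r::finite itself \<Rightarrow> complex^'n^'n" where
  "scaled S _ = (\<chi> j k. S $ j $ k / of_nat CARD('r))"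

lemma sesq_blockdiag:
  "sesq (blockdiag Q) \<gamma> \<gamma> = (\<Sum>\<kappa>\<in>UNIV. sesq (Q \<kappa>) (\<chi> j. \<gamma> $ (j, \<kappa>)) (\<chi> j. \<gamma> $ (j, \<kappa>)))"
proof -
  have "sesq (blockdiag Q) \<gamma> \<gamma> =
    (\<Sum>j\<in>UNIV. \<Sum>\<kappa>\<in>UNIV. \<Sum>k\<in>UNIV. \<Sum>\<mu>\<in>UNIV. if \<kappa> = \<mu> then Q \<kappa> $ j $ k * \<gamma> $ (j, \<kappa>) * cnj (\<gamma> $ (k, \<kappa>)) else 0)"
    unfolding sesq_def sum_UNIV_prod by (intro sum.cong refl) (auto simp: blockdiag_nth)
  also have "\<dots> = (\<Sum>j\<in>UNIV. \<Sum>\<kappa>\<in>UNIV. \<Sum>k\<in>UNIV. Q \<kappa> $ j $ k * \<gamma> $ (j, \<kappa>) * cnj (\<gamma> $ (k, \<kappa>)))" by simp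
  also have "\<dots> = (\<Sum>\<kappa>\<in>UNIV. \<Sum>j\<in>UNIV. \<Sum>k\<in>UNIV. Q \<kappa> $ j $ k * \<gamma> $ (j, \<kappa>) * cnj (\<gamma> $ (k, \<kappa>)))" by (rule sum.swap)
  finally show ?thesis by (simp add: sesq_def)
qed

lemma posdef_blockdiag:
  fixes Q :: "'r::finite \<Rightarrow> complex^'n^'n"
  assumes "\<And>\<kappa>. posdef (Q \<kappa>)"
  shows "posdef (blockdiag Q)"
  unfolding posdef_def
proof (intro allI impI)
  fix \<gamma> :: "complex^('n \<times> 'r)" assume "\<gamma> \<noteq> 0"
  then obtain j \<kappa> where "\<gamma> $ (j, \<kappa>) \<noteq> 0" by (auto simp: vec_eq_iff)
  then have ne: "(\<chi> j. \<gamma> $ (j, \<kappa>)) \<noteq> 0" by (auto simp: vec_eq_iff)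
  have nn: "0 \<le> sesq (Q \<kappa>) v v" for \<kappa> v
    using posdef_possemidef[OF assms] by (simp add: possemidef_def)
  have "0 < sesq (Q \<kappa>) (\<chi> j. \<gamma> $ (j, \<kappa>)) (\<chi> j. \<gamma> $ (j, \<kappa>))" using assms ne by (simp add: posdef_def)
  then show "0 < sesq (blockdiag Q) \<gamma> \<gamma>"
    unfolding sesq_blockdiag by (intro sum_pos2[of _ \<kappa>]) (use nn in auto)
qed

lemma posdef_scaled:
  fixes S :: "complex^'n^'n"
  shows "posdef S \<Longrightarrow> posdef (scaled S TYPE('r::finite))"
  unfolding posdef_def
proof (intro allI impI)
  fix u :: "complex^'n" assume "\<forall>u. u \<noteq> 0 \<longrightarrow> 0 < sesq S u u" "u \<noteq> 0"
  then have s: "0 < sesq S u u" by blast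
  have "sesq (scaled S TYPE('r)) u u = sesq S u u / of_real (real CARD('r))"
    by (simp add: sesq_def scaled_def sum_divide_distrib)
  then show "0 < sesq (scaled S TYPE('r)) u u" using s by (simp add: pos_complex_iff)
qed

lemma ptrace_blockdiag: "ptrace (blockdiag Q) = (\<Sum>\<kappa>\<in>UNIV. Q \<kappa>)"
  by (simp add: ptrace_def vec_eq_iff blockdiag_nth)

lemma ptrace_scaled: "ptrace (blockdiag (\<lambda>_::'r::finite. scaled S TYPE('r))) = S"
  by (simp add: ptrace_def vec_eq_iff blockdiag_nth scaled_def)

text \<open>The determinant has a maximum on the compact convex set of positive semidefinite matrices with
  partial trace \<open>S\<close>.  At a maximum \<open>M\<close> its derivative \<open>det M * trace (matrix_inv M ** K)\<close> vanishes for
  all hermitian \<open>K\<close> of zero partial trace, which forces \<open>matrix_inv M\<close>, and hence \<open>M\<close>, to be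
  block diagonal with equal blocks.\<close>

lemma ptrace_critical:
  fixes M :: "complex^('n::finite \<times> 'r::finite)^('n \<times> 'r)"
  assumes M: "posdef M" and S: "ptrace M = S"
    and crit: "\<And>K. hermitian K \<Longrightarrow> ptrace K = 0 \<Longrightarrow> Re (det M * trace (matrix_inv M ** K)) = 0"
  shows "M = blockdiag (\<lambda>_. scaled S TYPE('r))"
proof -
  define N where "N = matrix_inv M"
  have dM: "det M \<noteq> 0" and dMp: "0 < det M" using posdef_det_nz posdef_det M by auto
  have NM: "N ** M = mat 1" and MN: "M ** N = mat 1"
    unfolding N_def using matrix_inv_left matrix_inv_right dM by auto
  have hM: "hermitian M" using M possemidef_hermitian posdef_possemidef by blast
  have hN: "N $ b $ a = cnj (N $ a $ b)" for a b
  proof -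
    define N' where "N' = (\<chi> a b. cnj (N $ b $ a))"
    have "M ** N' = mat 1"
      unfolding vec_eq_iff
    proof (intro allI)
      fix a b
      have "(M ** N') $ a $ b = cnj ((N ** M) $ b $ a)"
        unfolding N'_def matrix_matrix_mult_def vec_lambda_beta cnj_sum complex_cnj_mult
        by (intro sum.cong refl) (metis hermitianD[OF hM] mult.commute)
      then show "(M ** N') $ a $ b = mat 1 $ a $ b" unfolding NM by (simp add: mat_def)
    qed
    then have "N = N'" unfolding N_def by (rule matrix_inv_unique)
    then have "N $ b $ a = N' $ b $ a" by simp
    then show ?thesis by (simp add: N'_def)
  qed
  have re0: "Re (trace (N ** K)) = 0" if "hermitian K" "ptrace K = 0" for K
    using crit[OF that] dMp by (simp add: N_def pos_complex_iff)
  \<comment> \<open>Hermitian directions span all directions: \<open>K + K'\<close> and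
    \<open>\<i>\<close> times \<open>K - K'\<close> are hermitian, and they yield the real and the
    imaginary part of the trace.\<close>
  have tr0: "trace (N ** K) = 0" if K: "ptrace K = 0" for K
  proof -
    define K' where "K' = (\<chi> a b. cnj (K $ b $ a))"
    have trK': "trace (N ** K') = cnj (trace (N ** K))"
    proof -
      have "trace (N ** K') = (\<Sum>a\<in>UNIV. \<Sum>b\<in>UNIV. N $ a $ b * cnj (K $ a $ b))"
        by (simp add: trace_def matrix_matrix_mult_def K'_def)
      also have "\<dots> = (\<Sum>a\<in>UNIV. \<Sum>b\<in>UNIV. cnj (N $ b $ a * K $ a $ b))"
        by (intro sum.cong refl) (metis complex_cnj_mult hN)
      also have "\<dots> = (\<Sum>b\<in>UNIV. \<Sum>a\<in>UNIV. cnj (N $ b $ a * K $ a $ b))" by (rule sum.swap)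
      finally show ?thesis by (simp add: trace_def matrix_matrix_mult_def)
    qed
    have ptK': "ptrace K' = 0"
      using K by (simp add: ptrace_def vec_eq_iff K'_def flip: cnj_sum)
    have lin: "trace (N ** (X + Y)) = trace (N ** X) + trace (N ** Y)" for X Y
      by (simp add: matrix_add_ldistrib trace_add)
    have "hermitian (K + K')" "ptrace (K + K') = 0"
      using K ptK' by (auto simp: hermitian_def K'_def ptrace_def vec_eq_iff sum.distrib)
    from re0[OF this] have 1: "Re (trace (N ** K)) = 0" unfolding lin trK' by simp
    define L where "L = (\<chi> a b. \<i> * K $ a $ b)"
    define L' where "L' = (\<chi> a b. - \<i> * K' $ a $ b)"
    have "hermitian (L + L')" by (simp add: hermitian_def K'_def L_def L'_def)
    moreover have "ptrace (L + L') $ j $ k = \<i> * ptrace K $ j $ k - \<i> * ptrace K' $ j $ k" for j k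
      by (simp add: L_def L'_def ptrace_def sum_subtractf sum_distrib_left)
    then have "ptrace (L + L') = 0" unfolding K ptK' by (simp add: vec_eq_iff)
    moreover have "trace (N ** L) = \<i> * trace (N ** K)" "trace (N ** L') = - \<i> * trace (N ** K')"
      by (simp_all add: trace_def matrix_matrix_mult_def L_def L'_def sum_distrib_left sum_negf mult.left_commute)
    ultimately have 2: "Im (trace (N ** K)) = 0" using re0[of "L + L'"] unfolding lin trK' by simp
    show ?thesis using 1 2 by (simp add: complex_eq_iff)
  qed
  \<comment> \<open>Elementary matrices as test directions. One with two different fibre indices has
    zero partial trace, which gives the block structure of \<open>N\<close>; so has the difference
    of two that share their tangent indices and lie in diagonal blocks, which gives equality of the
    blocks.\<close>
  define el :: "'n \<times> 'r \<Rightarrow> 'n \<times> 'r \<Rightarrow> complex^('n \<times> 'r)^('n \<times> 'r)"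
    where "el x y = (\<chi> a b. if a = x \<and> b = y then 1 else 0)" for x y
  have tre: "trace (N ** el x y) = N $ y $ x" for x y
  proof -
    have "trace (N ** el x y) = (\<Sum>a\<in>UNIV. \<Sum>b\<in>UNIV. if b = x then (if a = y then N $ y $ x else 0) else 0)"
      unfolding trace_def matrix_matrix_mult_def vec_lambda_beta
      by (intro sum.cong refl) (auto simp: el_def)
    then show ?thesis by simp
  qed
  have N1: "N $ (j, \<kappa>) $ (k, \<mu>) = 0" if "\<kappa> \<noteq> \<mu>" for j k \<kappa> \<mu>
  proof -
    have "ptrace (el (k, \<mu>) (j, \<kappa>)) = 0"
      using that by (auto simp: ptrace_def vec_eq_iff el_def intro!: sum.neutral)
    then show ?thesis using tr0 tre by metis
  qed
  have N2: "N $ (j, \<kappa>) $ (k, \<kappa>) = N $ (j, \<mu>) $ (k, \<mu>)" for j k \<kappa> \<mu>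
  proof -
    have pe: "ptrace (el (k, \<nu>) (j, \<nu>)) = (\<chi> a b. if a = k \<and> b = j then 1 else 0)" for \<nu> :: 'r
      by (auto simp: ptrace_def vec_eq_iff el_def if_distrib cong: if_cong)
    have pd: "ptrace (X - Y) = ptrace X - ptrace Y" for X Y :: "complex^('n \<times> 'r)^('n \<times> 'r)"
      by (simp add: ptrace_def vec_eq_iff sum_subtractf)
    have "ptrace (el (k, \<kappa>) (j, \<kappa>) - el (k, \<mu>) (j, \<mu>)) = 0" unfolding pd pe by simp
    from tr0[OF this] have "trace (N ** el (k, \<kappa>) (j, \<kappa>)) - trace (N ** el (k, \<mu>) (j, \<mu>)) = 0"
      by (simp add: trace_def matrix_matrix_mult_def right_diff_distrib sum_subtractf)
    then show ?thesis unfolding tre by simp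
  qed
  \<comment> \<open>By \<open>N2\<close> all fibre indices give the same block;
    \<open>undefined\<close> picks one.\<close>
  define A where "A = (\<chi> j k. N $ (j, undefined) $ (k, undefined :: 'r))"
  have NA: "N = blockdiag (\<lambda>_. A)"
  proof -
    have "N $ (j, \<kappa>) $ (k, \<mu>) = blockdiag (\<lambda>_. A) $ (j, \<kappa>) $ (k, \<mu>)" for j k \<kappa> \<mu>
      using N1 N2[of j \<kappa> k undefined] by (auto simp: blockdiag_nth A_def)
    then show ?thesis by (simp add: vec_eq_iff)
  qed
  have "det N * det M = 1" using arg_cong[OF NM, of det] by (simp only: det_mul det_I)
  then have "det N \<noteq> 0" by auto
  then have dA: "det A \<noteq> 0" unfolding NA det_blockdiag by simp
  have "N ** blockdiag (\<lambda>_. matrix_inv A) = mat 1"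
    unfolding NA blockdiag_mult matrix_inv_right[OF dA] by (rule blockdiag_1)
  then have "matrix_inv N = blockdiag (\<lambda>_. matrix_inv A)" by (rule matrix_inv_unique)
  moreover have "matrix_inv N = M" using NM by (rule matrix_inv_unique)
  ultimately have MB: "M = blockdiag (\<lambda>_. matrix_inv A)" by simp
  have "S = ptrace (blockdiag (\<lambda>_::'r. matrix_inv A))" using S MB by simp
  then have "S $ j $ k = of_nat CARD('r) * matrix_inv A $ j $ k" for j k
    by (simp add: ptrace_def blockdiag_nth)
  then have "matrix_inv A = scaled S TYPE('r)"
    by (simp add: scaled_def vec_eq_iff)
  then show ?thesis using MB by simp
qed

theorem det_le_ptrace:
  fixes M :: "complex^('n::finite \<times> 'r::finite)^('n \<times> 'r)"
  assumes M: "possemidef M" and S: "ptrace M = S" "posdef S"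
  shows "Re (det M) \<le> Re (det (scaled S TYPE('r))) ^ CARD('r)"
    and "Re (det M) = Re (det (scaled S TYPE('r))) ^ CARD('r) \<Longrightarrow> M = blockdiag (\<lambda>_. scaled S TYPE('r))"
proof -
  define C where "C = {M :: complex^('n \<times> 'r)^('n \<times> 'r). possemidef M \<and> ptrace M = S}"
  define D where "D = blockdiag (\<lambda>_::'r. scaled S TYPE('r))"
  define T where "T = (\<Sum>j\<in>UNIV. Re (S $ j $ j))"
  have pdD: "posdef D" unfolding D_def by (intro posdef_blockdiag posdef_scaled S)
  have "D \<in> C" using pdD posdef_possemidef ptrace_scaled by (auto simp: C_def D_def)
  have detD: "Re (det D) = Re (det (scaled S TYPE('r))) ^ CARD('r)" "Re (det D) > 0"
  proof -
    have "Im (det (scaled S TYPE('r))) = 0" using posdef_det[OF posdef_scaled[OF S(2), where 'r = 'r]] by (simp add: pos_complex_iff)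
    then have "det (scaled S TYPE('r)) = of_real (Re (det (scaled S TYPE('r))))" by (simp add: complex_eq_iff)
    then have "det D = of_real (Re (det (scaled S TYPE('r))) ^ CARD('r))"
      unfolding D_def det_blockdiag by (metis of_real_power prod_constant)
    then show "Re (det D) = Re (det (scaled S TYPE('r))) ^ CARD('r)" by simp
    show "Re (det D) > 0" using posdef_det[OF pdD] by (simp add: pos_complex_iff)
  qed
  have "closed C"
  proof -
    have "C = (\<Inter>u. {M. 0 \<le> Re (sesq M u u)}) \<inter> (\<Inter>u. {M. Im (sesq M u u) = 0}) \<inter> {M. ptrace M = S}"
      by (auto simp: C_def possemidef_def nonneg_complex_iff)
    moreover have "closed \<dots>"
      unfolding sesq_def ptrace_def by (intro closed_Int closed_INT ballI closed_Collect_le closed_Collect_eq continuous_intros)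
    ultimately show ?thesis by simp
  qed
  \<comment> \<open>\<open>S\<close> fixes the full trace, the full trace bounds each diagonal
    entry, and the diagonal bounds every entry.\<close>
  moreover have "bounded C"
  proof (rule boundedI)
    fix M assume M: "M \<in> C"
    then have psd: "possemidef M" by (simp add: C_def)
    have dnn: "0 \<le> Re (M $ a $ a)" for a using possemidef_diag[OF psd] by (simp add: nonneg_complex_iff)
    have T: "T = (\<Sum>a\<in>UNIV. Re (M $ a $ a))"
      using M by (auto simp: T_def C_def ptrace_def sum_UNIV_prod)
    have "Re (M $ a $ a) \<le> T" for a
      unfolding T by (rule member_le_sum) (use dnn in auto)
    then have b: "norm (M $ a $ b) \<le> T" for a b
      using possemidef_bound[OF psd, of a b] by (smt (verit))
    have "norm M \<le> (\<Sum>a\<in>UNIV. norm (M $ a))" by (simp add: norm_vec_def L2_set_le_sum)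
    also have "\<dots> \<le> (\<Sum>a\<in>UNIV. \<Sum>b\<in>UNIV. norm (M $ a $ b))"
      by (intro sum_mono) (simp add: norm_vec_def L2_set_le_sum)
    also have "\<dots> \<le> (\<Sum>a\<in>(UNIV::('n\<times>'r) set). \<Sum>b\<in>(UNIV::('n\<times>'r) set). T)" by (intro sum_mono b)
    finally show "norm M \<le> (\<Sum>a\<in>(UNIV::('n\<times>'r) set). \<Sum>b\<in>(UNIV::('n\<times>'r) set). T)" .
  qed
  ultimately have "compact C" by (simp add: compact_eq_bounded_closed)
  then obtain M0 where M0: "M0 \<in> C" "\<And>M. M \<in> C \<Longrightarrow> Re (det M) \<le> Re (det M0)"
    using continuous_attains_sup[of C "\<lambda>M. Re (det M)"] \<open>D \<in> C\<close> continuous_on_Re[OF continuous_on_det] by blast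
  \<comment> \<open>Proved for an arbitrary maximum and not only for \<open>M0\<close>, because it
    is used again for the matrix \<open>M\<close> of the equality case.\<close>
  have max_D: "M1 = D" if M1: "M1 \<in> C" and max: "\<And>M. M \<in> C \<Longrightarrow> Re (det M) \<le> Re (det M1)" for M1
  proof -
    \<comment> \<open>The competitor \<open>D\<close> makes the maximal determinant positive, so
      \<open>M1\<close> is positive definite, and small hermitian perturbations with zero partial
      trace remain in \<open>C\<close>.\<close>
    have "Re (det M1) > 0" using max[OF \<open>D \<in> C\<close>] detD by linarith
    then have d1: "det M1 \<noteq> 0" by auto
    have pd: "posdef M1" using M1 d1 possemidef_det_posdef by (auto simp: C_def)
    have "Re (det M1 * trace (matrix_inv M1 ** K)) = 0" if K: "hermitian K" "ptrace K = 0" for K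
    proof -
      obtain \<epsilon> where e: "\<epsilon> > 0" "\<And>t. \<bar>t\<bar> < \<epsilon> \<Longrightarrow> posdef (M1 + t *\<^sub>R K)" using posdef_open[OF pd K(1)] by blast
      have inC: "M1 + t *\<^sub>R K \<in> C" if "\<bar>t\<bar> < \<epsilon>" for t
      proof -
        have "ptrace (M1 + t *\<^sub>R K) = ptrace M1 + t *\<^sub>R ptrace K"
          by (simp add: ptrace_def vec_eq_iff sum.distrib scaleR_sum_right)
        then show ?thesis using M1 K(2) e(2)[OF that] posdef_possemidef by (simp add: C_def)
      qed
      have l: "((\<lambda>t. M1 + t *\<^sub>R K) has_derivative (\<lambda>t. t *\<^sub>R K)) (at 0)"
        by (auto intro!: derivative_eq_intros)
      have d: "(det has_derivative (\<lambda>K. det M1 * trace (matrix_inv M1 ** K))) (at (M1 + 0 *\<^sub>R K))"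
        using has_derivative_det[OF d1] by simp
      have tk: "trace (matrix_inv M1 ** (t *\<^sub>R K)) = of_real t * trace (matrix_inv M1 ** K)" for t
        unfolding trace_def matrix_matrix_mult_def vec_lambda_beta vector_scaleR_component mult_scaleR_right
          scaleR_sum_right[symmetric] by (simp add: scaleR_conv_of_real)
      have "((\<lambda>t. Re (det (M1 + t *\<^sub>R K))) has_derivative (\<lambda>t. Re (det M1 * trace (matrix_inv M1 ** (t *\<^sub>R K))))) (at 0)"
        by (rule bounded_linear.has_derivative[OF bounded_linear_Re has_derivative_compose[OF l d]])
      then have "((\<lambda>t. Re (det (M1 + t *\<^sub>R K))) has_real_derivative Re (det M1 * trace (matrix_inv M1 ** K))) (at 0)"
        by (rule has_derivative_imp_has_field_derivative) (simp add: tk algebra_simps)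
      then show ?thesis
        by (rule DERIV_local_max[OF _ e(1)]) (use max inC in auto)
    qed
    then show ?thesis unfolding D_def
      by (intro ptrace_critical pd) (use M1 in \<open>auto simp: C_def\<close>)
  qed
  have "M0 = D" by (rule max_D[OF M0])
  then have le: "Re (det M) \<le> Re (det D)" if "M \<in> C" for M using M0(2)[OF that] by simp
  show "Re (det M) \<le> Re (det (scaled S TYPE('r))) ^ CARD('r)"
    using le[of M] M S detD by (simp add: C_def)
  assume "Re (det M) = Re (det (scaled S TYPE('r))) ^ CARD('r)"
  then have "M = D" using le detD M S by (intro max_D) (auto simp: C_def)
  then show "M = blockdiag (\<lambda>_. scaled S TYPE('r))" by (simp add: D_def)
qed

section \<open>Pointwise inequalities for positive curvature tensors\<close>

definition coeff_trace :: "('n::finite \<Rightarrow> 'n \<Rightarrow> 'r::finite \<Rightarrow> 'r \<Rightarrow> complex) \<Rightarrow> complex^'n^'n" where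
  "coeff_trace q = (\<chi> j k. \<Sum>\<kappa>\<in>UNIV. q j k \<kappa> \<kappa>)"

definition coeff_matrix :: "('n::finite \<Rightarrow> 'n \<Rightarrow> 'r::finite \<Rightarrow> 'r \<Rightarrow> complex) \<Rightarrow> complex^('n \<times> 'r)^('n \<times> 'r)" where
  "coeff_matrix q = (\<chi> a b. q (fst a) (fst b) (snd a) (snd b))"

text \<open>The coefficients of the (1,1)-form \<open>\<langle>\<Theta> v, v\<rangle>\<close>, for
  \<open>v\<close> given by its coordinates in an orthonormal frame.\<close>

definition coeff_at :: "('n::finite \<Rightarrow> 'n \<Rightarrow> 'r::finite \<Rightarrow> 'r \<Rightarrow> complex) \<Rightarrow> complex^'r \<Rightarrow> complex^'n^'n" where
  "coeff_at q v = (\<chi> j k. \<Sum>\<kappa>\<in>UNIV. \<Sum>\<mu>\<in>UNIV. q j k \<kappa> \<mu> * v $ \<kappa> * cnj (v $ \<mu>))"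

lemma ptrace_coeff_matrix: "ptrace (coeff_matrix q) = coeff_trace q"
  by (simp add: ptrace_def coeff_matrix_def coeff_trace_def)

lemma sesq_coeff_matrix:
  "sesq (coeff_matrix q) g g = (\<Sum>j\<in>UNIV. \<Sum>k\<in>UNIV. \<Sum>\<kappa>\<in>UNIV. \<Sum>\<mu>\<in>UNIV. q j k \<kappa> \<mu> * g $ (j, \<kappa>) * cnj (g $ (k, \<mu>)))"
proof -
  have "sesq (coeff_matrix q) g g = (\<Sum>j\<in>UNIV. \<Sum>\<kappa>\<in>UNIV. \<Sum>k\<in>UNIV. \<Sum>\<mu>\<in>UNIV. q j k \<kappa> \<mu> * g $ (j, \<kappa>) * cnj (g $ (k, \<mu>)))"
    by (simp add: sesq_def sum_UNIV_prod coeff_matrix_def)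
  also have "\<dots> = (\<Sum>j\<in>UNIV. \<Sum>k\<in>UNIV. \<Sum>\<kappa>\<in>UNIV. \<Sum>\<mu>\<in>UNIV. q j k \<kappa> \<mu> * g $ (j, \<kappa>) * cnj (g $ (k, \<mu>)))"
    by (intro sum.cong refl sum.swap)
  finally show ?thesis .
qed

lemma positive_Nakano_iff: "positive_coeffs Nakano q \<longleftrightarrow> posdef (coeff_matrix q)"
proof
  assume q: "positive_coeffs Nakano q"
  show "posdef (coeff_matrix q)"
    unfolding posdef_def
  proof (intro allI impI)
    fix g :: "complex^('a \<times> 'b)" assume g: "g \<noteq> 0"
    define \<gamma> :: "complex^'b^'a" where "\<gamma> = (\<chi> j \<kappa>. g $ (j, \<kappa>))"
    have "\<gamma> \<noteq> 0" using g by (auto simp: \<gamma>_def vec_eq_iff)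
    then have "0 < (\<Sum>j\<in>UNIV. \<Sum>k\<in>UNIV. \<Sum>\<kappa>\<in>UNIV. \<Sum>\<mu>\<in>UNIV. q j k \<kappa> \<mu> * \<gamma> $ j $ \<kappa> * cnj (\<gamma> $ k $ \<mu>))"
      using q by simp
    then show "0 < sesq (coeff_matrix q) g g" unfolding sesq_coeff_matrix \<gamma>_def by simp
  qed
next
  assume q: "posdef (coeff_matrix q)"
  show "positive_coeffs Nakano q"
    unfolding positive_coeffs.simps
  proof (intro allI impI)
    fix \<gamma> :: "complex^'b^'a" assume g: "\<gamma> \<noteq> 0"
    define g :: "complex^('a \<times> 'b)" where "g = (\<chi> a. \<gamma> $ fst a $ snd a)"
    have "g \<noteq> 0" using g by (auto simp: g_def vec_eq_iff)
    then have "0 < sesq (coeff_matrix q) g g" using q by (simp add: posdef_def)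
    then show "0 < (\<Sum>j\<in>UNIV. \<Sum>k\<in>UNIV. \<Sum>\<kappa>\<in>UNIV. \<Sum>\<mu>\<in>UNIV. q j k \<kappa> \<mu> * \<gamma> $ j $ \<kappa> * cnj (\<gamma> $ k $ \<mu>))"
      unfolding sesq_coeff_matrix g_def by simp
  qed
qed

lemma positive_Dual_Nakano_iff: "positive_coeffs Dual_Nakano q \<longleftrightarrow> positive_coeffs Nakano (\<lambda>j k \<kappa> \<mu>. q j k \<mu> \<kappa>)"
  by simp

lemma positive_Griffiths_iff: "positive_coeffs Griffiths q \<longleftrightarrow> (\<forall>v. v \<noteq> 0 \<longrightarrow> posdef (coeff_at q v))"
proof -
  have "sesq (coeff_at q v) \<xi> \<xi> = (\<Sum>j\<in>UNIV. \<Sum>k\<in>UNIV. \<Sum>\<kappa>\<in>UNIV. \<Sum>\<mu>\<in>UNIV.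
            q j k \<kappa> \<mu> * \<xi> $ j * cnj (\<xi> $ k) * v $ \<kappa> * cnj (v $ \<mu>))" for v \<xi>
    unfolding sesq_def coeff_at_def vec_lambda_beta sum_distrib_right
    by (intro sum.cong refl) (simp add: mult_ac)
  then show ?thesis unfolding posdef_def by auto
qed

lemma coeff_at_sesq: "coeff_at q v $ j $ k = sesq (\<chi> \<kappa> \<mu>. q j k \<kappa> \<mu>) v v"
  by (simp add: coeff_at_def sesq_def)

lemma coeff_at_axis: "coeff_at q (axis \<nu> 1) = (\<chi> j k. q j k \<nu> \<nu>)"
  by (simp add: vec_eq_iff coeff_at_sesq sesq_axis)

lemma posdef_sum:
  assumes "finite F" "F \<noteq> {}" "\<And>i. i \<in> F \<Longrightarrow> posdef (M i)"
  shows "posdef (\<Sum>i\<in>F. M i)"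
  using assms
proof (induction F rule: finite_ne_induct)
  case (insert i F)
  then show ?case by (auto simp: posdef_def sesq_add_matrix intro!: add_pos_pos)
qed auto

text \<open>Each notion, tested on a tangent vector times a basis vector of the fibre, gives a
  positive definite diagonal block; the trace is the sum of these blocks.\<close>

lemma posdef_coeff_trace:
  assumes "positive_coeffs P q"
  shows "posdef (coeff_trace q)"
proof -
  have "posdef (\<chi> j k. q j k \<nu> \<nu>)" for \<nu>
  proof -
    have *: "posdef (\<chi> j k. q j k \<nu> \<nu>)" if "posdef (coeff_matrix q)" for q :: "'a \<Rightarrow> 'a \<Rightarrow> 'b \<Rightarrow> 'b \<Rightarrow> complex"
      unfolding posdef_def
    proof (intro allI impI)
      fix u :: "complex^'a" assume u: "u \<noteq> 0"
      define g :: "complex^('a \<times> 'b)" where "g = (\<chi> a. if snd a = \<nu> then u $ fst a else 0)"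
      have "g \<noteq> 0" using u by (auto simp: g_def vec_eq_iff)
      then have "0 < sesq (coeff_matrix q) g g" using that by (simp add: posdef_def)
      moreover have "(\<Sum>\<mu>\<in>UNIV. q j k \<kappa> \<mu> * g $ (j, \<kappa>) * cnj (g $ (k, \<mu>))) =
         (if \<kappa> = \<nu> then (\<Sum>\<mu>\<in>UNIV. if \<mu> = \<nu> then q j k \<nu> \<nu> * u $ j * cnj (u $ k) else 0) else 0)" for j k \<kappa>
      proof (cases "\<kappa> = \<nu>")
        case True
        show ?thesis unfolding if_P[OF True] by (intro sum.cong refl) (use True in \<open>simp add: g_def\<close>)
      next
        case False
        then show ?thesis by (simp add: g_def)
      qed
      then have "sesq (coeff_matrix q) g g = (\<Sum>j\<in>UNIV. \<Sum>k\<in>UNIV. \<Sum>\<kappa>\<in>UNIV. if \<kappa> = \<nu> then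
          (\<Sum>\<mu>\<in>UNIV. if \<mu> = \<nu> then q j k \<nu> \<nu> * u $ j * cnj (u $ k) else 0) else 0)"
        unfolding sesq_coeff_matrix by (simp only:)
      ultimately show "0 < sesq (\<chi> j k. q j k \<nu> \<nu>) u u" by (simp add: sesq_def)
    qed
    show ?thesis
    proof (cases P)
      case Nakano
      then show ?thesis using assms * positive_Nakano_iff by blast
    next
      case Dual_Nakano
      then show ?thesis using assms *[of "\<lambda>j k \<kappa> \<mu>. q j k \<mu> \<kappa>"] positive_Nakano_iff positive_Dual_Nakano_iff by blast
    next
      case Griffiths
      have "axis \<nu> 1 \<noteq> (0 :: complex^'b)" by (simp add: axis_eq_0_iff)
      then show ?thesis using assms Griffiths coeff_at_axis[of q \<nu>] positive_Griffiths_iff by metis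
    qed
  qed
  then have "posdef (\<Sum>\<nu>\<in>UNIV. \<chi> j k. q j k \<nu> \<nu>)" by (intro posdef_sum) auto
  also have "(\<Sum>\<nu>\<in>UNIV. \<chi> j k. q j k \<nu> \<nu>) = coeff_trace q"
    by (simp add: vec_eq_iff coeff_trace_def)
  finally show ?thesis .
qed

definition scalar_coeffs :: "('n::finite \<Rightarrow> 'n \<Rightarrow> 'r::finite \<Rightarrow> 'r \<Rightarrow> complex) \<Rightarrow> complex^'n^'n \<Rightarrow> bool" where
  "scalar_coeffs q \<alpha> \<longleftrightarrow> (\<forall>j k \<kappa> \<mu>. q j k \<kappa> \<mu> = (if \<kappa> = \<mu> then \<alpha> $ j $ k else 0))"

lemma scalar_coeffs_iff_blockdiag: "scalar_coeffs q \<alpha> \<longleftrightarrow> coeff_matrix q = blockdiag (\<lambda>_. \<alpha>)"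
  by (auto simp: scalar_coeffs_def vec_eq_iff coeff_matrix_def blockdiag_nth)

lemma powr_root_le:
  assumes "0 < x" "0 < (y::real)" "x \<le> y ^ n" "n > 0"
  shows "x powr (1 / n) \<le> y" and "x powr (1 / n) = y \<Longrightarrow> x = y ^ n"
proof -
  have y: "(y ^ n) powr (1 / n) = y"
    using assms by (simp add: powr_realpow[symmetric] powr_powr)
  show "x powr (1 / n) \<le> y"
    using powr_mono2[of "1/n" x "y ^ n"] assms y by simp
  assume "x powr (1 / n) = y"
  then have "(x powr (1 / n)) powr n = y powr n" by simp
  then show "x = y ^ n" using assms by (simp add: powr_powr powr_realpow)
qed

lemma Nakano_det:
  fixes q :: "'n::finite \<Rightarrow> 'n \<Rightarrow> 'r::finite \<Rightarrow> 'r \<Rightarrow> complex"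
  assumes "positive_coeffs Nakano q"
  defines "\<alpha> \<equiv> scaled (coeff_trace q) TYPE('r)"
  shows "Re (det (coeff_matrix q)) powr (1 / CARD('r)) \<le> Re (det \<alpha>)"
    and "Re (det (coeff_matrix q)) powr (1 / CARD('r)) = Re (det \<alpha>) \<Longrightarrow> scalar_coeffs q \<alpha>"
proof -
  have pd: "posdef (coeff_matrix q)" using assms positive_Nakano_iff by blast
  have S: "posdef (coeff_trace q)" using assms posdef_coeff_trace by blast
  note d = det_le_ptrace[OF posdef_possemidef[OF pd] ptrace_coeff_matrix S, folded \<alpha>_def]
  have "0 < Re (det (coeff_matrix q))" "0 < Re (det \<alpha>)"
    using posdef_det[OF pd] posdef_det[OF posdef_scaled[OF S, where 'r = 'r]] by (auto simp: pos_complex_iff \<alpha>_def)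
  note r = powr_root_le[OF this d(1)]
  show "Re (det (coeff_matrix q)) powr (1 / CARD('r)) \<le> Re (det \<alpha>)" using r(1) by simp
  assume "Re (det (coeff_matrix q)) powr (1 / CARD('r)) = Re (det \<alpha>)"
  then show "scalar_coeffs q \<alpha>" using r(2) d(2) unfolding scalar_coeffs_iff_blockdiag by simp
qed

text \<open>The infimum over unit vectors is bounded through the geometric mean over an orthonormal basis,
  which is the determinant of a block diagonal matrix.\<close>

lemma Griffiths_basis:
  fixes Q :: "'r::finite \<Rightarrow> complex^'n^'n"
  assumes Q: "\<And>\<nu>. posdef (Q \<nu>)" and S: "(\<Sum>\<nu>\<in>UNIV. Q \<nu>) = S" and m: "\<And>\<nu>. m \<le> Re (det (Q \<nu>))"
  shows "m \<le> Re (det (scaled S TYPE('r)))"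
    and "m = Re (det (scaled S TYPE('r))) \<Longrightarrow> Q \<nu> = scaled S TYPE('r)"
proof -
  let ?d = "Re (det (scaled S TYPE('r)))"
  have pS: "posdef S" unfolding S[symmetric] using Q by (intro posdef_sum) auto
  have d: "?d > 0" using posdef_det[OF posdef_scaled[OF pS, where 'r = 'r]] by (simp add: pos_complex_iff)
  have pd: "posdef (blockdiag Q)" using Q by (rule posdef_blockdiag)
  have dq: "det (Q \<nu>) = of_real (Re (det (Q \<nu>)))" "0 < Re (det (Q \<nu>))" for \<nu>
    using posdef_det[OF Q] by (auto simp: pos_complex_iff complex_eq_iff)
  have "det (blockdiag Q) = (\<Prod>\<nu>\<in>UNIV. of_real (Re (det (Q \<nu>))))"
    unfolding det_blockdiag using dq(1) by (intro prod.cong) auto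
  then have db: "Re (det (blockdiag Q)) = (\<Prod>\<nu>\<in>UNIV. Re (det (Q \<nu>)))" by (simp flip: of_real_prod)
  note le = det_le_ptrace[OF posdef_possemidef[OF pd] _ pS]
  have pt: "ptrace (blockdiag Q) = S" by (simp add: ptrace_blockdiag S)
  \<comment> \<open>Powers are monotone on nonnegative numbers; a negative \<open>m\<close> lies
    below \<open>?d\<close> anyway.\<close>
  have lem: "m ^ CARD('r) \<le> (\<Prod>\<nu>\<in>UNIV. Re (det (Q \<nu>)))" if "0 \<le> m"
    using prod_mono[of UNIV "\<lambda>_::'r. m" "\<lambda>\<nu>. Re (det (Q \<nu>))"] m that by simp
  show m1: "m \<le> ?d"
  proof (rule ccontr)
    assume "\<not> m \<le> ?d"
    then have "?d ^ CARD('r) < m ^ CARD('r)" using d by (intro power_strict_mono) auto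
    then show False using le(1)[OF pt] lem d \<open>\<not> m \<le> ?d\<close> db by linarith
  qed
  assume "m = ?d"
  then have "?d ^ CARD('r) \<le> Re (det (blockdiag Q))" using lem d db by simp
  then have "Re (det (blockdiag Q)) = ?d ^ CARD('r)" using le(1)[OF pt] by (rule antisym[rotated])
  then have "blockdiag Q = blockdiag (\<lambda>_. scaled S TYPE('r))" using le(2)[OF pt] by simp
  then have "blockdiag Q $ (j, \<nu>) $ (k, \<nu>) = blockdiag (\<lambda>_. scaled S TYPE('r)) $ (j, \<nu>) $ (k, \<nu>)" for j k by simp
  then show "Q \<nu> = scaled S TYPE('r)" by (simp add: blockdiag_nth vec_eq_iff)
qed

lemma coeff_at_two:
  assumes "\<nu> \<noteq> \<eta>"
  shows "coeff_at q (a *s axis \<nu> 1 + b *s axis \<eta> 1) $ j $ k =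
    q j k \<nu> \<nu> * (a * cnj a) + q j k \<eta> \<eta> * (b * cnj b) + q j k \<nu> \<eta> * (a * cnj b) + q j k \<eta> \<nu> * (b * cnj a)"
  by (simp add: coeff_at_sesq sesq_add_left sesq_add_right sesq_scale_left sesq_scale_right sesq_axis algebra_simps)


lemma sum_norm_two:
  assumes "\<nu> \<noteq> \<eta>"
  shows "(\<Sum>\<kappa>\<in>UNIV. (norm ((a *s axis \<nu> 1 + b *s axis \<eta> 1 :: complex^'r) $ \<kappa>))\<^sup>2) = (norm a)\<^sup>2 + (norm b)\<^sup>2"
proof -
  have "(\<Sum>\<kappa>\<in>UNIV. (norm ((a *s axis \<nu> 1 + b *s axis \<eta> 1 :: complex^'r) $ \<kappa>))\<^sup>2)
     = (\<Sum>\<kappa>\<in>UNIV. (if \<kappa> = \<nu> then (norm a)\<^sup>2 else 0) + (if \<kappa> = \<eta> then (norm b)\<^sup>2 else 0))"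
    by (intro sum.cong refl) (use assms in \<open>auto simp: axis_def\<close>)
  then show ?thesis by (simp add: sum.distrib)
qed

text \<open>Applied to the standard basis, \<open>Griffiths_basis\<close> fixes the diagonal. For
  two indices \<open>\<nu>\<close> and \<open>\<eta>\<close> it is applied again with their basis
  vectors rotated into each other with a phase \<open>t\<close>. The new block differs from
  \<open>\<alpha>\<close> only by the mixed terms, so these vanish together, and the phases
  \<open>1\<close> and \<open>\<i>\<close> separate them.\<close>

lemma Griffiths_det:
  fixes q :: "'n::finite \<Rightarrow> 'n \<Rightarrow> 'r::finite \<Rightarrow> 'r \<Rightarrow> complex"
  assumes q: "positive_coeffs Griffiths q"
    and m: "\<And>v :: complex^'r. (\<Sum>\<kappa>\<in>UNIV. (norm (v $ \<kappa>))\<^sup>2) = 1 \<Longrightarrow> m \<le> Re (det (coeff_at q v))"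
  defines "\<alpha> \<equiv> scaled (coeff_trace q) TYPE('r)"
  shows "m \<le> Re (det \<alpha>)"
    and "m = Re (det \<alpha>) \<Longrightarrow> scalar_coeffs q \<alpha>"
proof -
  have ax: "(\<Sum>\<kappa>\<in>UNIV. (norm ((axis \<nu> 1 :: complex^'r) $ \<kappa>))\<^sup>2) = 1" for \<nu>
  proof -
    have "(\<Sum>\<kappa>\<in>UNIV. (norm ((axis \<nu> 1 :: complex^'r) $ \<kappa>))\<^sup>2) = (\<Sum>\<kappa>\<in>UNIV. if \<kappa> = \<nu> then 1 else 0)"
      by (intro sum.cong refl) (auto simp: axis_def)
    then show ?thesis by simp
  qed
  have pd: "posdef (coeff_at q v)" if "(\<Sum>\<kappa>\<in>UNIV. (norm (v $ \<kappa>))\<^sup>2) = 1" for v :: "complex^'r"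
  proof -
    have "v \<noteq> 0" using that by auto
    then show ?thesis using q positive_Griffiths_iff by blast
  qed
  have S: "(\<Sum>\<nu>\<in>UNIV. coeff_at q (axis \<nu> 1)) = coeff_trace q"
    by (simp add: vec_eq_iff coeff_trace_def coeff_at_axis)
  note basis = Griffiths_basis[where m = m, OF pd[OF ax] S m[OF ax], folded \<alpha>_def]
  show "m \<le> Re (det \<alpha>)" by (rule basis)
  assume eq: "m = Re (det \<alpha>)"
  have diag: "q j k \<nu> \<nu> = \<alpha> $ j $ k" for j k \<nu>
    using basis(2)[OF eq, of \<nu>] by (simp add: coeff_at_axis vec_eq_iff)
  have off: "q j k \<nu> \<eta> = 0" if ne: "\<nu> \<noteq> \<eta>" for j k \<nu> \<eta>
  proof -
    have main: "q j k \<nu> \<eta> * cnj t + q j k \<eta> \<nu> * t = 0" if t: "norm t = 1" for t :: complex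
    proof -
      define c :: complex where "c = of_real (1 / sqrt 2)"
      have c: "c * c = 1 / 2" "cnj c = c" "norm c = 1 / sqrt 2"
        by (simp_all add: c_def norm_divide flip: of_real_mult)
      have tt: "t * cnj t = 1" using t complex_norm_square[of t] by simp
      \<comment> \<open>The two rotated vectors carry opposite signs of \<open>t\<close>, so the
        mixed terms cancel in the sum of the blocks and the trace is unchanged.\<close>
      define w where "w \<kappa> = (if \<kappa> = \<nu> then c *s axis \<nu> 1 + (c * t) *s axis \<eta> 1
          else if \<kappa> = \<eta> then c *s axis \<nu> 1 + (c * - t) *s axis \<eta> 1 else axis \<kappa> 1 :: complex^'r)" for \<kappa>
      have wn: "(\<Sum>\<kappa>\<in>UNIV. (norm (w \<nu>' $ \<kappa>))\<^sup>2) = 1" for \<nu>'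
      proof -
        have A: "(\<Sum>\<kappa>\<in>UNIV. (norm ((c *s axis \<nu> 1 + (c * s) *s axis \<eta> 1 :: complex^'r) $ \<kappa>))\<^sup>2) = 1" if "norm s = 1" for s
          unfolding sum_norm_two[OF ne] by (simp add: norm_mult c(3) that power_divide)
        consider "\<nu>' = \<nu>" | "\<nu>' = \<eta>" "\<nu>' \<noteq> \<nu>" | "\<nu>' \<noteq> \<nu>" "\<nu>' \<noteq> \<eta>" by blast
        then show ?thesis
        proof cases
          case 1
          then show ?thesis unfolding w_def if_P[OF 1] by (intro A t)
        next
          case 2
          show ?thesis unfolding w_def if_P[OF 2(1)] if_not_P[OF 2(2)] by (rule A) (use t in simp)
        next
          case 3
          show ?thesis unfolding w_def if_not_P[OF 3(1)] if_not_P[OF 3(2)] by (rule ax)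
        qed
      qed
      have e: "coeff_at q (c *s axis \<nu> 1 + (c * s) *s axis \<eta> 1) $ j $ k
          = (q j k \<nu> \<nu> + q j k \<eta> \<eta> + (q j k \<nu> \<eta> * cnj s + q j k \<eta> \<nu> * s)) / 2" if s: "s * cnj s = 1" for s j k
      proof -
        have H0: "c * cnj c = 1/2" using c by simp
        have H1: "c * s * cnj (c * s) = (c * cnj c) * (s * cnj s)" "c * cnj (c * s) = (c * cnj c) * cnj s"
            "c * s * cnj c = (c * cnj c) * s" by simp_all
        show ?thesis unfolding coeff_at_two[OF ne] H1 H0 s by (simp add: field_simps)
      qed
      have e1: "coeff_at q (w \<nu>) $ j $ k = (q j k \<nu> \<nu> + q j k \<eta> \<eta> + (q j k \<nu> \<eta> * cnj t + q j k \<eta> \<nu> * t)) / 2" for j k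
        unfolding w_def using e[OF tt] by simp
      have e2: "coeff_at q (w \<eta>) $ j $ k = (q j k \<nu> \<nu> + q j k \<eta> \<eta> - (q j k \<nu> \<eta> * cnj t + q j k \<eta> \<nu> * t)) / 2" for j k
        unfolding w_def using e[of "- t" j k] tt ne by simp
      have "(\<Sum>\<kappa>\<in>UNIV. coeff_at q (w \<kappa>)) = coeff_trace q"
        unfolding vec_eq_iff
      proof (intro allI)
        fix j k
        have u: "(UNIV :: 'r set) = insert \<nu> (insert \<eta> (UNIV - {\<nu>, \<eta>}))" by auto
        have "(\<Sum>\<kappa>\<in>UNIV. coeff_at q (w \<kappa>) $ j $ k)
           = coeff_at q (w \<nu>) $ j $ k + (coeff_at q (w \<eta>) $ j $ k + (\<Sum>\<kappa>\<in>UNIV - {\<nu>, \<eta>}. coeff_at q (w \<kappa>) $ j $ k))"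
          by (subst u) (use ne in simp)
        also have "(\<Sum>\<kappa>\<in>UNIV - {\<nu>, \<eta>}. coeff_at q (w \<kappa>) $ j $ k) = (\<Sum>\<kappa>\<in>UNIV - {\<nu>, \<eta>}. q j k \<kappa> \<kappa>)"
          by (intro sum.cong refl) (auto simp: w_def coeff_at_axis)
        also have "coeff_at q (w \<nu>) $ j $ k + (coeff_at q (w \<eta>) $ j $ k + (\<Sum>\<kappa>\<in>UNIV - {\<nu>, \<eta>}. q j k \<kappa> \<kappa>))
           = q j k \<nu> \<nu> + (q j k \<eta> \<eta> + (\<Sum>\<kappa>\<in>UNIV - {\<nu>, \<eta>}. q j k \<kappa> \<kappa>))"
          unfolding e1 e2 by (simp add: field_simps)
        also have "\<dots> = (\<Sum>\<kappa>\<in>UNIV. q j k \<kappa> \<kappa>)"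
          by (subst (2) u) (use ne in simp)
        finally show "(\<Sum>\<kappa>\<in>UNIV. coeff_at q (w \<kappa>)) $ j $ k = coeff_trace q $ j $ k"
          by (simp add: coeff_trace_def)
      qed
      from Griffiths_basis(2)[where m = m, OF pd[OF wn] this m[OF wn], folded \<alpha>_def, OF eq, of \<nu>]
      have "coeff_at q (w \<nu>) $ j $ k = \<alpha> $ j $ k" by simp
      then show ?thesis unfolding e1 diag by simp
    qed
    from main[of 1] main[of \<i>] have "q j k \<nu> \<eta> + q j k \<eta> \<nu> = 0" "- \<i> * q j k \<nu> \<eta> + \<i> * q j k \<eta> \<nu> = 0"
      by (simp_all add: mult.commute)
    then show ?thesis by (simp add: complex_eq_iff)
  qed
  show "scalar_coeffs q \<alpha>" unfolding scalar_coeffs_def using diag off by simp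
qed

section \<open>Coefficients that are scalar in the fibre\<close>

lemma scalar_coeffs_at:
  assumes "scalar_coeffs q \<alpha>"
  shows "coeff_at q v = (\<chi> j k. of_real (\<Sum>\<kappa>\<in>UNIV. (norm (v $ \<kappa>))\<^sup>2) * \<alpha> $ j $ k)"
proof -
  have "(\<Sum>\<kappa>\<in>UNIV. \<Sum>\<mu>\<in>UNIV. q j k \<kappa> \<mu> * v $ \<kappa> * cnj (v $ \<mu>)) = (\<Sum>\<kappa>\<in>UNIV. of_real ((norm (v $ \<kappa>))\<^sup>2) * \<alpha> $ j $ k)" for j k
  proof (intro sum.cong refl)
    fix \<kappa>
    have "(\<Sum>\<mu>\<in>UNIV. q j k \<kappa> \<mu> * v $ \<kappa> * cnj (v $ \<mu>)) = (\<Sum>\<mu>\<in>UNIV. if \<kappa> = \<mu> then \<alpha> $ j $ k * (v $ \<kappa> * cnj (v $ \<kappa>)) else 0)"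
      using assms unfolding scalar_coeffs_def by (intro sum.cong refl) auto
    then show "(\<Sum>\<mu>\<in>UNIV. q j k \<kappa> \<mu> * v $ \<kappa> * cnj (v $ \<mu>)) = of_real ((norm (v $ \<kappa>))\<^sup>2) * \<alpha> $ j $ k"
      unfolding complex_norm_square by (simp add: mult.commute)
  qed
  then show ?thesis by (simp add: coeff_at_def sum_distrib_right)
qed

lemma scalar_coeffs_positive:
  fixes q :: "'n::finite \<Rightarrow> 'n \<Rightarrow> 'r::finite \<Rightarrow> 'r \<Rightarrow> complex"
  assumes q: "scalar_coeffs q \<alpha>" and \<alpha>: "posdef \<alpha>"
  shows "positive_coeffs P q"
proof -
  have N: "positive_coeffs Nakano q"
    unfolding positive_Nakano_iff using q posdef_blockdiag[of "\<lambda>_::'r. \<alpha>"] \<alpha> by (simp add: scalar_coeffs_iff_blockdiag)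
  have D: "positive_coeffs Dual_Nakano q"
  proof -
    have "(\<lambda>j k \<kappa> \<mu>. q j k \<mu> \<kappa>) = q" using q by (auto simp: scalar_coeffs_def fun_eq_iff)
    then show ?thesis using N positive_Dual_Nakano_iff[of q] by simp
  qed
  have G: "positive_coeffs Griffiths q"
    unfolding positive_Griffiths_iff
  proof (intro allI impI)
    fix v :: "complex^'r" assume "v \<noteq> 0"
    then obtain i where "v $ i \<noteq> 0" by (auto simp: vec_eq_iff)
    then have s: "0 < (\<Sum>\<kappa>\<in>UNIV. (norm (v $ \<kappa>))\<^sup>2)" by (intro sum_pos2[of _ i]) auto
    have "coeff_at q v = (\<Sum>\<kappa>\<in>UNIV. (norm (v $ \<kappa>))\<^sup>2) *\<^sub>R \<alpha>"
      unfolding scalar_coeffs_at[OF q] vec_eq_iff vec_lambda_beta vector_scaleR_component by (simp add: scaleR_conv_of_real)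
    then show "posdef (coeff_at q v)"
      using \<alpha> s by (auto simp: posdef_def sesq_scaleR_matrix pos_complex_iff simp del: of_real_sum)
  qed
  show ?thesis using N D G by (cases P) simp_all
qed

lemma scalar_coeffs_det:
  fixes q :: "'n::finite \<Rightarrow> 'n \<Rightarrow> 'r::finite \<Rightarrow> 'r \<Rightarrow> complex"
  assumes q: "scalar_coeffs q \<alpha>" and \<alpha>: "posdef \<alpha>"
  shows "Re (det (coeff_matrix q)) powr (1 / CARD('r)) = Re (det \<alpha>)"
proof -
  have d: "0 < Re (det \<alpha>)" "det \<alpha> = of_real (Re (det \<alpha>))" using posdef_det[OF \<alpha>] by (auto simp: pos_complex_iff complex_eq_iff)
  have "det (coeff_matrix q) = det \<alpha> ^ CARD('r)"
    using q unfolding scalar_coeffs_iff_blockdiag by (simp add: det_blockdiag)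
  also have "\<dots> = of_real (Re (det \<alpha>) ^ CARD('r))" by (subst d(2)) simp
  finally have "Re (det (coeff_matrix q)) = Re (det \<alpha>) ^ CARD('r)" by simp
  then show ?thesis using d(1) by (simp add: powr_realpow[symmetric] powr_powr)
qed

section \<open>Differential forms on complex manifolds\<close>

definition jac :: "('x, 'n::finite) chart \<Rightarrow> ('x, 'n) chart \<Rightarrow> 'x \<Rightarrow> complex^'n^'n" where
  "jac c d x = (\<chi> l j. dz j (\<lambda>z. snd d (cinv c z) $ l) (snd c x))"

text \<open>Relative to an open part \<open>V\<close>, since connection forms exist only over the
  domain of a trivialization.\<close>

definition form10_on ::
    "('x, 'n::finite) chart set \<Rightarrow> 'x set \<Rightarrow> (('x, 'n) chart \<Rightarrow> 'x \<Rightarrow> complex^'n) \<Rightarrow> bool" where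
  "form10_on A V w \<longleftrightarrow>
     (\<forall>c\<in>A. \<forall>j. smooth_on (snd c ` (fst c \<inter> V)) (\<lambda>z. w c (cinv c z) $ j)) \<and>
     (\<forall>c\<in>A. \<forall>d\<in>A. \<forall>x\<in>fst c \<inter> fst d \<inter> V. \<forall>j. w c x $ j = (\<Sum>l\<in>UNIV. w d x $ l * jac c d x $ l $ j))"

definition form11_on ::
    "('x, 'n::finite) chart set \<Rightarrow> 'x set \<Rightarrow> (('x, 'n) chart \<Rightarrow> 'x \<Rightarrow> complex^'n^'n) \<Rightarrow> bool" where
  "form11_on A V \<alpha> \<longleftrightarrow>
     (\<forall>c\<in>A. \<forall>j k. smooth_on (snd c ` (fst c \<inter> V)) (\<lambda>z. \<alpha> c (cinv c z) $ j $ k)) \<and>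
     (\<forall>c\<in>A. \<forall>d\<in>A. \<forall>x\<in>fst c \<inter> fst d \<inter> V. \<forall>j k.
        \<alpha> c x $ j $ k = (\<Sum>l\<in>UNIV. \<Sum>m\<in>UNIV. \<alpha> d x $ l $ m * jac c d x $ l $ j * cnj (jac c d x $ m $ k)))"

text \<open>Bare coefficients: the sign from exchanging \<open>d(conj z_k)\<close> with
  \<open>dz_j\<close> enters where the form is used, as in \<open>curv_trace_dbar\<close>.\<close>

definition dbar ::
    "(('x, 'n::finite) chart \<Rightarrow> 'x \<Rightarrow> complex^'n) \<Rightarrow> ('x, 'n) chart \<Rightarrow> 'x \<Rightarrow> complex^'n^'n" where
  "dbar w c x = (\<chi> j k. dzbar k (\<lambda>z. w c (cinv c z) $ j) (snd c x))"

text \<open>The dbar of a (1,1)-form has as coefficients the antisymmetrization of these derivatives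
  in the two conjugate indices.\<close>

definition dbar_closed ::
    "('x, 'n::finite) chart set \<Rightarrow> (('x, 'n) chart \<Rightarrow> 'x \<Rightarrow> complex^'n^'n) \<Rightarrow> bool" where
  "dbar_closed A \<alpha> \<longleftrightarrow> (\<forall>c\<in>A. \<forall>z\<in>snd c ` fst c. \<forall>i j k.
     dzbar i (\<lambda>z. \<alpha> c (cinv c z) $ j $ k) z = dzbar k (\<lambda>z. \<alpha> c (cinv c z) $ j $ i) z)"

lemma form11_iff: "form11 A \<alpha> \<longleftrightarrow> form11_on A UNIV \<alpha>"
  by (simp add: form11_def form11_on_def jac_def)

lemma form10_trans:
  "form10_on A V w \<Longrightarrow> c \<in> A \<Longrightarrow> d \<in> A \<Longrightarrow> x \<in> fst c \<inter> fst d \<inter> V \<Longrightarrow>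
     w c x $ j = (\<Sum>l\<in>UNIV. w d x $ l * jac c d x $ l $ j)"
  unfolding form10_on_def by blast

lemma form11_trans:
  "form11_on A V \<alpha> \<Longrightarrow> c \<in> A \<Longrightarrow> d \<in> A \<Longrightarrow> x \<in> fst c \<inter> fst d \<inter> V \<Longrightarrow>
     \<alpha> c x $ j $ k = (\<Sum>l\<in>UNIV. \<Sum>m\<in>UNIV. \<alpha> d x $ l $ m * jac c d x $ l $ j * cnj (jac c d x $ m $ k))"
  unfolding form11_on_def by blast

text \<open>As matrices, coefficients transform by the transposed Jacobian on the left and the
  conjugate Jacobian on the right. The determinant picks up the square of the modulus, which is the
  real Jacobian of the transition map.\<close>

lemma form11_det:
  assumes "form11 A \<alpha>" "c \<in> A" "d \<in> A" "x \<in> fst c \<inter> fst d"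
  shows "det (\<alpha> c x) = of_real ((norm (det (jac c d x)))\<^sup>2) * det (\<alpha> d x)"
proof -
  let ?J = "jac c d x"
  have "\<alpha> c x $ j $ k = (transpose ?J ** (\<alpha> d x ** (\<chi> i j. cnj (?J $ i $ j)))) $ j $ k" for j k
    using form11_trans[OF assms(1)[unfolded form11_iff] assms(2,3), of x j k] assms(4)
    by (simp add: matrix_matrix_mult_def transpose_def sum_distrib_left mult_ac)
  then have "\<alpha> c x = transpose ?J ** (\<alpha> d x ** (\<chi> i j. cnj (?J $ i $ j)))"
    by (simp add: vec_eq_iff)
  then have "det (\<alpha> c x) = det ?J * (det (\<alpha> d x) * cnj (det ?J))"
    by (simp add: det_mul det_cnj)
  then show ?thesis unfolding complex_norm_square by simp
qed

lemma dzbar_prod: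
  assumes "finite I" "\<And>i. i \<in> I \<Longrightarrow> f i differentiable (at z)"
  shows "dzbar k (\<lambda>z. \<Prod>i\<in>I. f i z) z = (\<Sum>i\<in>I. dzbar k (f i) z * (\<Prod>j\<in>I - {i}. f j z))"
proof -
  have d: "((\<lambda>z. \<Prod>i\<in>I. f i z) has_derivative
     (\<lambda>y. \<Sum>i\<in>I. frechet_derivative (f i) (at z) y * (\<Prod>j\<in>I - {i}. f j z))) (at z)"
    by (intro has_derivative_prod differentiable_has_derivative assms)
  show ?thesis
    unfolding dzbar_eq[OF d] unfolding dzbar_def sum_distrib_left sum.distrib[symmetric] sum_divide_distrib
    by (intro sum.cong refl) (simp add: algebra_simps)
qed

section \<open>Charts and the transformation of forms between them\<close>

locale cmfd =
  fixes A :: "('x::t2_space, 'n::finite) chart set"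
  assumes manifold: "complex_manifold A"
begin

lemma open_chart: "c \<in> A \<Longrightarrow> open (fst c)"
  and open_image: "c \<in> A \<Longrightarrow> open (snd c ` fst c)"
  and chart_homeo: "c \<in> A \<Longrightarrow> homeomorphism (fst c) (snd c ` fst c) (snd c) (cinv c)"
  and chart_cover: "\<exists>c\<in>A. x \<in> fst c"
  using manifold unfolding complex_manifold_def by auto

lemma chart_inv: "c \<in> A \<Longrightarrow> x \<in> fst c \<Longrightarrow> cinv c (snd c x) = x"
  using chart_homeo unfolding homeomorphism_def by blast

lemma image_iff: "c \<in> A \<Longrightarrow> z \<in> snd c ` (fst c \<inter> V) \<longleftrightarrow> z \<in> snd c ` fst c \<and> cinv c z \<in> V"
  using chart_inv by fastforce

lemma inv_chart: "z \<in> snd c ` fst c \<Longrightarrow> snd c (cinv c z) = z"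
  by (rule f_inv_into_f)

lemma inv_in: "z \<in> snd c ` fst c \<Longrightarrow> cinv c z \<in> fst c"
  by (rule inv_into_into)

lemma image_IntD:
  assumes "c \<in> A" "z \<in> snd c ` (fst c \<inter> V)"
  shows "cinv c z \<in> fst c \<inter> V" "snd c (cinv c z) = z" "z \<in> snd c ` fst c"
proof -
  have z: "z \<in> snd c ` fst c \<and> cinv c z \<in> V" using assms(2) unfolding image_iff[OF assms(1)] .
  then show "z \<in> snd c ` fst c" ..
  from z inv_in[of z c] inv_chart[of z c]
  show "cinv c z \<in> fst c \<inter> V" "snd c (cinv c z) = z" by blast+
qed

lemma image_IntI: "c \<in> A \<Longrightarrow> z \<in> snd c ` fst c \<Longrightarrow> cinv c z \<in> V \<Longrightarrow> z \<in> snd c ` (fst c \<inter> V)"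
  by (simp only: image_iff simp_thms)

lemma chart_in_image: "c \<in> A \<Longrightarrow> x \<in> fst c \<Longrightarrow> snd c x \<in> R \<Longrightarrow> x \<in> cinv c ` R"
  using imageI[of "snd c x" R "cinv c"] by (simp add: chart_inv)

lemma continuous_cinv: "c \<in> A \<Longrightarrow> continuous_on (snd c ` fst c) (cinv c)"
  and continuous_chart: "c \<in> A \<Longrightarrow> continuous_on (fst c) (snd c)"
  using chart_homeo unfolding homeomorphism_def by blast+

lemma open_image_Int: "c \<in> A \<Longrightarrow> open V \<Longrightarrow> open (snd c ` (fst c \<inter> V))"
proof -
  assume c: "c \<in> A" "open V"
  have "snd c ` (fst c \<inter> V) = cinv c -` V \<inter> snd c ` fst c"
    using image_iff[OF c(1)] by blast
  then show ?thesis
    using continuous_open_preimage[OF continuous_cinv[OF c(1)] open_image[OF c(1)] c(2)] by (simp add: Int_commute)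
qed

lemma trans_holo: "c \<in> A \<Longrightarrow> d \<in> A \<Longrightarrow> holo_on (snd c ` (fst c \<inter> fst d)) (\<lambda>z. snd d (cinv c z) $ l)"
  using manifold unfolding complex_manifold_def by blast

lemma jac_at: "z \<in> snd c ` fst c \<Longrightarrow> jac c d (cinv c z) $ l $ j = dz j (\<lambda>z. snd d (cinv c z) $ l) z"
  by (simp add: jac_def inv_chart)

lemma
  fixes f :: "'x \<Rightarrow> complex"
  assumes c: "c \<in> A" and d: "d \<in> A" and x: "x \<in> fst c \<inter> fst d"
    and f: "(\<lambda>z. f (cinv d z)) differentiable (at (snd d x))"
  shows dz_chart: "dz j (\<lambda>z. f (cinv c z)) (snd c x) = (\<Sum>l\<in>UNIV. dz l (\<lambda>z. f (cinv d z)) (snd d x) * jac c d x $ l $ j)"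
    and dzbar_chart: "dzbar j (\<lambda>z. f (cinv c z)) (snd c x) = (\<Sum>l\<in>UNIV. dzbar l (\<lambda>z. f (cinv d z)) (snd d x) * cnj (jac c d x $ l $ j))"
    and differentiable_chart: "(\<lambda>z. f (cinv c z)) differentiable (at (snd c x))"
proof -
  let ?U = "snd c ` (fst c \<inter> fst d)"
  have U: "open ?U" "snd c x \<in> ?U" using open_image_Int[OF c open_chart[OF d]] x by auto
  have eq: "f (cinv c z) = f (cinv d (snd d (cinv c z)))" if "z \<in> ?U" for z
    using that image_iff[OF c] chart_inv[OF d] by simp
  have e: "snd d (cinv c (snd c x)) = snd d x" using chart_inv[OF c] x by simp
  note f' = f[folded e]
  note r = dz_compose[where g = "\<lambda>z. snd d (cinv c z)", OF f' trans_holo[OF c d] U(2)]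
    dzbar_compose[where g = "\<lambda>z. snd d (cinv c z)", OF f' trans_holo[OF c d] U(2)]
    differentiable_compose_holo[where g = "\<lambda>z. snd d (cinv c z)", OF f' trans_holo[OF c d] U(2)]
  show "dz j (\<lambda>z. f (cinv c z)) (snd c x) = (\<Sum>l\<in>UNIV. dz l (\<lambda>z. f (cinv d z)) (snd d x) * jac c d x $ l $ j)"
    using r(1) dz_cong[OF U eq] by (simp add: jac_def e)
  show "dzbar j (\<lambda>z. f (cinv c z)) (snd c x) = (\<Sum>l\<in>UNIV. dzbar l (\<lambda>z. f (cinv d z)) (snd d x) * cnj (jac c d x $ l $ j))"
    using r(2) dzbar_cong[OF U eq] by (simp add: jac_def e)
  have "((\<lambda>z. f (cinv c z)) has_derivative frechet_derivative (\<lambda>z. f (cinv d (snd d (cinv c z)))) (at (snd c x))) (at (snd c x))"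
    by (rule has_derivative_transform_within_open[OF differentiable_has_derivative[OF r(3)] U]) (simp add: eq)
  then show "(\<lambda>z. f (cinv c z)) differentiable (at (snd c x))" by (auto simp: differentiable_def)
qed

lemma form10_smooth: "form10_on A V w \<Longrightarrow> c \<in> A \<Longrightarrow> smooth_on (snd c ` (fst c \<inter> V)) (\<lambda>z. w c (cinv c z) $ j)"
  and form11_smooth: "form11_on A V \<alpha> \<Longrightarrow> c \<in> A \<Longrightarrow> smooth_on (snd c ` (fst c \<inter> V)) (\<lambda>z. \<alpha> c (cinv c z) $ j $ k)"
  unfolding form10_on_def form11_on_def by blast+

lemma form11_smooth_UNIV: "form11 A \<alpha> \<Longrightarrow> c \<in> A \<Longrightarrow> smooth_on (snd c ` fst c) (\<lambda>z. \<alpha> c (cinv c z) $ j $ k)"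
  unfolding form11_def by blast

lemma form10_dz:
  assumes "open V" "smooth_fun A V f"
  shows "form10_on A V (\<lambda>c x. \<chi> j. dz j (\<lambda>z. f (cinv c z)) (snd c x))"
  unfolding form10_on_def
proof (intro conjI ballI allI)
  fix c j assume c: "c \<in> A"
  have "smooth_on (snd c ` (fst c \<inter> V)) (dz j (\<lambda>z. f (cinv c z)))"
    using assms c by (intro smooth_on_dz open_image_Int) (auto simp: smooth_fun_def)
  then show "smooth_on (snd c ` (fst c \<inter> V)) (\<lambda>z. (\<chi> j. dz j (\<lambda>z. f (cinv c z)) (snd c (cinv c z))) $ j)"
    by (rule smooth_on_cong_imp[OF open_image_Int[OF c assms(1)], rotated]) (use image_IntD(2)[OF c] in simp)
next
  fix c d x j assume "c \<in> A" "d \<in> A" "x \<in> fst c \<inter> fst d \<inter> V"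
  moreover have "(\<lambda>z. f (cinv d z)) differentiable (at (snd d x))" if "d \<in> A" "x \<in> fst d" "x \<in> V"
    by (rule smooth_on_differentiable[of "snd d ` (fst d \<inter> V)"]) (use assms(2) that in \<open>auto simp: smooth_fun_def\<close>)
  ultimately show "(\<chi> j. dz j (\<lambda>z. f (cinv c z)) (snd c x)) $ j
     = (\<Sum>l\<in>UNIV. (\<chi> j. dz j (\<lambda>z. f (cinv d z)) (snd d x)) $ l * jac c d x $ l $ j)"
    using dz_chart[of c d x f j] by simp
qed

text \<open>The Jacobian entries in the transformation rule of \<open>w\<close> are holomorphic, so
  \<open>dzbar\<close> passes over them and only a conjugate Jacobian is added.\<close>

lemma form11_dbar:
  assumes V: "open V" and w: "form10_on A V w"
  shows "form11_on A V (dbar w)"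
  unfolding form11_on_def
proof (intro conjI ballI allI)
  fix c j k assume c: "c \<in> A"
  have "smooth_on (snd c ` (fst c \<inter> V)) (dzbar k (\<lambda>z. w c (cinv c z) $ j))"
    by (intro smooth_on_dzbar open_image_Int[OF c V] form10_smooth[OF w c])
  then show "smooth_on (snd c ` (fst c \<inter> V)) (\<lambda>z. dbar w c (cinv c z) $ j $ k)"
    by (rule smooth_on_cong_imp[OF open_image_Int[OF c V], rotated]) (use image_IntD(2)[OF c] in \<open>simp add: dbar_def\<close>)
next
  fix c d x j k assume c: "c \<in> A" and d: "d \<in> A" and x: "x \<in> fst c \<inter> fst d \<inter> V"
  let ?U = "snd c ` (fst c \<inter> (fst d \<inter> V))"
  let ?J = "\<lambda>l j. dz j (\<lambda>z. snd d (cinv c z) $ l)"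
  have U: "open ?U" "snd c x \<in> ?U" using open_image_Int[OF c open_Int[OF open_chart[OF d] V]] x by auto
  have eq: "w c (cinv c z) $ j = (\<Sum>l\<in>UNIV. w d (cinv c z) $ l * ?J l j z)" if "z \<in> ?U" for z
  proof -
    have z: "z \<in> snd c ` fst c" "cinv c z \<in> fst c \<inter> fst d \<inter> V" using that image_iff[OF c] inv_in by auto
    then have "w c (cinv c z) $ j = (\<Sum>l\<in>UNIV. w d (cinv c z) $ l * jac c d (cinv c z) $ l $ j)"
      using w c d unfolding form10_on_def by blast
    then show ?thesis unfolding jac_at[OF z(1)] .
  qed
  have Jh: "holo_on (snd c ` (fst c \<inter> fst d)) (?J l j)" for l
    using holo_on_dz_holo[OF open_image_Int[OF c open_chart[OF d]] trans_holo[OF c d]] .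
  have xU: "snd c x \<in> snd c ` (fst c \<inter> fst d)" using x by auto
  have dw: "(\<lambda>z. w d (cinv d z) $ l) differentiable (at (snd d x))" for l
    by (rule smooth_on_differentiable[OF form10_smooth[OF w d]]) (use x in auto)
  have dwc: "(\<lambda>z. w d (cinv c z) $ l) differentiable (at (snd c x))" for l
    by (rule differentiable_chart[OF c d _ dw]) (use x in auto)
  have dJ: "?J l j differentiable (at (snd c x))" for l by (rule holo_on_differentiable[OF Jh xU])
  have "dbar w c x $ j $ k = dzbar k (\<lambda>z. \<Sum>l\<in>UNIV. w d (cinv c z) $ l * ?J l j z) (snd c x)"
    unfolding dbar_def vec_lambda_beta by (rule dzbar_cong[OF U eq])
  also have "\<dots> = (\<Sum>l\<in>UNIV. dzbar k (\<lambda>z. w d (cinv c z) $ l * ?J l j z) (snd c x))"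
    by (rule dzbar_sum) (intro differentiable_mult dwc dJ)
  also have "\<dots> = (\<Sum>l\<in>UNIV. dzbar k (\<lambda>z. w d (cinv c z) $ l) (snd c x) * jac c d x $ l $ j)"
    unfolding dzbar_mult[OF dwc dJ] holo_on_dzbar[OF Jh xU] by (simp add: jac_def)
  also have "\<dots> = (\<Sum>l\<in>UNIV. (\<Sum>m\<in>UNIV. dzbar m (\<lambda>z. w d (cinv d z) $ l) (snd d x) * cnj (jac c d x $ m $ k)) * jac c d x $ l $ j)"
  proof -
    have x': "x \<in> fst c \<inter> fst d" using x by auto
    show ?thesis unfolding dzbar_chart[OF c d x' dw] ..
  qed
  also have "\<dots> = (\<Sum>l\<in>UNIV. \<Sum>m\<in>UNIV. dbar w d x $ l $ m * jac c d x $ l $ j * cnj (jac c d x $ m $ k))"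
    by (simp add: dbar_def sum_distrib_left sum_distrib_right mult_ac)
  finally show "dbar w c x $ j $ k = (\<Sum>l\<in>UNIV. \<Sum>m\<in>UNIV. dbar w d x $ l $ m * jac c d x $ l $ j * cnj (jac c d x $ m $ k))" .
qed

lemma form10_diff:
  assumes "open V" "form10_on A V w" "form10_on A V v"
  shows "form10_on A V (\<lambda>c x. w c x - v c x)"
  unfolding form10_on_def
proof (intro conjI ballI allI)
  fix c j assume "c \<in> A"
  then show "smooth_on (snd c ` (fst c \<inter> V)) (\<lambda>z. (w c (cinv c z) - v c (cinv c z)) $ j)"
    using assms by (auto intro!: smooth_on_diff open_image_Int form10_smooth)
next
  fix c d x j assume "c \<in> A" "d \<in> A" "x \<in> fst c \<inter> fst d \<inter> V"
  then have "w c x $ j = (\<Sum>l\<in>UNIV. w d x $ l * jac c d x $ l $ j)" "v c x $ j = (\<Sum>l\<in>UNIV. v d x $ l * jac c d x $ l $ j)"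
    using assms unfolding form10_on_def by blast+
  then show "(w c x - v c x) $ j = (\<Sum>l\<in>UNIV. (w d x - v d x) $ l * jac c d x $ l $ j)"
    by (simp add: left_diff_distrib sum_subtractf)
qed

lemma form10_sum:
  assumes "open V" "\<And>i. i \<in> I \<Longrightarrow> form10_on A V (w i)"
  shows "form10_on A V (\<lambda>c x. \<Sum>i\<in>I. w i c x)"
  unfolding form10_on_def
proof (intro conjI ballI allI)
  fix c j assume c: "c \<in> A"
  show "smooth_on (snd c ` (fst c \<inter> V)) (\<lambda>z. (\<Sum>i\<in>I. w i c (cinv c z)) $ j)"
    unfolding sum_component by (intro smooth_on_sum open_image_Int c assms(1) form10_smooth assms(2))
  fix d x assume d: "d \<in> A" "x \<in> fst c \<inter> fst d \<inter> V"
  have "(\<Sum>i\<in>I. w i c x $ j) = (\<Sum>i\<in>I. \<Sum>l\<in>UNIV. w i d x $ l * jac c d x $ l $ j)"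
    by (intro sum.cong refl form10_trans[OF assms(2) c d])
  also have "\<dots> = (\<Sum>l\<in>UNIV. (\<Sum>i\<in>I. w i d x $ l) * jac c d x $ l $ j)"
    unfolding sum_distrib_right by (rule sum.swap)
  finally show "(\<Sum>i\<in>I. w i c x) $ j = (\<Sum>l\<in>UNIV. (\<Sum>i\<in>I. w i d x) $ l * jac c d x $ l $ j)"
    by (simp add: sum_component)
qed

lemma form10_scale:
  assumes "open V" "form10_on A V w" "smooth_fun A V f"
  shows "form10_on A V (\<lambda>c x. f x *s w c x)"
  unfolding form10_on_def
proof (intro conjI ballI allI)
  fix c j assume "c \<in> A"
  then show "smooth_on (snd c ` (fst c \<inter> V)) (\<lambda>z. (f (cinv c z) *s w c (cinv c z)) $ j)"
    using assms by (auto simp: smooth_fun_def intro!: smooth_on_mult open_image_Int form10_smooth)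
next
  fix c d x j assume "c \<in> A" "d \<in> A" "x \<in> fst c \<inter> fst d \<inter> V"
  then have "w c x $ j = (\<Sum>l\<in>UNIV. w d x $ l * jac c d x $ l $ j)"
    using assms unfolding form10_on_def by blast
  then show "(f x *s w c x) $ j = (\<Sum>l\<in>UNIV. (f x *s w d x) $ l * jac c d x $ l $ j)"
    by (simp add: sum_distrib_left mult.assoc)
qed

lemma form11_add:
  assumes "open V" "form11_on A V a" "form11_on A V b"
  shows "form11_on A V (\<lambda>c x. a c x + b c x)"
  unfolding form11_on_def
proof (intro conjI ballI allI)
  fix c j k assume "c \<in> A"
  then show "smooth_on (snd c ` (fst c \<inter> V)) (\<lambda>z. (a c (cinv c z) + b c (cinv c z)) $ j $ k)"
    using assms by (auto intro!: smooth_on_add open_image_Int form11_smooth)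
next
  fix c d x j k assume "c \<in> A" "d \<in> A" "x \<in> fst c \<inter> fst d \<inter> V"
  then have "a c x $ j $ k = (\<Sum>l\<in>UNIV. \<Sum>m\<in>UNIV. a d x $ l $ m * jac c d x $ l $ j * cnj (jac c d x $ m $ k))"
    "b c x $ j $ k = (\<Sum>l\<in>UNIV. \<Sum>m\<in>UNIV. b d x $ l $ m * jac c d x $ l $ j * cnj (jac c d x $ m $ k))"
    using assms unfolding form11_on_def by blast+
  then show "(a c x + b c x) $ j $ k = (\<Sum>l\<in>UNIV. \<Sum>m\<in>UNIV. (a d x + b d x) $ l $ m * jac c d x $ l $ j * cnj (jac c d x $ m $ k))"
    by (simp add: distrib_right sum.distrib)
qed

lemma form11_cmult:
  assumes "open V" "form11_on A V a"
  shows "form11_on A V (\<lambda>c x. \<chi> j k. s * a c x $ j $ k)"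
  unfolding form11_on_def
proof (intro conjI ballI allI)
  fix c j k assume "c \<in> A"
  then show "smooth_on (snd c ` (fst c \<inter> V)) (\<lambda>z. (\<chi> j k. s * a c (cinv c z) $ j $ k) $ j $ k)"
    using assms by (auto intro!: smooth_on_mult smooth_on_const open_image_Int form11_smooth)
next
  fix c d x j k assume "c \<in> A" "d \<in> A" "x \<in> fst c \<inter> fst d \<inter> V"
  then have "a c x $ j $ k = (\<Sum>l\<in>UNIV. \<Sum>m\<in>UNIV. a d x $ l $ m * jac c d x $ l $ j * cnj (jac c d x $ m $ k))"
    using assms unfolding form11_on_def by blast
  then show "(\<chi> j k. s * a c x $ j $ k) $ j $ k = (\<Sum>l\<in>UNIV. \<Sum>m\<in>UNIV. (\<chi> j k. s * a d x $ j $ k) $ l $ m * jac c d x $ l $ j * cnj (jac c d x $ m $ k))"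
    by (simp add: sum_distrib_left mult.assoc)
qed

lemma form11_local:
  assumes "\<And>x. \<exists>V b. open V \<and> x \<in> V \<and> form11_on A V b \<and> (\<forall>c\<in>A. \<forall>y\<in>fst c \<inter> V. a c y = b c y)"
  shows "form11 A a"
  unfolding form11_iff form11_on_def
proof (intro conjI ballI allI)
  fix c j k assume c: "c \<in> A"
  show "smooth_on (snd c ` (fst c \<inter> UNIV)) (\<lambda>z. a c (cinv c z) $ j $ k)"
  proof (rule smooth_on_local)
    fix z assume z: "z \<in> snd c ` (fst c \<inter> UNIV)"
    then obtain V b where V: "open V" "cinv c z \<in> V" "form11_on A V b" "\<forall>c\<in>A. \<forall>y\<in>fst c \<inter> V. a c y = b c y"
      using assms by blast
    show "\<exists>U. open U \<and> z \<in> U \<and> smooth_on U (\<lambda>z. a c (cinv c z) $ j $ k)"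
    proof (intro exI conjI)
      show o: "open (snd c ` (fst c \<inter> V))" using open_image_Int[OF c V(1)] .
      show "z \<in> snd c ` (fst c \<inter> V)" using z V(2) image_iff[OF c] by simp
      show "smooth_on (snd c ` (fst c \<inter> V)) (\<lambda>z. a c (cinv c z) $ j $ k)"
        by (rule smooth_on_cong_imp[OF o _ form11_smooth[OF V(3) c, of j k]])
          (use V(4) c image_IntD(1)[OF c] in simp)
    qed
  qed
next
  fix c d x j k assume cd: "c \<in> A" "d \<in> A" "x \<in> fst c \<inter> fst d \<inter> UNIV"
  obtain V b where V: "x \<in> V" "form11_on A V b" "\<forall>c\<in>A. \<forall>y\<in>fst c \<inter> V. a c y = b c y"
    using assms by blast
  have "b c x $ j $ k = (\<Sum>l\<in>UNIV. \<Sum>m\<in>UNIV. b d x $ l $ m * jac c d x $ l $ j * cnj (jac c d x $ m $ k))"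
    using V cd unfolding form11_on_def by blast
  then show "a c x $ j $ k = (\<Sum>l\<in>UNIV. \<Sum>m\<in>UNIV. a d x $ l $ m * jac c d x $ l $ j * cnj (jac c d x $ m $ k))"
    using V cd by simp
qed

lemma form10_local:
  assumes "\<And>x. \<exists>V b. open V \<and> x \<in> V \<and> form10_on A V b \<and> (\<forall>c\<in>A. \<forall>y\<in>fst c \<inter> V. a c y = b c y)"
  shows "form10_on A UNIV a"
  unfolding form10_on_def
proof (intro conjI ballI allI)
  fix c j assume c: "c \<in> A"
  show "smooth_on (snd c ` (fst c \<inter> UNIV)) (\<lambda>z. a c (cinv c z) $ j)"
  proof (rule smooth_on_local)
    fix z assume z: "z \<in> snd c ` (fst c \<inter> UNIV)"
    then obtain V b where V: "open V" "cinv c z \<in> V" "form10_on A V b" "\<forall>c\<in>A. \<forall>y\<in>fst c \<inter> V. a c y = b c y"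
      using assms by blast
    show "\<exists>U. open U \<and> z \<in> U \<and> smooth_on U (\<lambda>z. a c (cinv c z) $ j)"
    proof (intro exI conjI)
      show o: "open (snd c ` (fst c \<inter> V))" using open_image_Int[OF c V(1)] .
      show "z \<in> snd c ` (fst c \<inter> V)" using z V(2) image_iff[OF c] by simp
      show "smooth_on (snd c ` (fst c \<inter> V)) (\<lambda>z. a c (cinv c z) $ j)"
        by (rule smooth_on_cong_imp[OF o _ form10_smooth[OF V(3) c, of j]])
          (use V(4) c image_IntD(1)[OF c] in simp)
    qed
  qed
next
  fix c d x j assume cd: "c \<in> A" "d \<in> A" "x \<in> fst c \<inter> fst d \<inter> UNIV"
  obtain V b where V: "x \<in> V" "form10_on A V b" "\<forall>c\<in>A. \<forall>y\<in>fst c \<inter> V. a c y = b c y"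
    using assms by blast
  have "b c x $ j = (\<Sum>l\<in>UNIV. b d x $ l * jac c d x $ l $ j)"
    using V cd unfolding form10_on_def by blast
  then show "a c x $ j = (\<Sum>l\<in>UNIV. a d x $ l * jac c d x $ l $ j)"
    using V cd by simp
qed

lemma dbar_closed_dbar:
  assumes "form10_on A UNIV w"
  shows "dbar_closed A (dbar w)"
  unfolding dbar_closed_def
proof (intro ballI allI)
  fix c z i j k assume c: "c \<in> A" and z: "z \<in> snd c ` fst c"
  let ?f = "\<lambda>z. w c (cinv c z) $ j"
  have s: "smooth_on (snd c ` fst c) ?f" using form10_smooth[OF assms c] by simp
  have "dzbar i (\<lambda>z. dbar w c (cinv c z) $ j $ k) z = dzbar i (dzbar k ?f) z" for i k
    by (rule dzbar_cong[OF open_image[OF c] z]) (simp add: dbar_def inv_chart)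
  then show "dzbar i (\<lambda>z. dbar w c (cinv c z) $ j $ k) z = dzbar k (\<lambda>z. dbar w c (cinv c z) $ j $ i) z"
    using dzbar_commute[OF open_image[OF c] s z] by simp
qed

lemma dbar_closed_add:
  assumes "form11 A a" "form11 A b" "dbar_closed A a" "dbar_closed A b"
  shows "dbar_closed A (\<lambda>c x. a c x + b c x)"
  unfolding dbar_closed_def
proof (intro ballI allI)
  fix c z i j k assume c: "c \<in> A" and z: "z \<in> snd c ` fst c"
  have "dzbar i (\<lambda>z. a c (cinv c z) $ j $ k + b c (cinv c z) $ j $ k) z
     = dzbar i (\<lambda>z. a c (cinv c z) $ j $ k) z + dzbar i (\<lambda>z. b c (cinv c z) $ j $ k) z" for i k
    by (intro dzbar_add smooth_on_differentiable[OF form11_smooth_UNIV[OF _ c] z] assms)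
  moreover have "dzbar i (\<lambda>z. a c (cinv c z) $ j $ k) z = dzbar k (\<lambda>z. a c (cinv c z) $ j $ i) z"
    "dzbar i (\<lambda>z. b c (cinv c z) $ j $ k) z = dzbar k (\<lambda>z. b c (cinv c z) $ j $ i) z"
    using assms(3,4) c z unfolding dbar_closed_def by blast+
  ultimately show "dzbar i (\<lambda>z. (a c (cinv c z) + b c (cinv c z)) $ j $ k) z = dzbar k (\<lambda>z. (a c (cinv c z) + b c (cinv c z)) $ j $ i) z"
    by simp
qed

end

section \<open>Change of variables for holomorphic maps\<close>

text \<open>\<open>G\<close> is the adjoint of \<open>L\<close> on the standard bases and matches
  them bijectively. So preimages of boxes are boxes with the same side lengths, and boxes determine
  Lebesgue measure.\<close>

lemma lborel_distr_orthonormal: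
  fixes L :: "'a::euclidean_space \<Rightarrow> 'b::euclidean_space"
  assumes L: "L \<in> borel_measurable borel" and G: "bij_betw G Basis (Basis :: 'a set)"
    and adj: "\<And>v b. b \<in> Basis \<Longrightarrow> L v \<bullet> b = v \<bullet> G b"
  shows "distr lborel borel L = lborel"
proof (rule lborel_eqI[symmetric])
  fix l u :: 'b assume lu: "\<And>b. b \<in> Basis \<Longrightarrow> l \<bullet> b \<le> u \<bullet> b"
  define pull :: "'b \<Rightarrow> 'a" where "pull y = (\<Sum>b\<in>Basis. (y \<bullet> b) *\<^sub>R G b)" for y
  have GB: "G b \<in> Basis" if "b \<in> Basis" for b using G that by (auto simp: bij_betw_def)
  have pull: "pull y \<bullet> G b = y \<bullet> b" if b: "b \<in> Basis" for y b
  proof -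
    have "pull y \<bullet> G b = (\<Sum>b'\<in>Basis. if b' = b then y \<bullet> b' else 0)"
      unfolding pull_def inner_sum_left
    proof (intro sum.cong refl)
      fix b' :: 'b assume b': "b' \<in> Basis"
      have "G b' = G b \<longleftrightarrow> b' = b" using G b b' by (auto simp: bij_betw_def inj_on_def)
      then show "(y \<bullet> b') *\<^sub>R G b' \<bullet> G b = (if b' = b then y \<bullet> b' else 0)"
        using inner_Basis[OF GB[OF b'] GB[OF b]] by simp
    qed
    then show ?thesis using b by simp
  qed
  have "v \<in> L -` box l u \<longleftrightarrow> v \<in> box (pull l) (pull u)" for v
  proof -
    have "v \<in> L -` box l u \<longleftrightarrow> (\<forall>b\<in>Basis. l \<bullet> b < v \<bullet> G b \<and> v \<bullet> G b < u \<bullet> b)" using adj by (auto simp: mem_box)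
    also have "\<dots> \<longleftrightarrow> (\<forall>b\<in>Basis. pull l \<bullet> G b < v \<bullet> G b \<and> v \<bullet> G b < pull u \<bullet> G b)" using pull by auto
    also have "\<dots> \<longleftrightarrow> (\<forall>i\<in>G ` Basis. pull l \<bullet> i < v \<bullet> i \<and> v \<bullet> i < pull u \<bullet> i)" by simp
    also have "\<dots> \<longleftrightarrow> v \<in> box (pull l) (pull u)" unfolding bij_betw_imp_surj_on[OF G] mem_box ..
    finally show ?thesis .
  qed
  then have "L -` box l u = box (pull l) (pull u)" by blast
  then have "emeasure (distr lborel borel L) (box l u) = emeasure lborel (box (pull l) (pull u))"
    using L by (subst emeasure_distr) auto
  also have "\<dots> = (\<Prod>i\<in>Basis. (pull u - pull l) \<bullet> i)"
  proof (rule emeasure_lborel_box)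
    fix i :: 'a assume "i \<in> Basis"
    then obtain b where "b \<in> Basis" "i = G b" using G by (auto simp: bij_betw_def)
    then show "pull l \<bullet> i \<le> pull u \<bullet> i" using pull lu by simp
  qed
  also have "(\<Prod>i\<in>Basis. (pull u - pull l) \<bullet> i) = (\<Prod>b\<in>Basis. (pull u - pull l) \<bullet> G b)"
    by (rule prod.reindex_bij_betw[OF G, symmetric])
  also have "\<dots> = (\<Prod>b\<in>Basis. (u - l) \<bullet> b)"
    using pull by (intro prod.cong refl) (simp add: inner_diff_left)
  finally show "emeasure (distr lborel borel L) (box l u) = ennreal (\<Prod>b\<in>Basis. (u - l) \<bullet> b)" .
qed simp

text \<open>Real coordinates are indexed by the well-ordered type \<open>'n bit0\<close> with \<open>2 * CARD('n)\<close> elements,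
  because the change of variables theorem of the library needs a well-ordered index type.\<close>

definition ridx :: "'n::finite bit0 \<Rightarrow> 'n \<times> bool" where
  "ridx = (SOME e. bij e)"

lemma bij_ridx: "bij (ridx :: 'n::finite bit0 \<Rightarrow> 'n \<times> bool)"
proof -
  have "card (UNIV :: 'n bit0 set) = card (UNIV :: ('n \<times> bool) set)" by simp
  then have "\<exists>e :: 'n bit0 \<Rightarrow> 'n \<times> bool. bij e"
    by (intro finite_same_card_bij) auto
  then show ?thesis unfolding ridx_def by (rule someI_ex)
qed

definition to_complex :: "real^'n::finite bit0 \<Rightarrow> complex^'n" where
  "to_complex v = (\<chi> k. Complex (v $ inv ridx (k, True)) (v $ inv ridx (k, False)))"

definition to_real :: "complex^'n::finite \<Rightarrow> real^'n bit0" where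
  "to_real w = (\<chi> a. (if snd (ridx a) then Re else Im) (w $ fst (ridx a)))"

lemma inv_ridx [simp]: "inv ridx (ridx a) = a" "ridx (inv ridx b) = b"
  by (rule inv_f_f[OF bij_is_inj[OF bij_ridx]], rule surj_f_inv_f[OF bij_is_surj[OF bij_ridx]])

lemma inv_ridx_eq [simp]: "inv ridx p = inv ridx q \<longleftrightarrow> p = q"
  by (metis inv_ridx(2))

lemma to_complex_inverse [simp]: "to_real (to_complex v) = v"
proof -
  have "to_real (to_complex v) $ a = v $ a" for a
    using inv_ridx(1)[of a] by (cases "ridx a"; cases "snd (ridx a)") (auto simp: to_real_def to_complex_def)
  then show ?thesis by (simp add: vec_eq_iff)
qed

lemma to_real_inverse [simp]: "to_complex (to_real w) = w"
  by (simp add: to_real_def to_complex_def vec_eq_iff)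

lemma linear_to_complex: "linear to_complex"
  by (rule linearI) (simp_all add: to_complex_def vec_eq_iff complex_eq_iff)

lemma linear_to_real: "linear to_real"
  by (rule linearI) (simp_all add: to_real_def vec_eq_iff)

lemma lborel_distr_to_complex: "distr lborel borel to_complex = (lborel :: (complex^'n) measure)"
proof (rule lborel_distr_orthonormal)
  show "to_complex \<in> borel_measurable borel"
    by (intro borel_measurable_continuous_onI linear_continuous_on linear_conv_bounded_linear[THEN iffD1] linear_to_complex)
  have B: "(Basis :: (complex^'n) set) = {axis k b | k b. b \<in> {1, \<i>}}"
    by (auto simp: Basis_vec_def Basis_complex_def)
  have to_real_axis: "to_real (axis k 1) = axis (inv ridx (k, True)) 1" "to_real (axis k \<i>) = axis (inv ridx (k, False)) 1" for k :: 'n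
  proof -
    have "to_complex (axis (inv ridx (k, True)) 1) = axis k 1" "to_complex (axis (inv ridx (k, False)) 1) = axis k \<i>"
      by (auto simp: to_complex_def vec_eq_iff axis_def complex_eq_iff)
    then show "to_real (axis k 1) = axis (inv ridx (k, True)) 1" "to_real (axis k \<i>) = axis (inv ridx (k, False)) 1"
      using to_complex_inverse by metis+
  qed
  show "bij_betw to_real (Basis :: (complex^'n) set) Basis"
    unfolding bij_betw_def
  proof
    show "inj_on to_real (Basis :: (complex^'n) set)" by (metis inj_onI to_real_inverse)
    show "to_real ` (Basis :: (complex^'n) set) = Basis"
    proof
      show "to_real ` (Basis :: (complex^'n) set) \<subseteq> Basis"
        using to_real_axis by (auto simp: B Basis_vec_def)
      show "Basis \<subseteq> to_real ` (Basis :: (complex^'n) set)"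
      proof
        fix i :: "real^'n bit0" assume "i \<in> Basis"
        then obtain a where i: "i = axis a 1" by (auto simp: Basis_vec_def)
        obtain k s where ks: "ridx a = (k, s)" by fastforce
        have a: "a = inv ridx (k, s)" using inv_ridx(1)[of a] by (simp add: ks)
        show "i \<in> to_real ` (Basis :: (complex^'n) set)"
          by (cases s) (use i a to_real_axis[of k] B in \<open>auto intro!: image_eqI[of _ _ "axis k (if s then 1 else \<i>)"]\<close>)
      qed
    qed
  qed
  fix v and b :: "complex^'n" assume "b \<in> Basis"
  then obtain k where "b = axis k 1 \<or> b = axis k \<i>" by (auto simp: B)
  then show "to_complex v \<bullet> b = v \<bullet> to_real b"
    using to_real_axis[of k] by (auto simp: inner_axis to_complex_def inner_complex_def)
qed

lemma measurable_to_complex: "to_complex \<in> borel_measurable borel"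
  by (intro borel_measurable_continuous_onI linear_continuous_on linear_conv_bounded_linear[THEN iffD1] linear_to_complex)

lemma det_to_real:
  fixes J :: "complex^'n^'n"
  shows "det (matrix (\<lambda>v. to_real (J *v to_complex v))) = (norm (det J))\<^sup>2"
proof -
  have "matrix (\<lambda>v. to_real (J *v to_complex v)) $ a $ b = real_matrix J $ ridx a $ ridx b" for a b
  proof -
    obtain k s where ks: "ridx a = (k, s)" by fastforce
    obtain l t where lt: "ridx b = (l, t)" by fastforce
    have b: "b = inv ridx (l, t)" using inv_ridx(1)[of b] by (simp add: lt)
    have inj: "inv ridx p = b \<longleftrightarrow> p = (l, t)" for p using b inv_ridx(2) by metis
    have "to_complex (axis b 1) = axis l (if t then 1 else \<i>)"
      by (auto simp: to_complex_def vec_eq_iff axis_def complex_eq_iff inj)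
    then have "(J *v to_complex (axis b 1)) $ k = J $ k $ l * (if t then 1 else \<i>)"
      by (simp add: matrix_vector_mult_def axis_def if_distrib cong: if_cong)
    then show ?thesis by (simp add: matrix_def to_real_def real_matrix_def ks lt Let_def)
  qed
  then have "matrix (\<lambda>v. to_real (J *v to_complex v)) = (\<chi> a b. real_matrix J $ ridx a $ ridx b)"
    by (simp add: vec_eq_iff)
  also have "det \<dots> = det (real_matrix J)"
    by (rule det_embed[symmetric]) (use bij_ridx in \<open>auto simp: bij_def\<close>)
  finally show ?thesis by (simp add: det_real_matrix)
qed

text \<open>By \<open>det_to_real\<close> the real Jacobian determinant is the square of the modulus
  of the complex one. The integrals are carried to real coordinates and back, since
  \<open>to_complex\<close> preserves Lebesgue measure.\<close>

theorem holo_change_of_variables: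
  fixes \<phi> :: "complex^'n \<Rightarrow> complex^'n" and g :: "complex^'n \<Rightarrow> real"
  assumes W: "open W" and holo: "\<And>l. holo_on W (\<lambda>z. \<phi> z $ l)" and inj: "inj_on \<phi> W" and W': "open (\<phi> ` W)"
    and g: "set_integrable lborel (\<phi> ` W) g"
    and f: "set_borel_measurable lborel W f"
    and fg: "\<And>z. z \<in> W \<Longrightarrow> f z = (norm (det (\<chi> l j. dz j (\<lambda>z. \<phi> z $ l) z)))\<^sup>2 * g (\<phi> z)"
  shows "set_integrable lborel W f \<and> (LINT z:W|lborel. f z) = (LINT z:\<phi> ` W|lborel. g z)"
proof -
  define S where "S = to_complex -` W"
  define \<psi> where "\<psi> v = to_real (\<phi> (to_complex v))" for v
  define J where "J z = (\<chi> l j. dz j (\<lambda>z. \<phi> z $ l) z)" for z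
  have lin: "bounded_linear to_complex" "bounded_linear to_real"
    using linear_to_complex linear_to_real linear_conv_bounded_linear by blast+
  have S: "open S" unfolding S_def using W lin(1)
    by (intro open_vimage linear_continuous_on) auto
  have im: "\<psi> ` S = to_complex -` (\<phi> ` W)"
  proof
    show "\<psi> ` S \<subseteq> to_complex -` (\<phi> ` W)" by (auto simp: \<psi>_def S_def)
    show "to_complex -` (\<phi> ` W) \<subseteq> \<psi> ` S"
    proof
      fix v assume "v \<in> to_complex -` (\<phi> ` W)"
      then obtain z where "z \<in> W" "to_complex v = \<phi> z" by auto
      then have "v = \<psi> (to_real z)" "to_real z \<in> S" by (auto simp: \<psi>_def S_def simp flip: \<open>to_complex v = \<phi> z\<close>)
      then show "v \<in> \<psi> ` S" by blast
    qed
  qed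
  have der: "(\<psi> has_derivative (\<lambda>v. to_real (J (to_complex x) *v to_complex v))) (at x within S)" if "x \<in> S" for x
  proof -
    have x: "to_complex x \<in> W" using that by (simp add: S_def)
    have "(\<phi> has_derivative (\<lambda>w. J (to_complex x) *v w)) (at (to_complex x))"
    proof (rule has_derivative_vecI)
      fix l
      have "((\<lambda>z. \<phi> z $ l) has_derivative frechet_derivative (\<lambda>z. \<phi> z $ l) (at (to_complex x))) (at (to_complex x))"
        using holo_on_differentiable[OF holo x] differentiable_has_derivative by blast
      moreover have "frechet_derivative (\<lambda>z. \<phi> z $ l) (at (to_complex x)) = (\<lambda>w. (J (to_complex x) *v w) $ l)"
        by (rule ext) (simp add: holo_on_frechet[OF holo x] J_def matrix_vector_mult_def mult.commute)
      ultimately show "((\<lambda>z. \<phi> z $ l) has_derivative (\<lambda>w. (J (to_complex x) *v w) $ l)) (at (to_complex x))" by simp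
    qed
    then have d: "((\<lambda>v. \<phi> (to_complex v)) has_derivative (\<lambda>v. J (to_complex x) *v to_complex v)) (at x)"
      by (rule has_derivative_compose[OF bounded_linear_imp_has_derivative[OF lin(1)]])
    show ?thesis unfolding \<psi>_def
      by (rule has_derivative_at_withinI[OF bounded_linear.has_derivative[OF lin(2) d]])
  qed
  have injS: "inj_on \<psi> S"
  proof (rule inj_onI)
    fix x y assume "x \<in> S" "y \<in> S" "\<psi> x = \<psi> y"
    then have "\<phi> (to_complex x) = \<phi> (to_complex y)" unfolding \<psi>_def by (metis to_real_inverse)
    then have "to_complex x = to_complex y" using inj \<open>x \<in> S\<close> \<open>y \<in> S\<close> by (auto simp: S_def inj_on_def)
    then show "x = y" by (metis to_complex_inverse)
  qed
  \<comment> \<open>The change of variables theorem speaks of vector-valued functions, so real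
    values are packed into \<open>real^1\<close>.\<close>
  define G where "G v = (vec (g (to_complex v)) :: real^1)" for v
  define F where "F v = (vec (f (to_complex v)) :: real^1)" for v
  have tr: "set_integrable lborel U h \<longleftrightarrow> set_integrable lborel (to_complex -` U) (\<lambda>v. h (to_complex v))"
    "(LINT z:U|lborel. h z) = (LINT v:to_complex -` U|lborel. h (to_complex v))"
    if "set_borel_measurable lborel U h" for U :: "(complex^'n) set" and h :: "complex^'n \<Rightarrow> real"
  proof -
    have m: "(\<lambda>z. indicator U z *\<^sub>R h z) \<in> borel_measurable borel" using that by (simp add: set_borel_measurable_def)
    have t: "to_complex \<in> measurable lborel (borel :: (complex^'n) measure)" using measurable_to_complex by simp
    have i: "indicator (to_complex -` U) v = (indicator U (to_complex v) :: real)" for v by (simp add: indicator_def)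
    show "set_integrable lborel U h \<longleftrightarrow> set_integrable lborel (to_complex -` U) (\<lambda>v. h (to_complex v))"
      unfolding set_integrable_def i using integrable_distr_eq[OF t m] unfolding lborel_distr_to_complex .
    show "(LINT z:U|lborel. h z) = (LINT v:to_complex -` U|lborel. h (to_complex v))"
      unfolding set_lebesgue_integral_def i using integral_distr[OF t m] unfolding lborel_distr_to_complex .
  qed
  \<comment> \<open>For Borel functions, integrability for \<open>lborel\<close> and for its
    completion agree.\<close>
  have leb: "set_integrable lborel U h \<longleftrightarrow> h absolutely_integrable_on U"
    if "set_borel_measurable lborel U h" for U :: "(real^'n bit0) set" and h :: "real^'n bit0 \<Rightarrow> real"
    using integrable_completion[of "\<lambda>v. indicator U v *\<^sub>R h v" lborel] that
    by (simp add: set_integrable_def set_borel_measurable_def)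
  have gm: "set_borel_measurable lborel (\<phi> ` W) g" using g by (simp add: set_integrable_def set_borel_measurable_def)
  have mt: "set_borel_measurable lborel (to_complex -` U) (\<lambda>v. h (to_complex v))"
    if "set_borel_measurable lborel U h" for U :: "(complex^'n) set" and h :: "complex^'n \<Rightarrow> real"
  proof -
    have m: "(\<lambda>z. indicator U z *\<^sub>R h z) \<in> borel_measurable borel" using that by (simp add: set_borel_measurable_def)
    have i: "indicator (to_complex -` U) v = (indicator U (to_complex v) :: real)" for v by (simp add: indicator_def)
    show ?thesis unfolding set_borel_measurable_def i using measurable_compose[OF measurable_to_complex m] by simp
  qed
  have gS: "set_integrable lborel (\<psi> ` S) (\<lambda>v. g (to_complex v))" using tr(1)[OF gm] g im by simp
  have "(\<lambda>v. g (to_complex v)) absolutely_integrable_on \<psi> ` S"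
    using leb[OF mt[OF gm]] gS im by simp
  then have Gi: "G absolutely_integrable_on \<psi> ` S"
    unfolding G_def absolutely_integrable_on_1_iff by simp
  have GF: "\<bar>det (matrix (\<lambda>v. to_real (J (to_complex x) *v to_complex v)))\<bar> *\<^sub>R G (\<psi> x) = F x" if "x \<in> S" for x
    using that fg[of "to_complex x"] unfolding det_to_real
    by (simp add: G_def F_def \<psi>_def S_def J_def vec_eq_iff)
  have cov: "(\<lambda>x. \<bar>det (matrix (\<lambda>v. to_real (J (to_complex x) *v to_complex v)))\<bar> *\<^sub>R G (\<psi> x)) absolutely_integrable_on S \<and>
      integral S (\<lambda>x. \<bar>det (matrix (\<lambda>v. to_real (J (to_complex x) *v to_complex v)))\<bar> *\<^sub>R G (\<psi> x)) = integral (\<psi> ` S) G"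
    using has_absolute_integral_change_of_variables[OF _ der injS, of G "integral (\<psi> ` S) G"] Gi S by auto
  have Fi: "F absolutely_integrable_on S"
  proof -
    have "set_integrable lebesgue S (\<lambda>x. \<bar>det (matrix (\<lambda>v. to_real (J (to_complex x) *v to_complex v)))\<bar> *\<^sub>R G (\<psi> x)) = set_integrable lebesgue S F"
      by (rule set_integrable_cong) (use GF in auto)
    then show ?thesis using cov by simp
  qed
  have intFG: "integral S F = integral (\<psi> ` S) G"
    using cov integral_cong[of S "\<lambda>x. \<bar>det (matrix (\<lambda>v. to_real (J (to_complex x) *v to_complex v)))\<bar> *\<^sub>R G (\<psi> x)" F] GF by auto
  have "(\<lambda>v. f (to_complex v)) absolutely_integrable_on S"
    using Fi unfolding F_def absolutely_integrable_on_1_iff by simp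
  then have fS: "set_integrable lborel S (\<lambda>v. f (to_complex v))"
    using leb[OF mt[OF f]] unfolding S_def by simp
  then have "set_integrable lborel W f" using tr(1)[OF f] unfolding S_def by simp
  moreover have "(LINT z:W|lborel. f z) = (LINT z:\<phi> ` W|lborel. g z)"
  proof -
    have "(LINT z:W|lborel. f z) = integral S (\<lambda>v. f (to_complex v))"
      using tr(2)[OF f] set_borel_integral_eq_integral(2)[OF fS] by (simp add: S_def)
    also have "\<dots> = integral S F $ 1"
      using Fi unfolding F_def by (subst integral_on_1_eq) (auto simp: absolutely_integrable_on_def)
    also have "\<dots> = integral (\<psi> ` S) G $ 1" by (simp add: intFG)
    also have "\<dots> = integral (\<psi> ` S) (\<lambda>v. g (to_complex v))"
      using Gi unfolding G_def by (subst integral_on_1_eq) (auto simp: absolutely_integrable_on_def)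
    also have "\<dots> = (LINT z:\<phi> ` W|lborel. g z)"
      using tr(2)[OF gm] set_borel_integral_eq_integral(2)[OF gS] im by simp
    finally show ?thesis .
  qed
  ultimately show ?thesis by blast
qed

section \<open>Stokes' theorem in a chart\<close>

lemma integrable_compact_support:
  fixes f :: "'a::euclidean_space \<Rightarrow> 'b::{banach, second_countable_topology}"
  assumes "compact K" "continuous_on UNIV f" "\<And>x. x \<notin> K \<Longrightarrow> f x = 0"
  shows "integrable lborel f"
proof -
  have "integrable lborel (\<lambda>x. indicator K x *\<^sub>R f x)"
    using assms by (intro borel_integrable_compact continuous_on_subset[OF assms(2)]) auto
  also have "(\<lambda>x. indicator K x *\<^sub>R f x) = f" using assms(3) by (auto simp: fun_eq_iff indicator_def)
  finally show ?thesis .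
qed

text \<open>By translation invariance every difference quotient has integral zero, and dominated
  convergence passes to the derivative.\<close>

lemma integral_directional_derivative:
  fixes f :: "'a::euclidean_space \<Rightarrow> complex"
  assumes K: "compact K" and f: "smooth_on UNIV f" and f0: "\<And>x. x \<notin> K \<Longrightarrow> f x = 0"
  shows "(\<integral>x. frechet_derivative f (at x) v \<partial>lborel) = 0"
proof -
  let ?g = "\<lambda>x. frechet_derivative f (at x) v"
  have der: "(f has_derivative frechet_derivative f (at x)) (at x)" for x
    using smooth_on_has_derivative[OF f] by simp
  have contf: "continuous_on UNIV f" and contg: "continuous_on UNIV ?g"
    using smooth_on_continuous f smooth_on_frechet_derivative by blast+
  have g0: "?g x = 0" if "x \<notin> K" for x
  proof -
    have "open (- K)" using K compact_imp_closed by blast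
    then have "(f has_derivative (\<lambda>_. 0)) (at x)"
      using has_derivative_transform_within_open[OF has_derivative_const[of 0], of "- K" x f] that f0 by auto
    then show ?thesis using frechet_derivative_at by metis
  qed
  obtain M where M: "M > 0" "\<And>x. norm (?g x) \<le> M"
  proof -
    have "bounded (?g ` K)" using K contg by (intro compact_imp_bounded compact_continuous_image continuous_on_subset[OF contg]) auto
    then obtain B where "\<And>x. x \<in> K \<Longrightarrow> norm (?g x) \<le> B" unfolding bounded_iff by auto
    then have "norm (?g x) \<le> max B 1" for x using g0[of x] by (cases "x \<in> K") force+
    then show thesis using that[of "max B 1"] by auto
  qed
  define s where "s n = inverse (real (Suc n))" for n
  have s: "s n > 0" "s n \<le> 1" for n by (auto simp: s_def divide_simps)
  have s0: "s \<longlonglongrightarrow> 0" unfolding s_def by (rule LIMSEQ_inverse_real_of_nat)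
  define F where "F n x = (f (x + s n *\<^sub>R v) - f x) /\<^sub>R s n" for n x
  have lim: "(\<lambda>n. F n x) \<longlonglongrightarrow> ?g x" for x
  proof -
    have l: "((\<lambda>t. x + t *\<^sub>R v) has_derivative (\<lambda>t. t *\<^sub>R v)) (at (0::real))"
      by (auto intro!: derivative_eq_intros)
    have d: "(f has_derivative frechet_derivative f (at x)) (at (x + 0 *\<^sub>R v))" using der by simp
    have fl: "((\<lambda>t. f (x + t *\<^sub>R v)) has_derivative (\<lambda>t. t *\<^sub>R ?g x)) (at 0)"
      using has_derivative_compose[OF l d] linear_scale[OF has_derivative_linear[OF der]] by simp
    \<comment> \<open>The limit is taken for the two real components, where the derivative in
      \<open>t\<close> is a field derivative.\<close>
    have c: "((\<lambda>t. (B (f (x + t *\<^sub>R v)) - B (f x)) / t) \<longlongrightarrow> B (?g x)) (at 0)"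
      if B: "bounded_linear B" for B :: "complex \<Rightarrow> real"
    proof -
      have "((\<lambda>t. B (f (x + t *\<^sub>R v))) has_derivative (\<lambda>t. B (t *\<^sub>R ?g x))) (at 0)"
        by (rule bounded_linear.has_derivative[OF B fl])
      then have "((\<lambda>t. B (f (x + t *\<^sub>R v))) has_real_derivative B (?g x)) (at 0)"
        by (rule has_derivative_imp_has_field_derivative) (simp add: linear_scale[OF bounded_linear.linear[OF B]])
      then show ?thesis by (simp add: has_field_derivative_iff)
    qed
    have "((\<lambda>t. (f (x + t *\<^sub>R v) - f x) /\<^sub>R t) \<longlongrightarrow> ?g x) (at 0)"
      unfolding tendsto_complex_iff
      using c[OF bounded_linear_Re] c[OF bounded_linear_Im] by (simp add: divide_inverse mult.commute)
    moreover have "filterlim s (at 0) sequentially"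
      using s0 s(1) by (auto simp: filterlim_at intro!: always_eventually less_imp_neq[THEN not_sym])
    ultimately show ?thesis unfolding F_def by (rule filterlim_compose)
  qed
  \<comment> \<open>All points from which some step \<open>t *\<^sub>R v\<close> with
    \<open>0 \<le> t \<le> 1\<close> reaches \<open>K\<close>: one compact set outside which all the
    difference quotients vanish.\<close>
  define K' where "K' = (\<lambda>(x, t). x - t *\<^sub>R v) ` (K \<times> {0..1::real})"
  have K': "compact K'" unfolding K'_def case_prod_unfold
    by (intro compact_continuous_image compact_Times K compact_Icc continuous_intros)
  have F0: "F n x = 0" if "x \<notin> K'" for n x
  proof -
    have "x + s n *\<^sub>R v \<notin> K"
    proof
      assume "x + s n *\<^sub>R v \<in> K"
      then have "x \<in> K'" unfolding K'_def using s[of n] by (intro image_eqI[of _ _ "(x + s n *\<^sub>R v, s n)"]) auto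
      then show False using that by blast
    qed
    moreover have "x \<notin> K"
    proof
      assume "x \<in> K"
      then have "x \<in> K'" unfolding K'_def by (intro image_eqI[of _ _ "(x, 0)"]) auto
      then show False using that by blast
    qed
    ultimately show ?thesis using f0 by (simp add: F_def)
  qed
  have bound: "norm (F n x) \<le> indicator K' x *\<^sub>R M" for n x
  proof (cases "x \<in> K'")
    case True
    have "norm (f (x + s n *\<^sub>R v) - f (x + 0 *\<^sub>R v)) \<le> M * norm (s n - 0)"
    proof (rule differentiable_bound[of "{0..s n}" "\<lambda>t. f (x + t *\<^sub>R v)" "\<lambda>t h. frechet_derivative f (at (x + t *\<^sub>R v)) (h *\<^sub>R v)"])
      fix t assume "t \<in> {0..s n}"
      have l: "((\<lambda>t. x + t *\<^sub>R v) has_derivative (\<lambda>t. t *\<^sub>R v)) (at t within {0..s n})"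
        by (auto intro!: derivative_eq_intros)
      show "((\<lambda>t. f (x + t *\<^sub>R v)) has_derivative (\<lambda>h. frechet_derivative f (at (x + t *\<^sub>R v)) (h *\<^sub>R v))) (at t within {0..s n})"
        by (rule has_derivative_compose[OF l der])
      show "onorm (\<lambda>h. frechet_derivative f (at (x + t *\<^sub>R v)) (h *\<^sub>R v)) \<le> M"
        unfolding linear_scale[OF has_derivative_linear[OF der]]
        by (rule onorm_bound) (use M in \<open>auto simp: mult.commute[of M] intro: mult_left_mono\<close>)
    qed (use s[of n] in auto)
    then have "norm (f (x + s n *\<^sub>R v) - f x) \<le> M * s n" using s[of n] by simp
    then have "inverse (s n) * norm (f (x + s n *\<^sub>R v) - f x) \<le> M"
      using s(1)[of n] by (simp add: field_simps)
    then show ?thesis using True s(1)[of n] unfolding F_def norm_scaleR by simp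
  next
    case False
    then show ?thesis by (simp add: F0)
  qed
  have fi: "integrable lborel f" by (rule integrable_compact_support[OF K contf f0])
  have shift: "integrable lborel (\<lambda>x. f (x + c))" "(\<integral>x. f (x + c) \<partial>lborel) = (\<integral>x. f x \<partial>lborel)" for c
  proof -
    have m: "(\<lambda>x. x + c) \<in> borel_measurable lborel" "f \<in> borel_measurable borel"
      using borel_measurable_continuous_onI[OF contf] by auto
    have d: "distr lborel borel (\<lambda>x. x + c) = (lborel :: 'a measure)"
      using lborel_distr_plus[of c] unfolding add.commute[of c] .
    show "integrable lborel (\<lambda>x. f (x + c))" using integrable_distr_eq[OF m(1) m(2)] fi unfolding d by simp
    show "(\<integral>x. f (x + c) \<partial>lborel) = (\<integral>x. f x \<partial>lborel)" using integral_distr[OF m(1) m(2)] unfolding d by simp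
  qed
  have "(\<lambda>n. \<integral>x. F n x \<partial>lborel) \<longlonglongrightarrow> (\<integral>x. ?g x \<partial>lborel)"
  proof (rule integral_dominated_convergence[where w = "\<lambda>x. indicator K' x *\<^sub>R M"])
    show "?g \<in> borel_measurable lborel" using borel_measurable_continuous_onI[OF contg] by simp
    show "F n \<in> borel_measurable lborel" for n
      unfolding F_def using borel_measurable_continuous_onI[OF contf]
      by (intro borel_measurable_scaleR borel_measurable_diff borel_measurable_const
          measurable_compose[of "\<lambda>x. x + s n *\<^sub>R v" lborel borel f]) auto
    show "integrable lborel (\<lambda>x. indicator K' x *\<^sub>R M)"
      by (rule borel_integrable_compact[OF K']) (rule continuous_on_const)
  qed (use lim bound in auto)
  moreover have "(\<integral>x. F n x \<partial>lborel) = 0" for n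
    unfolding F_def using shift fi by simp
  ultimately show ?thesis by (simp add: LIMSEQ_const_iff)
qed

lemma smooth_extend_0:
  fixes f :: "complex^'n \<Rightarrow> complex"
  assumes U: "open U" and K: "compact K" "K \<subseteq> U" and f: "smooth_on U f" and f0: "\<And>z. z \<in> U - K \<Longrightarrow> f z = 0"
  defines "F \<equiv> \<lambda>z. if z \<in> U then f z else 0"
  shows "smooth_on UNIV F"
proof (rule smooth_on_local)
  fix z
  have oK: "open (- K)" using K(1) compact_imp_closed by blast
  show "\<exists>W. open W \<and> z \<in> W \<and> smooth_on W F"
  proof (cases "z \<in> U")
    case True
    have "smooth_on U F" by (rule smooth_on_cong_imp[OF U _ f]) (simp add: F_def)
    then show ?thesis using True U by blast
  next
    case False
    have "smooth_on (- K) F"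
      by (rule smooth_on_cong_imp[OF oK _ smooth_on_const[OF oK, of 0]]) (use f0 in \<open>auto simp: F_def\<close>)
    then show ?thesis using False K oK by blast
  qed
qed

text \<open>Extension by zero reduces this to directional derivatives on the whole space.\<close>

lemma integral_dzbar_0:
  fixes f :: "complex^'n \<Rightarrow> complex"
  assumes U: "open U" and K: "compact K" "K \<subseteq> U" and f: "smooth_on U f" and f0: "\<And>z. z \<in> U - K \<Longrightarrow> f z = 0"
  shows "set_integrable lborel U (dzbar k f)" and "(LINT z:U|lborel. dzbar k f z) = 0"
proof -
  define F where "F = (\<lambda>z. if z \<in> U then f z else 0)"
  have F: "smooth_on UNIV F" unfolding F_def by (rule smooth_extend_0[OF assms])
  have F0: "F z = 0" if "z \<notin> K" for z using that f0 by (auto simp: F_def)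
  have oK: "open (- K)" using K(1) compact_imp_closed by blast
  have dF0: "dzbar k F z = 0" if "z \<notin> K" for z
    using dzbar_cong[OF oK, of z F "\<lambda>_. 0"] that F0 by simp
  have eq: "indicator U z *\<^sub>R dzbar k f z = dzbar k F z" for z
  proof (cases "z \<in> U")
    case True
    then show ?thesis using dzbar_cong[OF U True, of f F] by (simp add: F_def)
  next
    case False
    then show ?thesis using dF0 K by auto
  qed
  have gi: "integrable lborel (\<lambda>z. frechet_derivative F (at z) v)" for v
  proof (rule integrable_compact_support[OF K(1)])
    show "continuous_on UNIV (\<lambda>z. frechet_derivative F (at z) v)"
      by (intro smooth_on_continuous smooth_on_frechet_derivative F)
    fix z assume z: "z \<notin> K"
    have "(F has_derivative (\<lambda>_. 0)) (at z)"
      using has_derivative_transform_within_open[OF has_derivative_const[of 0], of "- K" z F] oK z F0 by auto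
    then show "frechet_derivative F (at z) v = 0" using frechet_derivative_at by metis
  qed
  have "integrable lborel (dzbar k F)" unfolding dzbar_def
    by (intro integrable_divide Bochner_Integration.integrable_add integrable_mult_right gi)
  then show "set_integrable lborel U (dzbar k f)" unfolding set_integrable_def eq .
  have "(\<integral>z. dzbar k F z \<partial>lborel) = 0"
    unfolding dzbar_def
    using integral_directional_derivative[OF K(1) F F0] gi
    by (simp add: Bochner_Integration.integral_add)
  then show "(LINT z:U|lborel. dzbar k f z) = 0" unfolding set_lebesgue_integral_def eq .
qed

text \<open>Composition with the transposition permutes the summands, changes the sign and keeps
  \<open>X\<close>, so the sum is its own negative.\<close>

lemma sum_sign_swap:
  fixes X :: "('n::finite \<Rightarrow> 'n) \<Rightarrow> complex"
  assumes "s \<noteq> u" and X: "\<And>\<tau>. \<tau> permutes UNIV \<Longrightarrow> X (\<tau> \<circ> Transposition.transpose s u) = X \<tau>"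
  shows "(\<Sum>\<tau> | \<tau> permutes UNIV. of_int (sign \<tau>) * X \<tau>) = 0"
proof -
  let ?t = "Transposition.transpose s u"
  have t: "?t permutes UNIV" by (rule permutes_swap_id) auto
  have "(\<Sum>\<tau> | \<tau> permutes UNIV. of_int (sign \<tau>) * X \<tau>) = (\<Sum>\<tau> | \<tau> permutes UNIV. of_int (sign (\<tau> \<circ> ?t)) * X (\<tau> \<circ> ?t))"
    by (rule sum_permutations_compose_right[OF t])
  also have "\<dots> = (\<Sum>\<tau> | \<tau> permutes UNIV. - (of_int (sign \<tau>) * X \<tau>))"
  proof (intro sum.cong refl)
    fix \<tau> assume "\<tau> \<in> {\<tau>. \<tau> permutes (UNIV :: 'n set)}"
    then have \<tau>: "\<tau> permutes UNIV" by simp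
    have "sign (\<tau> \<circ> ?t) = sign \<tau> * sign ?t"
      using \<tau> t by (intro sign_compose) (auto simp: permutation_permutes)
    also have "\<dots> = - sign \<tau>" using assms(1) by (simp add: sign_swap_id)
    finally show "of_int (sign (\<tau> \<circ> ?t)) * X (\<tau> \<circ> ?t) = - (of_int (sign \<tau>) * X \<tau>)" using X[OF \<tau>] by simp
  qed
  finally show ?thesis by (simp add: sum_negf)
qed

text \<open>A determinant with \<open>dbar\<close>-closed rows, one of which is the \<open>dbar\<close> of a function \<open>w\<close>, is a
  divergence: the terms in which the derivative falls on another row cancel by closedness.\<close>

lemma det_divergence:
  fixes b :: "'n \<Rightarrow> 'n \<Rightarrow> complex^'n \<Rightarrow> complex" and w :: "complex^'n \<Rightarrow> complex"
  assumes b: "\<And>j k. b j k differentiable (at z)" and w: "w differentiable (at z)"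
    and closed: "\<And>i j k. dzbar i (b j k) z = dzbar k (b j i) z"
  shows "det (\<chi> j. if j = s then \<chi> k. dzbar k w z else \<chi> k. b j k z) =
    (\<Sum>\<tau> | \<tau> permutes UNIV. of_int (sign \<tau>) * dzbar (\<tau> s) (\<lambda>z. w z * (\<Prod>j\<in>UNIV - {s}. b j (\<tau> j) z)) z)"
proof -
  let ?P = "{\<tau>. \<tau> permutes (UNIV :: 'n set)}"
  let ?R = "\<lambda>\<tau> z. \<Prod>j\<in>UNIV - {s}. b j (\<tau> j) z"
  have R: "?R \<tau> differentiable (at z)" for \<tau>
    unfolding differentiable_def by (rule exI, rule has_derivative_prod, rule differentiable_has_derivative[OF b])
  have "det (\<chi> j. if j = s then \<chi> k. dzbar k w z else \<chi> k. b j k z) = (\<Sum>\<tau>\<in>?P. of_int (sign \<tau>) * (dzbar (\<tau> s) w z * ?R \<tau> z))"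
    unfolding det_def
  proof (intro sum.cong refl arg_cong2[where f = "(*)"])
    fix \<tau>
    have "(\<Prod>i\<in>UNIV. (\<chi> j. if j = s then \<chi> k. dzbar k w z else \<chi> k. b j k z) $ i $ \<tau> i)
      = (\<chi> j. if j = s then \<chi> k. dzbar k w z else \<chi> k. b j k z) $ s $ \<tau> s *
        (\<Prod>i\<in>UNIV - {s}. (\<chi> j. if j = s then \<chi> k. dzbar k w z else \<chi> k. b j k z) $ i $ \<tau> i)"
      by (rule prod.remove) auto
    then show "(\<Prod>i\<in>UNIV. (\<chi> j. if j = s then \<chi> k. dzbar k w z else \<chi> k. b j k z) $ i $ \<tau> i) = dzbar (\<tau> s) w z * ?R \<tau> z"
      by simp
  qed
  moreover have "dzbar (\<tau> s) (\<lambda>z. w z * ?R \<tau> z) z = w z * (\<Sum>u\<in>UNIV - {s}. dzbar (\<tau> s) (b u (\<tau> u)) z * (\<Prod>j\<in>UNIV - {s} - {u}. b j (\<tau> j) z))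
     + dzbar (\<tau> s) w z * ?R \<tau> z" for \<tau>
    unfolding dzbar_mult[OF w R] by (subst dzbar_prod) (auto intro: b)
  moreover have "(\<Sum>\<tau>\<in>?P. of_int (sign \<tau>) * (w z * (\<Sum>u\<in>UNIV - {s}. dzbar (\<tau> s) (b u (\<tau> u)) z * (\<Prod>j\<in>UNIV - {s} - {u}. b j (\<tau> j) z)))) = 0"
  proof -
    have "(\<Sum>\<tau>\<in>?P. of_int (sign \<tau>) * (w z * (\<Sum>u\<in>UNIV - {s}. dzbar (\<tau> s) (b u (\<tau> u)) z * (\<Prod>j\<in>UNIV - {s} - {u}. b j (\<tau> j) z))))
      = (\<Sum>u\<in>UNIV - {s}. w z * (\<Sum>\<tau>\<in>?P. of_int (sign \<tau>) * (dzbar (\<tau> s) (b u (\<tau> u)) z * (\<Prod>j\<in>UNIV - {s} - {u}. b j (\<tau> j) z))))"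
      unfolding sum_distrib_left by (subst sum.swap) (intro sum.cong refl, simp add: mult_ac)
    also have "\<dots> = 0"
    proof (rule sum.neutral, rule ballI)
      fix u assume u: "u \<in> UNIV - {s}"
      have "(\<Sum>\<tau>\<in>?P. of_int (sign \<tau>) * (dzbar (\<tau> s) (b u (\<tau> u)) z * (\<Prod>j\<in>UNIV - {s} - {u}. b j (\<tau> j) z))) = 0"
      \<comment> \<open>Exchanging \<open>\<tau> s\<close> and \<open>\<tau> u\<close> preserves the
        differentiated factor by closedness and does not touch the remaining ones.\<close>
      proof (rule sum_sign_swap[of s u])
        show "s \<noteq> u" using u by auto
        fix \<tau> :: "'n \<Rightarrow> 'n"
        have "(\<Prod>j\<in>UNIV - {s} - {u}. b j ((\<tau> \<circ> Transposition.transpose s u) j) z) = (\<Prod>j\<in>UNIV - {s} - {u}. b j (\<tau> j) z)"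
          by (intro prod.cong refl) (auto simp: Transposition.transpose_def)
        then show "dzbar ((\<tau> \<circ> Transposition.transpose s u) s) (b u ((\<tau> \<circ> Transposition.transpose s u) u)) z *
            (\<Prod>j\<in>UNIV - {s} - {u}. b j ((\<tau> \<circ> Transposition.transpose s u) j) z)
          = dzbar (\<tau> s) (b u (\<tau> u)) z * (\<Prod>j\<in>UNIV - {s} - {u}. b j (\<tau> j) z)"
          using closed[of "\<tau> u" u "\<tau> s"] by simp
      qed
      then show "w z * (\<Sum>\<tau>\<in>?P. of_int (sign \<tau>) * (dzbar (\<tau> s) (b u (\<tau> u)) z * (\<Prod>j\<in>UNIV - {s} - {u}. b j (\<tau> j) z))) = 0" by simp
    qed
    finally show ?thesis .
  qed
  ultimately show ?thesis by (simp add: distrib_left sum.distrib)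
qed

text \<open>Rows are replaced one at a time. When row \<open>s\<close> passes from \<open>a\<close>
  to \<open>a + D\<close>, the determinant changes by one whose row \<open>s\<close> consists of the
  derivatives \<open>dzbar k\<close> of \<open>w z $ s\<close>. By \<open>det_divergence\<close>
  this is a divergence, compactly supported because \<open>w\<close> is, and it integrates to
  zero.\<close>

theorem stokes_chart:
  fixes a :: "complex^'n \<Rightarrow> complex^'n^'n" and w :: "complex^'n \<Rightarrow> complex^'n"
  assumes U: "open U" and K: "compact K" "K \<subseteq> U"
    and a: "\<And>j k. smooth_on U (\<lambda>z. a z $ j $ k)"
    and closed: "\<And>z i j k. z \<in> U \<Longrightarrow> dzbar i (\<lambda>z. a z $ j $ k) z = dzbar k (\<lambda>z. a z $ j $ i) z"
    and w: "\<And>j. smooth_on U (\<lambda>z. w z $ j)" and w0: "\<And>z. z \<in> U - K \<Longrightarrow> w z = 0"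
  defines "D \<equiv> \<lambda>z. \<chi> j k. dzbar k (\<lambda>z. w z $ j) z"
  shows "set_integrable lborel U (\<lambda>z. det (a z + D z) - det (a z))"
    and "(LINT z:U|lborel. det (a z + D z) - det (a z)) = 0"
proof -
  \<comment> \<open>\<open>F\<close> is the set of rows already replaced.\<close>
  define b where "b F j k z = (if j \<in> F then a z $ j $ k + dzbar k (\<lambda>z. w z $ j) z else a z $ j $ k)" for F j k z
  define M where "M F z = (\<chi> j k. b F j k z)" for F z
  have bs: "smooth_on U (b F j k)" for F j k
    unfolding b_def by (cases "j \<in> F") (auto intro!: smooth_on_add smooth_on_dzbar U a w)
  have bc: "dzbar i (b F j k) z = dzbar k (b F j i) z" if z: "z \<in> U" for F i j k z
  proof (cases "j \<in> F")
    case True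
    have "dzbar i (b F j k) z = dzbar i (\<lambda>z. a z $ j $ k) z + dzbar i (dzbar k (\<lambda>z. w z $ j)) z" for i k
      unfolding b_def using True dzbar_add[OF smooth_on_differentiable[OF a z] smooth_on_differentiable[OF smooth_on_dzbar[OF U w] z]] by simp
    then show ?thesis using closed[OF z] dzbar_commute[OF U w z] by simp
  next
    case False
    then show ?thesis unfolding b_def using closed[OF z] by simp
  qed
  have step: "set_integrable lborel U (\<lambda>z. det (M (insert s F) z) - det (M F z)) \<and>
      (LINT z:U|lborel. det (M (insert s F) z) - det (M F z)) = 0" if "s \<notin> F" for s F
  proof -
    define f where "f \<tau> z = w z $ s * (\<Prod>j\<in>UNIV - {s}. b F j (\<tau> j) z)" for \<tau> :: "'n \<Rightarrow> 'n" and z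
    have fs: "smooth_on U (f \<tau>)" for \<tau> unfolding f_def by (intro smooth_on_mult smooth_on_prod U w bs)
    have f0: "f \<tau> z = 0" if "z \<in> U - K" for \<tau> z using w0[OF that] by (simp add: f_def)
    have eq: "det (M (insert s F) z) - det (M F z) = (\<Sum>\<tau> | \<tau> permutes UNIV. of_int (sign \<tau>) * dzbar (\<tau> s) (f \<tau>) z)"
      if z: "z \<in> U" for z
    proof -
      have "M (insert s F) z = (\<chi> j. if j = s then (\<chi> k. b F j k z) + (\<chi> k. dzbar k (\<lambda>z. w z $ s) z) else \<chi> k. b F j k z)"
        using \<open>s \<notin> F\<close> by (simp add: M_def vec_eq_iff b_def)
      then have "det (M (insert s F) z) = det (\<chi> j. if j = s then (\<chi> k. b F j k z) else \<chi> k. b F j k z)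
         + det (\<chi> j. if j = s then (\<chi> k. dzbar k (\<lambda>z. w z $ s) z) else \<chi> k. b F j k z)"
        by (simp only: det_row_add)
      moreover have "(\<chi> j. if j = s then (\<chi> k. b F j k z) else \<chi> k. b F j k z) = M F z" by (simp add: M_def vec_eq_iff)
      moreover have "det (\<chi> j. if j = s then (\<chi> k. dzbar k (\<lambda>z. w z $ s) z) else \<chi> k. b F j k z)
         = (\<Sum>\<tau> | \<tau> permutes UNIV. of_int (sign \<tau>) * dzbar (\<tau> s) (f \<tau>) z)"
        unfolding f_def
        by (rule det_divergence[OF smooth_on_differentiable[OF bs z] smooth_on_differentiable[OF w z] bc[OF z]])
      ultimately show ?thesis by simp
    qed
    have i: "set_integrable lborel U (\<lambda>z. of_int (sign \<tau>) * dzbar (\<tau> s) (f \<tau>) z)" for \<tau>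
      using integral_dzbar_0(1)[OF U K fs f0] by (rule set_integrable_mult_right)
    have "set_integrable lborel U (\<lambda>z. \<Sum>\<tau> | \<tau> permutes UNIV. of_int (sign \<tau>) * dzbar (\<tau> s) (f \<tau>) z)"
      using i unfolding set_integrable_def scaleR_sum_right by (intro Bochner_Integration.integrable_sum) auto
    moreover have "(LINT z:U|lborel. (\<Sum>\<tau> | \<tau> permutes UNIV. of_int (sign \<tau>) * dzbar (\<tau> s) (f \<tau>) z)) = 0"
    proof -
      have "(LINT z:U|lborel. (\<Sum>\<tau> | \<tau> permutes UNIV. of_int (sign \<tau>) * dzbar (\<tau> s) (f \<tau>) z))
        = (\<Sum>\<tau> | \<tau> permutes UNIV. (LINT z:U|lborel. of_int (sign \<tau>) * dzbar (\<tau> s) (f \<tau>) z))"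
        using i unfolding set_lebesgue_integral_def set_integrable_def scaleR_sum_right
        by (intro Bochner_Integration.integral_sum) auto
      also have "\<dots> = 0" using integral_dzbar_0(2)[OF U K fs f0] by simp
      finally show ?thesis .
    qed
    moreover have "set_integrable lborel U (\<lambda>z. det (M (insert s F) z) - det (M F z))
        = set_integrable lborel U (\<lambda>z. \<Sum>\<tau> | \<tau> permutes UNIV. of_int (sign \<tau>) * dzbar (\<tau> s) (f \<tau>) z)"
      by (rule set_integrable_cong) (use eq in auto)
    moreover have "(LINT z:U|lborel. det (M (insert s F) z) - det (M F z))
        = (LINT z:U|lborel. (\<Sum>\<tau> | \<tau> permutes UNIV. of_int (sign \<tau>) * dzbar (\<tau> s) (f \<tau>) z))"
      by (rule set_lebesgue_integral_cong) (use eq U in auto)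
    ultimately show ?thesis by simp
  qed
  have "set_integrable lborel U (\<lambda>z. det (M F z) - det (M {} z)) \<and> (LINT z:U|lborel. det (M F z) - det (M {} z)) = 0" for F
    using finite[of F]
  proof (induction F rule: finite_induct)
    case empty
    then show ?case by (simp add: set_integrable_def set_lebesgue_integral_def)
  next
    case (insert s F)
    note st = step[OF insert.hyps(2)]
    have "(\<lambda>z. det (M (insert s F) z) - det (M {} z)) = (\<lambda>z. (det (M (insert s F) z) - det (M F z)) + (det (M F z) - det (M {} z)))" by auto
    then show ?case using set_integral_add[OF conjunct1[OF st] conjunct1[OF insert.IH]] st insert.IH by simp
  qed
  from this[of UNIV]
  have "set_integrable lborel U (\<lambda>z. det (M UNIV z) - det (M {} z)) \<and> (LINT z:U|lborel. det (M UNIV z) - det (M {} z)) = 0" .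
  moreover have "M UNIV z = a z + D z" "M {} z = a z" for z by (simp_all add: M_def b_def D_def vec_eq_iff)
  ultimately show "set_integrable lborel U (\<lambda>z. det (a z + D z) - det (a z))" "(LINT z:U|lborel. det (a z + D z) - det (a z)) = 0"
    by simp_all
qed

section \<open>Partitions of unity\<close>

text \<open>\<open>exp (- 1 / y)\<close> cut off at 0, with polynomial factors in
  \<open>1 / y\<close> so that derivatives stay in the family and smoothness at 0 comes down to a
  single limit.\<close>

definition flat :: "real poly \<Rightarrow> real \<Rightarrow> real" where
  "flat p y = (if y > 0 then poly p (1 / y) * exp (- 1 / y) else 0)"

lemma poly_exp_tendsto_0: "((\<lambda>t. poly p t * exp (- t)) \<longlongrightarrow> (0::real)) at_top"
proof -
  have "((\<lambda>t. \<Sum>i\<le>degree p. coeff p i * (t ^ i / exp t)) \<longlongrightarrow> (\<Sum>i\<le>degree p. coeff p i * 0)) at_top"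
    by (intro tendsto_sum tendsto_mult tendsto_const tendsto_power_div_exp_0)
  then show ?thesis
    by (simp add: poly_altdef sum_distrib_right exp_minus divide_inverse mult.assoc)
qed

text \<open>With \<open>t = 1 / y\<close>, differentiation sends \<open>p\<close> to
  \<open>t^2 * (p - p')\<close>, which the two \<open>pCons 0\<close> express. At 0 the exponential
  beats every polynomial in \<open>t\<close>.\<close>

lemma flat_derivative: "(flat p has_real_derivative flat (pCons 0 (pCons 0 (p - pderiv p))) y) (at y)"
proof -
  let ?q = "pCons 0 (pCons 0 (p - pderiv p))"
  consider "y > 0" | "y < 0" | "y = 0" by linarith
  then show ?thesis
  proof cases
    case 1
    have "((\<lambda>y. poly p (1 / y) * exp (- 1 / y)) has_real_derivative flat ?q y) (at y)"
      using 1 by (auto intro!: derivative_eq_intros DERIV_chain'[where g = "poly p", OF _ poly_DERIV] simp: flat_def field_simps power2_eq_square)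
    then show ?thesis
      by (rule has_field_derivative_transform_within_open[of _ _ _ "{0<..}"]) (use 1 in \<open>auto simp: flat_def\<close>)
  next
    case 2
    have "((\<lambda>y. 0) has_real_derivative flat ?q y) (at y)" using 2 by (simp add: flat_def)
    then show ?thesis
      by (rule has_field_derivative_transform_within_open[of _ _ _ "{..<0}"]) (use 2 in \<open>auto simp: flat_def\<close>)
  next
    case 3
    have "((\<lambda>y. flat p y / y) \<longlongrightarrow> 0) (at_right 0)"
      unfolding filterlim_at_right_to_top
    proof (rule Lim_transform_eventually[OF poly_exp_tendsto_0[of "pCons 0 p"]])
      show "\<forall>\<^sub>F t in at_top. poly (pCons 0 p) t * exp (- t) = flat p (inverse t) / inverse t"
        using eventually_gt_at_top[of 0] by eventually_elim (simp add: flat_def field_simps)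
    qed
    moreover have "((\<lambda>y. flat p y / y) \<longlongrightarrow> 0) (at_left 0)"
    proof (rule Lim_transform_eventually[OF tendsto_const])
      show "\<forall>\<^sub>F y in at_left 0. 0 = flat p y / y"
        by (auto simp: flat_def eventually_at_filter intro!: always_eventually)
    qed
    ultimately have "((\<lambda>y. flat p y / y) \<longlongrightarrow> 0) (at 0)" by (rule filterlim_split_at[rotated])
    then show ?thesis using 3 by (simp add: has_field_derivative_iff flat_def)
  qed
qed

lemma smooth_on_flat: "open S \<Longrightarrow> smooth_on S u \<Longrightarrow> smooth_on S (\<lambda>x. flat p (u x))"
  by (rule smooth_on_compose_real[where I = UNIV]) (use flat_derivative in auto)

lemma flat_1: "flat 1 y \<ge> 0" "flat 1 y > 0 \<longleftrightarrow> y > 0"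
  by (auto simp: flat_def)

lemma norm_vec_square: "(norm (v :: complex^'n))\<^sup>2 = (\<Sum>l\<in>UNIV. (norm (v $ l))\<^sup>2)"
  by (simp add: norm_vec_def L2_set_def sum_nonneg)

section \<open>Bump functions on a compact manifold\<close>

locale compact_cmfd = cmfd A
  for A :: "('x::t2_space, 'n::finite) chart set" +
  assumes compact_UNIV: "compact (UNIV :: 'x set)"
begin

text \<open>The compact set \<open>K\<close> between support and chart domain is part of the
  conclusion: being closed, it later contains the closure of the support of a sum of bumps.\<close>

lemma bump:
  obtains c and \<beta> :: "'x \<Rightarrow> real" and K where "c \<in> A" "smooth_fun A UNIV \<beta>" "\<And>y. \<beta> y \<ge> 0"
    "compact K" "K \<subseteq> fst c" "{y. \<beta> y \<noteq> 0} \<subseteq> K" "open {y. \<beta> y > 0}" "\<beta> x > 0"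
proof -
  obtain c where c: "c \<in> A" "x \<in> fst c" using chart_cover by blast
  have "snd c x \<in> snd c ` fst c" using c(2) by (rule imageI)
  then obtain r where r: "r > 0" "cball (snd c x) r \<subseteq> snd c ` fst c"
    using open_image[OF c(1)] unfolding open_contains_cball by auto
  \<comment> \<open>The square of the distance is smooth in the coordinates, and
    \<open>flat 1\<close> is positive exactly where this square is below
    \<open>r\<^sup>2\<close>.\<close>
  define \<beta> where "\<beta> y = (if y \<in> fst c then flat 1 (r\<^sup>2 - (norm (snd c y - snd c x))\<^sup>2) else 0)" for y
  define K where "K = cinv c ` cball (snd c x) r"
  have K: "compact K" unfolding K_def
    by (rule compact_continuous_image[OF continuous_on_subset[OF continuous_cinv[OF c(1)] r(2)] compact_cball])
  have Kc: "K \<subseteq> fst c" unfolding K_def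
    by (rule image_subsetI) (rule inv_in[OF subsetD[OF r(2)]])
  have pos: "\<beta> y > 0 \<longleftrightarrow> y \<in> fst c \<and> snd c y \<in> ball (snd c x) r" for y
  proof -
    have "(norm (snd c y - snd c x))\<^sup>2 < r\<^sup>2 \<longleftrightarrow> norm (snd c y - snd c x) < r"
    proof
      assume "(norm (snd c y - snd c x))\<^sup>2 < r\<^sup>2"
      then show "norm (snd c y - snd c x) < r" using r(1) by (rule power2_less_imp_less[OF _ less_imp_le])
    next
      assume "norm (snd c y - snd c x) < r"
      then show "(norm (snd c y - snd c x))\<^sup>2 < r\<^sup>2" by (rule power_strict_mono) auto
    qed
    then show ?thesis by (simp add: \<beta>_def flat_1 dist_norm norm_minus_commute)
  qed
  have nn: "\<beta> y \<ge> 0" for y by (simp add: \<beta>_def flat_1)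
  have sub: "{y. \<beta> y \<noteq> 0} \<subseteq> K"
  proof
    fix y assume "y \<in> {y. \<beta> y \<noteq> 0}"
    then have "\<beta> y > 0" using nn[of y] by simp
    then have "y \<in> fst c" "snd c y \<in> cball (snd c x) r" using pos by auto
    then show "y \<in> K" unfolding K_def by (rule chart_in_image[OF c(1)])
  qed
  have op: "open {y. \<beta> y > 0}"
  proof -
    have "{y. \<beta> y > 0} = fst c \<inter> snd c -` ball (snd c x) r" unfolding pos by blast
    then show ?thesis
      using continuous_open_preimage[OF continuous_chart[OF c(1)] open_chart[OF c(1)] open_ball] by (simp only:)
  qed
  have "smooth_fun A UNIV \<beta>"
    unfolding smooth_fun_def
  proof (intro ballI smooth_on_local)
    fix d z assume d: "d \<in> A" and z: "z \<in> snd d ` (fst d \<inter> UNIV)"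
    have zd: "z \<in> snd d ` fst d" using z by simp
    \<comment> \<open>Two open sets cover the manifold: the domain of \<open>c\<close>, where the
      formula applies, and the complement of \<open>K\<close>, where \<open>\<beta>\<close> is
      zero.\<close>
    show "\<exists>U. open U \<and> z \<in> U \<and> smooth_on U (\<lambda>z. \<beta> (cinv d z))"
    proof (cases "cinv d z \<in> fst c")
      case True
      let ?U = "snd d ` (fst d \<inter> fst c)"
      have U: "open ?U" using open_image_Int[OF d open_chart[OF c(1)]] .
      have "smooth_on ?U (\<lambda>z. flat 1 (r\<^sup>2 - (\<Sum>l\<in>UNIV. Re ((snd c (cinv d z) $ l - snd c x $ l) * cnj (snd c (cinv d z) $ l - snd c x $ l)))))"
        by (intro smooth_on_flat smooth_on_diff smooth_on_sum smooth_on_Re smooth_on_mult smooth_on_cnj smooth_on_const U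
            holo_on_smooth[OF U trans_holo[OF d c(1)]])
      then have "smooth_on ?U (\<lambda>z. \<beta> (cinv d z))"
      proof (rule smooth_on_cong_imp[OF U, rotated])
        fix z assume "z \<in> ?U"
        then have "cinv d z \<in> fst c" using image_IntD(1)[OF d, of z "fst c"] by auto
        then show "flat 1 (r\<^sup>2 - (\<Sum>l\<in>UNIV. Re ((snd c (cinv d z) $ l - snd c x $ l) * cnj (snd c (cinv d z) $ l - snd c x $ l)))) = \<beta> (cinv d z)"
          unfolding \<beta>_def norm_vec_square complex_norm_square[symmetric] by simp
      qed
      with U image_IntI[OF d zd True] show ?thesis by (intro exI[of _ ?U] conjI)
    next
      case False
      have oK: "open (- K)" using K compact_imp_closed by blast
      let ?U = "snd d ` (fst d \<inter> - K)"
      have U: "open ?U" using open_image_Int[OF d oK] .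
      have "smooth_on ?U (\<lambda>z. \<beta> (cinv d z))"
        by (rule smooth_on_cong_imp[OF U _ smooth_on_const[OF U, of 0]]) (use sub image_IntD(1)[OF d] in force)
      moreover have "z \<in> ?U" using False Kc by (intro image_IntI[OF d zd]) auto
      ultimately show ?thesis using U by (intro exI[of _ ?U] conjI)
    qed
  qed
  moreover have "\<beta> x > 0" using pos c(2) r(1) by simp
  ultimately show thesis using that[OF c(1) _ nn K Kc sub op] by blast
qed

theorem partition_of_unity_exists: "\<exists>C \<rho>. partition_of_unity A C \<rho>"
proof -
  have "\<exists>c \<beta> K. c \<in> A \<and> smooth_fun A UNIV \<beta> \<and> (\<forall>y. \<beta> y \<ge> (0::real)) \<and>
    compact K \<and> K \<subseteq> fst c \<and> {y. \<beta> y \<noteq> 0} \<subseteq> K \<and> open {y. \<beta> y > 0} \<and> \<beta> x > 0" for x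
    by (rule bump[of x]) blast
  then obtain c \<beta> K where cbK: "\<And>x. c x \<in> A \<and> smooth_fun A UNIV (\<beta> x) \<and> (\<forall>y. \<beta> x y \<ge> (0::real)) \<and>
    compact (K x) \<and> K x \<subseteq> fst (c x) \<and> {y. \<beta> x y \<noteq> 0} \<subseteq> K x \<and> open {y. \<beta> x y > 0} \<and> \<beta> x x > 0" by metis
  obtain X where X: "finite X" "UNIV \<subseteq> (\<Union>x\<in>X. {y. \<beta> x y > 0})"
    by (rule compactE_image[OF compact_UNIV, of UNIV "\<lambda>x. {y. \<beta> x y > 0}"]) (use cbK in auto)
  define s where "s y = (\<Sum>x\<in>X. \<beta> x y)" for y
  have s: "s y > 0" for y
  proof -
    obtain x where "x \<in> X" "\<beta> x y > 0" using X(2) by blast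
    then show ?thesis unfolding s_def using cbK by (intro sum_pos2[OF X(1)]) auto
  qed
  \<comment> \<open>Weights are indexed by charts, so bumps at different points that share a chart
    are added up.\<close>
  define \<rho> where "\<rho> d y = (\<Sum>x\<in>{x\<in>X. c x = d}. \<beta> x y) / s y" for d y
  have "partition_of_unity A (c ` X) \<rho>"
    unfolding partition_of_unity_def
  proof (intro conjI ballI allI)
    show "finite (c ` X)" "c ` X \<subseteq> A" using X cbK by auto
  next
    fix d assume "d \<in> c ` X"
    show "smooth_fun A UNIV (\<rho> d)"
      unfolding smooth_fun_def
    proof
      fix e assume e: "e \<in> A"
      have "smooth_on (snd e ` (fst e \<inter> UNIV)) (\<lambda>z. \<beta> x (cinv e z))" for x
        using cbK e by (auto simp: smooth_fun_def)
      then show "smooth_on (snd e ` (fst e \<inter> UNIV)) (\<lambda>z. \<rho> d (cinv e z))"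
        unfolding \<rho>_def using s open_image_Int[OF e open_UNIV]
        by (intro smooth_on_divide smooth_on_sum) (auto simp: s_def less_imp_neq[THEN not_sym] intro!: smooth_on_sum)
    qed
    show "0 \<le> \<rho> d x" for x unfolding \<rho>_def using s[of x] cbK by (intro divide_nonneg_pos sum_nonneg) auto
    have "{x. \<rho> d x \<noteq> 0} \<subseteq> (\<Union>x\<in>{x\<in>X. c x = d}. K x)"
    proof
      fix y assume "y \<in> {x. \<rho> d x \<noteq> 0}"
      then have "(\<Sum>x\<in>{x\<in>X. c x = d}. \<beta> x y) \<noteq> 0" unfolding \<rho>_def by auto
      then obtain x where x: "x \<in> {x\<in>X. c x = d}" "\<beta> x y \<noteq> 0" by (rule sum.not_neutral_contains_not_neutral)
      then have "y \<in> K x" using cbK[of x] by auto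
      then show "y \<in> (\<Union>x\<in>{x\<in>X. c x = d}. K x)" using x(1) by (rule UN_I[rotated])
    qed
    moreover have "closed (\<Union>x\<in>{x\<in>X. c x = d}. K x)"
      using X(1) cbK by (intro compact_imp_closed compact_UN) auto
    ultimately have "closure {x. \<rho> d x \<noteq> 0} \<subseteq> (\<Union>x\<in>{x\<in>X. c x = d}. K x)" by (rule closure_minimal)
    also have "\<dots> \<subseteq> fst d" using cbK by blast
    finally show "closure {x. \<rho> d x \<noteq> 0} \<subseteq> fst d" .
  next
    fix y
    have "(\<Sum>d\<in>c ` X. \<rho> d y) = (\<Sum>d\<in>c ` X. \<Sum>x\<in>{x\<in>X. c x = d}. \<beta> x y) / s y"
      unfolding \<rho>_def by (simp add: sum_divide_distrib)
    also have "(\<Sum>d\<in>c ` X. \<Sum>x\<in>{x\<in>X. c x = d}. \<beta> x y) = s y"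
      unfolding s_def by (rule sum.image_gen[OF X(1), symmetric])
    finally show "(\<Sum>d\<in>c ` X. \<rho> d y) = 1" using s[of y] by simp
  qed
  then show ?thesis by blast
qed

section \<open>Stokes' theorem on a compact complex manifold\<close>

text \<open>One and the same partition serves all \<open>\<omega>\<close>, which allows two
  integrals to be compared chart by chart.\<close>

lemma form_integral_partition:
  "\<exists>C \<rho>. partition_of_unity A C \<rho> \<and>
    (\<forall>\<omega>. form_integral A \<omega> = (\<Sum>c\<in>C. LINT z:(snd c ` fst c)|lborel. 2 ^ CARD('n) * (\<rho> c (cinv c z) * \<omega> c (cinv c z))))"
proof -
  define P where "P = (SOME (C, \<rho>). partition_of_unity A C \<rho>)"
  obtain C \<rho> where P: "P = (C, \<rho>)" by fastforce
  have "case P of (C, \<rho>) \<Rightarrow> partition_of_unity A C \<rho>"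
    unfolding P_def by (rule someI_ex) (use partition_of_unity_exists in auto)
  then have "partition_of_unity A C \<rho>" by (simp add: P)
  moreover have "form_integral A \<omega> = (\<Sum>c\<in>C. LINT z:(snd c ` fst c)|lborel. 2 ^ CARD('n) * (\<rho> c (cinv c z) * \<omega> c (cinv c z)))" for \<omega>
    unfolding form_integral_def P_def[symmetric] P by simp
  ultimately show ?thesis by (intro exI conjI allI)
qed

lemma compact_closure: "compact (closure (S :: 'x set))"
  using compact_UNIV closed_closure compact_Int_closed by force

lemma integrable_chart:
  fixes f :: "complex^'n \<Rightarrow> real"
  assumes c: "c \<in> A" and K: "compact K" "K \<subseteq> fst c" and f: "continuous_on (snd c ` fst c) f"
    and f0: "\<And>z. z \<in> snd c ` fst c \<Longrightarrow> cinv c z \<notin> K \<Longrightarrow> f z = 0"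
  shows "set_integrable lborel (snd c ` fst c) f"
proof -
  have KK: "compact (snd c ` K)" by (intro compact_continuous_image continuous_on_subset[OF continuous_chart[OF c]] K)
  have "integrable lborel (\<lambda>z. indicator (snd c ` K) z *\<^sub>R f z)"
    by (intro borel_integrable_compact KK continuous_on_subset[OF f]) (use K in auto)
  also have "(\<lambda>z. indicator (snd c ` K) z *\<^sub>R f z) = (\<lambda>z. indicator (snd c ` fst c) z *\<^sub>R f z)"
  proof
    fix z
    show "indicator (snd c ` K) z *\<^sub>R f z = indicator (snd c ` fst c) z *\<^sub>R f z"
    proof (cases "z \<in> snd c ` fst c \<and> z \<notin> snd c ` K")
      case True
      then have "cinv c z \<notin> K" using imageI[of "cinv c z" K "snd c"] inv_chart[of z c] by auto
      then show ?thesis using True f0 by simp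
    next
      case False
      then show ?thesis using K(2) by (auto simp: indicator_def)
    qed
  qed
  finally show ?thesis unfolding set_integrable_def .
qed

lemma smooth_fun_continuous: "smooth_fun A UNIV f \<Longrightarrow> d \<in> A \<Longrightarrow> continuous_on (snd d ` fst d) (\<lambda>z. f (cinv d z))"
  unfolding smooth_fun_def using smooth_on_continuous by fastforce

text \<open>The local coefficients of a continuous real (n,n)-form.\<close>

definition vol_density :: "(('x, 'n) chart \<Rightarrow> 'x \<Rightarrow> real) \<Rightarrow> bool" where
  "vol_density \<omega> \<longleftrightarrow> (\<forall>c\<in>A. continuous_on (snd c ` fst c) (\<lambda>z. \<omega> c (cinv c z))) \<and>
     (\<forall>c\<in>A. \<forall>d\<in>A. \<forall>x\<in>fst c \<inter> fst d. \<omega> c x = (norm (det (jac c d x)))\<^sup>2 * \<omega> d x)"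

text \<open>Each summand is carried from its chart \<open>c\<close> to \<open>d\<close>. Off the
  overlap the integrand vanishes, in \<open>c\<close> because of \<open>\<omega>\<close> and in
  \<open>d\<close> because of the weight; in \<open>d\<close> the weights add up to 1.\<close>

lemma partition_integral_supported:
  assumes P: "partition_of_unity A C \<rho>" and d: "d \<in> A" and K: "compact K" "K \<subseteq> fst d"
    and \<omega>: "vol_density \<omega>" and \<omega>0: "\<And>c x. c \<in> A \<Longrightarrow> x \<in> fst c \<Longrightarrow> x \<notin> K \<Longrightarrow> \<omega> c x = 0"
  shows "(\<Sum>c\<in>C. LINT z:(snd c ` fst c)|lborel. \<rho> c (cinv c z) * \<omega> c (cinv c z)) = (LINT z:(snd d ` fst d)|lborel. \<omega> d (cinv d z))"
proof -
  let ?U = "snd d ` fst d"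
  have C: "finite C" "\<And>c. c \<in> C \<Longrightarrow> c \<in> A" and sm: "\<And>c. c \<in> C \<Longrightarrow> smooth_fun A UNIV (\<rho> c)"
    and cl: "\<And>c. c \<in> C \<Longrightarrow> closure {x. \<rho> c x \<noteq> 0} \<subseteq> fst c" and one: "\<And>x. (\<Sum>c\<in>C. \<rho> c x) = 1"
    using P unfolding partition_of_unity_def by auto
  have supp: "x \<in> fst c" if "c \<in> C" "\<rho> c x \<noteq> 0" for c x
    using subsetD[OF cl[OF that(1)], of x] subsetD[OF closure_subset, of x "{x. \<rho> c x \<noteq> 0}"] that(2) by simp
  have \<omega>c: "continuous_on (snd c ` fst c) (\<lambda>z. \<omega> c (cinv c z))" if "c \<in> A" for c
    using \<omega> that by (simp add: vol_density_def)
  have int: "set_integrable lborel ?U (\<lambda>z. \<rho> c (cinv d z) * \<omega> d (cinv d z))" if c: "c \<in> C" for c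
  proof (rule integrable_chart[OF d K])
    show "continuous_on ?U (\<lambda>z. \<rho> c (cinv d z) * \<omega> d (cinv d z))"
      by (intro continuous_on_mult smooth_fun_continuous[OF sm[OF c] d] \<omega>c[OF d])
    show "\<rho> c (cinv d z) * \<omega> d (cinv d z) = 0" if "z \<in> ?U" "cinv d z \<notin> K" for z
      using \<omega>0[OF d inv_in[OF that(1)] that(2)] by simp
  qed
  have "(LINT z:(snd c ` fst c)|lborel. \<rho> c (cinv c z) * \<omega> c (cinv c z)) = (LINT z:?U|lborel. \<rho> c (cinv d z) * \<omega> d (cinv d z))"
    if c: "c \<in> C" for c
  proof -
    have cA: "c \<in> A" using C c by blast
    let ?W = "snd c ` (fst c \<inter> fst d)" and ?W' = "snd d ` (fst d \<inter> fst c)"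
    let ?\<phi> = "\<lambda>z. snd d (cinv c z)"
    let ?f = "\<lambda>z. \<rho> c (cinv c z) * \<omega> c (cinv c z)" and ?g = "\<lambda>z. \<rho> c (cinv d z) * \<omega> d (cinv d z)"
    have W: "open ?W" "open ?W'" using open_image_Int cA d open_chart by blast+
    have im: "?\<phi> ` ?W = ?W'"
    proof -
      have "?\<phi> ` ?W = (\<lambda>x. snd d (cinv c (snd c x))) ` (fst c \<inter> fst d)" by (simp add: image_image)
      also have "\<dots> = snd d ` (fst c \<inter> fst d)" using chart_inv[OF cA] by (intro image_cong) auto
      finally show ?thesis by (simp add: Int_commute)
    qed
    have inj: "inj_on ?\<phi> ?W"
    proof (rule inj_onI)
      fix z z' assume z: "z \<in> ?W" "z' \<in> ?W" "?\<phi> z = ?\<phi> z'"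
      have "cinv c z \<in> fst d" "cinv c z' \<in> fst d" using image_IntD(1)[OF cA z(1)] image_IntD(1)[OF cA z(2)] by auto
      then have "cinv c z = cinv c z'" using arg_cong[OF z(3), of "cinv d"] chart_inv[OF d] by simp
      from arg_cong[OF this, of "snd c"] show "z = z'" using image_IntD(2)[OF cA z(1)] image_IntD(2)[OF cA z(2)] by simp
    qed
    have contf: "continuous_on (snd c ` fst c) ?f"
      by (intro continuous_on_mult smooth_fun_continuous[OF sm[OF c] cA] \<omega>c[OF cA])
    have cov: "(LINT z:?W|lborel. ?f z) = (LINT z:?\<phi> ` ?W|lborel. ?g z)"
    proof (rule conjunct2[OF holo_change_of_variables[OF W(1) trans_holo[OF cA d] inj]])
      show "open (?\<phi> ` ?W)" unfolding im by (rule W(2))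
      show "set_integrable lborel (?\<phi> ` ?W) ?g"
        unfolding im by (rule set_integrable_subset[OF int[OF c]]) (use W(2) in auto)
      show "set_borel_measurable lborel ?W ?f"
        unfolding set_borel_measurable_def
        using borel_measurable_continuous_on_indicator[OF _ continuous_on_subset[OF contf], of ?W] W(1) by auto
      fix z assume z: "z \<in> ?W"
      note zD = image_IntD[OF cA z]
      have "\<omega> c (cinv c z) = (norm (det (jac c d (cinv c z))))\<^sup>2 * \<omega> d (cinv c z)"
        using \<omega>[unfolded vol_density_def, THEN conjunct2, THEN bspec, OF cA, THEN bspec, OF d, THEN bspec, OF zD(1)] .
      moreover have "jac c d (cinv c z) = (\<chi> l j. dz j (\<lambda>z. ?\<phi> z $ l) z)" by (simp add: jac_def zD(2))
      moreover have "cinv d (?\<phi> z) = cinv c z" using zD(1) by (intro chart_inv[OF d]) auto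
      ultimately show "?f z = (norm (det (\<chi> l j. dz j (\<lambda>z. ?\<phi> z $ l) z)))\<^sup>2 * ?g (?\<phi> z)" by simp
    qed
    have "(LINT z:(snd c ` fst c)|lborel. ?f z) = (LINT z:?W|lborel. ?f z)"
      unfolding set_lebesgue_integral_def
    proof (intro Bochner_Integration.integral_cong refl)
      fix z
      have "\<omega> c (cinv c z) = 0" if "z \<in> snd c ` fst c" "z \<notin> ?W"
        using \<omega>0[OF cA inv_in[OF that(1)]] that(2) K(2) image_IntI[OF cA that(1), of "fst d"] by auto
      then show "indicator (snd c ` fst c) z *\<^sub>R ?f z = indicator ?W z *\<^sub>R ?f z" by (auto simp: indicator_def)
    qed
    also have "\<dots> = (LINT z:?W'|lborel. ?g z)" using cov im by simp
    also have "\<dots> = (LINT z:?U|lborel. ?g z)"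
      unfolding set_lebesgue_integral_def
    proof (intro Bochner_Integration.integral_cong refl)
      fix z
      have "\<rho> c (cinv d z) = 0" if "z \<in> ?U" "z \<notin> ?W'"
        using supp[OF c, of "cinv d z"] that(2) image_IntI[OF d that(1), of "fst c"] by auto
      then show "indicator ?W' z *\<^sub>R ?g z = indicator ?U z *\<^sub>R ?g z" by (auto simp: indicator_def)
    qed
    finally show ?thesis .
  qed
  then have "(\<Sum>c\<in>C. LINT z:(snd c ` fst c)|lborel. \<rho> c (cinv c z) * \<omega> c (cinv c z)) = (\<Sum>c\<in>C. LINT z:?U|lborel. \<rho> c (cinv d z) * \<omega> d (cinv d z))"
    by (intro sum.cong) auto
  also have "\<dots> = (LINT z:?U|lborel. (\<Sum>c\<in>C. \<rho> c (cinv d z) * \<omega> d (cinv d z)))"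
    using int unfolding set_lebesgue_integral_def set_integrable_def scaleR_sum_right
    by (intro Bochner_Integration.integral_sum[symmetric]) auto
  also have "\<dots> = (LINT z:?U|lborel. \<omega> d (cinv d z))"
    using one by (simp flip: sum_distrib_right)
  finally show ?thesis .
qed

lemma partition_integrable:
  assumes P: "partition_of_unity A C \<rho>" and c: "c \<in> C" and \<omega>: "continuous_on (snd c ` fst c) (\<lambda>z. \<omega> (cinv c z))"
  shows "set_integrable lborel (snd c ` fst c) (\<lambda>z. \<rho> c (cinv c z) * \<omega> (cinv c z))"
proof (rule integrable_chart)
  show cA: "c \<in> A" using P c by (auto simp: partition_of_unity_def)
  show "compact (closure {x. \<rho> c x \<noteq> 0})" by (rule compact_closure)
  show "closure {x. \<rho> c x \<noteq> 0} \<subseteq> fst c" using P c by (auto simp: partition_of_unity_def)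
  show "continuous_on (snd c ` fst c) (\<lambda>z. \<rho> c (cinv c z) * \<omega> (cinv c z))"
    using P c by (intro continuous_on_mult smooth_fun_continuous cA \<omega>) (auto simp: partition_of_unity_def)
  show "\<rho> c (cinv c z) * \<omega> (cinv c z) = 0" if "cinv c z \<notin> closure {x. \<rho> c x \<noteq> 0}" for z
    using that closure_subset[of "{x. \<rho> c x \<noteq> 0}"] by auto
qed

lemma form11_det_continuous:
  assumes "form11 A a" "c \<in> A"
  shows "continuous_on (snd c ` fst c) (\<lambda>z. det (a c (cinv c z)))"
proof -
  have "smooth_on (snd c ` fst c) (\<lambda>z. det (a c (cinv c z)))"
    unfolding det_def
    by (intro smooth_on_sum smooth_on_mult smooth_on_prod smooth_on_const form11_smooth_UNIV assms open_image)
  then show ?thesis by (rule smooth_on_continuous)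
qed

text \<open>\<open>w\<close> is the sum of the pieces \<open>\<rho> d\<close> times
  \<open>w\<close>, and \<open>a\<close> is turned into \<open>a + dbar w\<close> by adding them one
  by one. Each step keeps the form closed and changes the determinant only on the closed support of
  \<open>\<rho> d\<close>, so the change is an integral in one chart, where
  \<open>stokes_chart\<close> applies.\<close>

theorem stokes:
  assumes a: "form11 A a" "dbar_closed A a" and w: "form10_on A UNIV w"
  shows "form_integral A (\<lambda>c x. Re (det (a c x + dbar w c x))) = form_integral A (\<lambda>c x. Re (det (a c x)))"
proof -
  obtain C \<rho> where PI: "partition_of_unity A C \<rho> \<and> (\<forall>\<omega>. form_integral A \<omega> = (\<Sum>c\<in>C. LINT z:(snd c ` fst c)|lborel. 2 ^ CARD('n) * (\<rho> c (cinv c z) * \<omega> c (cinv c z))))"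
    using form_integral_partition by (elim exE)
  note P = conjunct1[OF PI] and I = spec[OF conjunct2[OF PI]]
  have C: "finite C" "\<And>c. c \<in> C \<Longrightarrow> c \<in> A" and sm: "\<And>c. c \<in> C \<Longrightarrow> smooth_fun A UNIV (\<rho> c)"
    and supp: "\<And>c x. c \<in> C \<Longrightarrow> closure {x. \<rho> c x \<noteq> 0} \<subseteq> fst c" and one: "\<And>x. (\<Sum>c\<in>C. \<rho> c x) = 1"
    using P unfolding partition_of_unity_def by auto
  have smc: "smooth_fun A UNIV (\<lambda>x. complex_of_real (\<rho> c x))" if "c \<in> C" for c
    unfolding smooth_fun_def
  proof
    fix e assume e: "e \<in> A"
    show "smooth_on (snd e ` (fst e \<inter> UNIV)) (\<lambda>z. complex_of_real (\<rho> c (cinv e z)))"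
      by (rule smooth_on_of_real[OF open_image_Int[OF e open_UNIV] sm[OF that, unfolded smooth_fun_def, THEN bspec, OF e]])
  qed
  define v where "v F = (\<lambda>c x. (\<Sum>d\<in>F. complex_of_real (\<rho> d x)) *s w c x)" for F
  have sF: "smooth_fun A UNIV (\<lambda>x. \<Sum>d\<in>F. complex_of_real (\<rho> d x))" if "F \<subseteq> C" for F
    unfolding smooth_fun_def
  proof
    fix c assume c: "c \<in> A"
    show "smooth_on (snd c ` (fst c \<inter> UNIV)) (\<lambda>z. \<Sum>d\<in>F. complex_of_real (\<rho> d (cinv c z)))"
    proof (intro smooth_on_sum open_image_Int[OF c open_UNIV])
      fix d assume "d \<in> F"
      then have "d \<in> C" using that by blast
      from smc[OF this, unfolded smooth_fun_def, THEN bspec, OF c]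
      show "smooth_on (snd c ` (fst c \<inter> UNIV)) (\<lambda>z. complex_of_real (\<rho> d (cinv c z)))" .
    qed
  qed
  have v10: "form10_on A UNIV (v F)" if "F \<subseteq> C" for F
    unfolding v_def by (rule form10_scale[OF open_UNIV w sF[OF that]])
  define b where "b F = (\<lambda>c x. a c x + dbar (v F) c x)" for F
  have b11: "form11 A (b F)" if "F \<subseteq> C" for F
    using form11_add[OF open_UNIV _ form11_dbar[OF open_UNIV v10[OF that]], of a] a(1) by (simp add: b_def form11_iff)
  have bcl: "dbar_closed A (b F)" if "F \<subseteq> C" for F
    unfolding b_def using form11_dbar[OF open_UNIV v10[OF that]]
    by (intro dbar_closed_add a dbar_closed_dbar v10[OF that]) (simp add: form11_iff)
  have step: "form_integral A (\<lambda>c x. Re (det (b (insert d F) c x))) = form_integral A (\<lambda>c x. Re (det (b F c x)))"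
    if d: "d \<in> C" and F: "F \<subseteq> C" and dF: "d \<notin> F" "finite F" for d F
  proof -
    let ?K = "closure {x. \<rho> d x \<noteq> 0}"
    let ?u = "\<lambda>c x. complex_of_real (\<rho> d x) *s w c x"
    have dA: "d \<in> A" and iF: "insert d F \<subseteq> C" using C d F by auto
    have u10: "form10_on A UNIV ?u" by (rule form10_scale[OF open_UNIV w smc[OF d]])
    have binsert: "b (insert d F) c x = b F c x + dbar ?u c x" if c: "c \<in> A" and x: "x \<in> fst c" for c x
    proof -
      have xc: "snd c x \<in> snd c ` (fst c \<inter> UNIV)" using x by simp
      have "dbar (v (insert d F)) c x $ j $ k = dbar (v F) c x $ j $ k + dbar ?u c x $ j $ k" for j k
      proof -
        have "v (insert d F) c y $ j = v F c y $ j + ?u c y $ j" for y using dF by (simp add: v_def distrib_right)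
        then show ?thesis
          unfolding dbar_def vec_lambda_beta
          using dzbar_add[OF smooth_on_differentiable[OF form10_smooth[OF v10[OF F] c] xc] smooth_on_differentiable[OF form10_smooth[OF u10 c] xc]] by simp
      qed
      then show ?thesis by (simp add: b_def vec_eq_iff)
    qed
    define \<omega> where "\<omega> c x = Re (det (b (insert d F) c x)) - Re (det (b F c x))" for c x
    have dens: "vol_density \<omega>"
      unfolding vol_density_def
    proof (intro conjI ballI)
      fix c assume c: "c \<in> A"
      show "continuous_on (snd c ` fst c) (\<lambda>z. \<omega> c (cinv c z))"
        unfolding \<omega>_def by (intro continuous_intros form11_det_continuous b11 c iF F)
      fix e x assume e: "e \<in> A" and x: "x \<in> fst c \<inter> fst e"
      show "\<omega> c x = (norm (det (jac c e x)))\<^sup>2 * \<omega> e x"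
        unfolding \<omega>_def form11_det[OF b11[OF iF] c e x] form11_det[OF b11[OF F] c e x] by (simp add: right_diff_distrib)
    qed
    have u0: "dbar ?u c x = 0" if c: "c \<in> A" and x: "x \<in> fst c" "x \<notin> ?K" for c x
    proof -
      let ?V = "snd c ` (fst c \<inter> - ?K)"
      have V: "open ?V" "snd c x \<in> ?V" using open_image_Int[OF c, of "- ?K"] x by auto
      have "?u c (cinv c z) $ j = 0" if "z \<in> ?V" for z j
      proof -
        have "cinv c z \<notin> ?K" using image_IntD(1)[OF c that] by auto
        then have "\<rho> d (cinv c z) = 0" using closure_subset[of "{x. \<rho> d x \<noteq> 0}"] by auto
        then show ?thesis by simp
      qed
      then have "dbar ?u c x $ j $ k = 0" for j k
        unfolding dbar_def vec_lambda_beta using dzbar_cong[OF V, of "\<lambda>z. ?u c (cinv c z) $ j" "\<lambda>_. 0"] by simp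
      then show ?thesis by (simp add: vec_eq_iff)
    qed
    have \<omega>0: "\<omega> c x = 0" if "c \<in> A" "x \<in> fst c" "x \<notin> ?K" for c x
      unfolding \<omega>_def binsert[OF that(1,2)] u0[OF that] by simp
    have "(\<Sum>c\<in>C. LINT z:(snd c ` fst c)|lborel. \<rho> c (cinv c z) * \<omega> c (cinv c z)) = (LINT z:(snd d ` fst d)|lborel. \<omega> d (cinv d z))"
      by (rule partition_integral_supported[OF P dA compact_closure supp[OF d] dens \<omega>0])
    also have "\<dots> = 0"
    proof -
      let ?U = "snd d ` fst d" and ?L = "snd d ` ?K"
      let ?D = "\<lambda>z. \<chi> j k. dzbar k (\<lambda>z. ?u d (cinv d z) $ j) z"
      have L: "compact ?L" "?L \<subseteq> ?U"
        using supp[OF d] by (auto intro!: compact_continuous_image continuous_on_subset[OF continuous_chart[OF dA]] compact_closure)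
      have w0: "?u d (cinv d z) = 0" if "z \<in> ?U - ?L" for z
      proof -
        have "cinv d z \<notin> ?K" using that inv_chart[of z d] imageI[of "cinv d z" ?K "snd d"] by auto
        then have "\<rho> d (cinv d z) = 0" using closure_subset[of "{x. \<rho> d x \<noteq> 0}"] by auto
        then show ?thesis by simp
      qed
      have cl: "dzbar i (\<lambda>z. b F d (cinv d z) $ j $ k) z = dzbar k (\<lambda>z. b F d (cinv d z) $ j $ i) z" if "z \<in> ?U" for z i j k
        using bcl[OF F] dA that unfolding dbar_closed_def by blast
      have us: "smooth_on ?U (\<lambda>z. ?u d (cinv d z) $ j)" for j using form10_smooth[OF u10 dA, of j] unfolding Int_UNIV_right .
      note st = stokes_chart[OF open_image[OF dA] L form11_smooth_UNIV[OF b11[OF F] dA] cl us w0]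
      have eq: "\<omega> d (cinv d z) = Re (det (b F d (cinv d z) + ?D z) - det (b F d (cinv d z)))" if "z \<in> ?U" for z
        unfolding \<omega>_def binsert[OF dA inv_in[OF that]] by (simp add: dbar_def inv_chart[OF that])
      have "(LINT z:?U|lborel. \<omega> d (cinv d z)) = (LINT z:?U|lborel. Re (det (b F d (cinv d z) + ?D z) - det (b F d (cinv d z))))"
        by (rule set_lebesgue_integral_cong) (use eq open_image[OF dA] in auto)
      also have "\<dots> = Re (LINT z:?U|lborel. det (b F d (cinv d z) + ?D z) - det (b F d (cinv d z)))"
        using integral_Re[OF st(1)[unfolded set_integrable_def]] unfolding set_lebesgue_integral_def by simp
      finally show ?thesis using st(2) by simp
    qed
    finally have z: "(\<Sum>c\<in>C. LINT z:(snd c ` fst c)|lborel. \<rho> c (cinv c z) * \<omega> c (cinv c z)) = 0" .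
    have lin: "(LINT z:(snd c ` fst c)|lborel. 2 ^ CARD('n) * (\<rho> c (cinv c z) * Re (det (b (insert d F) c (cinv c z)))))
      = (LINT z:(snd c ` fst c)|lborel. 2 ^ CARD('n) * (\<rho> c (cinv c z) * Re (det (b F c (cinv c z)))))
        + 2 ^ CARD('n) * (LINT z:(snd c ` fst c)|lborel. \<rho> c (cinv c z) * \<omega> c (cinv c z))" if c: "c \<in> C" for c
    proof -
      have i: "set_integrable lborel (snd c ` fst c) (\<lambda>z. \<rho> c (cinv c z) * Re (det (b G c (cinv c z))))" if "G \<subseteq> C" for G
        by (rule partition_integrable[OF P c]) (intro continuous_intros form11_det_continuous b11 that C c)
      have "(LINT z:(snd c ` fst c)|lborel. \<rho> c (cinv c z) * \<omega> c (cinv c z)) =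
          (LINT z:(snd c ` fst c)|lborel. \<rho> c (cinv c z) * Re (det (b (insert d F) c (cinv c z))))
        - (LINT z:(snd c ` fst c)|lborel. \<rho> c (cinv c z) * Re (det (b F c (cinv c z))))"
        unfolding \<omega>_def right_diff_distrib by (rule set_integral_diff(2)[OF i[OF iF] i[OF F]])
      then show ?thesis by (simp add: right_diff_distrib)
    qed
    have "form_integral A (\<lambda>c x. Re (det (b (insert d F) c x))) = form_integral A (\<lambda>c x. Re (det (b F c x)))
       + 2 ^ CARD('n) * (\<Sum>c\<in>C. LINT z:(snd c ` fst c)|lborel. \<rho> c (cinv c z) * \<omega> c (cinv c z))"
      unfolding I using lin by (simp add: sum.distrib sum_distrib_left)
    then show ?thesis unfolding z by simp
  qed
  have all: "form_integral A (\<lambda>c x. Re (det (b F c x))) = form_integral A (\<lambda>c x. Re (det (b {} c x)))" if "F \<subseteq> C" for F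
    using finite_subset[OF that C(1)] that
  proof (induction F rule: finite_induct)
    case (insert d F)
    then show ?case using step[of d F] by auto
  qed simp
  have "b C = (\<lambda>c x. a c x + dbar w c x)"
  proof -
    have "v C = w" by (simp add: v_def fun_eq_iff one flip: of_real_sum)
    then show ?thesis by (simp add: b_def)
  qed
  moreover have "b {} c x = a c x" for c x
  proof -
    have "v {} = (\<lambda>_ _. 0)" by (simp add: v_def fun_eq_iff)
    then show ?thesis by (simp add: b_def dbar_def vec_eq_iff)
  qed
  ultimately show ?thesis using all[of C] by simp
qed

end

section \<open>Matrix-valued functions\<close>

lemma matrix_add_mult: "(A + B) ** C = A ** C + B ** (C :: complex^'r^'r)"
  by (simp add: vec_eq_iff matrix_matrix_mult_def distrib_right sum.distrib)

lemma zero_mult: "0 ** A = (0 :: complex^'r^'r)" and mult_zero: "A ** 0 = (0 :: complex^'r^'r)"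
  by (simp_all add: vec_eq_iff matrix_matrix_mult_def)

definition mat_deriv ::
    "((complex^'n \<Rightarrow> complex) \<Rightarrow> complex^'n \<Rightarrow> complex) \<Rightarrow> (complex^'n \<Rightarrow> complex^'r^'r) \<Rightarrow> complex^'n \<Rightarrow> complex^'r^'r" where
  "mat_deriv D M z = (\<chi> \<kappa> \<mu>. D (\<lambda>w. M w $ \<kappa> $ \<mu>) z)"

definition smooth_mat :: "(complex^'n) set \<Rightarrow> (complex^'n \<Rightarrow> complex^'r^'r) \<Rightarrow> bool" where
  "smooth_mat S M \<longleftrightarrow> (\<forall>\<kappa> \<mu>. smooth_on S (\<lambda>z. M z $ \<kappa> $ \<mu>))"

definition holo_mat :: "(complex^'n) set \<Rightarrow> (complex^'n \<Rightarrow> complex^'r^'r) \<Rightarrow> bool" where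
  "holo_mat S M \<longleftrightarrow> (\<forall>\<kappa> \<mu>. holo_on S (\<lambda>z. M z $ \<kappa> $ \<mu>))"

lemma smooth_matD: "smooth_mat S M \<Longrightarrow> smooth_on S (\<lambda>z. M z $ \<kappa> $ \<mu>)"
  by (simp add: smooth_mat_def)

lemma smooth_mat_differentiable: "smooth_mat S M \<Longrightarrow> z \<in> S \<Longrightarrow> (\<lambda>z. M z $ \<kappa> $ \<mu>) differentiable (at z)"
  by (rule smooth_on_differentiable[OF smooth_matD])

lemma smooth_mat_subset: "smooth_mat S M \<Longrightarrow> R \<subseteq> S \<Longrightarrow> smooth_mat R M"
  unfolding smooth_mat_def using smooth_on_subset by blast

lemma smooth_mat_mult: "open S \<Longrightarrow> smooth_mat S M \<Longrightarrow> smooth_mat S N \<Longrightarrow> smooth_mat S (\<lambda>z. M z ** N z)"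
  unfolding smooth_mat_def matrix_matrix_mult_def vec_lambda_beta
  by (intro allI smooth_on_sum smooth_on_mult) auto

lemma smooth_on_det: "open S \<Longrightarrow> smooth_mat S M \<Longrightarrow> smooth_on S (\<lambda>z. det (M z))"
  unfolding det_def by (intro smooth_on_sum smooth_on_mult smooth_on_prod smooth_on_const smooth_matD)

lemma smooth_on_trace: "open S \<Longrightarrow> smooth_mat S M \<Longrightarrow> smooth_on S (\<lambda>z. trace (M z))"
  unfolding trace_def by (intro smooth_on_sum smooth_matD)

text \<open>Cramer's rule for one column of the inverse. It shows the entries to be quotients of
  polynomials in those of \<open>A\<close>, from which smoothness follows.\<close>

lemma matrix_inv_entry:
  fixes A :: "complex^'r^'r"
  assumes "det A \<noteq> 0"
  shows "matrix_inv A $ a $ b = det (\<chi> i j. if j = a then axis b 1 $ i else A $ i $ j) / det A"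
proof -
  have "A *v column b (matrix_inv A) = column b (A ** matrix_inv A)"
    by (simp add: matrix_vector_mult_def matrix_matrix_mult_def column_def vec_eq_iff)
  also have "\<dots> = axis b 1"
    unfolding matrix_inv_right[OF assms] by (simp add: column_def mat_def axis_def vec_eq_iff)
  finally have "column b (matrix_inv A) = (\<chi> k. det (\<chi> i j. if j = k then axis b 1 $ i else A $ i $ j) / det A)"
    using cramer[OF assms] by blast
  then have "column b (matrix_inv A) $ a = det (\<chi> i j. if j = a then axis b 1 $ i else A $ i $ j) / det A" by simp
  then show ?thesis by (simp add: column_def)
qed

lemma smooth_mat_inv:
  assumes "open S" "smooth_mat S M" "\<And>z. z \<in> S \<Longrightarrow> det (M z) \<noteq> 0"
  shows "smooth_mat S (\<lambda>z. matrix_inv (M z))"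
  unfolding smooth_mat_def
proof (intro allI)
  fix a b
  have "smooth_mat S (\<lambda>z. \<chi> i j. if j = a then axis b 1 $ i else M z $ i $ j)"
    unfolding smooth_mat_def
  proof (intro allI)
    fix i j show "smooth_on S (\<lambda>z. (\<chi> i j. if j = a then axis b 1 $ i else M z $ i $ j) $ i $ j)"
      using assms(1) smooth_matD[OF assms(2)] by (cases "j = a") simp_all
  qed
  then have "smooth_on S (\<lambda>z. det (\<chi> i j. if j = a then axis b 1 $ i else M z $ i $ j) / det (M z))"
    by (intro smooth_on_divide smooth_on_det assms)
  then show "smooth_on S (\<lambda>z. matrix_inv (M z) $ a $ b)"
    by (rule smooth_on_cong_imp[OF assms(1), rotated]) (simp add: matrix_inv_entry assms(3))
qed

lemma
  assumes M: "smooth_mat S M" "smooth_mat S N" and z: "z \<in> S"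
  shows mat_dz_mult: "mat_deriv (dz j) (\<lambda>z. M z ** N z) z = mat_deriv (dz j) M z ** N z + M z ** mat_deriv (dz j) N z"
    and mat_dzbar_mult: "mat_deriv (dzbar j) (\<lambda>z. M z ** N z) z = mat_deriv (dzbar j) M z ** N z + M z ** mat_deriv (dzbar j) N z"
proof -
  note d = smooth_mat_differentiable[OF M(1) z] smooth_mat_differentiable[OF M(2) z]
  show "mat_deriv (dz j) (\<lambda>z. M z ** N z) z = mat_deriv (dz j) M z ** N z + M z ** mat_deriv (dz j) N z"
    by (simp add: vec_eq_iff mat_deriv_def matrix_matrix_mult_def dz_sum dz_mult differentiable_mult d sum.distrib add.commute)
  show "mat_deriv (dzbar j) (\<lambda>z. M z ** N z) z = mat_deriv (dzbar j) M z ** N z + M z ** mat_deriv (dzbar j) N z"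
    by (simp add: vec_eq_iff mat_deriv_def matrix_matrix_mult_def dzbar_sum dzbar_mult differentiable_mult d sum.distrib add.commute)
qed

lemma mat_dzbar_add:
  assumes M: "smooth_mat S M" "smooth_mat S N" and z: "z \<in> S"
  shows "mat_deriv (dzbar j) (\<lambda>z. M z + N z) z = mat_deriv (dzbar j) M z + mat_deriv (dzbar j) N z"
  by (simp add: vec_eq_iff mat_deriv_def dzbar_add smooth_mat_differentiable[OF M(1) z] smooth_mat_differentiable[OF M(2) z])

lemma
  assumes "open S" "z \<in> S" "\<And>w. w \<in> S \<Longrightarrow> M w = N w"
  shows mat_dz_cong: "mat_deriv (dz j) M z = mat_deriv (dz j) N z"
    and mat_dzbar_cong: "mat_deriv (dzbar j) M z = mat_deriv (dzbar j) N z"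
  unfolding mat_deriv_def vec_eq_iff vec_lambda_beta
  by (intro allI dz_cong[OF assms(1,2)] dzbar_cong[OF assms(1,2)]; simp add: assms(3))+

lemma trace_mat_dzbar:
  assumes "smooth_mat S M" "z \<in> S"
  shows "trace (mat_deriv (dzbar j) M z) = dzbar j (\<lambda>w. trace (M w)) z"
  unfolding trace_def mat_deriv_def vec_lambda_beta
  by (rule dzbar_sum[symmetric]) (rule smooth_mat_differentiable[OF assms])

lemma holo_mat_smooth: "open S \<Longrightarrow> holo_mat S M \<Longrightarrow> smooth_mat S M"
  unfolding holo_mat_def smooth_mat_def using holo_on_smooth by blast

lemma holo_mat_dzbar: "holo_mat S M \<Longrightarrow> z \<in> S \<Longrightarrow> mat_deriv (dzbar k) M z = 0"
  unfolding holo_mat_def mat_deriv_def vec_eq_iff using holo_on_dzbar by fastforce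

lemma holo_mat_dz: "open S \<Longrightarrow> holo_mat S M \<Longrightarrow> holo_mat S (mat_deriv (dz j) M)"
  unfolding holo_mat_def mat_deriv_def vec_lambda_beta using holo_on_dz_holo by blast

text \<open>The product rule on \<open>M z ** matrix_inv (M z) = mat 1\<close>, where the derivative
  of \<open>M\<close> vanishes.\<close>

lemma holo_mat_inv:
  assumes S: "open S" and M: "holo_mat S M" and d: "\<And>z. z \<in> S \<Longrightarrow> det (M z) \<noteq> 0" and z: "z \<in> S"
  shows "mat_deriv (dzbar k) (\<lambda>z. matrix_inv (M z)) z = 0"
proof -
  note sm = holo_mat_smooth[OF S M]
  have "mat_deriv (dzbar k) (\<lambda>z. M z ** matrix_inv (M z)) z = mat_deriv (dzbar k) (\<lambda>z. mat 1) z"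
    by (rule mat_dzbar_cong[OF S z]) (rule matrix_inv_right[OF d])
  also have "\<dots> = 0" by (simp add: mat_deriv_def vec_eq_iff)
  finally have "M z ** mat_deriv (dzbar k) (\<lambda>z. matrix_inv (M z)) z = 0"
    using mat_dzbar_mult[OF sm smooth_mat_inv[OF S sm d] z, of k] holo_mat_dzbar[OF M z, of k] zero_mult by simp
  from arg_cong[OF this, of "\<lambda>X. matrix_inv (M z) ** X"] show ?thesis
    by (simp add: matrix_mul_assoc matrix_inv_left[OF d[OF z]] mult_zero)
qed

definition adj :: "complex^'r^'r \<Rightarrow> complex^'r^'r" where
  "adj M = (\<chi> \<kappa> \<mu>. cnj (M $ \<mu> $ \<kappa>))"

lemma det_adj: "det (adj M) = cnj (det M)"
proof -
  have "adj M = transpose (\<chi> i j. cnj (M $ i $ j))" by (simp add: adj_def transpose_def vec_eq_iff)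
  then show ?thesis by (simp add: det_transpose det_cnj)
qed

lemma mat_commute: "mat c ** M = M ** mat (c :: complex)"
  by (simp add: vec_eq_iff matrix_matrix_mult_def mat_def if_distrib[of "\<lambda>x. x * _"] if_distrib[of "\<lambda>x. _ * x"] mult.commute cong: if_cong)

lemma mat_mult_nth: "(mat c ** M) $ i $ j = c * M $ i $ j"
  by (simp add: matrix_matrix_mult_def mat_def if_distrib[of "\<lambda>x. x * _"] cong: if_cong)

lemma trace_mat: "trace (mat c :: complex^'r^'r) = of_nat CARD('r) * c"
  by (simp add: trace_def mat_def)

lemma trace_similar: "b ** a = mat 1 \<Longrightarrow> trace (a ** M ** b) = trace (M :: complex^'r^'r)"
  by (metis matrix_mul_assoc matrix_mul_lid trace_mul_sym)

lemma scalar_matrix: "M = mat \<beta> \<Longrightarrow> \<beta> = trace (M :: complex^'r^'r) / of_nat CARD('r)"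
  by (simp add: trace_mat)

section \<open>The Chern connection of a hermitian matrix function\<close>

text \<open>The Chern connection of a bare Gram matrix function, so that changes of frame and of
  metric become matrix computations; \<open>chern_connection_conn\<close> links it to
  bundles.\<close>

definition conn :: "(complex^'n \<Rightarrow> complex^'r^'r) \<Rightarrow> 'n \<Rightarrow> complex^'n \<Rightarrow> complex^'r^'r" where
  "conn H j z = mat_deriv (dz j) H z ** matrix_inv (H z)"

lemma smooth_conn:
  assumes U: "open U" and H: "smooth_mat U H" "\<And>z. z \<in> U \<Longrightarrow> det (H z) \<noteq> 0"
  shows "smooth_mat U (conn H j)"
proof -
  have "smooth_mat U (mat_deriv (dz j) H)"
    unfolding smooth_mat_def mat_deriv_def vec_lambda_beta
    by (intro allI smooth_on_dz[OF U] smooth_matD[OF H(1)])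
  then have "smooth_mat U (\<lambda>z. mat_deriv (dz j) H z ** matrix_inv (H z))"
    by (intro smooth_mat_mult smooth_mat_inv U H)
  then show ?thesis unfolding conn_def[abs_def] .
qed

text \<open>Jacobi's formula: the trace is the logarithmic derivative of the determinant, so it
  depends on the metric only through the determinant.\<close>

lemma trace_conn:
  assumes H: "smooth_mat U H" and d: "det (H z) \<noteq> 0" and z: "z \<in> U"
  shows "trace (conn H j z) = dz j (\<lambda>w. det (H w)) z / det (H z)"
proof -
  let ?D = "\<lambda>v. \<chi> \<kappa> \<mu>. frechet_derivative (\<lambda>w. H w $ \<kappa> $ \<mu>) (at z) v"
  have "(H has_derivative ?D) (at z)"
    by (intro has_derivative_vecI) (simp add: smooth_on_has_derivative[OF smooth_matD[OF H] z])
  from has_derivative_compose[OF this has_derivative_det[OF d]]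
  have "((\<lambda>w. det (H w)) has_derivative (\<lambda>v. det (H z) * trace (matrix_inv (H z) ** ?D v))) (at z)" .
  from dz_eq[OF this, of j]
  have "dz j (\<lambda>w. det (H w)) z = det (H z) * ((trace (matrix_inv (H z) ** ?D (axis j 1)) - \<i> * trace (matrix_inv (H z) ** ?D (axis j \<i>))) / 2)"
    by (simp add: algebra_simps)
  also have "(trace (matrix_inv (H z) ** ?D (axis j 1)) - \<i> * trace (matrix_inv (H z) ** ?D (axis j \<i>))) / 2
      = trace (matrix_inv (H z) ** mat_deriv (dz j) H z)"
    by (simp add: trace_def matrix_matrix_mult_def mat_deriv_def dz_def sum_distrib_left sum_subtractf[symmetric] sum_divide_distrib algebra_simps)
  also have "\<dots> = trace (conn H j z)" unfolding conn_def by (rule trace_mul_sym)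
  finally show ?thesis using d by simp
qed

lemma matrix_cancel: "A ** B = mat 1 \<Longrightarrow> A ** (B ** C) = (C :: complex^'r^'r)"
  by (simp add: matrix_mul_assoc)

text \<open>The frame change \<open>a\<close> is holomorphic, so \<open>dz\<close> annihilates
  \<open>adj (a z)\<close>, and \<open>conn\<close> changes by a conjugation and the term
  \<open>(dz a) a^-1\<close>. That term is holomorphic too and drops out under
  \<open>dzbar\<close>.\<close>

lemma
  assumes U: "open U" and a: "holo_mat U a" "\<And>z. z \<in> U \<Longrightarrow> det (a z) \<noteq> 0"
    and H: "smooth_mat U H" "\<And>z. z \<in> U \<Longrightarrow> det (H z) \<noteq> 0"
    and K: "\<And>z. z \<in> U \<Longrightarrow> K z = a z ** H z ** adj (a z)" and z: "z \<in> U"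
  shows conn_change: "conn K j z = mat_deriv (dz j) a z ** matrix_inv (a z) + a z ** conn H j z ** matrix_inv (a z)"
    and curvature_change: "mat_deriv (dzbar k) (conn K j) z = a z ** mat_deriv (dzbar k) (conn H j) z ** matrix_inv (a z)"
proof -
  note sa = holo_mat_smooth[OF U a(1)]
  have sadj: "smooth_mat U (\<lambda>z. adj (a z))"
    unfolding smooth_mat_def adj_def vec_lambda_beta by (intro allI smooth_on_cnj[OF U] smooth_matD[OF sa])
  have adj0: "mat_deriv (dz j) (\<lambda>z. adj (a z)) z = 0" if "z \<in> U" for z
  proof -
    have "dz j (\<lambda>w. cnj (a w $ \<mu> $ \<kappa>)) z = 0" for \<kappa> \<mu>
      unfolding dz_cnj[OF smooth_mat_differentiable[OF sa that]]
      using a(1) that by (simp add: holo_mat_def holo_on_dzbar[where S = U])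
    then show ?thesis by (simp add: mat_deriv_def adj_def vec_eq_iff)
  qed
  have change: "conn K j z = mat_deriv (dz j) a z ** matrix_inv (a z) + a z ** conn H j z ** matrix_inv (a z)" if z: "z \<in> U" for z
  proof -
    have da: "det (adj (a z)) \<noteq> 0" using a(2)[OF z] by (simp add: det_adj)
    have inv: "matrix_inv (K z) = matrix_inv (adj (a z)) ** (matrix_inv (H z) ** matrix_inv (a z))"
      by (rule matrix_inv_unique)
        (simp add: K[OF z] matrix_mul_assoc[symmetric] matrix_cancel matrix_inv_right da H(2)[OF z] a(2)[OF z])
    have "mat_deriv (dz j) K z = mat_deriv (dz j) (\<lambda>z. a z ** H z ** adj (a z)) z"
      by (rule mat_dz_cong[OF U z K])
    also have "\<dots> = (mat_deriv (dz j) a z ** H z + a z ** mat_deriv (dz j) H z) ** adj (a z)"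
      by (simp add: mat_dz_mult[OF smooth_mat_mult[OF U sa H(1)] sadj z] mat_dz_mult[OF sa H(1) z] adj0[OF z] mult_zero)
    finally have "conn K j z = (mat_deriv (dz j) a z ** H z + a z ** mat_deriv (dz j) H z) ** (adj (a z) **
        (matrix_inv (adj (a z)) ** (matrix_inv (H z) ** matrix_inv (a z))))"
      unfolding conn_def inv by (simp add: matrix_mul_assoc)
    also have "\<dots> = (mat_deriv (dz j) a z ** H z + a z ** mat_deriv (dz j) H z) ** (matrix_inv (H z) ** matrix_inv (a z))"
      by (simp add: matrix_cancel matrix_inv_right da)
    also have "\<dots> = mat_deriv (dz j) a z ** (H z ** (matrix_inv (H z) ** matrix_inv (a z))) + a z ** conn H j z ** matrix_inv (a z)"
      unfolding conn_def by (simp add: matrix_add_mult matrix_mul_assoc)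
    finally show ?thesis by (simp add: matrix_cancel matrix_inv_right H(2)[OF z])
  qed
  then show "conn K j z = mat_deriv (dz j) a z ** matrix_inv (a z) + a z ** conn H j z ** matrix_inv (a z)" using z by blast
  note s1 = holo_mat_smooth[OF U holo_mat_dz[OF U a(1)]] and s2 = smooth_mat_inv[OF U sa a(2)] and s3 = smooth_conn[OF U H]
  note z2 = holo_mat_inv[OF U a z] and z0 = holo_mat_dzbar[OF a(1) z] and z1 = holo_mat_dzbar[OF holo_mat_dz[OF U a(1)] z]
  have "mat_deriv (dzbar k) (conn K j) z = mat_deriv (dzbar k) (\<lambda>z. mat_deriv (dz j) a z ** matrix_inv (a z) + a z ** conn H j z ** matrix_inv (a z)) z"
    by (rule mat_dzbar_cong[OF U z change])
  also have "\<dots> = mat_deriv (dzbar k) (\<lambda>z. mat_deriv (dz j) a z ** matrix_inv (a z)) z + mat_deriv (dzbar k) (\<lambda>z. a z ** conn H j z ** matrix_inv (a z)) z"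
    by (intro mat_dzbar_add[OF _ _ z] smooth_mat_mult U s1 s2 s3 sa)
  also have "mat_deriv (dzbar k) (\<lambda>z. mat_deriv (dz j) a z ** matrix_inv (a z)) z = 0"
    by (simp add: mat_dzbar_mult[OF s1 s2 z] z1 z2 zero_mult mult_zero)
  also have "mat_deriv (dzbar k) (\<lambda>z. a z ** conn H j z ** matrix_inv (a z)) z = a z ** mat_deriv (dzbar k) (conn H j) z ** matrix_inv (a z)"
    by (simp add: mat_dzbar_mult[OF smooth_mat_mult[OF U sa s3] s2 z] mat_dzbar_mult[OF sa s3 z] z0 z2 zero_mult mult_zero)
  finally show "mat_deriv (dzbar k) (conn K j) z = a z ** mat_deriv (dzbar k) (conn H j) z ** matrix_inv (a z)" by simp
qed

text \<open>Scalars commute with \<open>H\<close>, so the connection gains the scalar matrix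
  \<open>dz u / u\<close>. Hence a conformal change adds a scalar to the curvature, and scalar
  curvature stays scalar.\<close>

lemma conformal_curvature:
  fixes u :: "complex^'n \<Rightarrow> complex"
  assumes U: "open U" and u: "smooth_on U u" "\<And>z. z \<in> U \<Longrightarrow> u z \<noteq> 0"
    and H: "smooth_mat U H" "\<And>z. z \<in> U \<Longrightarrow> det (H z) \<noteq> 0"
    and K: "\<And>z. z \<in> U \<Longrightarrow> K z = mat (u z) ** H z" and z: "z \<in> U"
  shows "mat_deriv (dzbar k) (conn K j) z = mat (dzbar k (\<lambda>z. dz j u z / u z) z) + mat_deriv (dzbar k) (conn H j) z"
proof -
  have smat: "smooth_mat U (\<lambda>z. mat (f z))" if "smooth_on U f" for f
    unfolding smooth_mat_def
  proof (intro allI)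
    fix \<kappa> \<mu> show "smooth_on U (\<lambda>z. mat (f z) $ \<kappa> $ \<mu>)"
      using that U by (cases "\<kappa> = \<mu>") (simp_all add: mat_def)
  qed
  have mdz: "mat_deriv (dz j) (\<lambda>z. mat (u z)) z = mat (dz j u z)" for z
    by (simp add: mat_deriv_def mat_def vec_eq_iff)
  have mdzbar: "mat_deriv (dzbar k) (\<lambda>z. mat (f z)) z = mat (dzbar k f z)" for f z
    by (simp add: mat_deriv_def mat_def vec_eq_iff)
  have change: "conn K j z = mat (dz j u z / u z) + conn H j z" if z: "z \<in> U" for z
  proof -
    have mm: "mat x ** mat y = (mat (x * y) :: complex^'b^'b)" for x y :: complex
      by (simp add: vec_eq_iff mat_mult_nth) (simp add: mat_def)
    have inv: "matrix_inv (K z) = matrix_inv (H z) ** mat (1 / u z)"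
      by (rule matrix_inv_unique)
        (simp add: K[OF z] matrix_mul_assoc[symmetric] matrix_cancel matrix_inv_right H(2)[OF z] mm u(2)[OF z])
    have "mat_deriv (dz j) K z = mat_deriv (dz j) (\<lambda>z. mat (u z) ** H z) z"
      by (rule mat_dz_cong[OF U z K])
    also have "\<dots> = mat (dz j u z) ** H z + mat (u z) ** mat_deriv (dz j) H z"
      by (simp add: mat_dz_mult[OF smat[OF u(1)] H(1) z] mdz)
    finally have "conn K j z = mat (dz j u z) ** (H z ** (matrix_inv (H z) ** mat (1 / u z))) + mat (u z) ** (conn H j z ** mat (1 / u z))"
      unfolding conn_def inv by (simp add: matrix_add_mult matrix_mul_assoc)
    also have "mat (dz j u z) ** (H z ** (matrix_inv (H z) ** mat (1 / u z))) = mat (dz j u z / u z)"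
      by (simp add: matrix_cancel matrix_inv_right H(2)[OF z] mm)
    also have "mat (u z) ** (conn H j z ** mat (1 / u z)) = conn H j z"
      unfolding mat_commute[symmetric] using u(2)[OF z] by (simp add: matrix_mul_assoc mm)
    finally show ?thesis .
  qed
  have "mat_deriv (dzbar k) (conn K j) z = mat_deriv (dzbar k) (\<lambda>z. mat (dz j u z / u z) + conn H j z) z"
    by (rule mat_dzbar_cong[OF U z change])
  also have "\<dots> = mat_deriv (dzbar k) (\<lambda>z. mat (dz j u z / u z)) z + mat_deriv (dzbar k) (conn H j) z"
    by (intro mat_dzbar_add[OF _ _ z] smat smooth_on_divide smooth_on_dz smooth_conn U u H)
  finally show ?thesis by (simp add: mdzbar)
qed

section \<open>Curvature of hermitian metrics on a holomorphic vector bundle\<close>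

locale hol_bundle = cmfd A
  for A :: "('x::t2_space, 'n::finite) chart set" +
  fixes p :: "'e \<Rightarrow> 'x" and T :: "('x, 'e, 'r::finite) triv set"
  assumes vbundle: "holomorphic_vector_bundle A p T"
begin

section \<open>Trivializations, Gram matrices and changes of frame\<close>

lemma triv_cover: "\<exists>t\<in>T. x \<in> fst t"
proof -
  have "(\<Union>t\<in>T. fst t) = UNIV" using vbundle[unfolded holomorphic_vector_bundle_def] by (rule conjunct1)
  then show ?thesis by blast
qed

lemma triv_open: "t \<in> T \<Longrightarrow> open (fst t)"
  and triv_bij: "t \<in> T \<Longrightarrow> x \<in> fst t \<Longrightarrow> bij_betw (snd t) (p -` {x}) UNIV"
  using vbundle[unfolded holomorphic_vector_bundle_def, THEN conjunct2, THEN conjunct1] by blast+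

lemma triv_at: "triv_at T x \<in> T" "x \<in> fst (triv_at T x)"
proof -
  have "triv_at T x \<in> T \<and> x \<in> fst (triv_at T x)"
    unfolding triv_at_def by (rule someI_ex) (use triv_cover in blast)
  then show "triv_at T x \<in> T" "x \<in> fst (triv_at T x)" by auto
qed

lemma frame:
  assumes "t \<in> T" "x \<in> fst t"
  shows "p (frame p t x \<kappa>) = x" "snd t (frame p t x \<kappa>) = axis \<kappa> 1"
proof -
  have *: "axis \<kappa> 1 \<in> snd t ` (p -` {x})" using triv_bij[OF assms] by (simp add: bij_betw_def)
  show "p (frame p t x \<kappa>) = x" using inv_into_into[OF *] by (simp add: frame_def)
  show "snd t (frame p t x \<kappa>) = axis \<kappa> 1" using f_inv_into_f[OF *] by (simp add: frame_def)
qed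

lemma vector_exists:
  assumes "t \<in> T" "x \<in> fst t"
  obtains u where "p u = x" "snd t u = v"
proof -
  have "v \<in> snd t ` (p -` {x})" using triv_bij[OF assms] by (simp add: bij_betw_def)
  then show thesis using that by blast
qed

text \<open>Transition matrices are invertible because fibre coordinates are bijective: a kernel
  vector would give a second vector with the coordinates of the zero vector.\<close>

lemma transition:
  assumes ts: "t \<in> T" "s \<in> T"
  shows "\<exists>g. (\<forall>u. p u \<in> fst t \<inter> fst s \<longrightarrow> snd s u = g (p u) *v snd t u) \<and>
    (\<forall>\<kappa> \<mu>. holo_fun A (fst t \<inter> fst s) (\<lambda>x. g x $ \<kappa> $ \<mu>)) \<and> (\<forall>x\<in>fst t \<inter> fst s. det (g x) \<noteq> 0)"
proof -
  obtain g where g: "\<forall>u. p u \<in> fst t \<inter> fst s \<longrightarrow> snd s u = g (p u) *v snd t u"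
    "\<forall>\<kappa> \<mu>. holo_fun A (fst t \<inter> fst s) (\<lambda>x. g x $ \<kappa> $ \<mu>)"
    using vbundle[unfolded holomorphic_vector_bundle_def, THEN conjunct2, THEN conjunct2] ts by blast
  have "det (g x) \<noteq> 0" if x: "x \<in> fst t \<inter> fst s" for x
  proof
    assume "det (g x) = 0"
    then obtain v where v: "v \<noteq> 0" "g x *v v = 0" by (rule matrix_kernel)
    have xt: "x \<in> fst t" and xs: "x \<in> fst s" using x by auto
    obtain u where u: "p u = x" "snd t u = v" by (rule vector_exists[OF ts(1) xt])
    obtain u0 where u0: "p u0 = x" "snd t u0 = 0" by (rule vector_exists[OF ts(1) xt])
    have "snd s u = snd s u0" using g(1) x u u0 v(2) by simp
    then have "u = u0"
      using bij_betw_imp_inj_on[OF triv_bij[OF ts(2) xs]] u(1) u0(1) by (auto dest: inj_onD)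
    then show False using u(2) u0(2) v(1) by simp
  qed
  then show ?thesis using g by blast
qed

lemma gram_sesq:
  assumes h: "hermitian_metric A p T h" and t: "t \<in> T" and uv: "p u = p v" "p u \<in> fst t"
  shows "h u v = sesq (gram p t h (p u)) (snd t u) (snd t v)"
proof -
  have "h u v = (\<Sum>\<kappa>\<in>UNIV. \<Sum>\<mu>\<in>UNIV. snd t u $ \<kappa> * cnj (snd t v $ \<mu>) * gram p t h (p u) $ \<kappa> $ \<mu>)"
    using h[unfolded hermitian_metric_def, THEN conjunct2, THEN bspec, OF t, THEN conjunct1] uv by blast
  then show ?thesis by (simp add: sesq_def mult.commute mult.left_commute)
qed

lemma gram_posdef:
  assumes h: "hermitian_metric A p T h" and t: "t \<in> T" and x: "x \<in> fst t"
  shows "posdef (gram p t h x)"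
  unfolding posdef_def
proof (intro allI impI)
  fix v :: "complex^'r" assume v: "v \<noteq> 0"
  obtain u where u: "p u = x" "snd t u = v" by (rule vector_exists[OF t x])
  have "0 < h u u"
    using h[unfolded hermitian_metric_def, THEN conjunct2, THEN bspec, OF t, THEN conjunct2, THEN conjunct1] u x v by blast
  then show "0 < sesq (gram p t h x) v v" using gram_sesq[OF h t, of u u] u x by simp
qed

lemma gram_det: "hermitian_metric A p T h \<Longrightarrow> t \<in> T \<Longrightarrow> x \<in> fst t \<Longrightarrow> det (gram p t h x) \<noteq> 0"
  by (rule posdef_det_nz[OF gram_posdef])

lemma smooth_gram:
  assumes h: "hermitian_metric A p T h" and t: "t \<in> T" and c: "c \<in> A"
  shows "smooth_mat (snd c ` (fst c \<inter> fst t)) (\<lambda>z. gram p t h (cinv c z))"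
proof -
  have "\<forall>\<kappa> \<mu>. smooth_fun A (fst t) (\<lambda>x. gram p t h x $ \<kappa> $ \<mu>)"
    using h[unfolded hermitian_metric_def, THEN conjunct2, THEN bspec, OF t, THEN conjunct2, THEN conjunct2] .
  then show ?thesis unfolding smooth_mat_def smooth_fun_def using c by blast
qed

lemma gram_det_chart:
  assumes "hermitian_metric A p T h" "t \<in> T" "c \<in> A" "z \<in> snd c ` (fst c \<inter> fst t)"
  shows "det (gram p t h (cinv c z)) \<noteq> 0"
  by (rule gram_det[OF assms(1,2)]) (use image_IntD(1)[OF assms(3,4)] in simp)

text \<open>One matrix function \<open>a\<close> serves all metrics at once, so that the
  contributions of the frame change to two metrics can be compared.\<close>

lemma frame_change:
  assumes ts: "t \<in> T" "s \<in> T" and c: "c \<in> A"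
  defines "U \<equiv> snd c ` (fst c \<inter> (fst t \<inter> fst s))"
  shows "\<exists>a. holo_mat U a \<and> (\<forall>z\<in>U. det (a z) \<noteq> 0) \<and>
    (\<forall>h. hermitian_metric A p T h \<longrightarrow> (\<forall>z\<in>U. gram p t h (cinv c z) = a z ** gram p s h (cinv c z) ** adj (a z)))"
proof -
  obtain g where g: "\<forall>u. p u \<in> fst t \<inter> fst s \<longrightarrow> snd s u = g (p u) *v snd t u"
    "\<forall>\<kappa> \<mu>. holo_fun A (fst t \<inter> fst s) (\<lambda>x. g x $ \<kappa> $ \<mu>)" "\<forall>x\<in>fst t \<inter> fst s. det (g x) \<noteq> 0"
    using transition[OF ts] by blast
  \<comment> \<open>Row \<open>\<kappa>\<close> of \<open>a\<close> has to hold the coordinates in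
    \<open>s\<close> of the frame vector \<open>\<kappa>\<close> of \<open>t\<close>, which form a
    column of \<open>g\<close>.\<close>
  define a where "a z = transpose (g (cinv c z))" for z
  have "holo_mat U a"
    using g(2) c unfolding holo_fun_def holo_mat_def U_def a_def transpose_def by simp
  moreover have xU: "cinv c z \<in> fst t \<inter> fst s" if "z \<in> U" for z
    using image_IntD(1)[OF c that[unfolded U_def]] by simp
  then have "det (a z) \<noteq> 0" if "z \<in> U" for z using g(3) that unfolding a_def det_transpose by blast
  moreover have "gram p t h (cinv c z) = a z ** gram p s h (cinv c z) ** adj (a z)"
    if h: "hermitian_metric A p T h" and z: "z \<in> U" for h z
  proof -
    let ?x = "cinv c z"
    have x: "?x \<in> fst t" "?x \<in> fst s" using xU[OF z] by auto
    have s: "snd s (frame p t ?x \<kappa>) = column \<kappa> (g ?x)" for \<kappa>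
      using g(1) frame[OF ts(1) x(1)] x
      by (simp add: matrix_vector_mult_def column_def axis_def if_distrib[of "\<lambda>y. _ * y"] cong: if_cong)
    have "gram p t h ?x $ \<kappa> $ \<mu> = (a z ** gram p s h ?x ** adj (a z)) $ \<kappa> $ \<mu>" for \<kappa> \<mu>
    proof -
      have "gram p t h ?x $ \<kappa> $ \<mu> = sesq (gram p s h ?x) (column \<kappa> (g ?x)) (column \<mu> (g ?x))"
        using gram_sesq[OF h ts(2), of "frame p t ?x \<kappa>" "frame p t ?x \<mu>"] x
        by (simp add: gram_def[of p t h] frame[OF ts(1) x(1)] s)
      also have "\<dots> = (\<Sum>b\<in>UNIV. \<Sum>a\<in>UNIV. gram p s h ?x $ a $ b * column \<kappa> (g ?x) $ a * cnj (column \<mu> (g ?x) $ b))"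
        unfolding sesq_def by (rule sum.swap)
      also have "\<dots> = (a z ** gram p s h ?x ** adj (a z)) $ \<kappa> $ \<mu>"
        by (simp add: matrix_matrix_mult_def a_def adj_def transpose_def column_def sum_distrib_left sum_distrib_right mult.commute mult.left_commute)
      finally show ?thesis .
    qed
    then show ?thesis by (simp add: vec_eq_iff)
  qed
  ultimately show ?thesis by blast
qed

lemma chern_connection_conn: "chern_connection p t h c j = conn (\<lambda>w. gram p t h (cinv c w)) j"
  by (simp add: chern_connection_def conn_def mat_deriv_def fun_eq_iff)

lemma curvature_conn: "curvature_matrix p t h c x j k = - mat_deriv (dzbar k) (chern_connection p t h c j) (snd c x)"
  by (simp add: curvature_matrix_def mat_deriv_def vec_eq_iff)

lemma smooth_chern_connection:
  assumes "hermitian_metric A p T h" "t \<in> T" "c \<in> A"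
  shows "smooth_mat (snd c ` (fst c \<inter> fst t)) (chern_connection p t h c j)"
  unfolding chern_connection_conn
  by (intro smooth_conn open_image_Int smooth_gram gram_det_chart triv_open assms)

lemma change_triv:
  assumes h: "hermitian_metric A p T h" and ts: "t \<in> T" "s \<in> T" and c: "c \<in> A" and x: "x \<in> fst c" "x \<in> fst t" "x \<in> fst s"
  shows "\<exists>a b. a ** b = mat 1 \<and> b ** a = mat 1 \<and>
    (\<forall>j k. curvature_matrix p t h c x j k = a ** curvature_matrix p s h c x j k ** b)"
proof -
  let ?U = "snd c ` (fst c \<inter> (fst t \<inter> fst s))"
  obtain a where a: "holo_mat ?U a" "\<And>z. z \<in> ?U \<Longrightarrow> det (a z) \<noteq> 0"
    and H: "\<And>z. z \<in> ?U \<Longrightarrow> gram p t h (cinv c z) = a z ** gram p s h (cinv c z) ** adj (a z)"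
    using frame_change[OF ts c] h by metis
  have U: "open ?U" by (intro open_image_Int c open_Int triv_open ts)
  have z: "snd c x \<in> ?U" using x by simp
  have sub: "?U \<subseteq> snd c ` (fst c \<inter> fst s)" by blast
  have "mat_deriv (dzbar k) (chern_connection p t h c j) (snd c x) =
      a (snd c x) ** mat_deriv (dzbar k) (chern_connection p s h c j) (snd c x) ** matrix_inv (a (snd c x))" for j k
    unfolding chern_connection_conn
    by (rule curvature_change[OF U a smooth_mat_subset[OF smooth_gram[OF h ts(2) c] sub] gram_det_chart[OF h ts(2) c subsetD[OF sub]] H z])
  moreover have "A ** (- M) ** B = - (A ** M ** B)" for A M B :: "complex^'r^'r"
    by (simp add: vec_eq_iff matrix_matrix_mult_def sum_negf)
  ultimately show ?thesis
    by (intro exI[of _ "a (snd c x)"] exI[of _ "matrix_inv (a (snd c x))"] conjI allI)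
      (simp_all add: matrix_inv_left matrix_inv_right a(2)[OF z] curvature_conn)
qed

lemma trace_change_triv:
  assumes "hermitian_metric A p T h" "t \<in> T" "s \<in> T" "c \<in> A" "x \<in> fst c" "x \<in> fst t" "x \<in> fst s"
  shows "trace (curvature_matrix p t h c x j k) = trace (curvature_matrix p s h c x j k)"
  using change_triv[OF assms] trace_similar by metis

lemma scalar_change_triv:
  assumes "hermitian_metric A p T h" "t \<in> T" "s \<in> T" "c \<in> A" "x \<in> fst c" "x \<in> fst t" "x \<in> fst s"
    and "curvature_matrix p s h c x j k = mat \<alpha>"
  shows "curvature_matrix p t h c x j k = mat \<alpha>"
proof -
  obtain a b where ab: "a ** b = mat 1" "curvature_matrix p t h c x j k = a ** curvature_matrix p s h c x j k ** b"
    using change_triv[OF assms(1-7)] by blast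
  then show ?thesis unfolding assms(8) mat_commute[symmetric] by (simp add: matrix_mul_assoc[symmetric])
qed

section \<open>Traces of the connection and of the curvature\<close>

definition curv_trace :: "('e \<Rightarrow> 'e \<Rightarrow> complex) \<Rightarrow> ('x, 'n) chart \<Rightarrow> 'x \<Rightarrow> complex^'n^'n" where
  "curv_trace h c x = (\<chi> j k. trace (curvature_matrix p (triv_at T x) h c x j k))"

text \<open>The connection form of the determinant bundle in the frame given by \<open>t\<close>.
  Unlike the curvature it depends on that frame.\<close>

definition conn_trace :: "('x, 'e, 'r) triv \<Rightarrow> ('e \<Rightarrow> 'e \<Rightarrow> complex) \<Rightarrow> ('x, 'n) chart \<Rightarrow> 'x \<Rightarrow> complex^'n" where
  "conn_trace t h c x = (\<chi> j. trace (chern_connection p t h c j (snd c x)))"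

text \<open>\<open>triv_at\<close> may jump from point to point; a trivialization that stays fixed
  on an open set is what differentiation requires.\<close>

lemma curv_trace_local:
  assumes "hermitian_metric A p T h" "t \<in> T" "c \<in> A" "x \<in> fst c" "x \<in> fst t"
  shows "curv_trace h c x $ j $ k = trace (curvature_matrix p t h c x j k)"
  unfolding curv_trace_def by (simp add: trace_change_triv[OF assms(1) triv_at(1) assms(2-4) triv_at(2) assms(5)])

lemma curv_trace_dbar:
  assumes h: "hermitian_metric A p T h" and t: "t \<in> T" and c: "c \<in> A" and x: "x \<in> fst c" "x \<in> fst t"
  shows "curv_trace h c x $ j $ k = - dbar (conn_trace t h) c x $ j $ k"
proof -
  let ?U = "snd c ` (fst c \<inter> fst t)"
  have U: "open ?U" "snd c x \<in> ?U" using open_image_Int[OF c triv_open[OF t]] x by auto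
  have "curv_trace h c x $ j $ k = trace (- mat_deriv (dzbar k) (chern_connection p t h c j) (snd c x))"
    unfolding curv_trace_local[OF assms] curvature_conn ..
  also have "\<dots> = - trace (mat_deriv (dzbar k) (chern_connection p t h c j) (snd c x))"
    by (simp add: trace_def sum_negf)
  also have "trace (mat_deriv (dzbar k) (chern_connection p t h c j) (snd c x)) = dzbar k (\<lambda>z. trace (chern_connection p t h c j z)) (snd c x)"
    by (rule trace_mat_dzbar[OF smooth_chern_connection[OF h t c] U(2)])
  also have "\<dots> = dbar (conn_trace t h) c x $ j $ k"
    unfolding dbar_def vec_lambda_beta
  proof (rule dzbar_cong[OF U])
    fix z assume "z \<in> ?U"
    then have "snd c (cinv c z) = z" by (rule image_IntD(2)[OF c])
    then show "trace (chern_connection p t h c j z) = conn_trace t h c (cinv c z) $ j" by (simp add: conn_trace_def)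
  qed
  finally show ?thesis .
qed

text \<open>The entries of \<open>(\<partial>H) H^-1\<close> are sums of smooth functions times
  derivatives \<open>dz\<close> of smooth functions, and such products obey the transformation rule
  of (1,0)-forms.\<close>

lemma form10_connection:
  assumes h: "hermitian_metric A p T h" and t: "t \<in> T"
  shows "form10_on A (fst t) (\<lambda>c x. \<chi> j. chern_connection p t h c j (snd c x) $ \<kappa> $ \<mu>)"
proof -
  have V: "open (fst t)" by (rule triv_open[OF t])
  let ?w = "\<lambda>\<nu> c x. matrix_inv (gram p t h x) $ \<nu> $ \<mu> *s (\<chi> j. dz j (\<lambda>z. gram p t h (cinv c z) $ \<kappa> $ \<nu>) (snd c x))"
  have "form10_on A (fst t) (?w \<nu>)" for \<nu>
  proof (intro form10_scale form10_dz V)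
    show "smooth_fun A (fst t) (\<lambda>x. gram p t h x $ \<kappa> $ \<nu>)"
      unfolding smooth_fun_def using smooth_matD[OF smooth_gram[OF h t]] by blast
    have "smooth_mat (snd c ` (fst c \<inter> fst t)) (\<lambda>z. matrix_inv (gram p t h (cinv c z)))" if "c \<in> A" for c
      by (intro smooth_mat_inv open_image_Int smooth_gram gram_det_chart that V h t)
    then show "smooth_fun A (fst t) (\<lambda>x. matrix_inv (gram p t h x) $ \<nu> $ \<mu>)"
      unfolding smooth_fun_def smooth_mat_def by blast
  qed
  then have w: "form10_on A (fst t) (\<lambda>c x. \<Sum>\<nu>\<in>UNIV. ?w \<nu> c x)" by (intro form10_sum V)
  have eq: "chern_connection p t h c j (snd c x) $ \<kappa> $ \<mu> = (\<Sum>\<nu>\<in>UNIV. ?w \<nu> c x) $ j" if "c \<in> A" "x \<in> fst c" for c x j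
    by (simp add: chern_connection_def matrix_matrix_mult_def sum_component chart_inv[OF that] mult.commute)
  show ?thesis
    unfolding form10_on_def
  proof (intro conjI ballI allI)
    fix c j assume c: "c \<in> A"
    show "smooth_on (snd c ` (fst c \<inter> fst t)) (\<lambda>z. (\<chi> j. chern_connection p t h c j (snd c (cinv c z)) $ \<kappa> $ \<mu>) $ j)"
    proof (rule smooth_on_cong_imp[OF open_image_Int[OF c V] _ form10_smooth[OF w c]])
      fix z assume "z \<in> snd c ` (fst c \<inter> fst t)"
      from image_IntD(1)[OF c this] have "cinv c z \<in> fst c" by simp
      from eq[OF c this] show "(\<Sum>\<nu>\<in>UNIV. ?w \<nu> c (cinv c z)) $ j = (\<chi> j. chern_connection p t h c j (snd c (cinv c z)) $ \<kappa> $ \<mu>) $ j"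
        unfolding vec_lambda_beta by (rule sym)
    qed
    fix d x assume d: "d \<in> A" "x \<in> fst c \<inter> fst d \<inter> fst t"
    then have "x \<in> fst c" "x \<in> fst d" by auto
    then show "(\<chi> j. chern_connection p t h c j (snd c x) $ \<kappa> $ \<mu>) $ j = (\<Sum>l\<in>UNIV. (\<chi> j. chern_connection p t h d j (snd d x) $ \<kappa> $ \<mu>) $ l * jac c d x $ l $ j)"
      unfolding vec_lambda_beta using eq[OF c] eq[OF d(1)] form10_trans[OF w c d, of j] by (simp only:)
  qed
qed

lemma form10_conn_trace:
  assumes h: "hermitian_metric A p T h" and t: "t \<in> T"
  shows "form10_on A (fst t) (conn_trace t h)"
proof -
  have "conn_trace t h = (\<lambda>c x. \<Sum>\<kappa>\<in>UNIV. \<chi> j. chern_connection p t h c j (snd c x) $ \<kappa> $ \<kappa>)"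
    by (simp add: conn_trace_def fun_eq_iff vec_eq_iff sum_component trace_def)
  then show ?thesis using form10_sum[OF triv_open[OF t] form10_connection[OF h t]] by simp
qed

lemma form11_curvature:
  assumes h: "hermitian_metric A p T h" and t: "t \<in> T"
  shows "form11_on A (fst t) (\<lambda>c x. \<chi> j k. (-1) * dbar (\<lambda>c x. \<chi> j. chern_connection p t h c j (snd c x) $ \<kappa> $ \<mu>) c x $ j $ k)"
  by (intro form11_cmult form11_dbar triv_open form10_connection h t)

lemma curvature_dbar:
  assumes h: "hermitian_metric A p T h" and t: "t \<in> T" and c: "c \<in> A" and x: "x \<in> fst c" "x \<in> fst t"
  shows "curvature_matrix p t h c x j k $ \<kappa> $ \<mu> = (-1) * dbar (\<lambda>c x. \<chi> j. chern_connection p t h c j (snd c x) $ \<kappa> $ \<mu>) c x $ j $ k"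
proof -
  let ?U = "snd c ` (fst c \<inter> fst t)"
  have U: "open ?U" "snd c x \<in> ?U" using open_image_Int[OF c triv_open[OF t]] x by auto
  have "dzbar k (\<lambda>z. chern_connection p t h c j z $ \<kappa> $ \<mu>) (snd c x) = dzbar k (\<lambda>z. chern_connection p t h c j (snd c (cinv c z)) $ \<kappa> $ \<mu>) (snd c x)"
    by (rule dzbar_cong[OF U]) (simp add: image_IntD(2)[OF c])
  then show ?thesis by (simp add: curvature_matrix_def dbar_def)
qed

lemma curvature_smooth:
  assumes h: "hermitian_metric A p T h" and t: "t \<in> T" and c: "c \<in> A"
  shows "smooth_on (snd c ` (fst c \<inter> fst t)) (\<lambda>z. curvature_matrix p t h c (cinv c z) j k $ \<kappa> $ \<mu>)"
proof (rule smooth_on_cong_imp[OF open_image_Int[OF c triv_open[OF t]] _ form11_smooth[OF form11_curvature[OF h t] c]])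
  fix z assume "z \<in> snd c ` (fst c \<inter> fst t)"
  from image_IntD(1)[OF c this] have "cinv c z \<in> fst c" "cinv c z \<in> fst t" by auto
  from curvature_dbar[OF h t c this]
  show "(\<chi> j k. (-1) * dbar (\<lambda>c x. \<chi> j. chern_connection p t h c j (snd c x) $ \<kappa> $ \<mu>) c (cinv c z) $ j $ k) $ j $ k = curvature_matrix p t h c (cinv c z) j k $ \<kappa> $ \<mu>"
    by simp
qed

lemma curvature_chart:
  assumes h: "hermitian_metric A p T h" and t: "t \<in> T" and c: "c \<in> A" "d \<in> A" and x: "x \<in> fst c" "x \<in> fst d" "x \<in> fst t"
  shows "curvature_matrix p t h c x j k $ \<kappa> $ \<mu> =
    (\<Sum>l\<in>UNIV. \<Sum>m\<in>UNIV. curvature_matrix p t h d x l m $ \<kappa> $ \<mu> * jac c d x $ l $ j * cnj (jac c d x $ m $ k))"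
proof -
  have "x \<in> fst c \<inter> fst d \<inter> fst t" using x by blast
  from form11_trans[OF form11_curvature[OF h t] c this]
  show ?thesis unfolding curvature_dbar[OF h t c(1) x(1,3)] curvature_dbar[OF h t c(2) x(2,3)] by simp
qed

lemma form11_curv_trace:
  assumes h: "hermitian_metric A p T h"
  shows "form11 A (curv_trace h)"
proof (rule form11_local)
  fix x
  let ?t = "triv_at T x"
  show "\<exists>V b. open V \<and> x \<in> V \<and> form11_on A V b \<and> (\<forall>c\<in>A. \<forall>y\<in>fst c \<inter> V. curv_trace h c y = b c y)"
  proof (intro exI conjI ballI)
    show "open (fst ?t)" "x \<in> fst ?t" by (rule triv_open[OF triv_at(1)] triv_at)+
    show "form11_on A (fst ?t) (\<lambda>c x. \<chi> j k. (-1) * dbar (conn_trace ?t h) c x $ j $ k)"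
      by (intro form11_cmult form11_dbar triv_open form10_conn_trace h triv_at)
    fix c y assume "c \<in> A" "y \<in> fst c \<inter> fst ?t"
    then show "curv_trace h c y = (\<chi> j k. (-1) * dbar (conn_trace ?t h) c y $ j $ k)"
      by (simp add: vec_eq_iff curv_trace_dbar[OF h triv_at(1)])
  qed
qed

lemma dbar_closed_curv_trace:
  assumes h: "hermitian_metric A p T h"
  shows "dbar_closed A (curv_trace h)"
  unfolding dbar_closed_def
proof (intro ballI allI)
  fix c z i j k assume c: "c \<in> A" and z: "z \<in> snd c ` fst c"
  let ?t = "triv_at T (cinv c z)"
  let ?U = "snd c ` (fst c \<inter> fst ?t)" and ?W = "\<lambda>j z. trace (chern_connection p ?t h c j z)"
  have t: "?t \<in> T" by (rule triv_at)
  have U: "open ?U" "z \<in> ?U" using open_image_Int[OF c triv_open[OF t]] image_IntI[OF c z triv_at(2)] by auto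
  have W: "smooth_on ?U (?W j)" for j by (intro smooth_on_trace U smooth_chern_connection h t c)
  have eq: "curv_trace h c (cinv c w) $ j $ k = - dzbar k (?W j) w" if w: "w \<in> ?U" for w j k
  proof -
    note D = image_IntD[OF c w]
    have "curv_trace h c (cinv c w) $ j $ k = trace (curvature_matrix p ?t h c (cinv c w) j k)"
      by (rule curv_trace_local[OF h t c]) (use D(1) in auto)
    also have "\<dots> = - trace (mat_deriv (dzbar k) (chern_connection p ?t h c j) w)"
      unfolding curvature_conn D(2) by (simp add: trace_def sum_negf)
    finally show ?thesis unfolding trace_mat_dzbar[OF smooth_chern_connection[OF h t c] w] .
  qed
  have "dzbar i (\<lambda>z. curv_trace h c (cinv c z) $ j $ k) z = - dzbar i (dzbar k (?W j)) z" for i j k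
  proof -
    have "dzbar i (\<lambda>z. curv_trace h c (cinv c z) $ j $ k) z = dzbar i (\<lambda>z. - dzbar k (?W j) z) z"
      by (rule dzbar_cong[OF U eq])
    also have "\<dots> = - dzbar i (dzbar k (?W j)) z"
      by (rule dzbar_minus[OF smooth_on_differentiable[OF smooth_on_dzbar[OF U(1) W] U(2)]])
    finally show ?thesis .
  qed
  then show "dzbar i (\<lambda>z. curv_trace h c (cinv c z) $ j $ k) z = dzbar k (\<lambda>z. curv_trace h c (cinv c z) $ j $ i) z"
    using dzbar_commute[OF U(1) W U(2)] by simp
qed

text \<open>A change of frame adds to the trace of the connection a term that depends on
  \<open>a\<close> only, the same for both metrics. So the difference of the traces is independent
  of the trivialization and defines a global form.\<close>

lemma conn_trace_change:
  assumes h: "hermitian_metric A p T h" "hermitian_metric A p T h'" and ts: "t \<in> T" "s \<in> T"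
    and c: "c \<in> A" and x: "x \<in> fst c" "x \<in> fst t" "x \<in> fst s"
  shows "conn_trace t h c x - conn_trace t h' c x = conn_trace s h c x - conn_trace s h' c x"
proof -
  let ?U = "snd c ` (fst c \<inter> (fst t \<inter> fst s))"
  obtain a where a: "holo_mat ?U a" "\<And>z. z \<in> ?U \<Longrightarrow> det (a z) \<noteq> 0"
    and H: "\<And>h z. hermitian_metric A p T h \<Longrightarrow> z \<in> ?U \<Longrightarrow> gram p t h (cinv c z) = a z ** gram p s h (cinv c z) ** adj (a z)"
    using frame_change[OF ts c] by metis
  have U: "open ?U" by (intro open_image_Int c open_Int triv_open ts)
  have z: "snd c x \<in> ?U" using x by simp
  have sub: "?U \<subseteq> snd c ` (fst c \<inter> fst s)" by blast
  have "conn_trace t h c x $ j = trace (mat_deriv (dz j) a (snd c x) ** matrix_inv (a (snd c x))) + conn_trace s h c x $ j"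
    if h: "hermitian_metric A p T h" for h j
  proof -
    have "chern_connection p t h c j (snd c x) = mat_deriv (dz j) a (snd c x) ** matrix_inv (a (snd c x)) +
        a (snd c x) ** chern_connection p s h c j (snd c x) ** matrix_inv (a (snd c x))"
      unfolding chern_connection_conn
      by (rule conn_change[OF U a smooth_mat_subset[OF smooth_gram[OF h ts(2) c] sub] gram_det_chart[OF h ts(2) c subsetD[OF sub]] H[OF h] z])
    then show ?thesis
      by (simp add: conn_trace_def trace_add trace_similar matrix_inv_left a(2)[OF z])
  qed
  then show ?thesis using h by (simp add: vec_eq_iff)
qed

lemma curv_trace_metric_change:
  assumes h: "hermitian_metric A p T h" "hermitian_metric A p T h'"
  shows "\<exists>w. form10_on A UNIV w \<and> (\<forall>c\<in>A. \<forall>x\<in>fst c. curv_trace h' c x = curv_trace h c x + dbar w c x)"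
proof -
  define w where "w c x = conn_trace (triv_at T x) h c x - conn_trace (triv_at T x) h' c x" for c x
  have wt: "w c x = conn_trace t h c x - conn_trace t h' c x" if "t \<in> T" "c \<in> A" "x \<in> fst c" "x \<in> fst t" for c x t
    unfolding w_def by (rule conn_trace_change[OF h triv_at(1) that(1-3) triv_at(2) that(4)])
  have d10: "form10_on A (fst t) (\<lambda>c x. conn_trace t h c x - conn_trace t h' c x)" if "t \<in> T" for t
    by (intro form10_diff triv_open form10_conn_trace that h)
  have "form10_on A UNIV w"
  proof (rule form10_local)
    fix x
    let ?t = "triv_at T x"
    show "\<exists>V b. open V \<and> x \<in> V \<and> form10_on A V b \<and> (\<forall>c\<in>A. \<forall>y\<in>fst c \<inter> V. w c y = b c y)"
    proof (intro exI conjI ballI)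
      show "open (fst ?t)" "x \<in> fst ?t" by (rule triv_open[OF triv_at(1)] triv_at)+
      show "form10_on A (fst ?t) (\<lambda>c x. conn_trace ?t h c x - conn_trace ?t h' c x)"
        by (rule d10[OF triv_at(1)])
      fix c y assume "c \<in> A" "y \<in> fst c \<inter> fst ?t"
      then show "w c y = conn_trace ?t h c y - conn_trace ?t h' c y" using wt[OF triv_at(1)] by blast
    qed
  qed
  moreover have "curv_trace h' c x = curv_trace h c x + dbar w c x" if c: "c \<in> A" and x: "x \<in> fst c" for c x
  proof -
    let ?t = "triv_at T x"
    let ?U = "snd c ` (fst c \<inter> fst ?t)"
    have t: "?t \<in> T" by (rule triv_at)
    have U: "open ?U" "snd c x \<in> ?U" using open_image_Int[OF c triv_open[OF t]] triv_at(2)[of x] x by auto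
    have "dbar w c x $ j $ k = dbar (conn_trace ?t h) c x $ j $ k - dbar (conn_trace ?t h') c x $ j $ k" for j k
    proof -
      have "dbar w c x $ j $ k = dzbar k (\<lambda>z. conn_trace ?t h c (cinv c z) $ j - conn_trace ?t h' c (cinv c z) $ j) (snd c x)"
        unfolding dbar_def vec_lambda_beta
      proof (rule dzbar_cong[OF U])
        fix z assume "z \<in> ?U"
        from image_IntD(1)[OF c this] wt[OF t c, of "cinv c z"]
        show "w c (cinv c z) $ j = conn_trace ?t h c (cinv c z) $ j - conn_trace ?t h' c (cinv c z) $ j" by simp
      qed
      also have "\<dots> = dbar (conn_trace ?t h) c x $ j $ k - dbar (conn_trace ?t h') c x $ j $ k"
        unfolding dbar_def vec_lambda_beta
        by (intro dzbar_diff smooth_on_differentiable[OF form10_smooth[OF form10_conn_trace[OF h(1) t] c] U(2)]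
            smooth_on_differentiable[OF form10_smooth[OF form10_conn_trace[OF h(2) t] c] U(2)])
      finally show ?thesis .
    qed
    then show ?thesis
      by (simp add: vec_eq_iff curv_trace_dbar[OF h(1) t c x triv_at(2)] curv_trace_dbar[OF h(2) t c x triv_at(2)])
  qed
  ultimately show ?thesis by blast
qed

end

section \<open>The functionals in terms of curvature coefficients\<close>

text \<open>The functionals as functions of the coefficients alone, where the pointwise inequalities
  live. In the Griffiths case \<open>top_power_eq_det\<close> has removed the factorial.\<close>

primrec coeff_Phi :: "positivity \<Rightarrow> ('n::finite \<Rightarrow> 'n \<Rightarrow> 'r::finite \<Rightarrow> 'r \<Rightarrow> complex) \<Rightarrow> real" where
  "coeff_Phi Nakano q = Re (det (coeff_matrix q)) powr (1 / CARD('r))"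
| "coeff_Phi Dual_Nakano q = Re (det (coeff_matrix (\<lambda>j k \<kappa> \<mu>. q j k \<mu> \<kappa>))) powr (1 / CARD('r))"
| "coeff_Phi Griffiths q = (INF w\<in>{w::complex^'r. (\<Sum>\<kappa>\<in>UNIV. (norm (w $ \<kappa>))\<^sup>2) = 1}. Re (det (coeff_at q w)))"

lemma coeff_trace_swap: "coeff_trace (\<lambda>j k \<kappa> \<mu>. q j k \<mu> \<kappa>) = coeff_trace q"
  by (simp add: coeff_trace_def)

lemma scalar_coeffs_swap: "scalar_coeffs (\<lambda>j k \<kappa> \<mu>. q j k \<mu> \<kappa>) \<alpha> \<longleftrightarrow> scalar_coeffs q \<alpha>"
  unfolding scalar_coeffs_def by metis

text \<open>Positivity bounds the values below; this is what makes the infimum a lower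
  bound.\<close>

lemma Griffiths_lower:
  fixes q :: "'n::finite \<Rightarrow> 'n \<Rightarrow> 'r::finite \<Rightarrow> 'r \<Rightarrow> complex" and v :: "complex^'r"
  assumes q: "positive_coeffs Griffiths q" and v: "(\<Sum>\<kappa>\<in>UNIV. (norm (v $ \<kappa>))\<^sup>2) = 1"
  shows "coeff_Phi Griffiths q \<le> Re (det (coeff_at q v))"
  unfolding coeff_Phi.simps
proof (rule cINF_lower)
  show "bdd_below ((\<lambda>w. Re (det (coeff_at q w))) ` {w. (\<Sum>\<kappa>\<in>UNIV. (norm (w $ \<kappa>))\<^sup>2) = 1})"
  proof (rule bdd_belowI2)
    fix w :: "complex^'r" assume "w \<in> {w. (\<Sum>\<kappa>\<in>UNIV. (norm (w $ \<kappa>))\<^sup>2) = 1}"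
    then have "w \<noteq> 0" by auto
    then have "0 < det (coeff_at q w)" using q posdef_det unfolding positive_Griffiths_iff by blast
    then show "0 \<le> Re (det (coeff_at q w))" by (simp add: pos_complex_iff)
  qed
qed (use v in simp)

lemma coeff_Phi_bound:
  fixes q :: "'n::finite \<Rightarrow> 'n \<Rightarrow> 'r::finite \<Rightarrow> 'r \<Rightarrow> complex"
  assumes q: "positive_coeffs P q"
  defines "\<alpha> \<equiv> scaled (coeff_trace q) TYPE('r)"
  shows "coeff_Phi P q \<le> Re (det \<alpha>) \<and> (coeff_Phi P q = Re (det \<alpha>) \<longrightarrow> scalar_coeffs q \<alpha>)"
proof (cases P)
  case Nakano
  then show ?thesis using Nakano_det[of q] q unfolding \<alpha>_def by simp
next
  case Dual_Nakano
  have "positive_coeffs Nakano (\<lambda>j k \<kappa> \<mu>. q j k \<mu> \<kappa>)" using q[unfolded Dual_Nakano positive_Dual_Nakano_iff] .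
  note n = Nakano_det[OF this, unfolded coeff_trace_swap[of q] scalar_coeffs_swap[of q]]
  show ?thesis unfolding Dual_Nakano coeff_Phi.simps \<alpha>_def using n by blast
next
  case Griffiths
  note g = Griffiths_det[OF q[unfolded Griffiths] Griffiths_lower[OF q[unfolded Griffiths]]]
  show ?thesis unfolding Griffiths \<alpha>_def using g by blast
qed

lemma coeff_Phi_scalar:
  fixes q :: "'n::finite \<Rightarrow> 'n \<Rightarrow> 'r::finite \<Rightarrow> 'r \<Rightarrow> complex"
  assumes q: "scalar_coeffs q \<alpha>" and \<alpha>: "posdef \<alpha>"
  shows "coeff_Phi P q = Re (det \<alpha>)"
proof (cases P)
  case Nakano
  then show ?thesis using scalar_coeffs_det[OF q \<alpha>] by simp
next
  case Dual_Nakano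
  then show ?thesis using scalar_coeffs_det[of "\<lambda>j k \<kappa> \<mu>. q j k \<mu> \<kappa>" \<alpha>] q \<alpha> by (simp add: scalar_coeffs_swap[of q])
next
  case Griffiths
  \<comment> \<open>Any fibre index: its basis vector shows the unit sphere to be nonempty, so the
    infimum of a constant is that constant.\<close>
  obtain \<nu> :: 'r where True by blast
  have "(\<Sum>\<kappa>\<in>UNIV. (norm ((axis \<nu> 1 :: complex^'r) $ \<kappa>))\<^sup>2) = (\<Sum>\<kappa>\<in>UNIV. if \<kappa> = \<nu> then 1 else 0)"
    by (intro sum.cong) (auto simp: axis_def)
  then have ne: "{w::complex^'r. (\<Sum>\<kappa>\<in>UNIV. (norm (w $ \<kappa>))\<^sup>2) = 1} \<noteq> {}" by auto
  have "coeff_at q w = \<alpha>" if "w \<in> {w::complex^'r. (\<Sum>\<kappa>\<in>UNIV. (norm (w $ \<kappa>))\<^sup>2) = 1}" for w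
    using that by (simp add: scalar_coeffs_at[OF q] vec_eq_iff)
  then have "coeff_Phi Griffiths q = (INF w\<in>{w::complex^'r. (\<Sum>\<kappa>\<in>UNIV. (norm (w $ \<kappa>))\<^sup>2) = 1}. Re (det \<alpha>))"
    unfolding coeff_Phi.simps by (intro INF_cong) auto
  then show ?thesis using Griffiths cINF_const[OF ne] by simp
qed

section \<open>Curvature coefficients in orthonormal frames\<close>

lemma sesq_rows: "sesq M (E $ \<kappa>) (F $ \<mu>) = (E ** M ** adj F) $ \<kappa> $ \<mu>"
proof -
  have "sesq M (E $ \<kappa>) (F $ \<mu>) = (\<Sum>b\<in>UNIV. \<Sum>a\<in>UNIV. M $ a $ b * E $ \<kappa> $ a * cnj (F $ \<mu> $ b))"
    unfolding sesq_def by (rule sum.swap)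
  then show ?thesis by (simp add: matrix_matrix_mult_def adj_def sum_distrib_left mult.commute mult.left_commute)
qed

lemma sesq_sum_left: "finite I \<Longrightarrow> sesq M (\<Sum>i\<in>I. u i) v = (\<Sum>i\<in>I. sesq M (u i) v)"
  by (induction I rule: finite_induct) (simp_all add: sesq_add_left)

lemma sesq_sum_right: "finite I \<Longrightarrow> sesq M v (\<Sum>i\<in>I. u i) = (\<Sum>i\<in>I. sesq M v (u i))"
  by (induction I rule: finite_induct) (simp_all add: sesq_add_right)

lemma sesq_combination:
  "sesq M (\<Sum>\<kappa>\<in>UNIV. w $ \<kappa> *s E \<kappa>) (\<Sum>\<mu>\<in>UNIV. w $ \<mu> *s E \<mu>) =
    (\<Sum>\<kappa>\<in>UNIV. \<Sum>\<mu>\<in>UNIV. sesq M (E \<kappa>) (E \<mu>) * w $ \<kappa> * cnj (w $ \<mu>))"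
proof -
  have "sesq M (w $ \<kappa> *s E \<kappa>) (\<Sum>\<mu>\<in>UNIV. w $ \<mu> *s E \<mu>) = (\<Sum>\<mu>\<in>UNIV. sesq M (E \<kappa>) (E \<mu>) * w $ \<kappa> * cnj (w $ \<mu>))" for \<kappa>
    unfolding sesq_sum_right[OF finite] by (intro sum.cong refl) (simp add: sesq_scale_left sesq_scale_right)
  then show ?thesis unfolding sesq_sum_left[OF finite] by (intro sum.cong refl)
qed

context hol_bundle
begin

text \<open>\<open>curvature_matrix\<close> acts on coordinate rows from the right, so pairing with
  \<open>v\<close> multiplies it by the Gram matrix on the right.\<close>

lemma curv_sesq:
  fixes c :: "('x, 'n) chart"
  assumes h: "hermitian_metric A p T h" and v: "p v = x"
  defines "t \<equiv> triv_at T x"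
  shows "curv p T h c x j k u v = sesq (curvature_matrix p t h c x j k ** gram p t h x) (snd t u) (snd t v)"
proof -
  let ?C = "curvature_matrix p t h c x j k" and ?H = "gram p t h x"
  have t: "t \<in> T" "x \<in> fst t" unfolding t_def by (rule triv_at)+
  have hv: "h (frame p t x \<mu>) v = (\<Sum>b\<in>UNIV. ?H $ \<mu> $ b * cnj (snd t v $ b))" for \<mu>
  proof -
    have "h (frame p t x \<mu>) v = sesq ?H (axis \<mu> 1) (snd t v)"
      using gram_sesq[OF h t(1), of "frame p t x \<mu>" v] t v by (simp add: frame)
    also have "\<dots> = (\<Sum>a\<in>UNIV. if a = \<mu> then \<Sum>b\<in>UNIV. ?H $ a $ b * cnj (snd t v $ b) else 0)"
      unfolding sesq_def by (intro sum.cong refl) (simp add: axis_def)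
    finally show ?thesis by simp
  qed
  have "curv p T h c x j k u v = (\<Sum>\<kappa>\<in>UNIV. \<Sum>\<mu>\<in>UNIV. \<Sum>b\<in>UNIV. snd t u $ \<kappa> * ?C $ \<kappa> $ \<mu> * (?H $ \<mu> $ b * cnj (snd t v $ b)))"
    unfolding curv_def t_def[symmetric] Let_def hv by (simp add: sum_distrib_left)
  also have "\<dots> = (\<Sum>\<kappa>\<in>UNIV. \<Sum>b\<in>UNIV. \<Sum>\<mu>\<in>UNIV. snd t u $ \<kappa> * ?C $ \<kappa> $ \<mu> * (?H $ \<mu> $ b * cnj (snd t v $ b)))"
    by (intro sum.cong refl sum.swap)
  also have "\<dots> = sesq (?C ** ?H) (snd t u) (snd t v)"
    by (simp add: sesq_def matrix_matrix_mult_def sum_distrib_left sum_distrib_right mult.commute mult.left_commute)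
  finally show ?thesis .
qed

lemma orthonormal_frame_sesq:
  fixes e :: "'r \<Rightarrow> 'e"
  assumes h: "hermitian_metric A p T h" and e: "orthonormal_frame p h x e"
  shows "sesq (gram p (triv_at T x) h x) (snd (triv_at T x) (e \<kappa>)) (snd (triv_at T x) (e \<mu>)) = (if \<kappa> = \<mu> then 1 else 0)"
  using gram_sesq[OF h triv_at(1)[of x], of "e \<kappa>" "e \<mu>"] e triv_at(2)[of x] by (simp add: orthonormal_frame_def)

lemma orthonormal_frame_exists:
  assumes h: "hermitian_metric A p T h"
  shows "\<exists>e :: 'r \<Rightarrow> 'e. orthonormal_frame p h x e"
proof -
  let ?t = "triv_at T x"
  obtain E :: "'r \<Rightarrow> complex^'r" where E: "\<And>\<kappa> \<mu>. sesq (gram p ?t h x) (E \<kappa>) (E \<mu>) = (if \<kappa> = \<mu> then 1 else 0)"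
    using orthonormal_exists[OF gram_posdef[OF h triv_at]] by metis
  have "\<exists>u. p u = x \<and> snd ?t u = E \<kappa>" for \<kappa> using vector_exists[OF triv_at] by metis
  then obtain e where e: "\<And>\<kappa>. p (e \<kappa>) = x" "\<And>\<kappa>. snd ?t (e \<kappa>) = E \<kappa>" by metis
  have "h (e \<kappa>) (e \<mu>) = (if \<kappa> = \<mu> then 1 else 0)" for \<kappa> \<mu>
    using gram_sesq[OF h triv_at(1)[of x], of "e \<kappa>" "e \<mu>"] e triv_at(2)[of x] E[of \<kappa> \<mu>] by simp
  then show ?thesis using e(1) unfolding orthonormal_frame_def by blast
qed

text \<open>For the Gram matrix \<open>H\<close> and the matrix \<open>E\<close> of frame
  coordinates, orthonormality reads \<open>E ** H ** adj E = mat 1\<close>, so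
  \<open>H ** adj E\<close> inverts \<open>E\<close>. The coefficients are therefore the entries of
  a conjugate of the curvature matrix, and conjugation changes neither the trace nor the property of
  being scalar.\<close>

lemma curv_coeff_matrix:
  fixes e :: "'r \<Rightarrow> 'e"
  assumes h: "hermitian_metric A p T h" and e: "orthonormal_frame p h x e"
  defines "t \<equiv> triv_at T x"
  shows "\<exists>b. (\<chi> \<kappa>. snd t (e \<kappa>)) ** b = mat 1 \<and> b ** (\<chi> \<kappa>. snd t (e \<kappa>)) = mat 1 \<and>
    (\<forall>(c :: ('x, 'n) chart) j k \<kappa> \<mu>. curv_coeff p T h c x e j k \<kappa> \<mu> = ((\<chi> \<kappa>. snd t (e \<kappa>)) ** curvature_matrix p t h c x j k ** b) $ \<kappa> $ \<mu>)"
proof -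
  define E :: "complex^'r^'r" where "E = (\<chi> \<kappa>. snd t (e \<kappa>))"
  define b where "b = gram p t h x ** adj E"
  have E: "E $ \<kappa> = snd t (e \<kappa>)" for \<kappa> by (simp add: E_def)
  have "(E ** b) $ \<kappa> $ \<mu> = mat 1 $ \<kappa> $ \<mu>" for \<kappa> \<mu>
    using orthonormal_frame_sesq[OF h e, of \<kappa> \<mu>] sesq_rows[of "gram p t h x" E \<kappa> E \<mu>]
    unfolding E t_def[symmetric] b_def matrix_mul_assoc by (simp add: mat_def)
  then have 1: "E ** b = mat 1" by (simp add: vec_eq_iff)
  then have 2: "b ** E = mat 1" using matrix_left_right_inverse by blast
  have "curv_coeff p T h c x e j k \<kappa> \<mu> = (E ** curvature_matrix p t h c x j k ** b) $ \<kappa> $ \<mu>" for c :: "('x, 'n) chart" and j k \<kappa> \<mu>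
  proof -
    have "p (e \<mu>) = x" using e by (simp add: orthonormal_frame_def)
    then show ?thesis
      unfolding curv_coeff_def using curv_sesq[OF h, of "e \<mu>" x c j k "e \<kappa>"] sesq_rows[of "curvature_matrix p t h c x j k ** gram p t h x" E \<kappa> E \<mu>]
      unfolding E t_def[symmetric] b_def by (simp add: matrix_mul_assoc)
  qed
  with 1 2 show ?thesis unfolding E_def by blast
qed

lemma coeff_trace_curv:
  fixes e :: "'r \<Rightarrow> 'e" and c :: "('x, 'n) chart"
  assumes h: "hermitian_metric A p T h" and e: "orthonormal_frame p h x e"
  shows "coeff_trace (curv_coeff p T h c x e) = curv_trace h c x"
proof -
  let ?t = "triv_at T x"
  obtain a b where ab: "b ** a = mat 1" "\<And>j k \<kappa> \<mu>. curv_coeff p T h c x e j k \<kappa> \<mu> = (a ** curvature_matrix p ?t h c x j k ** b) $ \<kappa> $ \<mu>"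
    using curv_coeff_matrix[OF h e] by metis
  have "coeff_trace (curv_coeff p T h c x e) $ j $ k = trace (a ** curvature_matrix p ?t h c x j k ** b)" for j k
    by (simp add: coeff_trace_def ab(2) trace_def)
  then show ?thesis by (simp add: vec_eq_iff curv_trace_def trace_similar[OF ab(1)])
qed

lemma scalar_coeffs_curv:
  fixes e :: "'r \<Rightarrow> 'e" and c :: "('x, 'n) chart"
  assumes h: "hermitian_metric A p T h" and e: "orthonormal_frame p h x e"
  shows "scalar_coeffs (curv_coeff p T h c x e) \<alpha> \<longleftrightarrow> (\<forall>j k. curvature_matrix p (triv_at T x) h c x j k = mat (\<alpha> $ j $ k))"
proof -
  let ?C = "\<lambda>j k. curvature_matrix p (triv_at T x) h c x j k"
  obtain a b where ab: "a ** b = mat 1" "b ** a = mat 1" "\<And>j k \<kappa> \<mu>. curv_coeff p T h c x e j k \<kappa> \<mu> = (a ** ?C j k ** b) $ \<kappa> $ \<mu>"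
    using curv_coeff_matrix[OF h e] by metis
  have "scalar_coeffs (curv_coeff p T h c x e) \<alpha> \<longleftrightarrow> (\<forall>j k. a ** ?C j k ** b = mat (\<alpha> $ j $ k))"
    unfolding scalar_coeffs_def ab(3) by (simp add: vec_eq_iff mat_def)
  also have "\<dots> \<longleftrightarrow> (\<forall>j k. ?C j k = mat (\<alpha> $ j $ k))"
  proof -
    have "a ** M ** b = mat s \<longleftrightarrow> M = mat s" for M s
    proof
      assume "a ** M ** b = mat s"
      then have "b ** (a ** M ** b) ** a = b ** mat s ** a" by simp
      then have "(b ** a) ** M ** (b ** a) = mat s ** (b ** a)" by (simp add: matrix_mul_assoc mat_commute[symmetric])
      then show "M = mat s" using ab(2) by simp
    next
      assume "M = mat s"
      then have "a ** M ** b = mat s ** (a ** b)" by (simp add: matrix_mul_assoc mat_commute[symmetric])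
      then show "a ** M ** b = mat s" using ab(1) by simp
    qed
    then show ?thesis by simp
  qed
  finally show ?thesis .
qed

lemma curv_combination:
  fixes e :: "'r \<Rightarrow> 'e" and c :: "('x, 'n) chart"
  assumes h: "hermitian_metric A p T h" and e: "orthonormal_frame p h x e"
    and v: "p v = x" "snd (triv_at T x) v = (\<Sum>\<kappa>\<in>UNIV. w $ \<kappa> *s snd (triv_at T x) (e \<kappa>))"
  shows "curv p T h c x j k v v = coeff_at (curv_coeff p T h c x e) w $ j $ k"
    and "h v v = of_real (\<Sum>\<kappa>\<in>UNIV. (norm (w $ \<kappa>))\<^sup>2)"
proof -
  let ?t = "triv_at T x"
  have pe: "p (e \<mu>) = x" for \<mu> using e by (simp add: orthonormal_frame_def)
  show "curv p T h c x j k v v = coeff_at (curv_coeff p T h c x e) w $ j $ k"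
    unfolding curv_sesq[OF h v(1)] v(2) sesq_combination coeff_at_def vec_lambda_beta curv_coeff_def curv_sesq[OF h pe] ..
  have "h v v = sesq (gram p ?t h x) (snd ?t v) (snd ?t v)"
    using gram_sesq[OF h triv_at(1)[of x], of v v] v(1) triv_at(2)[of x] by simp
  also have "\<dots> = (\<Sum>\<kappa>\<in>UNIV. \<Sum>\<mu>\<in>UNIV. (if \<kappa> = \<mu> then 1 else 0) * w $ \<kappa> * cnj (w $ \<mu>))"
    unfolding v(2) sesq_combination orthonormal_frame_sesq[OF h e] ..
  also have "\<dots> = (\<Sum>\<kappa>\<in>UNIV. \<Sum>\<mu>\<in>UNIV. if \<kappa> = \<mu> then w $ \<mu> * cnj (w $ \<mu>) else 0)"
    by (intro sum.cong refl) simp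
  also have "\<dots> = of_real (\<Sum>\<kappa>\<in>UNIV. (norm (w $ \<kappa>))\<^sup>2)"
    by (simp add: complex_norm_square del: of_real_power)
  finally show "h v v = of_real (\<Sum>\<kappa>\<in>UNIV. (norm (w $ \<kappa>))\<^sup>2)" .
qed

text \<open>Unit vectors of the fibre are the combinations of \<open>e\<close> with coordinates on
  the unit sphere, so both infima range over the same set of matrices.\<close>

lemma Phi_Griffiths:
  fixes e :: "'r \<Rightarrow> 'e" and c :: "('x, 'n) chart"
  assumes h: "hermitian_metric A p T h" and e: "orthonormal_frame p h x e"
  shows "Phi Griffiths p T h c x = coeff_Phi Griffiths (curv_coeff p T h c x e)"
proof -
  let ?t = "triv_at T x" and ?q = "curv_coeff p T h c x e"
  let ?F = "\<lambda>v. \<chi> j k. curv p T h c x j k v v"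
  let ?S = "{w::complex^'r. (\<Sum>\<kappa>\<in>UNIV. (norm (w $ \<kappa>))\<^sup>2) = 1}"
  let ?E = "\<chi> \<kappa>. snd ?t (e \<kappa>)"
  obtain b where b: "b ** ?E = mat 1" using curv_coeff_matrix[OF h e] by blast
  have comb: "w v* ?E = (\<Sum>\<kappa>\<in>UNIV. w $ \<kappa> *s snd ?t (e \<kappa>))" for w
    by (simp add: vec_eq_iff vector_matrix_mult_def sum_component mult.commute)
  have "?F ` {v. p v = x \<and> h v v = 1} = coeff_at ?q ` ?S"
  proof (intro equalityI subsetI)
    fix M assume "M \<in> ?F ` {v. p v = x \<and> h v v = 1}"
    then obtain v where v: "p v = x" "h v v = 1" "M = ?F v" by blast
    define w where "w = snd ?t v v* b"
    have "snd ?t v = w v* ?E" unfolding w_def vector_matrix_mul_assoc b by simp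
    note c = curv_combination[OF h e v(1) this[unfolded comb]]
    have "complex_of_real (\<Sum>\<kappa>\<in>UNIV. (norm (w $ \<kappa>))\<^sup>2) = 1" using c(2) v(2) by simp
    then have "(\<Sum>\<kappa>\<in>UNIV. (norm (w $ \<kappa>))\<^sup>2) = 1" by (simp only: of_real_eq_1_iff)
    moreover have "M = coeff_at ?q w" unfolding v(3) vec_eq_iff vec_lambda_beta using c(1) by blast
    ultimately show "M \<in> coeff_at ?q ` ?S" by blast
  next
    fix M assume "M \<in> coeff_at ?q ` ?S"
    then obtain w where w: "(\<Sum>\<kappa>\<in>UNIV. (norm (w $ \<kappa>))\<^sup>2) = 1" "M = coeff_at ?q w" by blast
    obtain v where v: "p v = x" "snd ?t v = (\<Sum>\<kappa>\<in>UNIV. w $ \<kappa> *s snd ?t (e \<kappa>))" using vector_exists[OF triv_at] by metis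
    note c = curv_combination[OF h e v]
    have "M = ?F v" unfolding w(2) vec_eq_iff vec_lambda_beta using c(1) by simp
    moreover have "h v v = 1" using c(2) w(1) by simp
    ultimately show "M \<in> ?F ` {v. p v = x \<and> h v v = 1}" using v(1) by blast
  qed
  from arg_cong[OF this, of "\<lambda>X. Inf ((\<lambda>M. Re (det M)) ` X)"] show ?thesis
    by (simp add: image_image top_power_eq_det)
qed

text \<open>In the two Nakano cases the witness has to be the frame chosen by \<open>SOME\<close>;
  the Griffiths functional agrees in every orthonormal frame.\<close>

lemma Phi_coeff_Phi:
  fixes c :: "('x, 'n) chart"
  assumes h: "hermitian_metric A p T h"
  shows "\<exists>e :: 'r \<Rightarrow> 'e. orthonormal_frame p h x e \<and> Phi P p T h c x = coeff_Phi P (curv_coeff p T h c x e)"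
proof (intro exI conjI)
  let ?e = "SOME e :: 'r \<Rightarrow> 'e. orthonormal_frame p h x e"
  show e: "orthonormal_frame p h x ?e" by (rule someI_ex[OF orthonormal_frame_exists[OF h]])
  show "Phi P p T h c x = coeff_Phi P (curv_coeff p T h c x ?e)"
    using Phi_Griffiths[OF h e] by (cases P) (simp_all add: Let_def coeff_matrix_def)
qed

definition bound_density :: "('e \<Rightarrow> 'e \<Rightarrow> complex) \<Rightarrow> ('x, 'n) chart \<Rightarrow> 'x \<Rightarrow> real" where
  "bound_density h c x = Re (det (scaled (curv_trace h c x) TYPE('r)))"

lemma Phi_bound:
  fixes c :: "('x, 'n) chart"
  assumes pos: "positive_metric P A p T h" and c: "c \<in> A" "x \<in> fst c"
  shows "posdef (curv_trace h c x)" and "Phi P p T h c x \<le> bound_density h c x"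
    and "Phi P p T h c x = bound_density h c x \<Longrightarrow>
      curvature_matrix p (triv_at T x) h c x j k = mat (scaled (curv_trace h c x) TYPE('r) $ j $ k)"
proof -
  have h: "hermitian_metric A p T h" using pos by (simp add: positive_metric_def)
  obtain e :: "'r \<Rightarrow> 'e" where e: "orthonormal_frame p h x e" "Phi P p T h c x = coeff_Phi P (curv_coeff p T h c x e)"
    using Phi_coeff_Phi[OF h] by blast
  have q: "positive_coeffs P (curv_coeff p T h c x e)"
    using pos c e(1) by (simp add: positive_metric_def)
  show "posdef (curv_trace h c x)" using posdef_coeff_trace[OF q] unfolding coeff_trace_curv[OF h e(1)] .
  note b = coeff_Phi_bound[OF q, unfolded coeff_trace_curv[OF h e(1)] scalar_coeffs_curv[OF h e(1)], folded e(2) bound_density_def]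
  show "Phi P p T h c x \<le> bound_density h c x" using b by blast
  show "curvature_matrix p (triv_at T x) h c x j k = mat (scaled (curv_trace h c x) TYPE('r) $ j $ k)"
    if "Phi P p T h c x = bound_density h c x" using b that by blast
qed

lemma scalar_curvature_Phi:
  fixes c :: "('x, 'n) chart"
  assumes h: "hermitian_metric A p T h"
    and C: "\<And>j k. curvature_matrix p (triv_at T x) h c x j k = mat (\<alpha> $ j $ k)" and \<alpha>: "posdef \<alpha>"
  shows "orthonormal_frame p h x (e :: 'r \<Rightarrow> 'e) \<Longrightarrow> positive_coeffs P (curv_coeff p T h c x e)"
    and "Phi P p T h c x = Re (det \<alpha>)"
proof -
  have s: "scalar_coeffs (curv_coeff p T h c x e) \<alpha>" if "orthonormal_frame p h x e" for e :: "'r \<Rightarrow> 'e"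
    using C by (simp add: scalar_coeffs_curv[OF h that])
  then show "orthonormal_frame p h x e \<Longrightarrow> positive_coeffs P (curv_coeff p T h c x e)"
    by (rule scalar_coeffs_positive[OF _ \<alpha>])
  obtain e :: "'r \<Rightarrow> 'e" where e: "orthonormal_frame p h x e" "Phi P p T h c x = coeff_Phi P (curv_coeff p T h c x e)"
    using Phi_coeff_Phi[OF h] by blast
  show "Phi P p T h c x = Re (det \<alpha>)" unfolding e(2) by (rule coeff_Phi_scalar[OF s[OF e(1)] \<alpha>])
qed

end

lemma det_scaled:
  fixes S :: "complex^'n^'n"
  shows "det (scaled S TYPE('r::finite)) = det S / of_nat CARD('r) ^ CARD('n)"
proof -
  have "scaled S TYPE('r) = (\<chi> j. (1 / of_nat CARD('r)) *s S $ j)" by (simp add: scaled_def vec_eq_iff)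
  then show ?thesis by (simp add: det_rows_mul power_inverse divide_inverse)
qed

lemma Re_of_real_mult: "Re (complex_of_real a * z) = a * Re z"
  by simp

section \<open>Comparison of integrals\<close>

text \<open>The set where a continuous function is nonzero is open in the open set \<open>W\<close>,
  and a nonempty open set is not negligible.\<close>

lemma continuous_AE_zero:
  fixes g :: "complex^'n \<Rightarrow> complex"
  assumes W: "open W" and g: "continuous_on W g" and ae: "AE z in lborel. z \<in> W \<longrightarrow> g z = 0" and z: "z \<in> W"
  shows "g z = 0"
proof (rule ccontr)
  assume nz: "g z \<noteq> 0"
  let ?V = "W \<inter> g -` (- {0})"
  have V: "open ?V" by (rule continuous_open_preimage[OF g W]) auto
  have "AE z in lborel. z \<notin> ?V" using ae by eventually_elim auto
  then have "?V \<in> null_sets lborel" using V by (subst AE_iff_null_sets) auto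
  then have "negligible ?V" unfolding negligible_iff_null_sets by (rule null_sets_completionI)
  moreover have "?V \<noteq> {}" using z nz by auto
  ultimately show False using open_not_negligible[OF V] by blast
qed

context compact_cmfd
begin

lemma form_integral_cong:
  assumes "\<And>c x. c \<in> A \<Longrightarrow> x \<in> fst c \<Longrightarrow> \<omega> c x = \<omega>' c x"
  shows "form_integral A \<omega> = form_integral A \<omega>'"
proof -
  obtain C \<rho> where PI: "partition_of_unity A C \<rho> \<and> (\<forall>\<omega>. form_integral A \<omega> = (\<Sum>c\<in>C. LINT z:(snd c ` fst c)|lborel. 2 ^ CARD('n) * (\<rho> c (cinv c z) * \<omega> c (cinv c z))))"
    using form_integral_partition by (elim exE)
  have C: "C \<subseteq> A" using PI by (simp add: partition_of_unity_def)
  show ?thesis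
    unfolding spec[OF conjunct2[OF PI]]
  proof (intro sum.cong refl)
    fix c assume "c \<in> C"
    then have c: "c \<in> A" using C by blast
    show "(LINT z:(snd c ` fst c)|lborel. 2 ^ CARD('n) * (\<rho> c (cinv c z) * \<omega> c (cinv c z))) =
      (LINT z:(snd c ` fst c)|lborel. 2 ^ CARD('n) * (\<rho> c (cinv c z) * \<omega>' c (cinv c z)))"
      by (rule set_lebesgue_integral_cong) (use open_image[OF c] assms[OF c inv_in] in auto)
  qed
qed

lemma form_integral_cmult: "form_integral A (\<lambda>c x. k * \<omega> c x) = k * form_integral A \<omega>"
proof -
  obtain C \<rho> where PI: "partition_of_unity A C \<rho> \<and> (\<forall>\<omega>. form_integral A \<omega> = (\<Sum>c\<in>C. LINT z:(snd c ` fst c)|lborel. 2 ^ CARD('n) * (\<rho> c (cinv c z) * \<omega> c (cinv c z))))"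
    using form_integral_partition by (elim exE)
  have "2 ^ CARD('n) * (r * (k * w)) = k * (2 ^ CARD('n) * (r * w))" for r w :: real by simp
  then show ?thesis unfolding spec[OF conjunct2[OF PI]] by (simp only: sum_distrib_left set_integral_mult_right)
qed

text \<open>\<open>\<omega>\<close> may fail to be integrable in a chart, and its integral is then 0
  by convention. Against a positive \<open>\<beta>\<close> the inequality still holds, and equality
  forces the weight of that chart to vanish almost everywhere.\<close>

lemma form_integral_le:
  fixes \<omega> \<beta> :: "('x, 'n) chart \<Rightarrow> 'x \<Rightarrow> real"
  assumes \<beta>: "\<And>c. c \<in> A \<Longrightarrow> continuous_on (snd c ` fst c) (\<lambda>z. \<beta> c (cinv c z))" "\<And>c x. c \<in> A \<Longrightarrow> x \<in> fst c \<Longrightarrow> 0 < \<beta> c x"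
    and le: "\<And>c x. c \<in> A \<Longrightarrow> x \<in> fst c \<Longrightarrow> \<omega> c x \<le> \<beta> c x"
  shows "form_integral A \<omega> \<le> form_integral A \<beta>"
    and "form_integral A \<omega> = form_integral A \<beta> \<Longrightarrow> \<exists>C \<rho>. partition_of_unity A C \<rho> \<and>
      (\<forall>c\<in>C. AE z in lborel. z \<in> snd c ` fst c \<longrightarrow> \<rho> c (cinv c z) \<noteq> 0 \<longrightarrow> \<omega> c (cinv c z) = \<beta> c (cinv c z))"
proof -
  obtain C \<rho> where PI: "partition_of_unity A C \<rho> \<and> (\<forall>\<omega>. form_integral A \<omega> = (\<Sum>c\<in>C. LINT z:(snd c ` fst c)|lborel. 2 ^ CARD('n) * (\<rho> c (cinv c z) * \<omega> c (cinv c z))))"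
    using form_integral_partition by (elim exE)
  note P = conjunct1[OF PI]
  let ?I = "\<lambda>\<omega> c. LINT z:(snd c ` fst c)|lborel. \<rho> c (cinv c z) * \<omega> c (cinv c z)"
  have I: "form_integral A \<omega> = 2 ^ CARD('n) * (\<Sum>c\<in>C. ?I \<omega> c)" for \<omega>
    unfolding spec[OF conjunct2[OF PI]] by (simp add: sum_distrib_left)
  have C: "finite C" "C \<subseteq> A" and \<rho>: "\<And>c x. c \<in> C \<Longrightarrow> 0 \<le> \<rho> c x"
    using P by (simp_all add: partition_of_unity_def)
  have *: "?I \<omega> c \<le> ?I \<beta> c \<and> (?I \<omega> c = ?I \<beta> c \<longrightarrow>
      (AE z in lborel. z \<in> snd c ` fst c \<longrightarrow> \<rho> c (cinv c z) \<noteq> 0 \<longrightarrow> \<omega> c (cinv c z) = \<beta> c (cinv c z)))" if c: "c \<in> C" for c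
  proof -
    let ?U = "snd c ` fst c"
    let ?f = "\<lambda>z. indicator ?U z *\<^sub>R (\<rho> c (cinv c z) * \<omega> c (cinv c z))" and ?g = "\<lambda>z. indicator ?U z *\<^sub>R (\<rho> c (cinv c z) * \<beta> c (cinv c z))"
    have cA: "c \<in> A" using c C by blast
    have ig: "integrable lborel ?g" using partition_integrable[OF P c \<beta>(1)[OF cA]] unfolding set_integrable_def .
    have g0: "0 \<le> ?g z" for z
      using \<rho>[OF c, of "cinv c z"] \<beta>(2)[OF cA inv_in, of z] by (cases "z \<in> ?U") (simp_all add: less_imp_le)
    have fg: "?f z \<le> ?g z" for z
      using \<rho>[OF c, of "cinv c z"] le[OF cA inv_in, of z] by (cases "z \<in> ?U") (simp_all add: mult_left_mono)
    show ?thesis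
    proof (cases "integrable lborel ?f")
      case True
      have "integral\<^sup>L lborel ?f \<le> integral\<^sup>L lborel ?g" by (rule integral_mono[OF True ig fg])
      moreover have "AE z in lborel. z \<in> ?U \<longrightarrow> \<rho> c (cinv c z) \<noteq> 0 \<longrightarrow> \<omega> c (cinv c z) = \<beta> c (cinv c z)"
        if "integral\<^sup>L lborel ?f = integral\<^sup>L lborel ?g"
      proof -
        have "integral\<^sup>L lborel (\<lambda>z. ?g z - ?f z) = 0" using that Bochner_Integration.integral_diff[OF ig True] by simp
        moreover have "AE z in lborel. 0 \<le> ?g z - ?f z" using fg by simp
        ultimately have "AE z in lborel. ?g z - ?f z = 0"
          using integral_nonneg_eq_0_iff_AE[OF Bochner_Integration.integrable_diff[OF ig True]] by blast
        then show ?thesis by eventually_elim auto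
      qed
      ultimately show ?thesis unfolding set_lebesgue_integral_def by blast
    next
      case False
      have f0: "integral\<^sup>L lborel ?f = 0" by (rule not_integrable_integral_eq[OF False])
      have "0 \<le> integral\<^sup>L lborel ?g" by (rule Bochner_Integration.integral_nonneg) (rule g0)
      moreover have "AE z in lborel. z \<in> ?U \<longrightarrow> \<rho> c (cinv c z) \<noteq> 0 \<longrightarrow> \<omega> c (cinv c z) = \<beta> c (cinv c z)"
        if "0 = integral\<^sup>L lborel ?g"
      proof -
        have "AE z in lborel. 0 \<le> ?g z" using g0 by simp
        then have "AE z in lborel. ?g z = 0" using integral_nonneg_eq_0_iff_AE[OF ig] that by simp
        then show ?thesis
        proof eventually_elim
          case (elim z)
          show ?case
          proof (intro impI)
            assume z: "z \<in> ?U" "\<rho> c (cinv c z) \<noteq> 0"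
            then show "\<omega> c (cinv c z) = \<beta> c (cinv c z)" using elim \<beta>(2)[OF cA inv_in[OF z(1)]] by simp
          qed
        qed
      qed
      ultimately show ?thesis unfolding set_lebesgue_integral_def f0 by blast
    qed
  qed
  show "form_integral A \<omega> \<le> form_integral A \<beta>"
    unfolding I using * by (intro mult_left_mono sum_mono) auto
  assume "form_integral A \<omega> = form_integral A \<beta>"
  then have "(\<Sum>c\<in>C. ?I \<omega> c) = (\<Sum>c\<in>C. ?I \<beta> c)" unfolding I by simp
  then have "?I \<omega> c = ?I \<beta> c" if "c \<in> C" for c
    using sum_mono_inv[of "?I \<omega>" C "?I \<beta>" c] * that C(1) by blast
  then show "\<exists>C \<rho>. partition_of_unity A C \<rho> \<and>
      (\<forall>c\<in>C. AE z in lborel. z \<in> snd c ` fst c \<longrightarrow> \<rho> c (cinv c z) \<noteq> 0 \<longrightarrow> \<omega> c (cinv c z) = \<beta> c (cinv c z))"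
    using P * by blast
qed

end

section \<open>The Chern number bound and projective flatness\<close>

locale compact_bundle = compact_cmfd A + hol_bundle A p T
  for A :: "('x::t2_space, 'n::finite) chart set" and p :: "'e \<Rightarrow> 'x" and T :: "('x, 'e, 'r::finite) triv set"
begin

lemma bound_density_eq: "bound_density h c x = Re (det (curv_trace h c x)) / real CARD('r) ^ CARD('n)"
proof -
  have "det (curv_trace h c x) / of_nat CARD('r) ^ CARD('n) = det (curv_trace h c x) / complex_of_real (real CARD('r) ^ CARD('n))" by simp
  then show ?thesis unfolding bound_density_def det_scaled by (simp only: Re_divide_of_real)
qed

text \<open>\<open>c1_power\<close> uses a metric chosen by \<open>SOME\<close>; Stokes' theorem
  exchanges it for \<open>h\<close>. The constants are \<open>fact CARD('n)\<close> from
  \<open>top_power\<close>, the power of \<open>2 * pi\<close> from \<open>chern_form\<close> and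
  the power of the rank from \<open>scaled\<close>.\<close>

lemma c1_bound:
  assumes h: "hermitian_metric A p T h"
  shows "1 / (fact CARD('n) * real CARD('r) ^ CARD('n)) * c1_power A p T =
    1 / (2 * pi) ^ CARD('n) * form_integral A (bound_density h)"
proof -
  define h0 where "h0 = (SOME h. hermitian_metric A p T h)"
  have h0: "hermitian_metric A p T h0" unfolding h0_def by (rule someI[of "hermitian_metric A p T", OF h])
  obtain w where w: "form10_on A UNIV w" "\<forall>c\<in>A. \<forall>x\<in>fst c. curv_trace h0 c x = curv_trace h c x + dbar w c x"
    using curv_trace_metric_change[OF h h0] by blast
  have st: "form_integral A (\<lambda>c x. Re (det (curv_trace h0 c x))) = form_integral A (\<lambda>c x. Re (det (curv_trace h c x)))"
  proof -
    have "form_integral A (\<lambda>c x. Re (det (curv_trace h0 c x))) = form_integral A (\<lambda>c x. Re (det (curv_trace h c x + dbar w c x)))"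
      by (rule form_integral_cong) (use w(2) in simp)
    also have "\<dots> = form_integral A (\<lambda>c x. Re (det (curv_trace h c x)))"
      by (rule stokes[OF form11_curv_trace[OF h] dbar_closed_curv_trace[OF h] w(1)])
    finally show ?thesis .
  qed
  have "Re (top_power (chern_form p T h0 c x)) = fact CARD('n) / (2 * pi) ^ CARD('n) * Re (det (curv_trace h0 c x))" for c :: "('x, 'n) chart" and x
  proof -
    have "chern_form p T h0 c x = (\<chi> j. (1 / (2 * of_real pi)) *s curv_trace h0 c x $ j)"
      by (simp add: chern_form_def curv_trace_def vec_eq_iff)
    then have "det (chern_form p T h0 c x) = complex_of_real (1 / (2 * pi) ^ CARD('n)) * det (curv_trace h0 c x)"
      by (simp add: det_rows_mul power_one_over)
    then have "top_power (chern_form p T h0 c x) = complex_of_real (fact CARD('n) / (2 * pi) ^ CARD('n)) * det (curv_trace h0 c x)"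
      by (simp add: top_power_eq_det)
    then show ?thesis by (simp only: Re_of_real_mult)
  qed
  then have "c1_power A p T = fact CARD('n) / (2 * pi) ^ CARD('n) * form_integral A (\<lambda>c x. Re (det (curv_trace h c x)))"
    unfolding c1_power_def h0_def[symmetric] Let_def by (simp only: form_integral_cmult st)
  moreover have "form_integral A (bound_density h) = 1 / real CARD('r) ^ CARD('n) * form_integral A (\<lambda>c x. Re (det (curv_trace h c x)))"
    unfolding form_integral_cmult[symmetric] by (rule arg_cong[of _ _ "form_integral A"]) (simp add: fun_eq_iff bound_density_eq)
  ultimately show ?thesis by simp
qed

lemma bound_density_facts:
  assumes pos: "positive_metric P A p T h" and c: "c \<in> A"
  shows "continuous_on (snd c ` fst c) (\<lambda>z. bound_density h c (cinv c z))"
    and "x \<in> fst c \<Longrightarrow> 0 < bound_density h c x"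
proof -
  have h: "hermitian_metric A p T h" using pos by (simp add: positive_metric_def)
  show "continuous_on (snd c ` fst c) (\<lambda>z. bound_density h c (cinv c z))"
    unfolding bound_density_eq
    by (intro continuous_intros form11_det_continuous form11_curv_trace h c) simp
  assume x: "x \<in> fst c"
  have "posdef (scaled (curv_trace h c x) TYPE('r))" by (rule posdef_scaled[OF Phi_bound(1)[OF pos c x]])
  from posdef_det[OF this] show "0 < bound_density h c x" by (simp add: bound_density_def pos_complex_iff)
qed

lemma MA_integral_le:
  assumes pos: "positive_metric P A p T h"
  shows "MA_integral P A p T h \<le> 1 / (fact CARD('n) * real CARD('r) ^ CARD('n)) * c1_power A p T"
proof -
  have h: "hermitian_metric A p T h" using pos by (simp add: positive_metric_def)
  have "form_integral A (Phi P p T h) \<le> form_integral A (bound_density h)"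
    by (rule form_integral_le(1)) (use bound_density_facts[OF pos] Phi_bound(2)[OF pos] in auto)
  then show ?thesis unfolding c1_bound[OF h] MA_integral_def by (intro mult_left_mono) auto
qed

text \<open>Equality of the integrals gives pointwise equality only almost everywhere, and in a
  chart only where its weight is nonzero. Every point has a chart with nonzero weight, and there
  continuity of the curvature removes the exceptional set.\<close>

lemma MA_integral_eq_flat:
  assumes pos: "positive_metric P A p T h"
    and eq: "MA_integral P A p T h = 1 / (fact CARD('n) * real CARD('r) ^ CARD('n)) * c1_power A p T"
  shows "projectively_flat A p T"
proof -
  have h: "hermitian_metric A p T h" using pos by (simp add: positive_metric_def)
  have "form_integral A (Phi P p T h) = form_integral A (bound_density h)"
    using eq unfolding c1_bound[OF h] MA_integral_def by simp
  then have "\<exists>C \<rho>. partition_of_unity A C \<rho> \<and> (\<forall>c\<in>C. AE z in lborel. z \<in> snd c ` fst c \<longrightarrow> \<rho> c (cinv c z) \<noteq> 0 \<longrightarrow>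
      Phi P p T h c (cinv c z) = bound_density h c (cinv c z))"
    by (rule form_integral_le(2)[rotated -1]) (use bound_density_facts[OF pos] Phi_bound(2)[OF pos] in auto)
  then obtain C \<rho> where P: "partition_of_unity A C \<rho>" and
    ae: "\<And>c. c \<in> C \<Longrightarrow> AE z in lborel. z \<in> snd c ` fst c \<longrightarrow> \<rho> c (cinv c z) \<noteq> 0 \<longrightarrow>
      Phi P p T h c (cinv c z) = bound_density h c (cinv c z)" by blast
  have C: "C \<subseteq> A" and sm: "\<And>c. c \<in> C \<Longrightarrow> smooth_fun A UNIV (\<rho> c)"
    and supp: "\<And>c. c \<in> C \<Longrightarrow> closure {x. \<rho> c x \<noteq> 0} \<subseteq> fst c" and one: "\<And>x. (\<Sum>c\<in>C. \<rho> c x) = 1"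
    using P by (simp_all add: partition_of_unity_def)
  let ?\<alpha> = "\<lambda>c x. scaled (curv_trace h c x) TYPE('r)"
  have flat: "curvature_matrix p (triv_at T x) h d x j k = mat (?\<alpha> d x $ j $ k)" if d: "d \<in> A" "x \<in> fst d" for d x j k
  proof -
    \<comment> \<open>Held fixed near \<open>x\<close>: at a moving point \<open>triv_at\<close> is
      an unrelated choice, and continuity would be lost.\<close>
    let ?t = "triv_at T x"
    have t: "?t \<in> T" "x \<in> fst ?t" by (rule triv_at)+
    have "(\<Sum>c\<in>C. \<rho> c x) \<noteq> 0" using one by simp
    then obtain c where c: "c \<in> C" "\<rho> c x \<noteq> 0" by (rule sum.not_neutral_contains_not_neutral)
    have cA: "c \<in> A" using c C by blast
    have xc: "x \<in> fst c" using subsetD[OF supp[OF c(1)]] subsetD[OF closure_subset, of x "{x. \<rho> c x \<noteq> 0}"] c(2) by simp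
    let ?U = "snd c ` (fst c \<inter> fst ?t)"
    have U: "open ?U" by (rule open_image_Int[OF cA triv_open[OF t(1)]])
    have Usub: "?U \<subseteq> snd c ` fst c" by blast
    have \<rho>: "continuous_on ?U (\<lambda>z. \<rho> c (cinv c z))"
      by (rule continuous_on_subset[OF smooth_fun_continuous[OF sm[OF c(1)] cA] Usub])
    define W where "W = ?U \<inter> (\<lambda>z. \<rho> c (cinv c z)) -` (- {0})"
    have W: "open W" unfolding W_def by (rule continuous_open_preimage[OF \<rho> U]) auto
    have xW: "snd c x \<in> W" unfolding W_def using xc t(2) c(2) by (simp add: chart_inv[OF cA])
    have c_flat: "curvature_matrix p ?t h c x l m $ \<kappa> $ \<mu> = (if \<kappa> = \<mu> then trace (curvature_matrix p ?t h c x l m) / of_nat CARD('r) else 0)" for l m \<kappa> \<mu>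
    proof -
      \<comment> \<open>The deviation of one entry from the scalar matrix with the same trace,
        written in entries of the curvature so that its continuity is clear.\<close>
      define g where "g z = curvature_matrix p ?t h c (cinv c z) l m $ \<kappa> $ \<mu> -
        (if \<kappa> = \<mu> then (\<Sum>\<nu>\<in>UNIV. curvature_matrix p ?t h c (cinv c z) l m $ \<nu> $ \<nu>) / of_nat CARD('r) else 0)" for z
      have cc: "continuous_on W (\<lambda>z. curvature_matrix p ?t h c (cinv c z) l m $ \<kappa> $ \<mu>)" for \<kappa> \<mu>
        by (rule continuous_on_subset[OF smooth_on_continuous[OF curvature_smooth[OF h t(1) cA]]]) (simp add: W_def)
      have "continuous_on W g"
        unfolding g_def by (cases "\<kappa> = \<mu>") (auto intro!: continuous_intros cc)
      moreover have "AE z in lborel. z \<in> W \<longrightarrow> g z = 0"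
        using ae[OF c(1)]
      proof eventually_elim
        case (elim z)
        show ?case
        proof
          assume z: "z \<in> W"
          then have zU: "z \<in> ?U" "\<rho> c (cinv c z) \<noteq> 0" by (auto simp: W_def)
          have zc: "cinv c z \<in> fst c" "cinv c z \<in> fst ?t" using image_IntD(1)[OF cA zU(1)] by auto
          have "Phi P p T h c (cinv c z) = bound_density h c (cinv c z)" using elim zU Usub by blast
          from scalar_change_triv[OF h t(1) triv_at(1) cA zc triv_at(2) Phi_bound(3)[OF pos cA zc(1) this]]
          have M: "curvature_matrix p ?t h c (cinv c z) l m = mat (?\<alpha> c (cinv c z) $ l $ m)" .
          have "trace (curvature_matrix p ?t h c (cinv c z) l m) / of_nat CARD('r) = ?\<alpha> c (cinv c z) $ l $ m"
            using scalar_matrix[OF M] by simp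
          then show "g z = 0" unfolding g_def trace_def[symmetric] unfolding M by (simp add: mat_def)
        qed
      qed
      ultimately have "g (snd c x) = 0" by (rule continuous_AE_zero[OF W _ _ xW])
      then show ?thesis unfolding g_def trace_def[symmetric] chart_inv[OF cA xc] by simp
    qed
    \<comment> \<open>The transformation rule carries the scalar from the chart \<open>c\<close>,
      chosen by its weight, to the given chart \<open>d\<close>.\<close>
    define \<beta> where "\<beta> = (\<Sum>l\<in>UNIV. \<Sum>m\<in>UNIV. trace (curvature_matrix p ?t h c x l m) / of_nat CARD('r) * jac d c x $ l $ j * cnj (jac d c x $ m $ k))"
    have "curvature_matrix p ?t h d x j k $ \<kappa> $ \<mu> = (if \<kappa> = \<mu> then \<beta> else 0)" for \<kappa> \<mu>
      unfolding curvature_chart[OF h t(1) d(1) cA d(2) xc t(2)] c_flat \<beta>_def by (cases "\<kappa> = \<mu>") simp_all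
    then have M: "curvature_matrix p ?t h d x j k = mat \<beta>" by (simp add: vec_eq_iff mat_def)
    then show ?thesis using scalar_matrix[OF M] by (simp add: scaled_def curv_trace_def)
  qed
  have "form11 A ?\<alpha>"
  proof -
    have "?\<alpha> = (\<lambda>c x. \<chi> j k. (1 / of_nat CARD('r)) * curv_trace h c x $ j $ k)" by (simp add: scaled_def fun_eq_iff)
    then show ?thesis
      unfolding form11_iff using form11_cmult[OF open_UNIV form11_curv_trace[OF h, unfolded form11_iff]] by (simp only:)
  qed
  then show ?thesis unfolding projectively_flat_def using h flat by blast
qed

section \<open>Normalizing a projectively flat metric\<close>

lemma gram_det_real:
  assumes "hermitian_metric A p T h" "t \<in> T" "x \<in> fst t"
  shows "0 < Re (det (gram p t h x))" "det (gram p t h x) = of_real (Re (det (gram p t h x)))"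
  using posdef_det[OF gram_posdef[OF assms]] by (simp_all add: pos_complex_iff complex_eq_iff)

definition det_ratio :: "('x, 'e, 'r) triv \<Rightarrow> ('e \<Rightarrow> 'e \<Rightarrow> complex) \<Rightarrow> ('e \<Rightarrow> 'e \<Rightarrow> complex) \<Rightarrow> 'x \<Rightarrow> real" where
  "det_ratio t h h' x = Re (det (gram p t h x)) / Re (det (gram p t h' x))"

text \<open>A change of frame multiplies both determinants by the same factor, the square of the
  modulus of \<open>det (a z)\<close>.\<close>

lemma det_ratio_triv:
  assumes h: "hermitian_metric A p T h" "hermitian_metric A p T h'" and ts: "t \<in> T" "s \<in> T" and x: "x \<in> fst t" "x \<in> fst s"
  shows "det_ratio t h h' x = det_ratio s h h' x"
proof -
  obtain c where c: "c \<in> A" "x \<in> fst c" using chart_cover by blast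
  let ?U = "snd c ` (fst c \<inter> (fst t \<inter> fst s))"
  obtain a where a: "\<And>z. z \<in> ?U \<Longrightarrow> det (a z) \<noteq> 0"
    and H: "\<And>h z. hermitian_metric A p T h \<Longrightarrow> z \<in> ?U \<Longrightarrow> gram p t h (cinv c z) = a z ** gram p s h (cinv c z) ** adj (a z)"
    using frame_change[OF ts c(1)] by metis
  have z: "snd c x \<in> ?U" using x c by simp
  let ?d = "det (a (snd c x))"
  have "Re (det (gram p t h x)) = (norm ?d)\<^sup>2 * Re (det (gram p s h x))" if h: "hermitian_metric A p T h" for h
  proof -
    have "det (gram p t h x) = (?d * cnj ?d) * det (gram p s h x)"
      using arg_cong[OF H[OF h z], of det] by (simp add: chart_inv[OF c] det_mul det_adj)
    also have "\<dots> = of_real ((norm ?d)\<^sup>2) * det (gram p s h x)" by (simp only: complex_norm_square)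
    finally show ?thesis by (simp only: Re_of_real_mult)
  qed
  then show ?thesis using h a[OF z] by (simp add: det_ratio_def)
qed

lemma flat_metric_normalize:
  assumes h0: "hermitian_metric A p T h0" and h: "hermitian_metric A p T h"
  shows "\<exists>h' u. hermitian_metric A p T h' \<and>
    (\<forall>t\<in>T. \<forall>c\<in>A. smooth_on (snd c ` (fst c \<inter> fst t)) (\<lambda>z. complex_of_real (u (cinv c z)))) \<and>
    (\<forall>x. 0 < (u x :: real)) \<and> (\<forall>t\<in>T. \<forall>x\<in>fst t. gram p t h' x = mat (of_real (u x)) ** gram p t h x) \<and>
    (\<forall>t\<in>T. \<forall>x\<in>fst t. det (gram p t h' x) = det (gram p t h0 x))"
proof -
  \<comment> \<open>Scaling the metric by \<open>u\<close> multiplies the determinant by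
    \<open>u ^ CARD('r)\<close>; hence the root.\<close>
  define u where "u x = det_ratio (triv_at T x) h0 h x powr (1 / CARD('r))" for x
  define h' where "h' v w = complex_of_real (u (p v)) * h v w" for v w
  have rpos: "det_ratio t h0 h x > 0" if "t \<in> T" "x \<in> fst t" for t x
    using gram_det_real(1)[OF h0 that] gram_det_real(1)[OF h that] by (simp add: det_ratio_def)
  have upos: "u x > 0" for x using rpos[OF triv_at, of x] by (simp add: u_def)
  have ut: "u x = det_ratio t h0 h x powr (1 / CARD('r))" if "t \<in> T" "x \<in> fst t" for t x
    unfolding u_def det_ratio_triv[OF h0 h triv_at(1) that(1) triv_at(2) that(2)] ..
  have usm: "smooth_on (snd c ` (fst c \<inter> fst t)) (\<lambda>z. complex_of_real (u (cinv c z)))" if t: "t \<in> T" and c: "c \<in> A" for t c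
  proof -
    let ?U = "snd c ` (fst c \<inter> fst t)"
    have U: "open ?U" by (rule open_image_Int[OF c triv_open[OF t]])
    have xt: "cinv c z \<in> fst t" if "z \<in> ?U" for z using image_IntD(1)[OF c that] by simp
    have "smooth_on ?U (\<lambda>z. complex_of_real (det_ratio t h0 h (cinv c z) powr (1 / CARD('r))))"
      using rpos[OF t xt] gram_det_real(1)[OF h t xt]
      by (intro smooth_on_of_real smooth_on_powr U) (auto simp: det_ratio_def intro!: smooth_on_divide smooth_on_Re smooth_on_det U smooth_gram h0 h t c less_imp_neq[THEN not_sym])
    then show ?thesis by (rule smooth_on_cong_imp[OF U, rotated]) (simp add: ut[OF t xt])
  qed
  have gram': "gram p t h' x = mat (of_real (u x)) ** gram p t h x" if "t \<in> T" "x \<in> fst t" for t x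
    unfolding vec_eq_iff
  proof (intro allI)
    fix \<kappa> \<mu>
    show "gram p t h' x $ \<kappa> $ \<mu> = (mat (of_real (u x)) ** gram p t h x) $ \<kappa> $ \<mu>"
      unfolding mat_mult_nth unfolding gram_def vec_lambda_beta h'_def frame(1)[OF that] ..
  qed
  have "hermitian_metric A p T h'"
    unfolding hermitian_metric_def
  proof (intro conjI allI ballI impI)
    fix v w assume vw: "p v = p w"
    have "h w v = cnj (h v w)"
      by (rule h[unfolded hermitian_metric_def, THEN conjunct1, THEN spec, THEN spec, THEN mp, OF vw])
    then show "h' w v = cnj (h' v w)" unfolding h'_def vw by simp
  next
    fix t v w assume t: "t \<in> T" and vw: "p v = p w \<and> p v \<in> fst t"
    have "h v w = sesq (gram p t h (p v)) (snd t v) (snd t w)" using gram_sesq[OF h t] vw by blast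
    then show "h' v w = (\<Sum>\<kappa>\<in>UNIV. \<Sum>\<mu>\<in>UNIV. snd t v $ \<kappa> * cnj (snd t w $ \<mu>) * gram p t h' (p v) $ \<kappa> $ \<mu>)"
      unfolding gram'[OF t conjunct2[OF vw]] mat_mult_nth
      by (simp add: h'_def sesq_def sum_distrib_left mult.commute mult.left_commute)
  next
    fix t v assume t: "t \<in> T" and v: "p v \<in> fst t \<and> snd t v \<noteq> 0"
    have "0 < h v v" using h[unfolded hermitian_metric_def, THEN conjunct2, THEN bspec, OF t, THEN conjunct2, THEN conjunct1] v by blast
    then show "0 < h' v v" using upos[of "p v"] by (simp add: h'_def pos_complex_iff)
  next
    fix t \<kappa> \<mu> assume t: "t \<in> T"
    show "smooth_fun A (fst t) (\<lambda>x. gram p t h' x $ \<kappa> $ \<mu>)"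
      unfolding smooth_fun_def
    proof
      fix c assume c: "c \<in> A"
      let ?U = "snd c ` (fst c \<inter> fst t)"
      have U: "open ?U" by (rule open_image_Int[OF c triv_open[OF t]])
      have "smooth_on ?U (\<lambda>z. complex_of_real (u (cinv c z)) * gram p t h (cinv c z) $ \<kappa> $ \<mu>)"
        by (intro smooth_on_mult U usm t c smooth_matD smooth_gram h)
      then show "smooth_on ?U (\<lambda>z. gram p t h' (cinv c z) $ \<kappa> $ \<mu>)"
      proof (rule smooth_on_cong_imp[OF U, rotated])
        fix z assume "z \<in> ?U"
        from image_IntD(1)[OF c this] have "cinv c z \<in> fst t" by simp
        then show "complex_of_real (u (cinv c z)) * gram p t h (cinv c z) $ \<kappa> $ \<mu> = gram p t h' (cinv c z) $ \<kappa> $ \<mu>"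
          by (simp add: gram'[OF t] mat_mult_nth)
      qed
    qed
  qed
  moreover have "det (gram p t h' x) = det (gram p t h0 x)" if t: "t \<in> T" and x: "x \<in> fst t" for t x
  proof -
    have "det (mat (of_real (u x)) :: complex^'r^'r) = of_real (u x ^ CARD('r))"
      by (subst det_diagonal) (simp_all add: mat_def)
    also have "u x ^ CARD('r) = det_ratio t h0 h x"
      unfolding ut[OF t x] using rpos[OF t x] by (simp add: powr_realpow[symmetric] powr_powr)
    finally have "det (gram p t h' x) = of_real (det_ratio t h0 h x) * of_real (Re (det (gram p t h x)))"
      unfolding gram'[OF t x] det_mul using gram_det_real(2)[OF h t x] by simp
    also have "\<dots> = of_real (Re (det (gram p t h0 x)))"
      unfolding of_real_mult[symmetric] det_ratio_def using gram_det_real(1)[OF h t x] by simp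
    finally show ?thesis using gram_det_real(2)[OF h0 t x] by simp
  qed
  ultimately show ?thesis using usm upos gram' by (intro exI[of _ h'] exI[of _ u]) blast
qed

text \<open>By \<open>trace_conn\<close> the trace of the connection is the logarithmic derivative
  of the determinant of the Gram matrix.\<close>

lemma conn_trace_det:
  assumes h: "hermitian_metric A p T h" "hermitian_metric A p T h'" and t: "t \<in> T"
    and d: "\<And>x. x \<in> fst t \<Longrightarrow> det (gram p t h x) = det (gram p t h' x)" and c: "c \<in> A" and x: "x \<in> fst c" "x \<in> fst t"
  shows "conn_trace t h c x = conn_trace t h' c x"
proof -
  let ?U = "snd c ` (fst c \<inter> fst t)"
  have U: "open ?U" "snd c x \<in> ?U" using open_image_Int[OF c triv_open[OF t]] x by auto
  have xt: "cinv c z \<in> fst t" if "z \<in> ?U" for z using image_IntD(1)[OF c that] by simp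
  have "conn_trace t h c x $ j = dz j (\<lambda>w. det (gram p t h (cinv c w))) (snd c x) / det (gram p t h x)" if h: "hermitian_metric A p T h" for h j
    using trace_conn[OF smooth_gram[OF h t c] gram_det_chart[OF h t c U(2)] U(2), of j]
    by (simp add: conn_trace_def chern_connection_conn chart_inv[OF c x(1)])
  moreover have "dz j (\<lambda>w. det (gram p t h (cinv c w))) (snd c x) = dz j (\<lambda>w. det (gram p t h' (cinv c w))) (snd c x)" for j
    by (rule dz_cong[OF U d[OF xt]])
  ultimately show ?thesis using h d[OF x(2)] by (simp add: vec_eq_iff)
qed

text \<open>The given flat metric may fail to be positive. After normalization the trace forces its
  scalar factor to be \<open>S / r\<close> for the positive metric \<open>h0\<close>; this is
  positive definite, which yields positivity in each of the three senses as well as equality in the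
  bound.\<close>

lemma flat_attained:
  assumes flat: "projectively_flat A p T" and pos: "positive_metric P A p T h0"
  shows "\<exists>h. positive_metric P A p T h \<and> MA_integral P A p T h = 1 / (fact CARD('n) * real CARD('r) ^ CARD('n)) * c1_power A p T"
proof -
  have h0: "hermitian_metric A p T h0" using pos by (simp add: positive_metric_def)
  obtain h \<alpha> where h: "hermitian_metric A p T h" and \<alpha>: "\<And>c x j k. c \<in> A \<Longrightarrow> x \<in> fst c \<Longrightarrow> curvature_matrix p (triv_at T x) h c x j k = mat (\<alpha> c x $ j $ k)"
    using flat unfolding projectively_flat_def by blast
  obtain h' u where *: "hermitian_metric A p T h' \<and>
    (\<forall>t\<in>T. \<forall>c\<in>A. smooth_on (snd c ` (fst c \<inter> fst t)) (\<lambda>z. complex_of_real (u (cinv c z)))) \<and>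
    (\<forall>x. 0 < (u x :: real)) \<and> (\<forall>t\<in>T. \<forall>x\<in>fst t. gram p t h' x = mat (of_real (u x)) ** gram p t h x) \<and>
    (\<forall>t\<in>T. \<forall>x\<in>fst t. det (gram p t h' x) = det (gram p t h0 x))"
    using flat_metric_normalize[OF h0 h] by (elim exE)
  have h': "hermitian_metric A p T h'"
    and u: "\<And>t c. t \<in> T \<Longrightarrow> c \<in> A \<Longrightarrow> smooth_on (snd c ` (fst c \<inter> fst t)) (\<lambda>z. complex_of_real (u (cinv c z)))" "\<And>x. u x > 0"
    and gram': "\<And>t x. t \<in> T \<Longrightarrow> x \<in> fst t \<Longrightarrow> gram p t h' x = mat (of_real (u x)) ** gram p t h x"
    and det': "\<And>t x. t \<in> T \<Longrightarrow> x \<in> fst t \<Longrightarrow> det (gram p t h' x) = det (gram p t h0 x)"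
    using * by blast+
  have tr: "curv_trace h' c x = curv_trace h0 c x" if c: "c \<in> A" and x: "x \<in> fst c" for c x
  proof -
    let ?t = "triv_at T x"
    let ?U = "snd c ` (fst c \<inter> fst ?t)"
    have t: "?t \<in> T" "x \<in> fst ?t" by (rule triv_at)+
    have U: "open ?U" "snd c x \<in> ?U" using open_image_Int[OF c triv_open[OF t(1)]] x t by auto
    have "dbar (conn_trace ?t h') c x $ j $ k = dbar (conn_trace ?t h0) c x $ j $ k" for j k
      unfolding dbar_def vec_lambda_beta
    proof (rule dzbar_cong[OF U])
      fix z assume "z \<in> ?U"
      from image_IntD(1)[OF c this] have "cinv c z \<in> fst c" "cinv c z \<in> fst ?t" by auto
      then show "conn_trace ?t h' c (cinv c z) $ j = conn_trace ?t h0 c (cinv c z) $ j"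
        using conn_trace_det[OF h' h0 t(1) det'[OF t(1)] c] by simp
    qed
    then show ?thesis by (simp add: vec_eq_iff curv_trace_dbar[OF h' t(1) c x t(2)] curv_trace_dbar[OF h0 t(1) c x t(2)])
  qed
  have C': "curvature_matrix p (triv_at T x) h' c x j k = mat (scaled (curv_trace h0 c x) TYPE('r) $ j $ k)"
    if c: "c \<in> A" and x: "x \<in> fst c" for c x j k
  proof -
    let ?t = "triv_at T x"
    let ?U = "snd c ` (fst c \<inter> fst ?t)"
    have t: "?t \<in> T" "x \<in> fst ?t" by (rule triv_at)+
    have U: "open ?U" "snd c x \<in> ?U" using open_image_Int[OF c triv_open[OF t(1)]] x t by auto
    let ?u = "\<lambda>z. complex_of_real (u (cinv c z))"
    let ?s = "dzbar k (\<lambda>z. dz j ?u z / ?u z) (snd c x)"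
    have "mat_deriv (dzbar k) (conn (\<lambda>w. gram p ?t h' (cinv c w)) j) (snd c x) = mat ?s + mat_deriv (dzbar k) (conn (\<lambda>w. gram p ?t h (cinv c w)) j) (snd c x)"
    proof (rule conformal_curvature[OF U(1) u(1)[OF t(1) c] _ smooth_gram[OF h t(1) c] gram_det_chart[OF h t(1) c] _ U(2)])
      show "?u z \<noteq> 0" for z using u(2)[of "cinv c z"] by simp
      fix z assume "z \<in> ?U"
      from image_IntD(1)[OF c this] have "cinv c z \<in> fst ?t" by simp
      then show "gram p ?t h' (cinv c z) = mat (?u z) ** gram p ?t h (cinv c z)" by (rule gram'[OF t(1)])
    qed
    then have "curvature_matrix p ?t h' c x j k = curvature_matrix p ?t h c x j k - mat ?s"
      unfolding curvature_conn chern_connection_conn by simp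
    also have "\<dots> = mat (\<alpha> c x $ j $ k - ?s)" unfolding \<alpha>[OF c x] by (simp add: mat_def vec_eq_iff)
    finally have M: "curvature_matrix p ?t h' c x j k = mat (\<alpha> c x $ j $ k - ?s)" .
    have "scaled (curv_trace h0 c x) TYPE('r) $ j $ k = trace (curvature_matrix p ?t h' c x j k) / of_nat CARD('r)"
      unfolding tr[OF c x, symmetric] by (simp add: scaled_def curv_trace_def)
    also have "trace (curvature_matrix p ?t h' c x j k) / of_nat CARD('r) = \<alpha> c x $ j $ k - ?s"
      by (rule scalar_matrix[OF M, symmetric])
    finally show ?thesis unfolding M by (rule arg_cong[of _ _ mat, OF sym])
  qed
  have pd: "posdef (scaled (curv_trace h0 c x) TYPE('r))" if "c \<in> A" "x \<in> fst c" for c x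
    by (rule posdef_scaled[OF Phi_bound(1)[OF pos that]])
  have "positive_metric P A p T h'"
    unfolding positive_metric_def
  proof (intro conjI ballI allI impI h')
    fix c x and e :: "'r \<Rightarrow> 'e" assume "c \<in> A" "x \<in> fst c" "orthonormal_frame p h' x e"
    then show "positive_coeffs P (curv_coeff p T h' c x e)" using scalar_curvature_Phi(1)[OF h' C' pd] by blast
  qed
  moreover have "MA_integral P A p T h' = 1 / (fact CARD('n) * real CARD('r) ^ CARD('n)) * c1_power A p T"
    unfolding MA_integral_def c1_bound[OF h0]
    by (rule arg_cong[OF form_integral_cong]) (simp add: scalar_curvature_Phi(2)[OF h' C' pd] bound_density_def)
  ultimately show ?thesis by blast
qed

end

theorem corollary2p7:
  fixes A :: "('x::t2_space, 'n::finite) chart set"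
    and p :: "'e \<Rightarrow> 'x"
    and T :: "('x, 'e, 'r::finite) triv set"
    and P :: positivity
  assumes "complex_projective_manifold A"
    and "holomorphic_vector_bundle A p T"
    and "positive_bundle P A p T"
  shows "MAVol P A p T \<le> ereal (1 / (fact CARD('n) * real CARD('r) ^ CARD('n)) * c1_power A p T)
    \<and> ((MAVol P A p T = ereal (1 / (fact CARD('n) * real CARD('r) ^ CARD('n)) * c1_power A p T)
          \<and> (\<exists>h. positive_metric P A p T h \<and> ereal (MA_integral P A p T h) = MAVol P A p T))
        \<longleftrightarrow> projectively_flat A p T)"
proof -
  interpret compact_bundle A p T
    using assms(1,2) by unfold_locales (simp_all add: complex_projective_manifold_def)
  let ?B = "1 / (fact CARD('n) * real CARD('r) ^ CARD('n)) * c1_power A p T"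
  obtain h0 where h0: "positive_metric P A p T h0" using assms(3) by (auto simp: positive_bundle_def)
  have le: "MAVol P A p T \<le> ereal ?B"
    unfolding MAVol_def by (rule SUP_least) (use MA_integral_le in simp)
  have ge: "ereal (MA_integral P A p T h) \<le> MAVol P A p T" if "positive_metric P A p T h" for h
    unfolding MAVol_def by (rule SUP_upper) (use that in simp)
  have "projectively_flat A p T"
    if eq: "MAVol P A p T = ereal ?B" "positive_metric P A p T h" "ereal (MA_integral P A p T h) = MAVol P A p T" for h
    using MA_integral_eq_flat[OF eq(2)] eq(1,3) by simp
  moreover have "MAVol P A p T = ereal ?B \<and> (\<exists>h. positive_metric P A p T h \<and> ereal (MA_integral P A p T h) = MAVol P A p T)"
    if flat: "projectively_flat A p T"
  proof -
    obtain h where h: "positive_metric P A p T h" "MA_integral P A p T h = ?B" using flat_attained[OF flat h0] by blast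
    have "MAVol P A p T = ereal ?B" using le ge[OF h(1)] unfolding h(2) by (rule antisym)
    then show ?thesis using h by auto
  qed
  ultimately show ?thesis using le by blast
qed

end
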